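(* Let $\mathbb{T}=(\Sigma,E)$ be an algebraic theory and $(\mathcal{S},\Gamma,\mathit{ar},\mathit{coar})$ a monoidal signature. The category $\mathbf{Tape}_{\Gamma}^{\mathbb{T},cd}$ of $\mathbb{T}$-tape diagrams with copy and discard, equipped with $\oplus$, $\otimes$, $\delta^l$, the inclusion of sorts $\mathcal{S}\to\mathbf{Tape}_{\Gamma}^{\mathbb{T},cd}$, the morphism $\mathbf{L}_{\mathbb{T}}^{op}\to\mathbf{Tape}_{\Gamma}^{\mathbb{T},cd}$ sending each $f\in\Sigma$ of arity $n$ to $f_1$, and the comonoids $\mathrm{copy}_P,\mathrm{disc}_P$ defined below, is the free sesquistrict $\mathbb{T}$-copy discard rig category generated by $(\mathcal{S},\Gamma)$, via the interpretation $A\mapsto A$, $s\mapsto\lceil s\rceil$.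
   Context: Composition is diagrammatic. Algebraic theory $\mathbb{T}=(\Sigma,E)$; Lawvere theory $\mathbf{L}_{\mathbb{T}}$ (objects naturals, arrows $n\to m$ tuples of $m$ terms in $x_1..x_n$ mod $E$, composition by substitution, product = addition); $\aleph_0$ the strict fc category freely generated by one object; $d\colon\aleph_0\to\mathbf{L}_{\mathbb{T}}^{op}$ identity-on-objects fc morphism; $c\colon\aleph_0\to\mathcal{C}$, $n\mapsto\bigoplus^n1$. Rig category: symmetric monoidal $(\otimes,1)$, $(\oplus,0)$, natural isos $\delta^l_{X,Y,Z}\colon X\otimes(Y\oplus Z)\to(X\otimes Y)\oplus(X\otimes Z)$, $\delta^r_{X,Y,Z}\colon(X\oplus Y)\otimes Z\to(X\otimes Z)\oplus(Y\otimes Z)$, $\lambda^\bullet,\rho^\bullet$ with Laplaza's axioms; $\lambda^\oplus,\rho^\oplus$ unitors of $\oplus$. fc category: symmetric monoidal $(\oplus,0)$ with natural coherent commutative monoids $(\nabla_X,¡_X)$. cd category: symmetric monoidal $(\otimes,1)$ with cocommutative comonoids $(\mathrm{copy}_X\colon X\to X\otimes X,\mathrm{disc}_X\colon X\to1)$ coherent with $\otimes$. fc-cd rig category: rig category, $\oplus$-part fc, $\otimes$-part cd, with $\mathrm{disc}_{X\oplus Y}=(\mathrm{disc}_X\oplus\mathrm{disc}_Y);\nabla_1$ and $\mathrm{copy}_{X\oplus Y}=((\rho^\oplus_X)^{-1}\oplus(\lambda^\oplus_Y)^{-1});((\mathrm{copy}_X\oplus¡_{X\otimes Y})\oplus(¡_{Y\otimes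 X}\oplus\mathrm{copy}_Y));((\delta^l_{X,X,Y})^{-1}\oplus(\delta^l_{Y,X,Y})^{-1});(\delta^r_{X,Y,X\oplus Y})^{-1}$. $\mathbb{T}$-cd rig category: fc-cd rig category $\mathcal{C}$ with fc morphism (strong symmetric monoidal functor preserving monoids) $i\colon\mathbf{L}_{\mathbb{T}}^{op}\to\mathcal{C}$ with $d;i=c$; morphisms: rig functors preserving monoids and comonoids and commuting with the $i$'s. Right strict rig category: both monoidal structures strict and $\lambda^\bullet,\rho^\bullet,\delta^r$ identities. Sesquistrict rig category: functor $H\colon\mathcal{M}\to\mathcal{C}$, $\mathcal{M}$ discrete, $\mathcal{C}$ right strict rig, with $\delta^l_{H(A),X,Y}$ identity for all $A$; sesquistrict rig functor: pair $(\alpha,\beta)$, $\beta$ strict symmetric monoidal for both products preserving $\delta^l$, $\alpha;H'=H;\beta$. A sesquistrict $\mathbb{T}$-cd rig category is a sesquistrict rig category whose $\mathcal{C}$ is a $\mathbb{T}$-cd rig category; morphisms are sesquistrict rig functors whose $\beta$ is a morphism of $\mathbb{T}$-cd rig categories. Monoidal signature: sorts $\mathcal{S}$, generators $\Gamma$ with arities/coarities in $\mathcal{S}^\star$; interpretation $(\alpha_\mathcal{S},\alpha_\Gamma)$ in $H\colon\mathcal{M}\to\mathcal{D}$ with $\alpha_\Gamma(s)\colon(\alpha_\mathcal{S};H)^\sharp(\mathit{ar}(s))\to(\alpha_\mathcal{S};H)^\sharp(\mathit{coar}(s))$ ($\sharp$ = right-bracketed $\otimes$-extension). Freeness: for every sesquistrict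 $\mathbb{T}$-cd rig $H'$ and interpretation $(\alpha'_\mathcal{S},\alpha'_\Gamma)$ there is a unique morphism $(\alpha,\beta)$ with $\alpha_\mathcal{S};\alpha=\alpha'_\mathcal{S}$, $\alpha_\Gamma;\beta=\alpha'_\Gamma$. Tapes: $A,B\in\mathcal{S}$; $U,V,W\in\mathcal{S}^\star$ (concatenation $UV$, empty $1$); $P,Q,R,S\in(\mathcal{S}^\star)^\star$ (concatenation $\oplus$, empty $0$); $P\otimes Q=\bigoplus_i\bigoplus_jU_iV_j$. Circuits $c::=\mathrm{id}_A\mid\mathrm{id}_1\mid s\mid\sigma_{A,B}\mid c;c\mid c\otimes c\mid\mathrm{copy}_A\mid\mathrm{disc}_A$ ($\mathrm{copy}_A\colon A\to AA$, $\mathrm{disc}_A\colon A\to1$) modulo strict symmetric monoidal axioms and cocommutative comonoid axioms for $(\mathrm{copy}_A,\mathrm{disc}_A)$; $\mathrm{copy}_1=\mathrm{disc}_1=\mathrm{id}_1$, $\mathrm{copy}_{AU'}=(\mathrm{copy}_A\otimes\mathrm{copy}_{U'});(\mathrm{id}_A\otimes\sigma_{A,U'}\otimes\mathrm{id}_{U'})$, $\mathrm{disc}_{AU'}=\mathrm{disc}_A\otimes\mathrm{disc}_{U'}$. Tapes $\mathfrak{t}::=\mathrm{id}_U\mid\mathrm{id}_0\mid\lceil c\rceil\mid\sigma^\oplus_{U,V}\mid\mathfrak{t};\mathfrak{t}\mid\mathfrak{t}\oplus\mathfrak{t}\mid¡_U\mid\nabla_U\mid f_U$ with $\lceil c\rceil\colon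 U\to V$, $\sigma^\oplus_{U,V}\colon U\oplus V\to V\oplus U$, $¡_U\colon0\to U$, $\nabla_U\colon U\oplus U\to U$, $f_U\colon U\to\bigoplus^nU$ ($f$ of arity $n$). Derived: $\mathrm{id}_{U\oplus P'}=\mathrm{id}_U\oplus\mathrm{id}_{P'}$; $¡_0=\nabla_0=\mathrm{id}_0$, $¡_{U\oplus P'}=¡_U\oplus¡_{P'}$, $\nabla_{U\oplus P'}=(\mathrm{id}_U\oplus\sigma^\oplus_{U,P'}\oplus\mathrm{id}_{P'});(\nabla_U\oplus\nabla_{P'})$; $\sigma^\oplus_{P,Q}$ by the usual induction; $\delta^l_{0,Q,R}=\mathrm{id}_0$, $\delta^l_{U\oplus P',Q,R}=(\mathrm{id}_{U(Q\oplus R)}\oplus\delta^l_{P',Q,R});(\mathrm{id}_{UQ}\oplus\sigma^\oplus_{UR,P'Q}\oplus\mathrm{id}_{P'R})$; $f_0=\mathrm{id}_0$, $f_{U\oplus P'}=(f_U\oplus f_{P'});(\delta^l_{\bigoplus^n1,U,P'})^{-1}$; for a $\Sigma$-term $t$ in $x_1..x_n$: $(x_i)_U=¡_{\bigoplus^{i-1}U}\oplus\mathrm{id}_U\oplus¡_{\bigoplus^{n-i}U}$, $(f(t_1..t_m))_U=f_U;((t_1)_U\oplus\dots\oplus(t_m)_U);\nabla^m_{\bigoplus^nU}$ with $\nabla^0_P=¡_P$, $\nabla^{m+1}_P=(\mathrm{id}_P\oplus\nabla^m_P);\nabla_P$. Whiskerings: $L_U$ (resp. $R_U$) maps $\mathrm{id}_0\mapsto\mathrm{id}_0$,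 $\lceil c\rceil\mapsto\lceil\mathrm{id}_U\otimes c\rceil$ (resp. $\lceil c\otimes\mathrm{id}_U\rceil$), $\sigma^\oplus_{V,W}\mapsto\sigma^\oplus_{UV,UW}$ (resp. $\sigma^\oplus_{VU,WU}$), $\nabla_V\mapsto\nabla_{UV}$, $¡_V\mapsto¡_{UV}$, $f_V\mapsto f_{UV}$ (resp. with $VU$), preserving $;$ and $\oplus$; $L_0(\mathfrak{t})=R_0(\mathfrak{t})=\mathrm{id}_0$, $L_{W\oplus S'}(\mathfrak{t})=L_W(\mathfrak{t})\oplus L_{S'}(\mathfrak{t})$, $R_{W\oplus S'}(\mathfrak{t})=\delta^l_{P,W,S'};(R_W(\mathfrak{t})\oplus R_{S'}(\mathfrak{t}));(\delta^l_{Q,W,S'})^{-1}$ for $\mathfrak{t}\colon P\to Q$; $\mathfrak{t}_1\otimes\mathfrak{t}_2:=L_P(\mathfrak{t}_2);R_S(\mathfrak{t}_1)$ for $\mathfrak{t}_1\colon P\to Q$, $\mathfrak{t}_2\colon R\to S$. Comonoids on polynomials: $\mathrm{copy}_0=\mathrm{id}_0$, $\mathrm{disc}_0=¡_1$, $\mathrm{copy}_{U\oplus P'}=\lceil\mathrm{copy}_U\rceil\oplus¡_{UP'}\oplus((¡_{P'U}\oplus\mathrm{copy}_{P'});(\delta^l_{P',U,P'})^{-1})$, $\mathrm{disc}_{U\oplus P'}=(\lceil\mathrm{disc}_U\rceil\oplus\mathrm{disc}_{P'});\nabla_1$. $\mathbf{Tape}_{\Gamma}^{\mathbb{T},cd}$: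 objects $(\mathcal{S}^\star)^\star$, arrows typed tapes modulo the smallest congruence (w.r.t. $;$, $\oplus$, $\otimes$) containing the strict symmetric monoidal axioms for $(;,\oplus,\sigma^\oplus)$, commutative monoid axioms for $(\nabla_U,¡_U)$, $\nabla_U;\lceil c\rceil=(\lceil c\rceil\oplus\lceil c\rceil);\nabla_V$, $¡_U;\lceil c\rceil=¡_V$, $\nabla_U;f_U=(f_U\oplus f_U);\nabla_{\bigoplus^nU}$, $¡_U;f_U=¡_{\bigoplus^nU}$, $\mathfrak{t};f_Q=f_P;\bigoplus^n\mathfrak{t}$ for all $\mathfrak{t}\colon P\to Q$, $\lceil\mathrm{id}_U\rceil=\mathrm{id}_U$, $\lceil c;d\rceil=\lceil c\rceil;\lceil d\rceil$, and $t_U=t'_U$ for $(t,t')\in E$. *)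

theory Defs
  imports Main "HOL-Library.FuncSet"
begin

section \<open>Categories\<close>

text \<open>Composition is diagrammatic: \<open>f \<Zsemi> g\<close> is first \<open>f\<close>, then \<open>g\<close>.
  Objects and arrows live in carrier sets; operations are only meaningful on the carriers.\<close>

record ('o, 'a) cat =
  obj :: "'o set"
  arr :: "'a set"
  src :: "'a \<Rightarrow> 'o"
  tgt :: "'a \<Rightarrow> 'o"
  ide :: "'o \<Rightarrow> 'a" ("\<iota>\<index>")
  seq :: "'a \<Rightarrow> 'a \<Rightarrow> 'a" (infixl "\<Zsemi>\<index>" 55)

definition hom :: "('o, 'a, 'z) cat_scheme \<Rightarrow> 'o \<Rightarrow> 'o \<Rightarrow> 'a set" where
  "hom C X Y = {f \<in> arr C. src C f = X \<and> tgt C f = Y}"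

locale category =
  fixes C :: "('o, 'a, 'z) cat_scheme" (structure)
  assumes src_obj: "f \<in> arr C \<Longrightarrow> src C f \<in> obj C"
    and tgt_obj: "f \<in> arr C \<Longrightarrow> tgt C f \<in> obj C"
    and ide_hom: "X \<in> obj C \<Longrightarrow> \<iota> X \<in> hom C X X"
    and seq_hom: "\<lbrakk>f \<in> hom C X Y; g \<in> hom C Y Z\<rbrakk> \<Longrightarrow> f \<Zsemi> g \<in> hom C X Z"
    and ide_seq: "f \<in> hom C X Y \<Longrightarrow> \<iota> X \<Zsemi> f = f"
    and seq_ide: "f \<in> hom C X Y \<Longrightarrow> f \<Zsemi> \<iota> Y = f"
    and seq_assoc: "\<lbrakk>f \<in> hom C X Y; g \<in> hom C Y Z; h \<in> hom C Z W\<rbrakk>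
      \<Longrightarrow> (f \<Zsemi> g) \<Zsemi> h = f \<Zsemi> (g \<Zsemi> h)"

definition inverse_arrows :: "('o, 'a, 'z) cat_scheme \<Rightarrow> 'a \<Rightarrow> 'a \<Rightarrow> bool" where
  "inverse_arrows C f g \<longleftrightarrow> f \<in> arr C \<and> g \<in> hom C (tgt C f) (src C f)
    \<and> seq C f g = ide C (src C f) \<and> seq C g f = ide C (tgt C f)"

definition iso :: "('o, 'a, 'z) cat_scheme \<Rightarrow> 'a \<Rightarrow> bool" where
  "iso C f \<longleftrightarrow> (\<exists>g. inverse_arrows C f g)"

definition inv_arr :: "('o, 'a, 'z) cat_scheme \<Rightarrow> 'a \<Rightarrow> 'a" where
  "inv_arr C f = (THE g. inverse_arrows C f g)"

definition is_ide :: "('o, 'a, 'z) cat_scheme \<Rightarrow> 'a \<Rightarrow> bool" where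
  "is_ide C f \<longleftrightarrow> (\<exists>X \<in> obj C. f = ide C X)"

definition op_cat :: "('o, 'a) cat \<Rightarrow> ('o, 'a) cat" where
  "op_cat C = \<lparr>obj = obj C, arr = arr C, src = tgt C, tgt = src C, ide = ide C,
     seq = (\<lambda>f g. seq C g f)\<rparr>"

record ('o, 'a, 'p, 'b) func =
  onO :: "'o \<Rightarrow> 'p"
  onA :: "'a \<Rightarrow> 'b"

locale cat_functor = C: category C + D: category D
  for C :: "('o, 'a, 'y) cat_scheme" and D :: "('p, 'b, 'z) cat_scheme" +
  fixes F :: "('o, 'a, 'p, 'b) func"
  assumes onO_obj: "X \<in> obj C \<Longrightarrow> onO F X \<in> obj D"
    and onA_hom: "f \<in> hom C X Y \<Longrightarrow> onA F f \<in> hom D (onO F X) (onO F Y)"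
    and onA_ide: "X \<in> obj C \<Longrightarrow> onA F (ide C X) = ide D (onO F X)"
    and onA_seq: "\<lbrakk>f \<in> hom C X Y; g \<in> hom C Y Z\<rbrakk>
      \<Longrightarrow> onA F (seq C f g) = seq D (onA F f) (onA F g)"


section \<open>Symmetric monoidal categories and functors\<close>

text \<open>The monoidal data are kept apart from the category, since a rig category carries two of
  them.  \<open>tenO\<close> and \<open>tenA\<close> are the product on objects and on arrows; the directions are
  \<open>asc X Y Z : (X Y) Z \<rightarrow> X (Y Z)\<close>, \<open>lun X : 1 X \<rightarrow> X\<close>, \<open>run X : X 1 \<rightarrow> X\<close>.\<close>

record ('o, 'a) smon =
  tenO :: "'o \<Rightarrow> 'o \<Rightarrow> 'o" (infixr "\<odot>\<index>" 70)
  tenA :: "'a \<Rightarrow> 'a \<Rightarrow> 'a" (infixr "\<star>\<index>" 70)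
  unO :: "'o" ("\<bbbone>\<index>")
  asc :: "'o \<Rightarrow> 'o \<Rightarrow> 'o \<Rightarrow> 'a"
  lun :: "'o \<Rightarrow> 'a"
  run :: "'o \<Rightarrow> 'a"
  symm :: "'o \<Rightarrow> 'o \<Rightarrow> 'a"

locale sym_monoidal_category = category C
  for C :: "('o, 'a, 'z) cat_scheme" (structure) +
  fixes M :: "('o, 'a) smon"
  assumes un_obj: "\<bbbone>\<^bsub>M\<^esub> \<in> obj C"
    and tenO_obj: "\<lbrakk>X \<in> obj C; Y \<in> obj C\<rbrakk> \<Longrightarrow> X \<odot>\<^bsub>M\<^esub> Y \<in> obj C"
    and tenA_hom: "\<lbrakk>f \<in> hom C X Y; g \<in> hom C Z W\<rbrakk>
      \<Longrightarrow> f \<star>\<^bsub>M\<^esub> g \<in> hom C (X \<odot>\<^bsub>M\<^esub> Z) (Y \<odot>\<^bsub>M\<^esub> W)"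
    and tenA_ide: "\<lbrakk>X \<in> obj C; Y \<in> obj C\<rbrakk> \<Longrightarrow> \<iota> X \<star>\<^bsub>M\<^esub> \<iota> Y = \<iota> (X \<odot>\<^bsub>M\<^esub> Y)"
    and interchange: "\<lbrakk>f \<in> hom C X Y; f' \<in> hom C Y Z; g \<in> hom C U V; g' \<in> hom C V W\<rbrakk>
      \<Longrightarrow> (f \<Zsemi> f') \<star>\<^bsub>M\<^esub> (g \<Zsemi> g') = (f \<star>\<^bsub>M\<^esub> g) \<Zsemi> (f' \<star>\<^bsub>M\<^esub> g')"
    and asc_hom: "\<lbrakk>X \<in> obj C; Y \<in> obj C; Z \<in> obj C\<rbrakk>
      \<Longrightarrow> asc M X Y Z \<in> hom C ((X \<odot>\<^bsub>M\<^esub> Y) \<odot>\<^bsub>M\<^esub> Z) (X \<odot>\<^bsub>M\<^esub> (Y \<odot>\<^bsub>M\<^esub> Z))"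
    and asc_iso: "\<lbrakk>X \<in> obj C; Y \<in> obj C; Z \<in> obj C\<rbrakk> \<Longrightarrow> iso C (asc M X Y Z)"
    and asc_nat: "\<lbrakk>f \<in> hom C X X'; g \<in> hom C Y Y'; h \<in> hom C Z Z'\<rbrakk>
      \<Longrightarrow> ((f \<star>\<^bsub>M\<^esub> g) \<star>\<^bsub>M\<^esub> h) \<Zsemi> asc M X' Y' Z' = asc M X Y Z \<Zsemi> (f \<star>\<^bsub>M\<^esub> (g \<star>\<^bsub>M\<^esub> h))"
    and lun_hom: "X \<in> obj C \<Longrightarrow> lun M X \<in> hom C (\<bbbone>\<^bsub>M\<^esub> \<odot>\<^bsub>M\<^esub> X) X"
    and lun_iso: "X \<in> obj C \<Longrightarrow> iso C (lun M X)"
    and lun_nat: "f \<in> hom C X Y \<Longrightarrow> (\<iota> \<bbbone>\<^bsub>M\<^esub> \<star>\<^bsub>M\<^esub> f) \<Zsemi> lun M Y = lun M X \<Zsemi> f"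
    and run_hom: "X \<in> obj C \<Longrightarrow> run M X \<in> hom C (X \<odot>\<^bsub>M\<^esub> \<bbbone>\<^bsub>M\<^esub>) X"
    and run_iso: "X \<in> obj C \<Longrightarrow> iso C (run M X)"
    and run_nat: "f \<in> hom C X Y \<Longrightarrow> (f \<star>\<^bsub>M\<^esub> \<iota> \<bbbone>\<^bsub>M\<^esub>) \<Zsemi> run M Y = run M X \<Zsemi> f"
    and sym_hom: "\<lbrakk>X \<in> obj C; Y \<in> obj C\<rbrakk> \<Longrightarrow> symm M X Y \<in> hom C (X \<odot>\<^bsub>M\<^esub> Y) (Y \<odot>\<^bsub>M\<^esub> X)"
    and sym_sym: "\<lbrakk>X \<in> obj C; Y \<in> obj C\<rbrakk> \<Longrightarrow> symm M X Y \<Zsemi> symm M Y X = \<iota> (X \<odot>\<^bsub>M\<^esub> Y)"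
    and sym_nat: "\<lbrakk>f \<in> hom C X X'; g \<in> hom C Y Y'\<rbrakk>
      \<Longrightarrow> (f \<star>\<^bsub>M\<^esub> g) \<Zsemi> symm M X' Y' = symm M X Y \<Zsemi> (g \<star>\<^bsub>M\<^esub> f)"
    and pentagon: "\<lbrakk>X \<in> obj C; Y \<in> obj C; Z \<in> obj C; W \<in> obj C\<rbrakk>
      \<Longrightarrow> asc M (X \<odot>\<^bsub>M\<^esub> Y) Z W \<Zsemi> asc M X Y (Z \<odot>\<^bsub>M\<^esub> W)
        = (asc M X Y Z \<star>\<^bsub>M\<^esub> \<iota> W) \<Zsemi> asc M X (Y \<odot>\<^bsub>M\<^esub> Z) W \<Zsemi> (\<iota> X \<star>\<^bsub>M\<^esub> asc M Y Z W)"
    and triangle: "\<lbrakk>X \<in> obj C; Y \<in> obj C\<rbrakk>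
      \<Longrightarrow> asc M X \<bbbone>\<^bsub>M\<^esub> Y \<Zsemi> (\<iota> X \<star>\<^bsub>M\<^esub> lun M Y) = run M X \<star>\<^bsub>M\<^esub> \<iota> Y"
    and hexagon: "\<lbrakk>X \<in> obj C; Y \<in> obj C; Z \<in> obj C\<rbrakk>
      \<Longrightarrow> asc M X Y Z \<Zsemi> symm M X (Y \<odot>\<^bsub>M\<^esub> Z) \<Zsemi> asc M Y Z X
        = (symm M X Y \<star>\<^bsub>M\<^esub> \<iota> Z) \<Zsemi> asc M Y X Z \<Zsemi> (\<iota> Y \<star>\<^bsub>M\<^esub> symm M X Z)"

definition mid4 ::
  "('o, 'a, 'z) cat_scheme \<Rightarrow> ('o, 'a) smon \<Rightarrow> 'o \<Rightarrow> 'o \<Rightarrow> 'o \<Rightarrow> 'o \<Rightarrow> 'a" where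
  \<comment> \<open>the canonical isomorphism \<open>(X Y) (Z W) \<rightarrow> (X Z) (Y W)\<close>\<close>
  "mid4 C M X Y Z W =
     asc M X Y (Z \<odot>\<^bsub>M\<^esub> W)
     \<Zsemi>\<^bsub>C\<^esub> (ide C X \<star>\<^bsub>M\<^esub> (inv_arr C (asc M Y Z W) \<Zsemi>\<^bsub>C\<^esub> (symm M Y Z \<star>\<^bsub>M\<^esub> ide C W) \<Zsemi>\<^bsub>C\<^esub> asc M Z Y W))
     \<Zsemi>\<^bsub>C\<^esub> inv_arr C (asc M X Z (Y \<odot>\<^bsub>M\<^esub> W))"

text \<open>A strong symmetric monoidal functor, with structure isomorphisms
  \<open>mu X Y : F X \<odot> F Y \<rightarrow> F (X \<odot> Y)\<close> and \<open>eta : 1 \<rightarrow> F 1\<close>.\<close>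

locale strong_sym_monoidal_functor =
  C: sym_monoidal_category C M + D: sym_monoidal_category D N + cat_functor C D F
  for C :: "('o, 'a, 'y) cat_scheme" and M
    and D :: "('p, 'b, 'z) cat_scheme" (structure) and N
    and F :: "('o, 'a, 'p, 'b) func" +
  fixes mu :: "'o \<Rightarrow> 'o \<Rightarrow> 'b" and eta :: 'b
  assumes mu_hom: "\<lbrakk>X \<in> obj C; Y \<in> obj C\<rbrakk>
      \<Longrightarrow> mu X Y \<in> hom D (onO F X \<odot>\<^bsub>N\<^esub> onO F Y) (onO F (X \<odot>\<^bsub>M\<^esub> Y))"
    and mu_iso: "\<lbrakk>X \<in> obj C; Y \<in> obj C\<rbrakk> \<Longrightarrow> iso D (mu X Y)"
    and mu_nat: "\<lbrakk>f \<in> hom C X X'; g \<in> hom C Y Y'\<rbrakk>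
      \<Longrightarrow> (onA F f \<star>\<^bsub>N\<^esub> onA F g) \<Zsemi> mu X' Y' = mu X Y \<Zsemi> onA F (f \<star>\<^bsub>M\<^esub> g)"
    and eta_hom: "eta \<in> hom D \<bbbone>\<^bsub>N\<^esub> (onO F \<bbbone>\<^bsub>M\<^esub>)"
    and eta_iso: "iso D eta"
    and mu_asc: "\<lbrakk>X \<in> obj C; Y \<in> obj C; Z \<in> obj C\<rbrakk>
      \<Longrightarrow> (mu X Y \<star>\<^bsub>N\<^esub> \<iota> (onO F Z)) \<Zsemi> mu (X \<odot>\<^bsub>M\<^esub> Y) Z \<Zsemi> onA F (asc M X Y Z)
        = asc N (onO F X) (onO F Y) (onO F Z) \<Zsemi> (\<iota> (onO F X) \<star>\<^bsub>N\<^esub> mu Y Z) \<Zsemi> mu X (Y \<odot>\<^bsub>M\<^esub> Z)"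
    and mu_lun: "X \<in> obj C
      \<Longrightarrow> (eta \<star>\<^bsub>N\<^esub> \<iota> (onO F X)) \<Zsemi> mu \<bbbone>\<^bsub>M\<^esub> X \<Zsemi> onA F (lun M X) = lun N (onO F X)"
    and mu_run: "X \<in> obj C
      \<Longrightarrow> (\<iota> (onO F X) \<star>\<^bsub>N\<^esub> eta) \<Zsemi> mu X \<bbbone>\<^bsub>M\<^esub> \<Zsemi> onA F (run M X) = run N (onO F X)"
    and mu_sym: "\<lbrakk>X \<in> obj C; Y \<in> obj C\<rbrakk>
      \<Longrightarrow> mu X Y \<Zsemi> onA F (symm M X Y) = symm N (onO F X) (onO F Y) \<Zsemi> mu Y X"

locale strict_sym_monoidal_functor =
  C: sym_monoidal_category C M + D: sym_monoidal_category D N + cat_functor C D F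
  for C :: "('o, 'a, 'y) cat_scheme" and M
    and D :: "('p, 'b, 'z) cat_scheme" (structure) and N
    and F :: "('o, 'a, 'p, 'b) func" +
  assumes pres_un: "onO F \<bbbone>\<^bsub>M\<^esub> = \<bbbone>\<^bsub>N\<^esub>"
    and pres_tenO: "\<lbrakk>X \<in> obj C; Y \<in> obj C\<rbrakk> \<Longrightarrow> onO F (X \<odot>\<^bsub>M\<^esub> Y) = onO F X \<odot>\<^bsub>N\<^esub> onO F Y"
    and pres_tenA: "\<lbrakk>f \<in> arr C; g \<in> arr C\<rbrakk> \<Longrightarrow> onA F (f \<star>\<^bsub>M\<^esub> g) = onA F f \<star>\<^bsub>N\<^esub> onA F g"
    and pres_asc: "\<lbrakk>X \<in> obj C; Y \<in> obj C; Z \<in> obj C\<rbrakk>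
      \<Longrightarrow> onA F (asc M X Y Z) = asc N (onO F X) (onO F Y) (onO F Z)"
    and pres_lun: "X \<in> obj C \<Longrightarrow> onA F (lun M X) = lun N (onO F X)"
    and pres_run: "X \<in> obj C \<Longrightarrow> onA F (run M X) = run N (onO F X)"
    and pres_sym: "\<lbrakk>X \<in> obj C; Y \<in> obj C\<rbrakk>
      \<Longrightarrow> onA F (symm M X Y) = symm N (onO F X) (onO F Y)"

locale strict_sym_monoidal_category = sym_monoidal_category C M
  for C :: "('o, 'a, 'z) cat_scheme" (structure) and M +
  assumes asc_ide: "\<lbrakk>X \<in> obj C; Y \<in> obj C; Z \<in> obj C\<rbrakk> \<Longrightarrow> is_ide C (asc M X Y Z)"
    and lun_ide: "X \<in> obj C \<Longrightarrow> is_ide C (lun M X)"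
    and run_ide: "X \<in> obj C \<Longrightarrow> is_ide C (run M X)"


section \<open>Finite coproduct and copy-discard categories\<close>

locale fc_category = sym_monoidal_category C M
  for C :: "('o, 'a, 'z) cat_scheme" (structure) and M +
  fixes nab :: "'o \<Rightarrow> 'a" and bng :: "'o \<Rightarrow> 'a"
  assumes nab_hom: "X \<in> obj C \<Longrightarrow> nab X \<in> hom C (X \<odot>\<^bsub>M\<^esub> X) X"
    and bng_hom: "X \<in> obj C \<Longrightarrow> bng X \<in> hom C \<bbbone>\<^bsub>M\<^esub> X"
    and nab_assoc: "X \<in> obj C
      \<Longrightarrow> (nab X \<star>\<^bsub>M\<^esub> \<iota> X) \<Zsemi> nab X = asc M X X X \<Zsemi> (\<iota> X \<star>\<^bsub>M\<^esub> nab X) \<Zsemi> nab X"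
    and nab_lunit: "X \<in> obj C \<Longrightarrow> (bng X \<star>\<^bsub>M\<^esub> \<iota> X) \<Zsemi> nab X = lun M X"
    and nab_runit: "X \<in> obj C \<Longrightarrow> (\<iota> X \<star>\<^bsub>M\<^esub> bng X) \<Zsemi> nab X = run M X"
    and nab_comm: "X \<in> obj C \<Longrightarrow> symm M X X \<Zsemi> nab X = nab X"
    and nab_nat: "f \<in> hom C X Y \<Longrightarrow> nab X \<Zsemi> f = (f \<star>\<^bsub>M\<^esub> f) \<Zsemi> nab Y"
    and bng_nat: "f \<in> hom C X Y \<Longrightarrow> bng X \<Zsemi> f = bng Y"
    and nab_ten: "\<lbrakk>X \<in> obj C; Y \<in> obj C\<rbrakk>
      \<Longrightarrow> nab (X \<odot>\<^bsub>M\<^esub> Y) = mid4 C M X Y X Y \<Zsemi> (nab X \<star>\<^bsub>M\<^esub> nab Y)"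
    and bng_ten: "\<lbrakk>X \<in> obj C; Y \<in> obj C\<rbrakk>
      \<Longrightarrow> bng (X \<odot>\<^bsub>M\<^esub> Y) = inv_arr C (lun M \<bbbone>\<^bsub>M\<^esub>) \<Zsemi> (bng X \<star>\<^bsub>M\<^esub> bng Y)"
    and nab_un: "nab \<bbbone>\<^bsub>M\<^esub> = lun M \<bbbone>\<^bsub>M\<^esub>"
    and bng_un: "bng \<bbbone>\<^bsub>M\<^esub> = \<iota> \<bbbone>\<^bsub>M\<^esub>"

locale cd_category = sym_monoidal_category C M
  for C :: "('o, 'a, 'z) cat_scheme" (structure) and M +
  fixes copy :: "'o \<Rightarrow> 'a" and disc :: "'o \<Rightarrow> 'a"
  assumes copy_hom: "X \<in> obj C \<Longrightarrow> copy X \<in> hom C X (X \<odot>\<^bsub>M\<^esub> X)"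
    and disc_hom: "X \<in> obj C \<Longrightarrow> disc X \<in> hom C X \<bbbone>\<^bsub>M\<^esub>"
    and copy_coassoc: "X \<in> obj C
      \<Longrightarrow> copy X \<Zsemi> (copy X \<star>\<^bsub>M\<^esub> \<iota> X) \<Zsemi> asc M X X X = copy X \<Zsemi> (\<iota> X \<star>\<^bsub>M\<^esub> copy X)"
    and copy_lcounit: "X \<in> obj C \<Longrightarrow> copy X \<Zsemi> (disc X \<star>\<^bsub>M\<^esub> \<iota> X) \<Zsemi> lun M X = \<iota> X"
    and copy_rcounit: "X \<in> obj C \<Longrightarrow> copy X \<Zsemi> (\<iota> X \<star>\<^bsub>M\<^esub> disc X) \<Zsemi> run M X = \<iota> X"
    and copy_cocomm: "X \<in> obj C \<Longrightarrow> copy X \<Zsemi> symm M X X = copy X"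
    and copy_ten: "\<lbrakk>X \<in> obj C; Y \<in> obj C\<rbrakk>
      \<Longrightarrow> copy (X \<odot>\<^bsub>M\<^esub> Y) = (copy X \<star>\<^bsub>M\<^esub> copy Y) \<Zsemi> mid4 C M X X Y Y"
    and disc_ten: "\<lbrakk>X \<in> obj C; Y \<in> obj C\<rbrakk>
      \<Longrightarrow> disc (X \<odot>\<^bsub>M\<^esub> Y) = (disc X \<star>\<^bsub>M\<^esub> disc Y) \<Zsemi> lun M \<bbbone>\<^bsub>M\<^esub>"
    and copy_un: "copy \<bbbone>\<^bsub>M\<^esub> = inv_arr C (lun M \<bbbone>\<^bsub>M\<^esub>)"
    and disc_un: "disc \<bbbone>\<^bsub>M\<^esub> = \<iota> \<bbbone>\<^bsub>M\<^esub>"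

text \<open>The isomorphisms \<open>mu\<close> and \<open>eta\<close> of a strong symmetric monoidal functor that preserves the
  monoids are determined by the functor (\<open>eta\<close> is initial, \<open>mu\<close> is the copairing of the images of
  the injections), so they are quantified away instead of being carried along.\<close>

definition fc_morphism ::
  "('o, 'a, 'y) cat_scheme \<Rightarrow> ('o, 'a) smon \<Rightarrow> ('o \<Rightarrow> 'a) \<Rightarrow> ('o \<Rightarrow> 'a) \<Rightarrow>
   ('p, 'b, 'z) cat_scheme \<Rightarrow> ('p, 'b) smon \<Rightarrow> ('p \<Rightarrow> 'b) \<Rightarrow> ('p \<Rightarrow> 'b) \<Rightarrow>
   ('o, 'a, 'p, 'b) func \<Rightarrow> bool" where
  "fc_morphism C M nab bng D N nab' bng' F \<longleftrightarrow>
     fc_category C M nab bng \<and> fc_category D N nab' bng' \<and>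
     (\<exists>mu eta. strong_sym_monoidal_functor C M D N F mu eta \<and>
       (\<forall>X \<in> obj C. mu X X \<Zsemi>\<^bsub>D\<^esub> onA F (nab X) = nab' (onO F X)
          \<and> eta \<Zsemi>\<^bsub>D\<^esub> onA F (bng X) = bng' (onO F X)))"


section \<open>Rig categories\<close>

record ('o, 'a) rig = "('o, 'a) cat" +
  add :: "('o, 'a) smon"
  mul :: "('o, 'a) smon"
  dl :: "'o \<Rightarrow> 'o \<Rightarrow> 'o \<Rightarrow> 'a"
  dr :: "'o \<Rightarrow> 'o \<Rightarrow> 'o \<Rightarrow> 'a"
  lz :: "'o \<Rightarrow> 'a"
  rz :: "'o \<Rightarrow> 'a"

abbreviation addO (infixr "\<oplus>\<index>" 65) where "addO R \<equiv> tenO (add R)"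
abbreviation addA (infixr "\<boxplus>\<index>" 65) where "addA R \<equiv> tenA (add R)"
abbreviation zeroO ("\<zero>\<index>") where "zeroO R \<equiv> unO (add R)"
abbreviation mulO (infixr "\<otimes>\<index>" 70) where "mulO R \<equiv> tenO (mul R)"
abbreviation mulA (infixr "\<boxtimes>\<index>" 70) where "mulA R \<equiv> tenA (mul R)"
abbreviation oneO ("\<one>\<index>") where "oneO R \<equiv> unO (mul R)"

text \<open>\<open>dl X Y Z : X (Y + Z) \<rightarrow> X Y + X Z\<close>, \<open>dr X Y Z : (X + Y) Z \<rightarrow> X Z + Y Z\<close>,
  \<open>lz X : 0 X \<rightarrow> 0\<close> and \<open>rz X : X 0 \<rightarrow> 0\<close>, subject to the twenty-four coherence axioms of
  Laplaza, listed in his order.\<close>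

locale rig_category =
  add: sym_monoidal_category R "add R" + mul: sym_monoidal_category R "mul R"
  for R :: "('o, 'a, 'z) rig_scheme" (structure) +
  assumes dl_hom: "\<lbrakk>X \<in> obj R; Y \<in> obj R; Z \<in> obj R\<rbrakk>
      \<Longrightarrow> dl R X Y Z \<in> hom R (X \<otimes> (Y \<oplus> Z)) (X \<otimes> Y \<oplus> X \<otimes> Z)"
    and dl_iso: "\<lbrakk>X \<in> obj R; Y \<in> obj R; Z \<in> obj R\<rbrakk> \<Longrightarrow> iso R (dl R X Y Z)"
    and dl_nat: "\<lbrakk>f \<in> hom R X X'; g \<in> hom R Y Y'; h \<in> hom R Z Z'\<rbrakk>
      \<Longrightarrow> (f \<boxtimes> (g \<boxplus> h)) \<Zsemi> dl R X' Y' Z' = dl R X Y Z \<Zsemi> (f \<boxtimes> g \<boxplus> f \<boxtimes> h)"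
    and dr_hom: "\<lbrakk>X \<in> obj R; Y \<in> obj R; Z \<in> obj R\<rbrakk>
      \<Longrightarrow> dr R X Y Z \<in> hom R ((X \<oplus> Y) \<otimes> Z) (X \<otimes> Z \<oplus> Y \<otimes> Z)"
    and dr_iso: "\<lbrakk>X \<in> obj R; Y \<in> obj R; Z \<in> obj R\<rbrakk> \<Longrightarrow> iso R (dr R X Y Z)"
    and dr_nat: "\<lbrakk>f \<in> hom R X X'; g \<in> hom R Y Y'; h \<in> hom R Z Z'\<rbrakk>
      \<Longrightarrow> ((f \<boxplus> g) \<boxtimes> h) \<Zsemi> dr R X' Y' Z' = dr R X Y Z \<Zsemi> (f \<boxtimes> h \<boxplus> g \<boxtimes> h)"
    and lz_hom: "X \<in> obj R \<Longrightarrow> lz R X \<in> hom R (\<zero> \<otimes> X) \<zero>"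
    and lz_iso: "X \<in> obj R \<Longrightarrow> iso R (lz R X)"
    and lz_nat: "f \<in> hom R X Y \<Longrightarrow> (\<iota> \<zero> \<boxtimes> f) \<Zsemi> lz R Y = lz R X"
    and rz_hom: "X \<in> obj R \<Longrightarrow> rz R X \<in> hom R (X \<otimes> \<zero>) \<zero>"
    and rz_iso: "X \<in> obj R \<Longrightarrow> iso R (rz R X)"
    and rz_nat: "f \<in> hom R X Y \<Longrightarrow> (f \<boxtimes> \<iota> \<zero>) \<Zsemi> rz R Y = rz R X"
    and laplaza_1: "\<lbrakk>X \<in> obj R; Y \<in> obj R; Z \<in> obj R\<rbrakk>
      \<Longrightarrow> dl R X Y Z \<Zsemi> symm (add R) (X \<otimes> Y) (X \<otimes> Z) = (\<iota> X \<boxtimes> symm (add R) Y Z) \<Zsemi> dl R X Z Y"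
    and laplaza_2: "\<lbrakk>X \<in> obj R; Y \<in> obj R; Z \<in> obj R\<rbrakk>
      \<Longrightarrow> symm (mul R) (X \<oplus> Y) Z \<Zsemi> dl R Z X Y
        = dr R X Y Z \<Zsemi> (symm (mul R) X Z \<boxplus> symm (mul R) Y Z)"
    and laplaza_3: "\<lbrakk>X \<in> obj R; Y \<in> obj R; Z \<in> obj R\<rbrakk>
      \<Longrightarrow> dr R X Y Z \<Zsemi> symm (add R) (X \<otimes> Z) (Y \<otimes> Z) = (symm (add R) X Y \<boxtimes> \<iota> Z) \<Zsemi> dr R Y X Z"
    and laplaza_4: "\<lbrakk>X \<in> obj R; Y \<in> obj R; Z \<in> obj R; W \<in> obj R\<rbrakk>
      \<Longrightarrow> (asc (add R) X Y Z \<boxtimes> \<iota> W) \<Zsemi> dr R X (Y \<oplus> Z) W \<Zsemi> (\<iota> (X \<otimes> W) \<boxplus> dr R Y Z W)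
        = dr R (X \<oplus> Y) Z W \<Zsemi> (dr R X Y W \<boxplus> \<iota> (Z \<otimes> W)) \<Zsemi> asc (add R) (X \<otimes> W) (Y \<otimes> W) (Z \<otimes> W)"
    and laplaza_5: "\<lbrakk>X \<in> obj R; Y \<in> obj R; Z \<in> obj R; W \<in> obj R\<rbrakk>
      \<Longrightarrow> (\<iota> X \<boxtimes> asc (add R) Y Z W) \<Zsemi> dl R X Y (Z \<oplus> W) \<Zsemi> (\<iota> (X \<otimes> Y) \<boxplus> dl R X Z W)
        = dl R X (Y \<oplus> Z) W \<Zsemi> (dl R X Y Z \<boxplus> \<iota> (X \<otimes> W)) \<Zsemi> asc (add R) (X \<otimes> Y) (X \<otimes> Z) (X \<otimes> W)"
    and laplaza_6: "\<lbrakk>X \<in> obj R; Y \<in> obj R; Z \<in> obj R; W \<in> obj R\<rbrakk>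
      \<Longrightarrow> dl R (X \<otimes> Y) Z W \<Zsemi> (asc (mul R) X Y Z \<boxplus> asc (mul R) X Y W)
        = asc (mul R) X Y (Z \<oplus> W) \<Zsemi> (\<iota> X \<boxtimes> dl R Y Z W) \<Zsemi> dl R X (Y \<otimes> Z) (Y \<otimes> W)"
    and laplaza_7: "\<lbrakk>X \<in> obj R; Y \<in> obj R; Z \<in> obj R; W \<in> obj R\<rbrakk>
      \<Longrightarrow> asc (mul R) (X \<oplus> Y) Z W \<Zsemi> dr R X Y (Z \<otimes> W)
        = (dr R X Y Z \<boxtimes> \<iota> W) \<Zsemi> dr R (X \<otimes> Z) (Y \<otimes> Z) W \<Zsemi> (asc (mul R) X Z W \<boxplus> asc (mul R) Y Z W)"
    and laplaza_8: "\<lbrakk>X \<in> obj R; Y \<in> obj R; Z \<in> obj R; W \<in> obj R\<rbrakk>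
      \<Longrightarrow> asc (mul R) X (Y \<oplus> Z) W \<Zsemi> (\<iota> X \<boxtimes> dr R Y Z W) \<Zsemi> dl R X (Y \<otimes> W) (Z \<otimes> W)
        = (dl R X Y Z \<boxtimes> \<iota> W) \<Zsemi> dr R (X \<otimes> Y) (X \<otimes> Z) W \<Zsemi> (asc (mul R) X Y W \<boxplus> asc (mul R) X Z W)"
    and laplaza_9: "\<lbrakk>X \<in> obj R; Y \<in> obj R; Z \<in> obj R; W \<in> obj R\<rbrakk>
      \<Longrightarrow> dl R (X \<oplus> Y) Z W \<Zsemi> (dr R X Y Z \<boxplus> dr R X Y W)
        = dr R X Y (Z \<oplus> W) \<Zsemi> (dl R X Z W \<boxplus> dl R Y Z W)
          \<Zsemi> mid4 R (add R) (X \<otimes> Z) (X \<otimes> W) (Y \<otimes> Z) (Y \<otimes> W)"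
    and laplaza_10: "lz R \<zero> = rz R \<zero>"
    and laplaza_11: "\<lbrakk>X \<in> obj R; Y \<in> obj R\<rbrakk>
      \<Longrightarrow> dl R \<zero> X Y \<Zsemi> (lz R X \<boxplus> lz R Y) \<Zsemi> lun (add R) \<zero> = lz R (X \<oplus> Y)"
    and laplaza_12: "\<lbrakk>X \<in> obj R; Y \<in> obj R\<rbrakk>
      \<Longrightarrow> dr R X Y \<zero> \<Zsemi> (rz R X \<boxplus> rz R Y) \<Zsemi> lun (add R) \<zero> = rz R (X \<oplus> Y)"
    and laplaza_13: "run (mul R) \<zero> = lz R \<one>"
    and laplaza_14: "lun (mul R) \<zero> = rz R \<one>"
    and laplaza_15: "X \<in> obj R \<Longrightarrow> rz R X = symm (mul R) X \<zero> \<Zsemi> lz R X"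
    and laplaza_16: "\<lbrakk>X \<in> obj R; Y \<in> obj R\<rbrakk>
      \<Longrightarrow> asc (mul R) \<zero> X Y \<Zsemi> lz R (X \<otimes> Y) = (lz R X \<boxtimes> \<iota> Y) \<Zsemi> lz R Y"
    and laplaza_17: "\<lbrakk>X \<in> obj R; Y \<in> obj R\<rbrakk>
      \<Longrightarrow> asc (mul R) X \<zero> Y \<Zsemi> (\<iota> X \<boxtimes> lz R Y) \<Zsemi> rz R X = (rz R X \<boxtimes> \<iota> Y) \<Zsemi> lz R Y"
    and laplaza_18: "\<lbrakk>X \<in> obj R; Y \<in> obj R\<rbrakk>
      \<Longrightarrow> asc (mul R) X Y \<zero> \<Zsemi> (\<iota> X \<boxtimes> rz R Y) \<Zsemi> rz R X = rz R (X \<otimes> Y)"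
    and laplaza_19: "\<lbrakk>X \<in> obj R; Y \<in> obj R\<rbrakk>
      \<Longrightarrow> dl R X \<zero> Y \<Zsemi> (rz R X \<boxplus> \<iota> (X \<otimes> Y)) \<Zsemi> lun (add R) (X \<otimes> Y) = \<iota> X \<boxtimes> lun (add R) Y"
    and laplaza_20: "\<lbrakk>X \<in> obj R; Y \<in> obj R\<rbrakk>
      \<Longrightarrow> dr R \<zero> Y X \<Zsemi> (lz R X \<boxplus> \<iota> (Y \<otimes> X)) \<Zsemi> lun (add R) (Y \<otimes> X) = lun (add R) Y \<boxtimes> \<iota> X"
    and laplaza_21: "\<lbrakk>X \<in> obj R; Y \<in> obj R\<rbrakk>
      \<Longrightarrow> dl R X Y \<zero> \<Zsemi> (\<iota> (X \<otimes> Y) \<boxplus> rz R X) \<Zsemi> run (add R) (X \<otimes> Y) = \<iota> X \<boxtimes> run (add R) Y"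
    and laplaza_22: "\<lbrakk>X \<in> obj R; Y \<in> obj R\<rbrakk>
      \<Longrightarrow> dr R Y \<zero> X \<Zsemi> (\<iota> (Y \<otimes> X) \<boxplus> lz R X) \<Zsemi> run (add R) (Y \<otimes> X) = run (add R) Y \<boxtimes> \<iota> X"
    and laplaza_23: "\<lbrakk>X \<in> obj R; Y \<in> obj R\<rbrakk>
      \<Longrightarrow> dl R \<one> X Y \<Zsemi> (lun (mul R) X \<boxplus> lun (mul R) Y) = lun (mul R) (X \<oplus> Y)"
    and laplaza_24: "\<lbrakk>X \<in> obj R; Y \<in> obj R\<rbrakk>
      \<Longrightarrow> dr R X Y \<one> \<Zsemi> (run (mul R) X \<boxplus> run (mul R) Y) = run (mul R) (X \<oplus> Y)"

locale right_strict_rig_category =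
  rig_category R +
  add: strict_sym_monoidal_category R "add R" + mul: strict_sym_monoidal_category R "mul R"
  for R :: "('o, 'a, 'z) rig_scheme" (structure) +
  assumes lz_ide: "X \<in> obj R \<Longrightarrow> is_ide R (lz R X)"
    and rz_ide: "X \<in> obj R \<Longrightarrow> is_ide R (rz R X)"
    and dr_ide: "\<lbrakk>X \<in> obj R; Y \<in> obj R; Z \<in> obj R\<rbrakk> \<Longrightarrow> is_ide R (dr R X Y Z)"

text \<open>A discrete category is a set \<open>M\<close>, and a functor out of it is a map on objects.\<close>

locale sesquistrict_rig_category = right_strict_rig_category R
  for M :: "'m set" and H :: "'m \<Rightarrow> 'o" and R :: "('o, 'a, 'z) rig_scheme" (structure) +
  assumes H_obj: "A \<in> M \<Longrightarrow> H A \<in> obj R"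
    and dl_ide: "\<lbrakk>A \<in> M; X \<in> obj R; Y \<in> obj R\<rbrakk> \<Longrightarrow> is_ide R (dl R (H A) X Y)"

locale sesquistrict_rig_functor =
  S: sesquistrict_rig_category M H R + S': sesquistrict_rig_category M' H' R' +
  add: strict_sym_monoidal_functor R "add R" R' "add R'" \<beta> +
  mul: strict_sym_monoidal_functor R "mul R" R' "mul R'" \<beta>
  for M :: "'m set" and H and R :: "('o, 'a, 'y) rig_scheme"
    and M' :: "'n set" and H' and R' :: "('p, 'b, 'z) rig_scheme"
    and \<alpha> :: "'m \<Rightarrow> 'n" and \<beta> :: "('o, 'a, 'p, 'b) func" +
  assumes \<alpha>_closed: "A \<in> M \<Longrightarrow> \<alpha> A \<in> M'"
    and \<alpha>_H: "A \<in> M \<Longrightarrow> H' (\<alpha> A) = onO \<beta> (H A)"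
    and pres_dl: "\<lbrakk>X \<in> obj R; Y \<in> obj R; Z \<in> obj R\<rbrakk>
      \<Longrightarrow> onA \<beta> (dl R X Y Z) = dl R' (onO \<beta> X) (onO \<beta> Y) (onO \<beta> Z)"

record ('o, 'a) fccd_rig = "('o, 'a) rig" +
  nab :: "'o \<Rightarrow> 'a"
  bng :: "'o \<Rightarrow> 'a"
  copy :: "'o \<Rightarrow> 'a"
  disc :: "'o \<Rightarrow> 'a"

locale fccd_rig_category =
  rig_category R +
  fc: fc_category R "add R" "nab R" "bng R" + cd: cd_category R "mul R" "copy R" "disc R"
  for R :: "('o, 'a, 'z) fccd_rig_scheme" (structure) +
  assumes disc_add: "\<lbrakk>X \<in> obj R; Y \<in> obj R\<rbrakk>
      \<Longrightarrow> disc R (X \<oplus> Y) = (disc R X \<boxplus> disc R Y) \<Zsemi> nab R \<one>"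
    and copy_add: "\<lbrakk>X \<in> obj R; Y \<in> obj R\<rbrakk>
      \<Longrightarrow> copy R (X \<oplus> Y) =
        (inv_arr R (run (add R) X) \<boxplus> inv_arr R (lun (add R) Y))
        \<Zsemi> ((copy R X \<boxplus> bng R (X \<otimes> Y)) \<boxplus> (bng R (Y \<otimes> X) \<boxplus> copy R Y))
        \<Zsemi> (inv_arr R (dl R X X Y) \<boxplus> inv_arr R (dl R Y X Y))
        \<Zsemi> inv_arr R (dr R X Y (X \<oplus> Y))"


section \<open>Algebraic theories and their Lawvere theories\<close>

datatype 'f trm = Var nat | App 'f "'f trm list"

text \<open>An equation is in context: \<open>(n, t, t')\<close> equates two terms in the variables
  \<open>Var 0, \<dots>, Var (n - 1)\<close>.\<close>

record 'f alg_theory =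
  ops :: "'f set"
  arity :: "'f \<Rightarrow> nat"
  eqs :: "(nat \<times> 'f trm \<times> 'f trm) set"

fun wf_trm :: "'f alg_theory \<Rightarrow> nat \<Rightarrow> 'f trm \<Rightarrow> bool" where
  "wf_trm T n (Var i) \<longleftrightarrow> i < n"
| "wf_trm T n (App f ts) \<longleftrightarrow> f \<in> ops T \<and> length ts = arity T f \<and> (\<forall>t \<in> set ts. wf_trm T n t)"

definition algebraic_theory :: "'f alg_theory \<Rightarrow> bool" where
  "algebraic_theory T \<longleftrightarrow> (\<forall>(n, t, t') \<in> eqs T. wf_trm T n t \<and> wf_trm T n t')"

fun subst :: "(nat \<Rightarrow> 'f trm) \<Rightarrow> 'f trm \<Rightarrow> 'f trm" where
  "subst s (Var i) = s i"
| "subst s (App f ts) = App f (map (subst s) ts)"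

text \<open>Provable equality of terms in \<open>n\<close> variables.\<close>

inductive trm_eq :: "'f alg_theory \<Rightarrow> nat \<Rightarrow> 'f trm \<Rightarrow> 'f trm \<Rightarrow> bool"
  for T :: "'f alg_theory" and n :: nat where
  ax: "\<lbrakk>(k, t, t') \<in> eqs T; \<And>i. i < k \<Longrightarrow> wf_trm T n (s i)\<rbrakk> \<Longrightarrow> trm_eq T n (subst s t) (subst s t')"
| refl: "wf_trm T n t \<Longrightarrow> trm_eq T n t t"
| sym: "trm_eq T n t u \<Longrightarrow> trm_eq T n u t"
| trans: "\<lbrakk>trm_eq T n t u; trm_eq T n u v\<rbrakk> \<Longrightarrow> trm_eq T n t v"
| cong: "\<lbrakk>f \<in> ops T; length ts = arity T f; list_all2 (trm_eq T n) ts us\<rbrakk>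
    \<Longrightarrow> trm_eq T n (App f ts) (App f us)"

definition trm_class :: "'f alg_theory \<Rightarrow> nat \<Rightarrow> 'f trm \<Rightarrow> 'f trm set" where
  "trm_class T n t = {t'. trm_eq T n t t'}"

definition rep :: "'x set \<Rightarrow> 'x" where
  "rep c = (SOME x. x \<in> c)"

text \<open>\<open>(n, m, cs)\<close> is the arrow \<open>n \<rightarrow> m\<close> of the Lawvere theory given by the \<open>m\<close>-tuple \<open>cs\<close> of
  classes of terms in \<open>n\<close> variables.\<close>

type_synonym 'f larr = "nat \<times> nat \<times> 'f trm set list"

definition lawvere :: "'f alg_theory \<Rightarrow> (nat, 'f larr) cat" where
  "lawvere T = \<lparr>obj = UNIV,
     arr = {(n, m, map (trm_class T n) ts) | n m ts. length ts = m \<and> (\<forall>t \<in> set ts. wf_trm T n t)},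
     src = (\<lambda>(n, m, cs). n),
     tgt = (\<lambda>(n, m, cs). m),
     ide = (\<lambda>n. (n, n, map (\<lambda>i. trm_class T n (Var i)) [0..<n])),
     seq = (\<lambda>(n, m, cs) (_, k, ds).
       (n, k, map (\<lambda>d. trm_class T n (subst (\<lambda>i. rep (cs ! i)) (rep d))) ds))\<rparr>"

text \<open>The strict fc category freely generated by one object: \<open>(n, m, ks)\<close> is the function
  \<open>{0..<n} \<rightarrow> {0..<m}\<close> with list of values \<open>ks\<close>.\<close>

definition aleph0 :: "(nat, nat \<times> nat \<times> nat list) cat" where
  "aleph0 = \<lparr>obj = UNIV,
     arr = {(n, m, ks). length ks = n \<and> set ks \<subseteq> {..<m}},
     src = (\<lambda>(n, m, ks). n),
     tgt = (\<lambda>(n, m, ks). m),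
     ide = (\<lambda>n. (n, n, [0..<n])),
     seq = (\<lambda>(n, _, ks) (_, m, ls). (n, m, map (\<lambda>k. ls ! k) ks))\<rparr>"

definition law_incl :: "'f alg_theory \<Rightarrow> nat \<times> nat \<times> nat list \<Rightarrow> 'f larr" where
  \<comment> \<open>the functor \<open>d\<close> from \<open>aleph0\<close> to the opposite of the Lawvere theory, on arrows\<close>
  "law_incl T = (\<lambda>(n, m, ks). (m, n, map (\<lambda>k. trm_class T m (Var k)) ks))"

definition law_op :: "'f alg_theory \<Rightarrow> (nat, 'f larr) cat" where
  "law_op T = op_cat (lawvere T)"

definition law_op_add :: "'f alg_theory \<Rightarrow> (nat, 'f larr) smon" where
  "law_op_add T = \<lparr>tenO = (+),
     tenA = (\<lambda>(n, m, cs) (n', m', ds). (n + n', m + m',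
       map (\<lambda>c. trm_class T (n + n') (rep c)) cs
       @ map (\<lambda>d. trm_class T (n + n') (subst (\<lambda>i. Var (n + i)) (rep d))) ds)),
     unO = 0,
     asc = (\<lambda>n m k. ide (law_op T) (n + m + k)),
     lun = ide (law_op T),
     run = ide (law_op T),
     symm = (\<lambda>n m. law_incl T (n + m, m + n, [m..<m + n] @ [0..<m]))\<rparr>"

definition law_op_nab :: "'f alg_theory \<Rightarrow> nat \<Rightarrow> 'f larr" where
  "law_op_nab T n = law_incl T (n + n, n, [0..<n] @ [0..<n])"

definition law_op_bng :: "'f alg_theory \<Rightarrow> nat \<Rightarrow> 'f larr" where
  "law_op_bng T n = law_incl T (0, n, [])"

definition law_gen :: "'f alg_theory \<Rightarrow> 'f \<Rightarrow> 'f larr" where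
  \<comment> \<open>the operation \<open>f\<close> of arity \<open>n\<close> as an arrow \<open>n \<rightarrow> 1\<close> of the Lawvere theory\<close>
  "law_gen T f = (arity T f, 1, [trm_class T (arity T f) (App f (map Var [0..<arity T f]))])"


section \<open>Copy-discard rig categories over a theory\<close>

record ('f, 'o, 'a) tcd_rig = "('o, 'a) fccd_rig" +
  thy :: "(nat, 'f larr, 'o, 'a) func"

text \<open>The functor \<open>c\<close> from \<open>aleph0\<close> sends \<open>n\<close> to the \<open>n\<close>-fold sum of \<open>1\<close>, and a function to the
  copairing of the injections at its values.\<close>

primrec nsum :: "('o, 'a, 'z) fccd_rig_scheme \<Rightarrow> nat \<Rightarrow> 'o" where
  "nsum R 0 = \<zero>\<^bsub>R\<^esub>"
| "nsum R (Suc n) = \<one>\<^bsub>R\<^esub> \<oplus>\<^bsub>R\<^esub> nsum R n"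

fun ninj :: "('o, 'a, 'z) fccd_rig_scheme \<Rightarrow> nat \<Rightarrow> nat \<Rightarrow> 'a" where
  "ninj R 0 k = undefined"
| "ninj R (Suc m) 0 =
     inv_arr R (run (add R) \<one>\<^bsub>R\<^esub>) \<Zsemi>\<^bsub>R\<^esub> (ide R \<one>\<^bsub>R\<^esub> \<boxplus>\<^bsub>R\<^esub> bng R (nsum R m))"
| "ninj R (Suc m) (Suc k) =
     inv_arr R (lun (add R) \<one>\<^bsub>R\<^esub>) \<Zsemi>\<^bsub>R\<^esub> (bng R \<one>\<^bsub>R\<^esub> \<boxplus>\<^bsub>R\<^esub> ninj R m k)"

primrec ncopair :: "('o, 'a, 'z) fccd_rig_scheme \<Rightarrow> nat \<Rightarrow> nat list \<Rightarrow> 'a" where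
  "ncopair R m [] = bng R (nsum R m)"
| "ncopair R m (k # ks) = (ninj R m k \<boxplus>\<^bsub>R\<^esub> ncopair R m ks) \<Zsemi>\<^bsub>R\<^esub> nab R (nsum R m)"

definition one_incl :: "('o, 'a, 'z) fccd_rig_scheme \<Rightarrow> nat \<times> nat \<times> nat list \<Rightarrow> 'a" where
  "one_incl R = (\<lambda>(n, m, ks). ncopair R m ks)"

locale tcd_rig_category = fccd_rig_category R
  for T :: "'f alg_theory" and R :: "('f, 'o, 'a, 'z) tcd_rig_scheme" (structure) +
  assumes thy_fc: "fc_morphism (law_op T) (law_op_add T) (law_op_nab T) (law_op_bng T)
      R (add R) (nab R) (bng R) (thy R)"
    and thy_onO: "onO (thy R) n = nsum R n"
    and thy_onA: "h \<in> arr aleph0 \<Longrightarrow> onA (thy R) (law_incl T h) = one_incl R h"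

locale sesquistrict_tcd_rig_category =
  sesquistrict_rig_category M H R + tcd_rig_category T R
  for T :: "'f alg_theory" and M :: "'m set" and H :: "'m \<Rightarrow> 'o"
    and R :: "('f, 'o, 'a, 'z) tcd_rig_scheme" (structure)

text \<open>Outside the carriers the maps are \<open>undefined\<close>, so that equality of morphisms is equality
  in HOL.\<close>

locale sesquistrict_tcd_rig_morphism =
  S: sesquistrict_tcd_rig_category T M H R + S': sesquistrict_tcd_rig_category T M' H' R' +
  sesquistrict_rig_functor M H R M' H' R' \<alpha> \<beta>
  for T :: "'f alg_theory"
    and M :: "'m set" and H and R :: "('f, 'o, 'a, 'y) tcd_rig_scheme"
    and M' :: "'n set" and H' and R' :: "('f, 'p, 'b, 'z) tcd_rig_scheme"
    and \<alpha> :: "'m \<Rightarrow> 'n" and \<beta> :: "('o, 'a, 'p, 'b) func" +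
  assumes pres_nab: "X \<in> obj R \<Longrightarrow> onA \<beta> (nab R X) = nab R' (onO \<beta> X)"
    and pres_bng: "X \<in> obj R \<Longrightarrow> onA \<beta> (bng R X) = bng R' (onO \<beta> X)"
    and pres_copy: "X \<in> obj R \<Longrightarrow> onA \<beta> (copy R X) = copy R' (onO \<beta> X)"
    and pres_disc: "X \<in> obj R \<Longrightarrow> onA \<beta> (disc R X) = disc R' (onO \<beta> X)"
    and pres_thyO: "onO \<beta> (onO (thy R) n) = onO (thy R') n"
    and pres_thyA: "a \<in> arr (law_op T) \<Longrightarrow> onA \<beta> (onA (thy R) a) = onA (thy R') a"
    and ext_\<alpha>: "\<alpha> \<in> extensional M"
    and ext_onO: "onO \<beta> \<in> extensional (obj R)"
    and ext_onA: "onA \<beta> \<in> extensional (arr R)"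


section \<open>Monoidal signatures\<close>

record ('s, 'g) msig =
  sorts :: "'s set"
  gens :: "'g set"
  gar :: "'g \<Rightarrow> 's list"
  gcoar :: "'g \<Rightarrow> 's list"

definition monoidal_signature :: "('s, 'g) msig \<Rightarrow> bool" where
  "monoidal_signature G \<longleftrightarrow>
     (\<forall>s \<in> gens G. gar G s \<in> lists (sorts G) \<and> gcoar G s \<in> lists (sorts G))"

fun sharp :: "('o, 'a, 'z) rig_scheme \<Rightarrow> ('s \<Rightarrow> 'o) \<Rightarrow> 's list \<Rightarrow> 'o" where
  "sharp R h [] = \<one>\<^bsub>R\<^esub>"
| "sharp R h [A] = h A"
| "sharp R h (A # B # U) = h A \<otimes>\<^bsub>R\<^esub> sharp R h (B # U)"

definition sig_interp ::
  "('s, 'g) msig \<Rightarrow> 'm set \<Rightarrow> ('m \<Rightarrow> 'o) \<Rightarrow> ('o, 'a, 'z) rig_scheme \<Rightarrow>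
   ('s \<Rightarrow> 'm) \<Rightarrow> ('g \<Rightarrow> 'a) \<Rightarrow> bool" where
  "sig_interp G M H R aS aG \<longleftrightarrow>
     (\<forall>A \<in> sorts G. aS A \<in> M) \<and>
     (\<forall>s \<in> gens G. aG s \<in> hom R (sharp R (H \<circ> aS) (gar G s)) (sharp R (H \<circ> aS) (gcoar G s)))"


section \<open>Circuits\<close>

datatype ('s, 'g) circ =
    CId 's
  | CId1
  | CGen 'g
  | CSym 's 's
  | CSeq "('s, 'g) circ" "('s, 'g) circ"
  | CTen "('s, 'g) circ" "('s, 'g) circ"
  | CCopy 's
  | CDisc 's

fun cdom :: "('s, 'g) msig \<Rightarrow> ('s, 'g) circ \<Rightarrow> 's list" where
  "cdom G (CId A) = [A]"
| "cdom G CId1 = []"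
| "cdom G (CGen s) = gar G s"
| "cdom G (CSym A B) = [A, B]"
| "cdom G (CSeq c d) = cdom G c"
| "cdom G (CTen c d) = cdom G c @ cdom G d"
| "cdom G (CCopy A) = [A]"
| "cdom G (CDisc A) = [A]"

fun ccod :: "('s, 'g) msig \<Rightarrow> ('s, 'g) circ \<Rightarrow> 's list" where
  "ccod G (CId A) = [A]"
| "ccod G CId1 = []"
| "ccod G (CGen s) = gcoar G s"
| "ccod G (CSym A B) = [B, A]"
| "ccod G (CSeq c d) = ccod G d"
| "ccod G (CTen c d) = ccod G c @ ccod G d"
| "ccod G (CCopy A) = [A, A]"
| "ccod G (CDisc A) = []"

fun wf_circ :: "('s, 'g) msig \<Rightarrow> ('s, 'g) circ \<Rightarrow> bool" where
  "wf_circ G (CId A) \<longleftrightarrow> A \<in> sorts G"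
| "wf_circ G CId1 \<longleftrightarrow> True"
| "wf_circ G (CGen s) \<longleftrightarrow> s \<in> gens G"
| "wf_circ G (CSym A B) \<longleftrightarrow> A \<in> sorts G \<and> B \<in> sorts G"
| "wf_circ G (CSeq c d) \<longleftrightarrow> wf_circ G c \<and> wf_circ G d \<and> ccod G c = cdom G d"
| "wf_circ G (CTen c d) \<longleftrightarrow> wf_circ G c \<and> wf_circ G d"
| "wf_circ G (CCopy A) \<longleftrightarrow> A \<in> sorts G"
| "wf_circ G (CDisc A) \<longleftrightarrow> A \<in> sorts G"

text \<open>Identities, symmetries, copy and discard on words.\<close>

primrec cid :: "'s list \<Rightarrow> ('s, 'g) circ" where
  "cid [] = CId1"
| "cid (A # U) = CTen (CId A) (cid U)"

primrec csym1 :: "'s \<Rightarrow> 's list \<Rightarrow> ('s, 'g) circ" where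
  "csym1 A [] = CId A"
| "csym1 A (B # V) = CSeq (CTen (CSym A B) (cid V)) (CTen (CId B) (csym1 A V))"

primrec csym :: "'s list \<Rightarrow> 's list \<Rightarrow> ('s, 'g) circ" where
  "csym [] V = cid V"
| "csym (A # U) V = CSeq (CTen (CId A) (csym U V)) (CTen (csym1 A V) (cid U))"

primrec ccopy :: "'s list \<Rightarrow> ('s, 'g) circ" where
  "ccopy [] = CId1"
| "ccopy (A # U) = CSeq (CTen (CCopy A) (ccopy U)) (CTen (CTen (CId A) (csym1 A U)) (cid U))"

primrec cdisc :: "'s list \<Rightarrow> ('s, 'g) circ" where
  "cdisc [] = CId1"
| "cdisc (A # U) = CTen (CDisc A) (cdisc U)"

inductive circ_eq :: "('s, 'g) msig \<Rightarrow> ('s, 'g) circ \<Rightarrow> ('s, 'g) circ \<Rightarrow> bool"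
  for G :: "('s, 'g) msig" where
  refl: "wf_circ G c \<Longrightarrow> circ_eq G c c"
| sym: "circ_eq G c d \<Longrightarrow> circ_eq G d c"
| trans: "\<lbrakk>circ_eq G c d; circ_eq G d e\<rbrakk> \<Longrightarrow> circ_eq G c e"
| cong_seq: "\<lbrakk>circ_eq G c c'; circ_eq G d d'; ccod G c = cdom G d\<rbrakk>
    \<Longrightarrow> circ_eq G (CSeq c d) (CSeq c' d')"
| cong_ten: "\<lbrakk>circ_eq G c c'; circ_eq G d d'\<rbrakk> \<Longrightarrow> circ_eq G (CTen c d) (CTen c' d')"
| seq_assoc: "\<lbrakk>wf_circ G c; wf_circ G d; wf_circ G e; ccod G c = cdom G d; ccod G d = cdom G e\<rbrakk>
    \<Longrightarrow> circ_eq G (CSeq (CSeq c d) e) (CSeq c (CSeq d e))"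
| id_seq: "wf_circ G c \<Longrightarrow> circ_eq G (CSeq (cid (cdom G c)) c) c"
| seq_id: "wf_circ G c \<Longrightarrow> circ_eq G (CSeq c (cid (ccod G c))) c"
| ten_assoc: "\<lbrakk>wf_circ G c; wf_circ G d; wf_circ G e\<rbrakk>
    \<Longrightarrow> circ_eq G (CTen (CTen c d) e) (CTen c (CTen d e))"
| one_ten: "wf_circ G c \<Longrightarrow> circ_eq G (CTen CId1 c) c"
| ten_one: "wf_circ G c \<Longrightarrow> circ_eq G (CTen c CId1) c"
| interchange: "\<lbrakk>wf_circ G c; wf_circ G c'; wf_circ G d; wf_circ G d';
      ccod G c = cdom G c'; ccod G d = cdom G d'\<rbrakk>
    \<Longrightarrow> circ_eq G (CTen (CSeq c c') (CSeq d d')) (CSeq (CTen c d) (CTen c' d'))"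
| sym_sym: "\<lbrakk>A \<in> sorts G; B \<in> sorts G\<rbrakk>
    \<Longrightarrow> circ_eq G (CSeq (CSym A B) (CSym B A)) (cid [A, B])"
| sym_nat: "\<lbrakk>wf_circ G c; W \<in> lists (sorts G)\<rbrakk>
    \<Longrightarrow> circ_eq G (CSeq (CTen c (cid W)) (csym (ccod G c) W))
                 (CSeq (csym (cdom G c) W) (CTen (cid W) c))"
| copy_assoc: "A \<in> sorts G
    \<Longrightarrow> circ_eq G (CSeq (CCopy A) (CTen (CCopy A) (CId A))) (CSeq (CCopy A) (CTen (CId A) (CCopy A)))"
| copy_lunit: "A \<in> sorts G \<Longrightarrow> circ_eq G (CSeq (CCopy A) (CTen (CDisc A) (CId A))) (CId A)"
| copy_runit: "A \<in> sorts G \<Longrightarrow> circ_eq G (CSeq (CCopy A) (CTen (CId A) (CDisc A))) (CId A)"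
| copy_comm: "A \<in> sorts G \<Longrightarrow> circ_eq G (CSeq (CCopy A) (CSym A A)) (CCopy A)"


section \<open>Tapes\<close>

text \<open>A word over the sorts is a monomial, a list of words is a polynomial; the sum of
  polynomials is \<open>@\<close>, with unit \<open>[]\<close>, and the unit of the product is \<open>[[]]\<close>.\<close>

type_synonym 's poly = "'s list list"

definition pten :: "'s poly \<Rightarrow> 's poly \<Rightarrow> 's poly" where
  "pten P Q = concat (map (\<lambda>U. map (\<lambda>V. U @ V) Q) P)"

datatype ('s, 'g, 'f) tape =
    TId "'s list"
  | TId0
  | TCirc "('s, 'g) circ"
  | TSym "'s list" "'s list"
  | TSeq "('s, 'g, 'f) tape" "('s, 'g, 'f) tape"
  | TSum "('s, 'g, 'f) tape" "('s, 'g, 'f) tape"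
  | TBng "'s list"
  | TNab "'s list"
  | TOp 'f "'s list"

fun tdom :: "('s, 'g) msig \<Rightarrow> ('s, 'g, 'f) tape \<Rightarrow> 's poly" where
  "tdom G (TId U) = [U]"
| "tdom G TId0 = []"
| "tdom G (TCirc c) = [cdom G c]"
| "tdom G (TSym U V) = [U, V]"
| "tdom G (TSeq t u) = tdom G t"
| "tdom G (TSum t u) = tdom G t @ tdom G u"
| "tdom G (TBng U) = []"
| "tdom G (TNab U) = [U, U]"
| "tdom G (TOp f U) = [U]"

fun tcod :: "'f alg_theory \<Rightarrow> ('s, 'g) msig \<Rightarrow> ('s, 'g, 'f) tape \<Rightarrow> 's poly" where
  "tcod T G (TId U) = [U]"
| "tcod T G TId0 = []"
| "tcod T G (TCirc c) = [ccod G c]"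
| "tcod T G (TSym U V) = [V, U]"
| "tcod T G (TSeq t u) = tcod T G u"
| "tcod T G (TSum t u) = tcod T G t @ tcod T G u"
| "tcod T G (TBng U) = [U]"
| "tcod T G (TNab U) = [U]"
| "tcod T G (TOp f U) = replicate (arity T f) U"

fun wf_tape :: "'f alg_theory \<Rightarrow> ('s, 'g) msig \<Rightarrow> ('s, 'g, 'f) tape \<Rightarrow> bool" where
  "wf_tape T G (TId U) \<longleftrightarrow> U \<in> lists (sorts G)"
| "wf_tape T G TId0 \<longleftrightarrow> True"
| "wf_tape T G (TCirc c) \<longleftrightarrow> wf_circ G c"
| "wf_tape T G (TSym U V) \<longleftrightarrow> U \<in> lists (sorts G) \<and> V \<in> lists (sorts G)"
| "wf_tape T G (TSeq t u) \<longleftrightarrow> wf_tape T G t \<and> wf_tape T G u \<and> tcod T G t = tdom G u"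
| "wf_tape T G (TSum t u) \<longleftrightarrow> wf_tape T G t \<and> wf_tape T G u"
| "wf_tape T G (TBng U) \<longleftrightarrow> U \<in> lists (sorts G)"
| "wf_tape T G (TNab U) \<longleftrightarrow> U \<in> lists (sorts G)"
| "wf_tape T G (TOp f U) \<longleftrightarrow> f \<in> ops T \<and> U \<in> lists (sorts G)"

definition tsum :: "('s, 'g, 'f) tape list \<Rightarrow> ('s, 'g, 'f) tape" where
  "tsum ts = foldr TSum ts TId0"

primrec tid :: "'s poly \<Rightarrow> ('s, 'g, 'f) tape" where
  "tid [] = TId0"
| "tid (U # P) = TSum (TId U) (tid P)"

primrec tsym1 :: "'s list \<Rightarrow> 's poly \<Rightarrow> ('s, 'g, 'f) tape" where
  "tsym1 U [] = TId U"
| "tsym1 U (V # Q) = TSeq (TSum (TSym U V) (tid Q)) (TSum (TId V) (tsym1 U Q))"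

primrec tsym :: "'s poly \<Rightarrow> 's poly \<Rightarrow> ('s, 'g, 'f) tape" where
  "tsym [] Q = tid Q"
| "tsym (U # P) Q = TSeq (TSum (TId U) (tsym P Q)) (TSum (tsym1 U Q) (tid P))"

primrec tbng :: "'s poly \<Rightarrow> ('s, 'g, 'f) tape" where
  "tbng [] = TId0"
| "tbng (U # P) = TSum (TBng U) (tbng P)"

primrec tnab :: "'s poly \<Rightarrow> ('s, 'g, 'f) tape" where
  "tnab [] = TId0"
| "tnab (U # P) = TSeq (TSum (TSum (TId U) (tsym P [U])) (tid P)) (TSum (TNab U) (tnab P))"

primrec tnabn :: "nat \<Rightarrow> 's poly \<Rightarrow> ('s, 'g, 'f) tape" where
  "tnabn 0 P = tbng P"
| "tnabn (Suc m) P = TSeq (TSum (tid P) (tnabn m P)) (tnab P)"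

fun tdl :: "'s poly \<Rightarrow> 's poly \<Rightarrow> 's poly \<Rightarrow> ('s, 'g, 'f) tape" where
  "tdl [] Q R = TId0"
| "tdl (U # P) Q R = TSeq
     (TSum (tid (pten [U] (Q @ R))) (tdl P Q R))
     (TSum (TSum (tid (pten [U] Q)) (tsym (pten [U] R) (pten P Q))) (tid (pten P R)))"

fun tdl_inv :: "'s poly \<Rightarrow> 's poly \<Rightarrow> 's poly \<Rightarrow> ('s, 'g, 'f) tape" where
  "tdl_inv [] Q R = TId0"
| "tdl_inv (U # P) Q R = TSeq
     (TSum (TSum (tid (pten [U] Q)) (tsym (pten P Q) (pten [U] R))) (tid (pten P R)))
     (TSum (tid (pten [U] (Q @ R))) (tdl_inv P Q R))"

text \<open>The symmetry of the product: distribute on the right factor, then swap monomials.\<close>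

primrec tsymm :: "'s poly \<Rightarrow> 's poly \<Rightarrow> ('s, 'g, 'f) tape" where
  "tsymm P [] = TId0"
| "tsymm P (V # Q) =
     TSeq (tdl P [V] Q) (TSum (tsum (map (\<lambda>U. TCirc (csym U V)) P)) (tsymm P Q))"

primrec top_poly :: "'f alg_theory \<Rightarrow> 'f \<Rightarrow> 's poly \<Rightarrow> ('s, 'g, 'f) tape" where
  "top_poly T f [] = TId0"
| "top_poly T f (U # P) =
     TSeq (TSum (TOp f U) (top_poly T f P)) (tdl_inv (replicate (arity T f) []) [U] P)"

fun ttrm :: "nat \<Rightarrow> 'f trm \<Rightarrow> 's list \<Rightarrow> ('s, 'g, 'f) tape" where
  "ttrm n (Var i) U =
     TSum (TSum (tbng (replicate i U)) (TId U)) (tbng (replicate (n - Suc i) U))"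
| "ttrm n (App f ts) U =
     TSeq (TSeq (TOp f U) (tsum (map (\<lambda>t. ttrm n t U) ts))) (tnabn (length ts) (replicate n U))"

primrec lwhisk1 :: "'s list \<Rightarrow> ('s, 'g, 'f) tape \<Rightarrow> ('s, 'g, 'f) tape" where
  "lwhisk1 U (TId V) = TId (U @ V)"
| "lwhisk1 U TId0 = TId0"
| "lwhisk1 U (TCirc c) = TCirc (CTen (cid U) c)"
| "lwhisk1 U (TSym V W) = TSym (U @ V) (U @ W)"
| "lwhisk1 U (TSeq t u) = TSeq (lwhisk1 U t) (lwhisk1 U u)"
| "lwhisk1 U (TSum t u) = TSum (lwhisk1 U t) (lwhisk1 U u)"
| "lwhisk1 U (TBng V) = TBng (U @ V)"
| "lwhisk1 U (TNab V) = TNab (U @ V)"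
| "lwhisk1 U (TOp f V) = TOp f (U @ V)"

primrec rwhisk1 :: "'s list \<Rightarrow> ('s, 'g, 'f) tape \<Rightarrow> ('s, 'g, 'f) tape" where
  "rwhisk1 U (TId V) = TId (V @ U)"
| "rwhisk1 U TId0 = TId0"
| "rwhisk1 U (TCirc c) = TCirc (CTen c (cid U))"
| "rwhisk1 U (TSym V W) = TSym (V @ U) (W @ U)"
| "rwhisk1 U (TSeq t u) = TSeq (rwhisk1 U t) (rwhisk1 U u)"
| "rwhisk1 U (TSum t u) = TSum (rwhisk1 U t) (rwhisk1 U u)"
| "rwhisk1 U (TBng V) = TBng (V @ U)"
| "rwhisk1 U (TNab V) = TNab (V @ U)"
| "rwhisk1 U (TOp f V) = TOp f (V @ U)"

primrec lwhisk :: "'s poly \<Rightarrow> ('s, 'g, 'f) tape \<Rightarrow> ('s, 'g, 'f) tape" where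
  "lwhisk [] t = TId0"
| "lwhisk (W # S) t = TSum (lwhisk1 W t) (lwhisk S t)"

primrec rwhisk ::
  "'f alg_theory \<Rightarrow> ('s, 'g) msig \<Rightarrow> 's poly \<Rightarrow> ('s, 'g, 'f) tape \<Rightarrow> ('s, 'g, 'f) tape" where
  "rwhisk T G [] t = TId0"
| "rwhisk T G (W # S) t = TSeq
     (TSeq (tdl (tdom G t) [W] S) (TSum (rwhisk1 W t) (rwhisk T G S t)))
     (tdl_inv (tcod T G t) [W] S)"

definition tten ::
  "'f alg_theory \<Rightarrow> ('s, 'g) msig \<Rightarrow> ('s, 'g, 'f) tape \<Rightarrow> ('s, 'g, 'f) tape \<Rightarrow> ('s, 'g, 'f) tape" where
  "tten T G t u = TSeq (lwhisk (tdom G t) u) (rwhisk T G (tcod T G u) t)"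

primrec tcopy :: "'s poly \<Rightarrow> ('s, 'g, 'f) tape" where
  "tcopy [] = TId0"
| "tcopy (U # P) =
     TSum (TSum (TCirc (ccopy U)) (tbng (pten [U] P)))
          (TSeq (TSum (tbng (pten P [U])) (tcopy P)) (tdl_inv P [U] P))"

primrec tdisc :: "'s poly \<Rightarrow> ('s, 'g, 'f) tape" where
  "tdisc [] = TBng []"
| "tdisc (U # P) = TSeq (TSum (TCirc (cdisc U)) (tdisc P)) (TNab [])"

inductive tape_eq ::
  "'f alg_theory \<Rightarrow> ('s, 'g) msig \<Rightarrow> ('s, 'g, 'f) tape \<Rightarrow> ('s, 'g, 'f) tape \<Rightarrow> bool"
  for T :: "'f alg_theory" and G :: "('s, 'g) msig" where
  refl: "wf_tape T G t \<Longrightarrow> tape_eq T G t t"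
| sym: "tape_eq T G t u \<Longrightarrow> tape_eq T G u t"
| trans: "\<lbrakk>tape_eq T G t u; tape_eq T G u v\<rbrakk> \<Longrightarrow> tape_eq T G t v"
| cong_seq: "\<lbrakk>tape_eq T G t t'; tape_eq T G u u'; tcod T G t = tdom G u\<rbrakk>
    \<Longrightarrow> tape_eq T G (TSeq t u) (TSeq t' u')"
| cong_sum: "\<lbrakk>tape_eq T G t t'; tape_eq T G u u'\<rbrakk> \<Longrightarrow> tape_eq T G (TSum t u) (TSum t' u')"
| cong_ten: "\<lbrakk>tape_eq T G t t'; tape_eq T G u u'\<rbrakk> \<Longrightarrow> tape_eq T G (tten T G t u) (tten T G t' u')"
| seq_assoc: "\<lbrakk>wf_tape T G t; wf_tape T G u; wf_tape T G v;
      tcod T G t = tdom G u; tcod T G u = tdom G v\<rbrakk>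
    \<Longrightarrow> tape_eq T G (TSeq (TSeq t u) v) (TSeq t (TSeq u v))"
| id_seq: "wf_tape T G t \<Longrightarrow> tape_eq T G (TSeq (tid (tdom G t)) t) t"
| seq_id: "wf_tape T G t \<Longrightarrow> tape_eq T G (TSeq t (tid (tcod T G t))) t"
| sum_assoc: "\<lbrakk>wf_tape T G t; wf_tape T G u; wf_tape T G v\<rbrakk>
    \<Longrightarrow> tape_eq T G (TSum (TSum t u) v) (TSum t (TSum u v))"
| zero_sum: "wf_tape T G t \<Longrightarrow> tape_eq T G (TSum TId0 t) t"
| sum_zero: "wf_tape T G t \<Longrightarrow> tape_eq T G (TSum t TId0) t"
| interchange: "\<lbrakk>wf_tape T G t; wf_tape T G t'; wf_tape T G u; wf_tape T G u';
      tcod T G t = tdom G t'; tcod T G u = tdom G u'\<rbrakk>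
    \<Longrightarrow> tape_eq T G (TSum (TSeq t t') (TSeq u u')) (TSeq (TSum t u) (TSum t' u'))"
| sym_sym: "\<lbrakk>U \<in> lists (sorts G); V \<in> lists (sorts G)\<rbrakk>
    \<Longrightarrow> tape_eq T G (TSeq (TSym U V) (TSym V U)) (tid [U, V])"
| sym_nat: "\<lbrakk>wf_tape T G t; R \<in> lists (lists (sorts G))\<rbrakk>
    \<Longrightarrow> tape_eq T G (TSeq (TSum t (tid R)) (tsym (tcod T G t) R))
                   (TSeq (tsym (tdom G t) R) (TSum (tid R) t))"
| nab_assoc: "U \<in> lists (sorts G)
    \<Longrightarrow> tape_eq T G (TSeq (TSum (TNab U) (TId U)) (TNab U)) (TSeq (TSum (TId U) (TNab U)) (TNab U))"
| nab_lunit: "U \<in> lists (sorts G) \<Longrightarrow> tape_eq T G (TSeq (TSum (TBng U) (TId U)) (TNab U)) (TId U)"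
| nab_runit: "U \<in> lists (sorts G) \<Longrightarrow> tape_eq T G (TSeq (TSum (TId U) (TBng U)) (TNab U)) (TId U)"
| nab_comm: "U \<in> lists (sorts G) \<Longrightarrow> tape_eq T G (TSeq (TSym U U) (TNab U)) (TNab U)"
| nab_circ: "wf_circ G c
    \<Longrightarrow> tape_eq T G (TSeq (TNab (cdom G c)) (TCirc c))
                   (TSeq (TSum (TCirc c) (TCirc c)) (TNab (ccod G c)))"
| bng_circ: "wf_circ G c \<Longrightarrow> tape_eq T G (TSeq (TBng (cdom G c)) (TCirc c)) (TBng (ccod G c))"
| nab_op: "\<lbrakk>f \<in> ops T; U \<in> lists (sorts G)\<rbrakk>
    \<Longrightarrow> tape_eq T G (TSeq (TNab U) (TOp f U))
                   (TSeq (TSum (TOp f U) (TOp f U)) (tnab (replicate (arity T f) U)))"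
| bng_op: "\<lbrakk>f \<in> ops T; U \<in> lists (sorts G)\<rbrakk>
    \<Longrightarrow> tape_eq T G (TSeq (TBng U) (TOp f U)) (tbng (replicate (arity T f) U))"
| op_nat: "\<lbrakk>f \<in> ops T; wf_tape T G t\<rbrakk>
    \<Longrightarrow> tape_eq T G (TSeq t (top_poly T f (tcod T G t)))
                   (TSeq (top_poly T f (tdom G t)) (tsum (replicate (arity T f) t)))"
| circ_id: "U \<in> lists (sorts G) \<Longrightarrow> tape_eq T G (TCirc (cid U)) (TId U)"
| circ_seq: "\<lbrakk>wf_circ G c; wf_circ G d; ccod G c = cdom G d\<rbrakk>
    \<Longrightarrow> tape_eq T G (TCirc (CSeq c d)) (TSeq (TCirc c) (TCirc d))"
| circ: "circ_eq G c d \<Longrightarrow> tape_eq T G (TCirc c) (TCirc d)"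
| thy_ax: "\<lbrakk>(n, t, t') \<in> eqs T; U \<in> lists (sorts G)\<rbrakk> \<Longrightarrow> tape_eq T G (ttrm n t U) (ttrm n t' U)"


section \<open>The category of tapes\<close>

type_synonym ('s, 'g, 'f) tarr = "'s poly \<times> 's poly \<times> ('s, 'g, 'f) tape set"

definition tape_class ::
  "'f alg_theory \<Rightarrow> ('s, 'g) msig \<Rightarrow> ('s, 'g, 'f) tape \<Rightarrow> ('s, 'g, 'f) tarr" where
  "tape_class T G t = (tdom G t, tcod T G t, {u. tape_eq T G t u})"

definition tape_rep :: "('s, 'g, 'f) tarr \<Rightarrow> ('s, 'g, 'f) tape" where
  "tape_rep = (\<lambda>(P, Q, c). rep c)"

definition tape_add :: "'f alg_theory \<Rightarrow> ('s, 'g) msig \<Rightarrow> ('s poly, ('s, 'g, 'f) tarr) smon" where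
  "tape_add T G = \<lparr>tenO = (@),
     tenA = (\<lambda>a b. tape_class T G (TSum (tape_rep a) (tape_rep b))),
     unO = [],
     asc = (\<lambda>P Q R. tape_class T G (tid (P @ Q @ R))),
     lun = (\<lambda>P. tape_class T G (tid P)),
     run = (\<lambda>P. tape_class T G (tid P)),
     symm = (\<lambda>P Q. tape_class T G (tsym P Q))\<rparr>"

definition tape_mul :: "'f alg_theory \<Rightarrow> ('s, 'g) msig \<Rightarrow> ('s poly, ('s, 'g, 'f) tarr) smon" where
  "tape_mul T G = \<lparr>tenO = pten,
     tenA = (\<lambda>a b. tape_class T G (tten T G (tape_rep a) (tape_rep b))),
     unO = [[]],
     asc = (\<lambda>P Q R. tape_class T G (tid (pten P (pten Q R)))),
     lun = (\<lambda>P. tape_class T G (tid P)),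
     run = (\<lambda>P. tape_class T G (tid P)),
     symm = (\<lambda>P Q. tape_class T G (tsymm P Q))\<rparr>"

text \<open>The functor from the opposite of the Lawvere theory is the copairing of the tapes of the
  components of a tuple, at the monomial \<open>1\<close>.\<close>

definition tape_thy ::
  "'f alg_theory \<Rightarrow> ('s, 'g) msig \<Rightarrow> (nat, 'f larr, 's poly, ('s, 'g, 'f) tarr) func" where
  "tape_thy T G = \<lparr>onO = (\<lambda>n. replicate n []),
     onA = (\<lambda>(n, m, cs). tape_class T G
       (TSeq (tsum (map (\<lambda>c. ttrm n (rep c) []) cs)) (tnabn m (replicate n []))))\<rparr>"

definition tape_cat ::
  "'f alg_theory \<Rightarrow> ('s, 'g) msig \<Rightarrow> ('f, 's poly, ('s, 'g, 'f) tarr) tcd_rig" where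
  "tape_cat T G = \<lparr>obj = lists (lists (sorts G)),
     arr = {tape_class T G t | t. wf_tape T G t},
     src = (\<lambda>(P, Q, c). P),
     tgt = (\<lambda>(P, Q, c). Q),
     ide = (\<lambda>P. tape_class T G (tid P)),
     seq = (\<lambda>a b. tape_class T G (TSeq (tape_rep a) (tape_rep b))),
     add = tape_add T G,
     mul = tape_mul T G,
     dl = (\<lambda>P Q R. tape_class T G (tdl P Q R)),
     dr = (\<lambda>P Q R. tape_class T G (tid (pten (P @ Q) R))),
     lz = (\<lambda>P. tape_class T G TId0),
     rz = (\<lambda>P. tape_class T G TId0),
     nab = (\<lambda>P. tape_class T G (tnab P)),
     bng = (\<lambda>P. tape_class T G (tbng P)),
     copy = (\<lambda>P. tape_class T G (tcopy P)),
     disc = (\<lambda>P. tape_class T G (tdisc P)),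
     thy = tape_thy T G\<rparr>"

definition tape_sort :: "'s \<Rightarrow> 's poly" where
  "tape_sort A = [[A]]"

definition tape_gen :: "'f alg_theory \<Rightarrow> ('s, 'g) msig \<Rightarrow> 'g \<Rightarrow> ('s, 'g, 'f) tarr" where
  "tape_gen T G s = tape_class T G (TCirc (CGen s))"

end

theory Submission
  imports Defs
begin

text \<open>
  In a category with coproducts an arrow out of a sum is determined by its composites with the
  injections.  Every coherence equation between tapes is therefore checked on the injections, where
  it becomes an equation between monomials.  The left distributor is characterised by the fact that
  it carries the whiskered injections to injections; Laplaza's axioms and the coherence of copy and
  discard with the sum follow from this characterisation in any right strict rig category.  That the
  product of tapes is a bifunctor means that two whiskered tapes slide past each other, which is
  proved by induction on one of them; for an operation \<open>f\<close> it is the axiom \<open>t; f\<^sub>Q = f\<^sub>P; (t \<oplus> \<dots> \<oplus> t)\<close>.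

  For freeness, a morphism is forced on letters, on generators and on the operations at the unit,
  and \<open>f\<^sub>U = id\<^sub>U \<otimes> f\<^sub>1\<close>, so it is unique.  Conversely, recursion on tapes, with \<open>f\<^sub>U\<close> sent to
  \<open>f \<otimes> id\<^sub>U\<close>, respects all the axioms: left distributors at words are identities in a sesquistrict
  rig category, hence so are the symmetries between a word and a sum of units, and a whiskered tape
  is sent to a product with an identity.
\<close>

section \<open>Strict symmetric monoidal categories\<close>

text \<open>The congruence on tapes is closed under the product by definition, so the product of
  classes exists from the outset; what is not given is that it is a functor. Left whiskering acts
  summand by summand, whereas right whiskering passes through \<open>tdl\<close>, because only right
  distributivity is strict: on lists (P + Q) R and PR + QR coincide, while P (Q + R) and PQ + PR
  differ by a permutation of summands. The two variables of the product therefore need different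
  arguments.

  The monoid axioms speak of generators only. Naturality at arbitrary tapes, and with it the
  coproduct property, has to be established before injections can serve as a test.

  In the target the same asymmetry decides the form of the interpretation: multiplying by an
  identity on the right preserves sums, injections and monoids without any distributor, so an
  operation at U is placed on the left of the identity of U.

  Strict structures are locales over plain operations, with arrows typed by \<open>src\<close>,
  \<open>tgt\<close> and carrier membership, so that simplification discharges typing conditions;
  separate lemmas translate from and to the records.\<close>

locale scat =
  fixes Ob :: "'o set" and Ar :: "'a set" and src tgt :: "'a \<Rightarrow> 'o" and ide :: "'o \<Rightarrow> 'a"
    and seq :: "'a \<Rightarrow> 'a \<Rightarrow> 'a" (infixr "\<cdot>" 55)
  assumes src_Ob [simp]: "f \<in> Ar \<Longrightarrow> src f \<in> Ob"
    and tgt_Ob [simp]: "f \<in> Ar \<Longrightarrow> tgt f \<in> Ob"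
    and ide_Ar [simp]: "X \<in> Ob \<Longrightarrow> ide X \<in> Ar"
    and src_ide [simp]: "X \<in> Ob \<Longrightarrow> src (ide X) = X"
    and tgt_ide [simp]: "X \<in> Ob \<Longrightarrow> tgt (ide X) = X"
    and seq_Ar [simp]: "\<lbrakk>f \<in> Ar; g \<in> Ar; tgt f = src g\<rbrakk> \<Longrightarrow> f \<cdot> g \<in> Ar"
    and src_seq [simp]: "\<lbrakk>f \<in> Ar; g \<in> Ar; tgt f = src g\<rbrakk> \<Longrightarrow> src (f \<cdot> g) = src f"
    and tgt_seq [simp]: "\<lbrakk>f \<in> Ar; g \<in> Ar; tgt f = src g\<rbrakk> \<Longrightarrow> tgt (f \<cdot> g) = tgt g"
    and ide_seq [simp]: "\<lbrakk>f \<in> Ar; src f = X\<rbrakk> \<Longrightarrow> ide X \<cdot> f = f"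
    and seq_ide [simp]: "\<lbrakk>f \<in> Ar; tgt f = X\<rbrakk> \<Longrightarrow> f \<cdot> ide X = f"
    and seq_assoc [simp]: "\<lbrakk>f \<in> Ar; g \<in> Ar; h \<in> Ar; tgt f = src g; tgt g = src h\<rbrakk>
      \<Longrightarrow> (f \<cdot> g) \<cdot> h = f \<cdot> g \<cdot> h"
begin

text \<open>Composites are normalised to the right, so an equation between f g and h no longer
  matches inside a longer composite. Its extension by a further factor k does;
  \<open>THEN seq_eq\<close> produces that form.\<close>

lemma seq_eq: "\<lbrakk>f \<cdot> g = h; f \<in> Ar; g \<in> Ar; k \<in> Ar; tgt f = src g; tgt g = src k\<rbrakk>
    \<Longrightarrow> f \<cdot> g \<cdot> k = h \<cdot> k"
  by auto

lemma split_epi_cancel: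
  "\<lbrakk>e \<in> Ar; d \<in> Ar; f \<in> Ar; g \<in> Ar; tgt e = src f; tgt e = src g; tgt d = src e; d \<cdot> e
    = ide (src d);
    src d = tgt e; e \<cdot> f = e \<cdot> g\<rbrakk> \<Longrightarrow> f = g"
  by (metis ide_seq seq_assoc)

end

locale stm = scat Ob Ar src tgt ide seq
  for Ob :: "'o set" and Ar :: "'a set" and src tgt :: "'a \<Rightarrow> 'o" and ide :: "'o \<Rightarrow> 'a"
    and seq :: "'a \<Rightarrow> 'a \<Rightarrow> 'a" (infixr "\<cdot>" 55) +
  fixes tO :: "'o \<Rightarrow> 'o \<Rightarrow> 'o" (infixr "\<^bold>+" 65)
    and tA :: "'a \<Rightarrow> 'a \<Rightarrow> 'a" (infixr "\<^bold>\<oplus>" 65)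
    and un :: 'o
  assumes un_Ob [simp]: "un \<in> Ob"
    and tO_Ob [simp]: "\<lbrakk>X \<in> Ob; Y \<in> Ob\<rbrakk> \<Longrightarrow> X \<^bold>+ Y \<in> Ob"
    and tO_assoc [simp]: "\<lbrakk>X \<in> Ob; Y \<in> Ob; Z \<in> Ob\<rbrakk> \<Longrightarrow> (X \<^bold>+ Y) \<^bold>+ Z = X \<^bold>+ Y \<^bold>+ Z"
    and un_tO [simp]: "X \<in> Ob \<Longrightarrow> un \<^bold>+ X = X"
    and tO_un [simp]: "X \<in> Ob \<Longrightarrow> X \<^bold>+ un = X"
    and tA_Ar [simp]: "\<lbrakk>f \<in> Ar; g \<in> Ar\<rbrakk> \<Longrightarrow> f \<^bold>\<oplus> g \<in> Ar"
    and src_tA [simp]: "\<lbrakk>f \<in> Ar; g \<in> Ar\<rbrakk> \<Longrightarrow> src (f \<^bold>\<oplus> g) = src f \<^bold>+ src g"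
    and tgt_tA [simp]: "\<lbrakk>f \<in> Ar; g \<in> Ar\<rbrakk> \<Longrightarrow> tgt (f \<^bold>\<oplus> g) = tgt f \<^bold>+ tgt g"
    and tA_ide [simp]: "\<lbrakk>X \<in> Ob; Y \<in> Ob\<rbrakk> \<Longrightarrow> ide X \<^bold>\<oplus> ide Y = ide (X \<^bold>+ Y)"
    and interchange [simp]: "\<lbrakk>f \<in> Ar; f' \<in> Ar; g \<in> Ar; g' \<in> Ar; tgt f = src f'; tgt g = src g'\<rbrakk>
      \<Longrightarrow> (f \<^bold>\<oplus> g) \<cdot> (f' \<^bold>\<oplus> g') = (f \<cdot> f') \<^bold>\<oplus> (g \<cdot> g')"
    and tA_assoc [simp]: "\<lbrakk>f \<in> Ar; g \<in> Ar; h \<in> Ar\<rbrakk> \<Longrightarrow> (f \<^bold>\<oplus> g) \<^bold>\<oplus> h = f \<^bold>\<oplus> g \<^bold>\<oplus> h"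
    and un_tA [simp]: "f \<in> Ar \<Longrightarrow> ide un \<^bold>\<oplus> f = f"
    and tA_un [simp]: "f \<in> Ar \<Longrightarrow> f \<^bold>\<oplus> ide un = f"
begin

text \<open>The form of interchange that matches once composites are nested to the right.\<close>

lemma interchange_seq [simp]:
  "\<lbrakk>f \<in> Ar; f' \<in> Ar; g \<in> Ar; g' \<in> Ar; k \<in> Ar; tgt f = src f'; tgt g = src g'; tgt f' \<^bold>+ tgt g'
    = src k\<rbrakk>
      \<Longrightarrow> (f \<^bold>\<oplus> g) \<cdot> (f' \<^bold>\<oplus> g') \<cdot> k = ((f \<cdot> f') \<^bold>\<oplus> (g \<cdot> g')) \<cdot> k"
  by (subst seq_assoc [symmetric]) auto

text \<open>Used with \<open>interchange\<close> removed from the simpset: the first two rules split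
  a whiskered composite into layers that can be permuted, the third merges neighbouring
  identities.\<close>

lemma whisk:
  "\<lbrakk>f \<in> Ar; g \<in> Ar; Z \<in> Ob; tgt f = src g\<rbrakk> \<Longrightarrow> (f \<cdot> g) \<^bold>\<oplus> ide Z = (f \<^bold>\<oplus> ide Z) \<cdot> (g \<^bold>\<oplus> ide Z)"
  "\<lbrakk>f \<in> Ar; g \<in> Ar; Z \<in> Ob; tgt f = src g\<rbrakk> \<Longrightarrow> ide Z \<^bold>\<oplus> (f \<cdot> g) = (ide Z \<^bold>\<oplus> f) \<cdot> (ide Z \<^bold>\<oplus> g)"
  "\<lbrakk>f \<in> Ar; X \<in> Ob; Y \<in> Ob\<rbrakk> \<Longrightarrow> ide X \<^bold>\<oplus> ide Y \<^bold>\<oplus> f = ide (X \<^bold>+ Y) \<^bold>\<oplus> f"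
  by simp_all (simp flip: tA_assoc)

lemma slide: "\<lbrakk>f \<in> Ar; g \<in> Ar; src f = X; tgt f = X'; src g = Y; tgt g = Y'\<rbrakk>
  \<Longrightarrow> (ide X \<^bold>\<oplus> g) \<cdot> (f \<^bold>\<oplus> ide Y') = (f \<^bold>\<oplus> ide Y) \<cdot> (ide X' \<^bold>\<oplus> g)"
  by auto

end

locale ssm = stm Ob Ar src tgt ide seq tO tA un
  for Ob :: "'o set" and Ar :: "'a set" and src tgt :: "'a \<Rightarrow> 'o" and ide :: "'o \<Rightarrow> 'a"
    and seq :: "'a \<Rightarrow> 'a \<Rightarrow> 'a" (infixr "\<cdot>" 55)
    and tO :: "'o \<Rightarrow> 'o \<Rightarrow> 'o" (infixr "\<^bold>+" 65)
    and tA :: "'a \<Rightarrow> 'a \<Rightarrow> 'a" (infixr "\<^bold>\<oplus>" 65)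
    and un :: 'o +
  fixes sy :: "'o \<Rightarrow> 'o \<Rightarrow> 'a"
  assumes sy_Ar [simp]: "\<lbrakk>X \<in> Ob; Y \<in> Ob\<rbrakk> \<Longrightarrow> sy X Y \<in> Ar"
    and src_sy [simp]: "\<lbrakk>X \<in> Ob; Y \<in> Ob\<rbrakk> \<Longrightarrow> src (sy X Y) = X \<^bold>+ Y"
    and tgt_sy [simp]: "\<lbrakk>X \<in> Ob; Y \<in> Ob\<rbrakk> \<Longrightarrow> tgt (sy X Y) = Y \<^bold>+ X"
    and sy_sy [simp]: "\<lbrakk>X \<in> Ob; Y \<in> Ob\<rbrakk> \<Longrightarrow> sy X Y \<cdot> sy Y X = ide (X \<^bold>+ Y)"
    and sy_nat: "\<lbrakk>f \<in> Ar; g \<in> Ar\<rbrakk>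
      \<Longrightarrow> (f \<^bold>\<oplus> g) \<cdot> sy (tgt f) (tgt g) = sy (src f) (src g) \<cdot> (g \<^bold>\<oplus> f)"
    and sy_hex: "\<lbrakk>X \<in> Ob; Y \<in> Ob; Z \<in> Ob\<rbrakk>
      \<Longrightarrow> sy X (Y \<^bold>+ Z) = (sy X Y \<^bold>\<oplus> ide Z) \<cdot> (ide Y \<^bold>\<oplus> sy X Z)"
begin

lemma sy_sy_seq [simp]: "\<lbrakk>X \<in> Ob; Y \<in> Ob; k \<in> Ar; src k = X \<^bold>+ Y\<rbrakk> \<Longrightarrow> sy X Y \<cdot> sy Y X \<cdot> k = k"
  by (subst seq_assoc [symmetric]) auto

lemma sy_nat': "\<lbrakk>f \<in> Ar; g \<in> Ar; src f = X; tgt f = X'; src g = Y; tgt g = Y'\<rbrakk>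
      \<Longrightarrow> (f \<^bold>\<oplus> g) \<cdot> sy X' Y' = sy X Y \<cdot> (g \<^bold>\<oplus> f)"
  using sy_nat by auto

lemma sy_cancel: "\<lbrakk>X \<in> Ob; Y \<in> Ob; f \<in> Ar; g \<in> Ar; src f = Y \<^bold>+ X; src g = Y \<^bold>+ X; sy X Y \<cdot> f
  = sy X Y \<cdot> g\<rbrakk>
   \<Longrightarrow> f = g"
  by (rule split_epi_cancel [of "sy X Y" "sy Y X"]) auto

text \<open>The hexagon at two units makes \<open>sy X un\<close> idempotent; being invertible, it
  is an identity.\<close>

lemma sy_un_right [simp]: assumes X: "X \<in> Ob" shows "sy X un = ide X"
proof -
  have "sy X un = sy X un \<cdot> sy X un" using sy_hex [of X un un] X by simp
  then have "ide X \<cdot> sy X un = sy X un \<cdot> sy X un" using X by simp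
  then have "sy un X \<cdot> sy X un = sy un X \<cdot> sy X un \<cdot> sy X un" using X by simp
  then show ?thesis using X by simp
qed

lemma sy_un_left [simp]: assumes X: "X \<in> Ob" shows "sy un X = ide X"
  using sy_sy [of X un] X sy_un_right [of X] by (metis ide_seq sy_Ar src_sy tO_un un_Ob un_tO)

text \<open>By \<open>sy_hex\<close> the right-hand side is inverse to the symmetry of Z with X + Y,
  and so is the left-hand side.\<close>

lemma sy_hex': assumes [simp]: "X \<in> Ob" "Y \<in> Ob" "Z \<in> Ob"
  shows "sy (X \<^bold>+ Y) Z = (ide X \<^bold>\<oplus> sy Y Z) \<cdot> (sy X Z \<^bold>\<oplus> ide Y)"
proof (rule sy_cancel [of Z "X \<^bold>+ Y"])
  have "sy Z (X \<^bold>+ Y) \<cdot> (ide X \<^bold>\<oplus> sy Y Z) \<cdot> (sy X Z \<^bold>\<oplus> ide Y) = ide (Z \<^bold>+ X \<^bold>+ Y)"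
    by (simp add: sy_hex)
  then show "sy Z (X \<^bold>+ Y) \<cdot> sy (X \<^bold>+ Y) Z = sy Z (X \<^bold>+ Y) \<cdot> (ide X \<^bold>\<oplus> sy Y Z)
    \<cdot> (sy X Z \<^bold>\<oplus> ide Y)"
    by simp
qed auto

text \<open>Swapping two blocks of two strands takes four crossings, and the first of them is undone
  by the middle exchange. This serves to show that \<open>nab\<close> is natural at a
  symmetry.\<close>

lemma mid_sy:
  assumes [simp]: "X \<in> Ob" "Y \<in> Ob"
  shows "(ide X \<^bold>\<oplus> sy Y X \<^bold>\<oplus> ide Y) \<cdot> sy (X \<^bold>+ X) (Y \<^bold>+ Y) = (sy X Y \<^bold>\<oplus> sy X Y)
    \<cdot> (ide Y \<^bold>\<oplus> sy X Y \<^bold>\<oplus> ide X)"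
proof -
  have "sy (X \<^bold>+ X) (Y \<^bold>+ Y) = (ide X \<^bold>\<oplus> sy X Y \<^bold>\<oplus> ide Y) \<cdot> (sy X Y \<^bold>\<oplus> ide (X \<^bold>+ Y))
    \<cdot> (ide (Y \<^bold>+ X) \<^bold>\<oplus> sy X Y) \<cdot> (ide Y \<^bold>\<oplus> sy X Y \<^bold>\<oplus> ide X)"
    by (simp add: whisk sy_hex sy_hex' del: interchange interchange_seq)
  then show ?thesis by simp
qed

text \<open>Cocommutative comonoids are closed under the product. The lemma is the induction step
  that adds one letter to a word; read in the opposite category it also handles monoids.\<close>

lemma comonoid_product:
  assumes X [simp]: "X \<in> Ob" "cX \<in> Ar" "src cX = X" "tgt cX = X \<^bold>+ X" "dX \<in> Ar" "src dX
    = X" "tgt dX = un"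
    and Y [simp]: "Y \<in> Ob" "cY \<in> Ar" "src cY = Y" "tgt cY = Y \<^bold>+ Y" "dY \<in> Ar" "src dY = Y" "tgt dY
      = un"
    and aX: "cX \<cdot> (cX \<^bold>\<oplus> ide X) = cX \<cdot> (ide X \<^bold>\<oplus> cX)" and aY: "cY \<cdot> (cY \<^bold>\<oplus> ide Y) = cY
      \<cdot> (ide Y \<^bold>\<oplus> cY)"
    and lX: "cX \<cdot> (dX \<^bold>\<oplus> ide X) = ide X" and lY: "cY \<cdot> (dY \<^bold>\<oplus> ide Y) = ide Y"
    and rX: "cX \<cdot> (ide X \<^bold>\<oplus> dX) = ide X" and rY: "cY \<cdot> (ide Y \<^bold>\<oplus> dY) = ide Y"
    and sX: "cX \<cdot> sy X X = cX" and sY: "cY \<cdot> sy Y Y = cY"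
    and c: "c = (cX \<^bold>\<oplus> cY) \<cdot> (ide X \<^bold>\<oplus> sy X Y \<^bold>\<oplus> ide Y)" and d: "d = dX \<^bold>\<oplus> dY"
  shows "c \<cdot> (c \<^bold>\<oplus> ide (X \<^bold>+ Y)) = c \<cdot> (ide (X \<^bold>+ Y) \<^bold>\<oplus> c)"
    and "c \<cdot> (d \<^bold>\<oplus> ide (X \<^bold>+ Y)) = ide (X \<^bold>+ Y)"
    and "c \<cdot> (ide (X \<^bold>+ Y) \<^bold>\<oplus> d) = ide (X \<^bold>+ Y)"
    and "c \<cdot> sy (X \<^bold>+ Y) (X \<^bold>+ Y) = c"
proof -
  let ?M = "ide X \<^bold>\<oplus> sy X Y \<^bold>\<oplus> ide Y"
  note [simp del] = interchange_seq
  \<comment> \<open>What remains of coassociativity after all copies are moved to the front: two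
    permutations of six strands, which differ only in the order of two disjoint crossings.\<close>
  have perm: "(ide (X \<^bold>+ X) \<^bold>\<oplus> sy X (Y \<^bold>+ Y) \<^bold>\<oplus> ide Y) \<cdot> (?M \<^bold>\<oplus> ide (X \<^bold>+ Y))
     = (ide X \<^bold>\<oplus> sy (X \<^bold>+ X) Y \<^bold>\<oplus> ide (Y \<^bold>+ Y)) \<cdot> (ide (X \<^bold>+ Y) \<^bold>\<oplus> ?M)"
  proof -
    have *: "(ide X \<^bold>\<oplus> (ide (X \<^bold>+ Y) \<^bold>\<oplus> (sy X Y \<^bold>\<oplus> ide Y)))
      \<cdot> (ide X \<^bold>\<oplus> (sy X Y \<^bold>\<oplus> ide (Y \<^bold>+ X \<^bold>+ Y)))
       = (ide X \<^bold>\<oplus> (sy X Y \<^bold>\<oplus> ide (X \<^bold>+ Y \<^bold>+ Y)))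
         \<cdot> (ide X \<^bold>\<oplus> (ide (Y \<^bold>+ X) \<^bold>\<oplus> (sy X Y \<^bold>\<oplus> ide Y)))"
      by simp
    show ?thesis
      using * by (simp add: whisk sy_hex sy_hex' del: interchange)
  qed
  have 1: "(cX \<^bold>\<oplus> cY) \<cdot> ?M \<cdot> ((cX \<^bold>\<oplus> cY) \<^bold>\<oplus> ide (X \<^bold>+ Y)) = ((cX \<cdot> (cX \<^bold>\<oplus> ide X)) \<^bold>\<oplus> (cY
    \<cdot> (cY \<^bold>\<oplus> ide Y))) \<cdot> (ide (X \<^bold>+ X) \<^bold>\<oplus> sy X (Y \<^bold>+ Y) \<^bold>\<oplus> ide Y)"
  proof -
    have "?M \<cdot> ((cX \<^bold>\<oplus> cY) \<^bold>\<oplus> ide (X \<^bold>+ Y)) = ?M \<cdot> (cX \<^bold>\<oplus> ((cY \<^bold>\<oplus> ide X) \<^bold>\<oplus> ide Y))" by simp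
    also have "\<dots> = cX \<^bold>\<oplus> (sy X Y \<cdot> (cY \<^bold>\<oplus> ide X)) \<^bold>\<oplus> ide Y" by (simp del: tA_assoc)
    also have "sy X Y \<cdot> (cY \<^bold>\<oplus> ide X) = (ide X \<^bold>\<oplus> cY) \<cdot> sy X (Y \<^bold>+ Y)"
      using sy_nat' [of "ide X" cY X X Y "Y \<^bold>+ Y"] by simp
    also have "cX \<^bold>\<oplus> ((ide X \<^bold>\<oplus> cY) \<cdot> sy X (Y \<^bold>+ Y)) \<^bold>\<oplus> ide Y
      = ((cX \<^bold>\<oplus> ide X) \<^bold>\<oplus> (cY \<^bold>\<oplus> ide Y)) \<cdot> (ide (X \<^bold>+ X) \<^bold>\<oplus> sy X (Y \<^bold>+ Y) \<^bold>\<oplus> ide Y)"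
    proof -
      have "((cX \<^bold>\<oplus> ide X) \<^bold>\<oplus> (cY \<^bold>\<oplus> ide Y)) = cX \<^bold>\<oplus> (ide X \<^bold>\<oplus> cY) \<^bold>\<oplus> ide Y" by simp
      then show ?thesis by (simp del: tA_assoc)
    qed
    finally show ?thesis by (simp del: tA_assoc add: interchange_seq)
  qed
  have 2: "(cX \<^bold>\<oplus> cY) \<cdot> ?M \<cdot> (ide (X \<^bold>+ Y) \<^bold>\<oplus> (cX \<^bold>\<oplus> cY)) = ((cX \<cdot> (ide X \<^bold>\<oplus> cX)) \<^bold>\<oplus> (cY
    \<cdot> (ide Y \<^bold>\<oplus> cY))) \<cdot> (ide X \<^bold>\<oplus> sy (X \<^bold>+ X) Y \<^bold>\<oplus> ide (Y \<^bold>+ Y))"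
  proof -
    have "ide (X \<^bold>+ Y) \<^bold>\<oplus> (cX \<^bold>\<oplus> cY) = ide X \<^bold>\<oplus> ((ide Y \<^bold>\<oplus> cX) \<^bold>\<oplus> cY)" by (simp flip: tA_ide)
    then have "?M \<cdot> (ide (X \<^bold>+ Y) \<^bold>\<oplus> (cX \<^bold>\<oplus> cY)) = ide X \<^bold>\<oplus> (sy X Y \<cdot> (ide Y \<^bold>\<oplus> cX)) \<^bold>\<oplus> cY"
      by (simp del: tA_assoc)
    also have "sy X Y \<cdot> (ide Y \<^bold>\<oplus> cX) = (cX \<^bold>\<oplus> ide Y) \<cdot> sy (X \<^bold>+ X) Y"
      using sy_nat' [of cX "ide Y" X "X \<^bold>+ X" Y Y] by simp
    also have "ide X \<^bold>\<oplus> ((cX \<^bold>\<oplus> ide Y) \<cdot> sy (X \<^bold>+ X) Y) \<^bold>\<oplus> cY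
      = ((ide X \<^bold>\<oplus> cX) \<^bold>\<oplus> (ide Y \<^bold>\<oplus> cY)) \<cdot> (ide X \<^bold>\<oplus> sy (X \<^bold>+ X) Y \<^bold>\<oplus> ide (Y \<^bold>+ Y))"
    proof -
      have "((ide X \<^bold>\<oplus> cX) \<^bold>\<oplus> (ide Y \<^bold>\<oplus> cY)) = ide X \<^bold>\<oplus> (cX \<^bold>\<oplus> ide Y) \<^bold>\<oplus> cY" by simp
      then show ?thesis by (simp del: tA_assoc)
    qed
    finally show ?thesis by (simp del: tA_assoc add: interchange_seq)
  qed
  have "c \<cdot> (c \<^bold>\<oplus> ide (X \<^bold>+ Y)) = ((cX \<^bold>\<oplus> cY) \<cdot> ?M \<cdot> ((cX \<^bold>\<oplus> cY) \<^bold>\<oplus> ide (X \<^bold>+ Y)))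
    \<cdot> (?M \<^bold>\<oplus> ide (X \<^bold>+ Y))"
    unfolding c by (simp add: whisk del: interchange)
  also have "\<dots> = ((cX \<^bold>\<oplus> cY) \<cdot> ?M \<cdot> (ide (X \<^bold>+ Y) \<^bold>\<oplus> (cX \<^bold>\<oplus> cY))) \<cdot> (ide (X \<^bold>+ Y) \<^bold>\<oplus> ?M)"
    unfolding 1 2 aX aY using perm by (simp del: tA_assoc interchange)
  also have "\<dots> = c \<cdot> (ide (X \<^bold>+ Y) \<^bold>\<oplus> c)"
    unfolding c by (simp add: whisk del: interchange)
  finally show "c \<cdot> (c \<^bold>\<oplus> ide (X \<^bold>+ Y)) = c \<cdot> (ide (X \<^bold>+ Y) \<^bold>\<oplus> c)" .
  have "?M \<cdot> (d \<^bold>\<oplus> ide (X \<^bold>+ Y)) = ?M \<cdot> (dX \<^bold>\<oplus> ((dY \<^bold>\<oplus> ide X) \<^bold>\<oplus> ide Y))" by (simp add: d)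
  also have "\<dots> = dX \<^bold>\<oplus> (sy X Y \<cdot> (dY \<^bold>\<oplus> ide X)) \<^bold>\<oplus> ide Y" by (simp del: tA_assoc)
  also have "sy X Y \<cdot> (dY \<^bold>\<oplus> ide X) = ide X \<^bold>\<oplus> dY"
    using sy_nat' [of "ide X" dY X X Y un] by simp
  also have "dX \<^bold>\<oplus> (ide X \<^bold>\<oplus> dY) \<^bold>\<oplus> ide Y = (dX \<^bold>\<oplus> ide X) \<^bold>\<oplus> (dY \<^bold>\<oplus> ide Y)" by simp
  finally show "c \<cdot> (d \<^bold>\<oplus> ide (X \<^bold>+ Y)) = ide (X \<^bold>+ Y)"
    unfolding c by (simp add: d lX lY del: tA_assoc)
  have "ide (X \<^bold>+ Y) \<^bold>\<oplus> d = ide X \<^bold>\<oplus> ((ide Y \<^bold>\<oplus> dX) \<^bold>\<oplus> dY)" by (simp add: d flip: tA_ide)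
  then have "?M \<cdot> (ide (X \<^bold>+ Y) \<^bold>\<oplus> d) = ide X \<^bold>\<oplus> (sy X Y \<cdot> (ide Y \<^bold>\<oplus> dX)) \<^bold>\<oplus> dY"
    by (simp del: tA_assoc)
  also have "sy X Y \<cdot> (ide Y \<^bold>\<oplus> dX) = dX \<^bold>\<oplus> ide Y"
    using sy_nat' [of dX "ide Y" X un Y Y] by simp
  also have "ide X \<^bold>\<oplus> (dX \<^bold>\<oplus> ide Y) \<^bold>\<oplus> dY = (ide X \<^bold>\<oplus> dX) \<^bold>\<oplus> (ide Y \<^bold>\<oplus> dY)" by simp
  finally show "c \<cdot> (ide (X \<^bold>+ Y) \<^bold>\<oplus> d) = ide (X \<^bold>+ Y)"
    unfolding c by (simp add: d rX rY del: tA_assoc)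
  \<comment> \<open>By the two hexagons the symmetry of X + Y with itself begins with the inverse of
    \<open>?M\<close>, which cancels.\<close>
  have sm: "?M \<cdot> sy (X \<^bold>+ Y) (X \<^bold>+ Y) = (sy X X \<^bold>\<oplus> sy Y Y) \<cdot> ?M"
  proof -
    have "sy (X \<^bold>+ Y) (X \<^bold>+ Y) = (ide X \<^bold>\<oplus> sy Y X \<^bold>\<oplus> ide Y) \<cdot> (sy X X \<^bold>\<oplus> ide (Y \<^bold>+ Y))
      \<cdot> (ide (X \<^bold>+ X) \<^bold>\<oplus> sy Y Y) \<cdot> ?M"
      by (simp add: whisk sy_hex [of _ X Y] sy_hex' [of X Y] del: interchange)
    then show ?thesis by (simp add: interchange_seq)
  qed
  then show "c \<cdot> sy (X \<^bold>+ Y) (X \<^bold>+ Y) = c"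
    unfolding c by (simp add: sX sY interchange_seq)
qed

end

text \<open>The axioms chosen are those that make the sum a coproduct. \<open>nab_incl\<close> says
  that the copairing of the two injections into X + Y is the identity, which yields the uniqueness
  half of the universal property. Associativity, commutativity and the formula for
  \<open>nab\<close> on a sum follow (\<open>nab_assoc\<close>, \<open>nab_comm\<close>,
  \<open>nab_tO\<close>).\<close>

locale sfc = ssm Ob Ar src tgt ide seq tO tA un sy
  for Ob :: "'o set" and Ar :: "'a set" and src tgt :: "'a \<Rightarrow> 'o" and ide :: "'o \<Rightarrow> 'a"
    and seq :: "'a \<Rightarrow> 'a \<Rightarrow> 'a" (infixr "\<cdot>" 55)
    and tO :: "'o \<Rightarrow> 'o \<Rightarrow> 'o" (infixr "\<^bold>+" 65)
    and tA :: "'a \<Rightarrow> 'a \<Rightarrow> 'a" (infixr "\<^bold>\<oplus>" 65)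
    and un :: 'o and sy :: "'o \<Rightarrow> 'o \<Rightarrow> 'a" +
  fixes nab bng :: "'o \<Rightarrow> 'a"
  assumes nab_Ar [simp]: "X \<in> Ob \<Longrightarrow> nab X \<in> Ar"
    and src_nab [simp]: "X \<in> Ob \<Longrightarrow> src (nab X) = X \<^bold>+ X"
    and tgt_nab [simp]: "X \<in> Ob \<Longrightarrow> tgt (nab X) = X"
    and bng_Ar [simp]: "X \<in> Ob \<Longrightarrow> bng X \<in> Ar"
    and src_bng [simp]: "X \<in> Ob \<Longrightarrow> src (bng X) = un"
    and tgt_bng [simp]: "X \<in> Ob \<Longrightarrow> tgt (bng X) = X"
    and nab_lun: "X \<in> Ob \<Longrightarrow> (bng X \<^bold>\<oplus> ide X) \<cdot> nab X = ide X"
    and nab_run: "X \<in> Ob \<Longrightarrow> (ide X \<^bold>\<oplus> bng X) \<cdot> nab X = ide X"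
    and nab_natural: "f \<in> Ar \<Longrightarrow> nab (src f) \<cdot> f = (f \<^bold>\<oplus> f) \<cdot> nab (tgt f)"
    and bng_natural: "f \<in> Ar \<Longrightarrow> bng (src f) \<cdot> f = bng (tgt f)"
    and bng_unit [simp]: "bng un = ide un"
    and nab_incl: "\<lbrakk>X \<in> Ob; Y \<in> Ob\<rbrakk>
      \<Longrightarrow> (ide X \<^bold>\<oplus> bng (Y \<^bold>+ X) \<^bold>\<oplus> ide Y) \<cdot> nab (X \<^bold>+ Y) = ide (X \<^bold>+ Y)"
begin

lemma bng_seq [simp]: "\<lbrakk>f \<in> Ar; src f = X\<rbrakk> \<Longrightarrow> bng X \<cdot> f = bng (tgt f)"
  using bng_natural by auto

text \<open>\<open>bng\<close> at the unit is the identity, so naturality of \<open>bng\<close>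
  makes the unit an initial object.\<close>

lemma ext0: "\<lbrakk>f \<in> Ar; g \<in> Ar; src f = un; src g = un; tgt f = tgt g\<rbrakk> \<Longrightarrow> f = g"
  by (metis bng_seq bng_unit ide_seq)

lemma bng_tO: "\<lbrakk>X \<in> Ob; Y \<in> Ob\<rbrakk> \<Longrightarrow> bng X \<^bold>\<oplus> bng Y = bng (X \<^bold>+ Y)"
  by (rule ext0) auto

section \<open>Injections and copairing in a strict coproduct category\<close>

definition inl :: "'o \<Rightarrow> 'o \<Rightarrow> 'a" where "inl X Y = ide X \<^bold>\<oplus> bng Y"
definition inr :: "'o \<Rightarrow> 'o \<Rightarrow> 'a" where "inr X Y = bng X \<^bold>\<oplus> ide Y"
definition cp :: "'a \<Rightarrow> 'a \<Rightarrow> 'a" where "cp f g = (f \<^bold>\<oplus> g) \<cdot> nab (tgt f)"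

lemma inl_type [simp]: assumes "X \<in> Ob" "Y \<in> Ob"
  shows "inl X Y \<in> Ar" "src (inl X Y) = X" "tgt (inl X Y) = X \<^bold>+ Y"
  using assms by (auto simp: inl_def)

lemma inr_type [simp]: assumes "X \<in> Ob" "Y \<in> Ob"
  shows "inr X Y \<in> Ar" "src (inr X Y) = Y" "tgt (inr X Y) = X \<^bold>+ Y"
  using assms by (auto simp: inr_def)

lemma cp_type [simp]: assumes "f \<in> Ar" "g \<in> Ar" "tgt f = tgt g"
  shows "cp f g \<in> Ar" "src (cp f g) = src f \<^bold>+ src g" "tgt (cp f g) = tgt g"
  using assms by (auto simp: cp_def)

lemma inl_tA [simp]: assumes "f \<in> Ar" "g \<in> Ar" "X = src f" "Y = src g"
  shows "inl X Y \<cdot> (f \<^bold>\<oplus> g) = f \<cdot> inl (tgt f) (tgt g)"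
proof -
  have "f \<cdot> inl (tgt f) (tgt g) = (f \<^bold>\<oplus> ide un) \<cdot> inl (tgt f) (tgt g)" using assms by simp
  also have "\<dots> = f \<^bold>\<oplus> bng (tgt g)" using assms unfolding inl_def by (subst interchange) auto
  finally show ?thesis using assms by (simp add: inl_def)
qed

lemma inr_tA [simp]: assumes "f \<in> Ar" "g \<in> Ar" "X = src f" "Y = src g"
  shows "inr X Y \<cdot> (f \<^bold>\<oplus> g) = g \<cdot> inr (tgt f) (tgt g)"
proof -
  have "g \<cdot> inr (tgt f) (tgt g) = (ide un \<^bold>\<oplus> g) \<cdot> inr (tgt f) (tgt g)" using assms by simp
  also have "\<dots> = bng (tgt f) \<^bold>\<oplus> g" using assms unfolding inr_def by (subst interchange) auto
  finally show ?thesis using assms by (simp add: inr_def)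
qed

lemma inl_nab [simp]: "X \<in> Ob \<Longrightarrow> inl X X \<cdot> nab X = ide X"
  by (simp add: inl_def nab_run)

lemma inr_nab [simp]: "X \<in> Ob \<Longrightarrow> inr X X \<cdot> nab X = ide X"
  by (simp add: inr_def nab_lun)

text \<open>The copairing of the injections is the identity. Naturality of \<open>nab\<close> pushes
  h through it and exhibits h as the copairing of its two restrictions.\<close>

lemma ext2: assumes "f \<in> Ar" "g \<in> Ar" "src f = X \<^bold>+ Y" "src g = X \<^bold>+ Y" "tgt f = tgt g"
    "X \<in> Ob" "Y \<in> Ob" "inl X Y \<cdot> f = inl X Y \<cdot> g" "inr X Y \<cdot> f = inr X Y \<cdot> g"
  shows "f = g"
proof -
  have *: "h = ((inl X Y \<cdot> h) \<^bold>\<oplus> (inr X Y \<cdot> h)) \<cdot> nab (tgt h)" if "h \<in> Ar" "src h = X \<^bold>+ Y" for h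
  proof -
    have "ide (X \<^bold>+ Y) = (inl X Y \<^bold>\<oplus> inr X Y) \<cdot> nab (X \<^bold>+ Y)"
      using assms bng_tO [of Y X, symmetric] by (simp add: inl_def inr_def nab_incl [symmetric])
    then have "h = ((inl X Y \<^bold>\<oplus> inr X Y) \<cdot> nab (X \<^bold>+ Y)) \<cdot> h" using that by (metis ide_seq)
    also have "\<dots> = (inl X Y \<^bold>\<oplus> inr X Y) \<cdot> nab (src h) \<cdot> h"
      using that assms by simp
    also have "\<dots> = (inl X Y \<^bold>\<oplus> inr X Y) \<cdot> (h \<^bold>\<oplus> h) \<cdot> nab (tgt h)"
      using nab_natural [OF that(1)] by simp
    finally show ?thesis using that assms by simp
  qed
  show ?thesis using * [of f] * [of g] assms by simp
qed

lemma inl_tA_seq [simp]: assumes "f \<in> Ar" "g \<in> Ar" "X = src f" "Y = src g" "k \<in> Ar" "src k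
  = tgt f \<^bold>+ tgt g"
  shows "inl X Y \<cdot> (f \<^bold>\<oplus> g) \<cdot> k = f \<cdot> inl (tgt f) (tgt g) \<cdot> k"
  using assms by (subst seq_assoc [symmetric]) auto

lemma inr_tA_seq [simp]: assumes "f \<in> Ar" "g \<in> Ar" "X = src f" "Y = src g" "k \<in> Ar" "src k
  = tgt f \<^bold>+ tgt g"
  shows "inr X Y \<cdot> (f \<^bold>\<oplus> g) \<cdot> k = g \<cdot> inr (tgt f) (tgt g) \<cdot> k"
  using assms by (subst seq_assoc [symmetric]) auto

lemma inl_nab_seq [simp]: "\<lbrakk>X \<in> Ob; k \<in> Ar; src k = X\<rbrakk> \<Longrightarrow> inl X X \<cdot> nab X \<cdot> k = k"
  by (subst seq_assoc [symmetric]) auto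

lemma inr_nab_seq [simp]: "\<lbrakk>X \<in> Ob; k \<in> Ar; src k = X\<rbrakk> \<Longrightarrow> inr X X \<cdot> nab X \<cdot> k = k"
  by (subst seq_assoc [symmetric]) auto

lemma inl_cp [simp]: "\<lbrakk>f \<in> Ar; g \<in> Ar; tgt f = tgt g; X = src f; Y = src g\<rbrakk> \<Longrightarrow> inl X Y \<cdot> cp f g
  = f"
  by (simp add: cp_def)

lemma inr_cp [simp]: "\<lbrakk>f \<in> Ar; g \<in> Ar; tgt f = tgt g; X = src f; Y = src g\<rbrakk> \<Longrightarrow> inr X Y \<cdot> cp f g
  = g"
  by (simp add: cp_def)

lemma inl_un [simp]: "X \<in> Ob \<Longrightarrow> inl X un = ide X"
  by (simp add: inl_def)

lemma inr_un [simp]: "X \<in> Ob \<Longrightarrow> inr un X = ide X"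
  by (simp add: inr_def)

lemma inl_un' [simp]: "X \<in> Ob \<Longrightarrow> inl un X = bng X"
  by (simp add: inl_def)

lemma inr_un' [simp]: "X \<in> Ob \<Longrightarrow> inr X un = bng X"
  by (simp add: inr_def)

text \<open>With a strictly associative sum, a summand of X + Y + Z is reached through either
  bracketing. The rules for iterated injections rewrite towards the right-bracketed
  description.\<close>

lemma inl_inl [simp]: "\<lbrakk>X \<in> Ob; Y \<in> Ob; Z \<in> Ob\<rbrakk> \<Longrightarrow> inl X Y \<cdot> inl (X \<^bold>+ Y) Z = inl X (Y \<^bold>+ Z)"
proof -
  assume [simp]: "X \<in> Ob" "Y \<in> Ob" "Z \<in> Ob"
  have "inl (X \<^bold>+ Y) Z = ide X \<^bold>\<oplus> inl Y Z" by (simp add: inl_def flip: tA_ide)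
  then show ?thesis by simp
qed

lemma inr_inl [simp]: "\<lbrakk>X \<in> Ob; Y \<in> Ob; Z \<in> Ob\<rbrakk> \<Longrightarrow> inr X Y \<cdot> inl (X \<^bold>+ Y) Z = inl Y Z
  \<cdot> inr X (Y \<^bold>+ Z)"
  by (simp add: inl_def [of "X \<^bold>+ Y"] flip: tA_ide) (simp add: inl_def)

text \<open>Applied on demand only: as a simplification rule it would break up injections that
  \<open>inr_nab\<close> or \<open>inr_tA\<close> must see whole.\<close>

lemma inr_expand: assumes [simp]: "X \<in> Ob" "Y \<in> Ob" "Z \<in> Ob" shows "inr (X \<^bold>+ Y) Z = inr Y Z
  \<cdot> inr X (Y \<^bold>+ Z)"
proof -
  have "inr Y Z \<cdot> inr X (Y \<^bold>+ Z) = (ide un \<^bold>\<oplus> inr Y Z) \<cdot> (bng X \<^bold>\<oplus> ide (Y \<^bold>+ Z))"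
    by (simp add: inr_def [of X "Y \<^bold>+ Z"])
  also have "\<dots> = inr (X \<^bold>+ Y) Z" by (subst interchange) (simp_all add: inr_def flip: bng_tO)
  finally show ?thesis ..
qed

lemma inl_inl_seq [simp]: "\<lbrakk>X \<in> Ob; Y \<in> Ob; Z \<in> Ob; k \<in> Ar; src k = X \<^bold>+ Y \<^bold>+ Z\<rbrakk>
   \<Longrightarrow> inl X Y \<cdot> inl (X \<^bold>+ Y) Z \<cdot> k = inl X (Y \<^bold>+ Z) \<cdot> k"
  by (subst seq_assoc [symmetric]) auto

lemma inr_inl_seq [simp]: "\<lbrakk>X \<in> Ob; Y \<in> Ob; Z \<in> Ob; k \<in> Ar; src k = X \<^bold>+ Y \<^bold>+ Z\<rbrakk>
   \<Longrightarrow> inr X Y \<cdot> inl (X \<^bold>+ Y) Z \<cdot> k = inl Y Z \<cdot> inr X (Y \<^bold>+ Z) \<cdot> k"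
  by (subst seq_assoc [symmetric]) auto

lemma inl_sy [simp]: assumes "X \<in> Ob" "Y \<in> Ob" shows "inl X Y \<cdot> sy X Y = inr Y X"
  using sy_nat' [of "ide X" "bng Y" X X un Y] assms by (simp add: inl_def inr_def)

lemma inr_sy [simp]: assumes "X \<in> Ob" "Y \<in> Ob" shows "inr X Y \<cdot> sy X Y = inl Y X"
  using sy_nat' [of "bng X" "ide Y" un X Y Y] assms by (simp add: inl_def inr_def)

lemma inl_sy_seq [simp]: assumes "X \<in> Ob" "Y \<in> Ob" "k \<in> Ar" "src k = Y \<^bold>+ X"
  shows "inl X Y \<cdot> sy X Y \<cdot> k = inr Y X \<cdot> k"
  using assms by (subst seq_assoc [symmetric]) auto

lemma inr_sy_seq [simp]: assumes "X \<in> Ob" "Y \<in> Ob" "k \<in> Ar" "src k = Y \<^bold>+ X"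
  shows "inr X Y \<cdot> sy X Y \<cdot> k = inl Y X \<cdot> k"
  using assms by (subst seq_assoc [symmetric]) auto

lemma nab_assoc: assumes [simp]: "X \<in> Ob" shows "(nab X \<^bold>\<oplus> ide X) \<cdot> nab X = (ide X \<^bold>\<oplus> nab X)
  \<cdot> nab X"
proof (rule ext2 [of _ _ "X \<^bold>+ X" X])
  show "inl (X \<^bold>+ X) X \<cdot> (nab X \<^bold>\<oplus> ide X) \<cdot> nab X = inl (X \<^bold>+ X) X \<cdot> (ide X \<^bold>\<oplus> nab X) \<cdot> nab X"
    by (rule ext2 [of _ _ X X]) simp_all
  have "inr (X \<^bold>+ X) X \<cdot> (ide X \<^bold>\<oplus> nab X) \<cdot> nab X = ide X" by (simp add: inr_expand)
  then show "inr (X \<^bold>+ X) X \<cdot> (nab X \<^bold>\<oplus> ide X) \<cdot> nab X = inr (X \<^bold>+ X) X \<cdot> (ide X \<^bold>\<oplus> nab X)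
    \<cdot> nab X"
    by simp
qed simp_all

lemma nab_comm: assumes [simp]: "X \<in> Ob" shows "sy X X \<cdot> nab X = nab X"
  by (rule ext2 [of _ _ X X]) simp_all

lemma ext4: assumes "f \<in> Ar" "g \<in> Ar" "src f = X \<^bold>+ Y \<^bold>+ Z \<^bold>+ W" "src g = X \<^bold>+ Y \<^bold>+ Z \<^bold>+ W" "tgt f
  = tgt g"
    and [simp]: "X \<in> Ob" "Y \<in> Ob" "Z \<in> Ob" "W \<in> Ob"
    and "inl X Y \<cdot> inl (X \<^bold>+ Y) (Z \<^bold>+ W) \<cdot> f = inl X Y \<cdot> inl (X \<^bold>+ Y) (Z \<^bold>+ W) \<cdot> g"
    "inr X Y \<cdot> inl (X \<^bold>+ Y) (Z \<^bold>+ W) \<cdot> f = inr X Y \<cdot> inl (X \<^bold>+ Y) (Z \<^bold>+ W) \<cdot> g"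
    "inl Z W \<cdot> inr (X \<^bold>+ Y) (Z \<^bold>+ W) \<cdot> f = inl Z W \<cdot> inr (X \<^bold>+ Y) (Z \<^bold>+ W) \<cdot> g"
    "inr Z W \<cdot> inr (X \<^bold>+ Y) (Z \<^bold>+ W) \<cdot> f = inr Z W \<cdot> inr (X \<^bold>+ Y) (Z \<^bold>+ W) \<cdot> g"
  shows "f = g"
proof (rule ext2 [of _ _ "X \<^bold>+ Y" "Z \<^bold>+ W"])
  show "inl (X \<^bold>+ Y) (Z \<^bold>+ W) \<cdot> f = inl (X \<^bold>+ Y) (Z \<^bold>+ W) \<cdot> g"
    by (rule ext2 [of _ _ X Y]) (use assms in simp_all)
  show "inr (X \<^bold>+ Y) (Z \<^bold>+ W) \<cdot> f = inr (X \<^bold>+ Y) (Z \<^bold>+ W) \<cdot> g"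
    by (rule ext2 [of _ _ Z W]) (use assms in simp_all)
qed (use assms in simp_all)

text \<open>Here f itself starts at a sum, so \<open>inl_tA\<close> would ask for the left-bracketed
  injection. This lemma and its variants compensate for the chosen normal form of
  injections.\<close>

lemma inl_comp: assumes "f \<in> Ar" "g \<in> Ar" "src f = X \<^bold>+ Y" "src g = Z" "X \<in> Ob" "Y \<in> Ob"
  shows "inl X (Y \<^bold>+ Z) \<cdot> (f \<^bold>\<oplus> g) = inl X Y \<cdot> f \<cdot> inl (tgt f) (tgt g)"
  using assms inl_inl_seq [of X Y Z "f \<^bold>\<oplus> g"] by (auto simp del: inl_inl_seq)

lemma inr_comp: assumes "f \<in> Ar" "g \<in> Ar" "src f = X \<^bold>+ Y" "src g = Z" "X \<in> Ob" "Y \<in> Ob"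
  shows "inl Y Z \<cdot> inr X (Y \<^bold>+ Z) \<cdot> (f \<^bold>\<oplus> g) = inr X Y \<cdot> f \<cdot> inl (tgt f) (tgt g)"
  using assms inr_inl_seq [of X Y Z "f \<^bold>\<oplus> g"] by (auto simp del: inr_inl_seq)

lemma inl_comp_seq: assumes "f \<in> Ar" "g \<in> Ar" "src f = X \<^bold>+ Y" "src g = Z" "X \<in> Ob" "Y \<in> Ob"
  "k \<in> Ar" "src k = tgt f \<^bold>+ tgt g"
  shows "inl X (Y \<^bold>+ Z) \<cdot> (f \<^bold>\<oplus> g) \<cdot> k = inl X Y \<cdot> f \<cdot> inl (tgt f) (tgt g) \<cdot> k"
  using assms inl_inl_seq [of X Y Z "(f \<^bold>\<oplus> g) \<cdot> k"] by (auto simp del: inl_inl_seq)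

lemma inr_comp_seq: assumes "f \<in> Ar" "g \<in> Ar" "src f = X \<^bold>+ Y" "src g = Z" "X \<in> Ob" "Y \<in> Ob"
  "k \<in> Ar" "src k = tgt f \<^bold>+ tgt g"
  shows "inl Y Z \<cdot> inr X (Y \<^bold>+ Z) \<cdot> (f \<^bold>\<oplus> g) \<cdot> k = inr X Y \<cdot> f \<cdot> inl (tgt f) (tgt g) \<cdot> k"
  using assms inr_inl_seq [of X Y Z "(f \<^bold>\<oplus> g) \<cdot> k"] by (auto simp del: inr_inl_seq)

lemma inrr_comp: assumes "f \<in> Ar" "g \<in> Ar" "src f = X \<^bold>+ Y" "src g = Z" "X \<in> Ob" "Y \<in> Ob"
  shows "inr Y Z \<cdot> inr X (Y \<^bold>+ Z) \<cdot> (f \<^bold>\<oplus> g) = g \<cdot> inr (tgt f) (tgt g)"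
proof -
  have "inr Y Z \<cdot> inr X (Y \<^bold>+ Z) \<cdot> (f \<^bold>\<oplus> g) = inr (X \<^bold>+ Y) Z \<cdot> (f \<^bold>\<oplus> g)"
    by (subst inr_expand) (use assms in auto)
  then show ?thesis using assms by simp
qed

lemma inrr_comp_seq: assumes "f \<in> Ar" "g \<in> Ar" "src f = X \<^bold>+ Y" "src g = Z" "X \<in> Ob" "Y \<in> Ob"
  "k \<in> Ar" "src k = tgt f \<^bold>+ tgt g"
  shows "inr Y Z \<cdot> inr X (Y \<^bold>+ Z) \<cdot> (f \<^bold>\<oplus> g) \<cdot> k = g \<cdot> inr (tgt f) (tgt g) \<cdot> k"
proof -
  have "inr Y Z \<cdot> inr X (Y \<^bold>+ Z) \<cdot> (f \<^bold>\<oplus> g) \<cdot> k = inr (X \<^bold>+ Y) Z \<cdot> (f \<^bold>\<oplus> g) \<cdot> k"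
    by (subst inr_expand) (use assms in auto)
  then show ?thesis using assms by simp
qed

lemma sy_comp [simp]: assumes [simp]: "g \<in> Ar" "src g = Z" "X \<in> Ob" "Y \<in> Ob"
  shows "inl X (Y \<^bold>+ Z) \<cdot> (sy X Y \<^bold>\<oplus> g) = inr Y X \<cdot> inl (Y \<^bold>+ X) (tgt g)"
    "inl Y Z \<cdot> inr X (Y \<^bold>+ Z) \<cdot> (sy X Y \<^bold>\<oplus> g) = inl Y (X \<^bold>+ tgt g)"
    "\<lbrakk>k \<in> Ar; src k = Y \<^bold>+ X \<^bold>+ tgt g\<rbrakk> \<Longrightarrow>
     inl X (Y \<^bold>+ Z) \<cdot> (sy X Y \<^bold>\<oplus> g) \<cdot> k = inr Y X \<cdot> inl (Y \<^bold>+ X) (tgt g) \<cdot> k"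
    "\<lbrakk>k \<in> Ar; src k = Y \<^bold>+ X \<^bold>+ tgt g\<rbrakk> \<Longrightarrow>
     inl Y Z \<cdot> inr X (Y \<^bold>+ Z) \<cdot> (sy X Y \<^bold>\<oplus> g) \<cdot> k = inl Y (X \<^bold>+ tgt g) \<cdot> k"
    "inr Y Z \<cdot> inr X (Y \<^bold>+ Z) \<cdot> (sy X Y \<^bold>\<oplus> g) = g \<cdot> inr (Y \<^bold>+ X) (tgt g)"
    "\<lbrakk>k \<in> Ar; src k = Y \<^bold>+ X \<^bold>+ tgt g\<rbrakk> \<Longrightarrow> inr Y Z \<cdot> inr X (Y \<^bold>+ Z) \<cdot> (sy X Y \<^bold>\<oplus> g) \<cdot> k = g
      \<cdot> inr (Y \<^bold>+ X) (tgt g) \<cdot> k"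
  using inl_comp [of "sy X Y" g X Y Z] inr_comp [of "sy X Y" g X Y Z]
    inl_comp_seq [of "sy X Y" g X Y Z k] inr_comp_seq [of "sy X Y" g X Y Z k]
    inrr_comp [of "sy X Y" g X Y Z] inrr_comp_seq [of "sy X Y" g X Y Z k]
  by (auto simp del: inr_inl)

lemma nab_comp [simp]: assumes [simp]: "g \<in> Ar" "src g = Z" "X \<in> Ob"
  shows "inl X (X \<^bold>+ Z) \<cdot> (nab X \<^bold>\<oplus> g) = inl X (tgt g)"
    "inl X Z \<cdot> inr X (X \<^bold>+ Z) \<cdot> (nab X \<^bold>\<oplus> g) = inl X (tgt g)"
    "\<lbrakk>k \<in> Ar; src k = X \<^bold>+ tgt g\<rbrakk> \<Longrightarrow> inl X (X \<^bold>+ Z) \<cdot> (nab X \<^bold>\<oplus> g) \<cdot> k = inl X (tgt g) \<cdot> k"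
    "\<lbrakk>k \<in> Ar; src k = X \<^bold>+ tgt g\<rbrakk> \<Longrightarrow>
      inl X Z \<cdot> inr X (X \<^bold>+ Z) \<cdot> (nab X \<^bold>\<oplus> g) \<cdot> k = inl X (tgt g) \<cdot> k"
    "inr X Z \<cdot> inr X (X \<^bold>+ Z) \<cdot> (nab X \<^bold>\<oplus> g) = g \<cdot> inr X (tgt g)"
    "\<lbrakk>k \<in> Ar; src k = X \<^bold>+ tgt g\<rbrakk> \<Longrightarrow> inr X Z \<cdot> inr X (X \<^bold>+ Z) \<cdot> (nab X \<^bold>\<oplus> g) \<cdot> k = g
      \<cdot> inr X (tgt g) \<cdot> k"
  using inl_comp [of "nab X" g X X Z] inr_comp [of "nab X" g X X Z]
    inl_comp_seq [of "nab X" g X X Z k] inr_comp_seq [of "nab X" g X X Z k]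
    inrr_comp [of "nab X" g X X Z] inrr_comp_seq [of "nab X" g X X Z k]
  by auto

lemma nab_tO: assumes [simp]: "X \<in> Ob" "Y \<in> Ob"
  shows "nab (X \<^bold>+ Y) = (ide X \<^bold>\<oplus> sy Y X \<^bold>\<oplus> ide Y) \<cdot> (nab X \<^bold>\<oplus> nab Y)"
proof (rule ext4 [of _ _ X Y X Y])
  let ?m = "(ide X \<^bold>\<oplus> sy Y X \<^bold>\<oplus> ide Y) \<cdot> (nab X \<^bold>\<oplus> nab Y)"
  show "inl X Y \<cdot> inl (X \<^bold>+ Y) (X \<^bold>+ Y) \<cdot> nab (X \<^bold>+ Y) = inl X Y \<cdot> inl (X \<^bold>+ Y) (X \<^bold>+ Y) \<cdot> ?m"
    by simp
  show "inr X Y \<cdot> inl (X \<^bold>+ Y) (X \<^bold>+ Y) \<cdot> nab (X \<^bold>+ Y) = inr X Y \<cdot> inl (X \<^bold>+ Y) (X \<^bold>+ Y) \<cdot> ?m"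
    by simp
  have * : "inl X Y \<cdot> inr (X \<^bold>+ Y) (X \<^bold>+ Y) \<cdot> ?m = inl X Y" "inr X Y \<cdot> inr (X \<^bold>+ Y) (X \<^bold>+ Y) \<cdot> ?m
    = inr X Y"
    by (simp_all add: inr_expand)
  show "inl X Y \<cdot> inr (X \<^bold>+ Y) (X \<^bold>+ Y) \<cdot> nab (X \<^bold>+ Y) = inl X Y \<cdot> inr (X \<^bold>+ Y) (X \<^bold>+ Y) \<cdot> ?m"
    unfolding * by simp
  show "inr X Y \<cdot> inr (X \<^bold>+ Y) (X \<^bold>+ Y) \<cdot> nab (X \<^bold>+ Y) = inr X Y \<cdot> inr (X \<^bold>+ Y) (X \<^bold>+ Y) \<cdot> ?m"
    unfolding * by simp
qed simp_all

end

section \<open>Strict rig categories with coproducts\<close>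

text \<open>\<open>inl_dl\<close> and \<open>inr_dl\<close> determine \<open>dl\<close>, so its
  naturality and coherence are theorems rather than axioms. The inverse \<open>dli\<close> is a
  parameter in its own right: for tapes it is given by a recursion, for other rig categories by
  \<open>inv_arr\<close>.\<close>

locale srig = add: sfc Ob Ar src tgt ide seq aO aA z sa nab bng + mul: ssm Ob Ar src tgt ide seq
  mO mA one sm
  for Ob :: "'o set" and Ar :: "'a set" and src tgt :: "'a \<Rightarrow> 'o" and ide :: "'o \<Rightarrow> 'a"
    and seq :: "'a \<Rightarrow> 'a \<Rightarrow> 'a" (infixr "\<cdot>" 55)
    and aO :: "'o \<Rightarrow> 'o \<Rightarrow> 'o" (infixr "\<^bold>+" 65)
    and aA :: "'a \<Rightarrow> 'a \<Rightarrow> 'a" (infixr "\<^bold>\<oplus>" 65)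
    and z :: 'o and sa :: "'o \<Rightarrow> 'o \<Rightarrow> 'a" and nab bng :: "'o \<Rightarrow> 'a"
    and mO :: "'o \<Rightarrow> 'o \<Rightarrow> 'o" (infixr "\<^bold>*" 70)
    and mA :: "'a \<Rightarrow> 'a \<Rightarrow> 'a" (infixr "\<^bold>\<otimes>" 70)
    and one :: 'o and sm :: "'o \<Rightarrow> 'o \<Rightarrow> 'a" +
  fixes dl dli :: "'o \<Rightarrow> 'o \<Rightarrow> 'o \<Rightarrow> 'a"
  assumes z_mO [simp]: "X \<in> Ob \<Longrightarrow> z \<^bold>* X = z"
    and mO_z [simp]: "X \<in> Ob \<Longrightarrow> X \<^bold>* z = z"
    and distr [simp]: "\<lbrakk>X \<in> Ob; Y \<in> Ob; Z \<in> Ob\<rbrakk> \<Longrightarrow> (X \<^bold>+ Y) \<^bold>* Z = X \<^bold>* Z \<^bold>+ Y \<^bold>* Z"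
    and aA_mA [simp]: "\<lbrakk>f \<in> Ar; g \<in> Ar; h \<in> Ar\<rbrakk> \<Longrightarrow> (f \<^bold>\<oplus> g) \<^bold>\<otimes> h = f \<^bold>\<otimes> h \<^bold>\<oplus> g \<^bold>\<otimes> h"
    and dl_type [simp]: "\<lbrakk>X \<in> Ob; Y \<in> Ob; Z \<in> Ob\<rbrakk> \<Longrightarrow> dl X Y Z \<in> Ar"
      "\<lbrakk>X \<in> Ob; Y \<in> Ob; Z \<in> Ob\<rbrakk> \<Longrightarrow> src (dl X Y Z) = X \<^bold>* (Y \<^bold>+ Z)"
      "\<lbrakk>X \<in> Ob; Y \<in> Ob; Z \<in> Ob\<rbrakk> \<Longrightarrow> tgt (dl X Y Z) = X \<^bold>* Y \<^bold>+ X \<^bold>* Z"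
    and dli_type [simp]: "\<lbrakk>X \<in> Ob; Y \<in> Ob; Z \<in> Ob\<rbrakk> \<Longrightarrow> dli X Y Z \<in> Ar"
      "\<lbrakk>X \<in> Ob; Y \<in> Ob; Z \<in> Ob\<rbrakk> \<Longrightarrow> src (dli X Y Z) = X \<^bold>* Y \<^bold>+ X \<^bold>* Z"
      "\<lbrakk>X \<in> Ob; Y \<in> Ob; Z \<in> Ob\<rbrakk> \<Longrightarrow> tgt (dli X Y Z) = X \<^bold>* (Y \<^bold>+ Z)"
    and dl_dli [simp]: "\<lbrakk>X \<in> Ob; Y \<in> Ob; Z \<in> Ob\<rbrakk> \<Longrightarrow> dl X Y Z \<cdot> dli X Y Z = ide (X \<^bold>* (Y \<^bold>+ Z))"
    and dli_dl [simp]: "\<lbrakk>X \<in> Ob; Y \<in> Ob; Z \<in> Ob\<rbrakk> \<Longrightarrow> dli X Y Z \<cdot> dl X Y Z = ide (X \<^bold>* Y \<^bold>+ X \<^bold>* Z)"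
    and inl_dl: "\<lbrakk>X \<in> Ob; Y \<in> Ob; Z \<in> Ob\<rbrakk> \<Longrightarrow> (ide X \<^bold>\<otimes> add.inl Y Z) \<cdot> dl X Y Z
      = add.inl (X \<^bold>* Y) (X \<^bold>* Z)"
    and inr_dl: "\<lbrakk>X \<in> Ob; Y \<in> Ob; Z \<in> Ob\<rbrakk> \<Longrightarrow> (ide X \<^bold>\<otimes> add.inr Y Z) \<cdot> dl X Y Z
      = add.inr (X \<^bold>* Y) (X \<^bold>* Z)"
begin

abbreviation "inl \<equiv> add.inl"
abbreviation "inr \<equiv> add.inr"

lemma dl_dli_seq [simp]: "\<lbrakk>X \<in> Ob; Y \<in> Ob; Z \<in> Ob; k \<in> Ar; src k = X \<^bold>* (Y \<^bold>+ Z)\<rbrakk> \<Longrightarrow> dl X Y Z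
  \<cdot> dli X Y Z \<cdot> k = k"
  by (subst add.seq_assoc [symmetric]) auto

lemma dli_dl_seq [simp]: "\<lbrakk>X \<in> Ob; Y \<in> Ob; Z \<in> Ob; k \<in> Ar; src k = X \<^bold>* Y \<^bold>+ X \<^bold>* Z\<rbrakk> \<Longrightarrow> dli X Y Z
  \<cdot> dl X Y Z \<cdot> k = k"
  by (subst add.seq_assoc [symmetric]) auto

lemma z_mA [simp]: "f \<in> Ar \<Longrightarrow> ide z \<^bold>\<otimes> f = ide z"
  by (rule add.ext0) auto

lemma mA_z [simp]: "f \<in> Ar \<Longrightarrow> f \<^bold>\<otimes> ide z = ide z"
  by (rule add.ext0) auto

lemma bng_mA [simp]: "\<lbrakk>X \<in> Ob; f \<in> Ar\<rbrakk> \<Longrightarrow> bng X \<^bold>\<otimes> f = bng (X \<^bold>* tgt f)"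
  by (rule add.ext0) auto

lemma mA_bng [simp]: "\<lbrakk>X \<in> Ob; f \<in> Ar\<rbrakk> \<Longrightarrow> f \<^bold>\<otimes> bng X = bng (tgt f \<^bold>* X)"
  by (rule add.ext0) auto

text \<open>Multiplying an injection on the right takes no distributor, because right distributivity
  is an equality. On the left, \<open>mA_inl_dl\<close> has to bring in \<open>dl\<close>.\<close>

lemma inl_mA [simp]: assumes "X \<in> Ob" "Y \<in> Ob" "f \<in> Ar"
  shows "inl X Y \<^bold>\<otimes> f = (ide X \<^bold>\<otimes> f) \<cdot> inl (X \<^bold>* tgt f) (Y \<^bold>* tgt f)"
proof -
  have "(ide X \<^bold>\<otimes> f) \<cdot> inl (X \<^bold>* tgt f) (Y \<^bold>* tgt f) = (ide X \<^bold>\<otimes> f \<^bold>\<oplus> ide z)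
    \<cdot> inl (X \<^bold>* tgt f) (Y \<^bold>* tgt f)"
    using assms by simp
  also have "\<dots> = inl X Y \<^bold>\<otimes> f"
    unfolding add.inl_def using assms by (subst add.interchange) auto
  finally show ?thesis ..
qed

lemma inr_mA [simp]: assumes "X \<in> Ob" "Y \<in> Ob" "f \<in> Ar"
  shows "inr X Y \<^bold>\<otimes> f = (ide Y \<^bold>\<otimes> f) \<cdot> inr (X \<^bold>* tgt f) (Y \<^bold>* tgt f)"
proof -
  have "(ide Y \<^bold>\<otimes> f) \<cdot> inr (X \<^bold>* tgt f) (Y \<^bold>* tgt f) = (ide z \<^bold>\<oplus> ide Y \<^bold>\<otimes> f)
    \<cdot> inr (X \<^bold>* tgt f) (Y \<^bold>* tgt f)"
    using assms by simp
  also have "\<dots> = inr X Y \<^bold>\<otimes> f"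
    unfolding add.inr_def using assms by (subst add.interchange) auto
  finally show ?thesis ..
qed

lemma mA_factor: "\<lbrakk>f \<in> Ar; g \<in> Ar; h \<in> Ar; tgt g = src h\<rbrakk> \<Longrightarrow> f \<^bold>\<otimes> (g \<cdot> h) = (f \<^bold>\<otimes> g)
  \<cdot> (ide (tgt f) \<^bold>\<otimes> h)"
  by simp

lemma mA_factor': "\<lbrakk>f \<in> Ar; g \<in> Ar; h \<in> Ar; tgt g = src h\<rbrakk> \<Longrightarrow> (g \<cdot> h) \<^bold>\<otimes> f = (g \<^bold>\<otimes> f)
  \<cdot> (h \<^bold>\<otimes> ide (tgt f))"
  by simp

lemma inr_mA' [simp]: "\<lbrakk>X \<in> Ob; Y \<in> Ob; f \<in> Ar; g \<in> Ar; tgt g = Y\<rbrakk> \<Longrightarrow>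
  (g \<cdot> inr X Y) \<^bold>\<otimes> f = (g \<^bold>\<otimes> f) \<cdot> inr (X \<^bold>* tgt f) (Y \<^bold>* tgt f)"
  by (simp add: mA_factor' del: mul.interchange)

lemma mA_inl_dl [simp]: assumes "f \<in> Ar" "Y \<in> Ob" "Z \<in> Ob" "X = tgt f"
  shows "(f \<^bold>\<otimes> inl Y Z) \<cdot> dl X Y Z = (f \<^bold>\<otimes> ide Y) \<cdot> inl (X \<^bold>* Y) (X \<^bold>* Z)"
proof -
  have "f \<^bold>\<otimes> inl Y Z = (f \<^bold>\<otimes> ide Y) \<cdot> (ide X \<^bold>\<otimes> inl Y Z)" using assms by (subst mul.interchange)
    auto
  then show ?thesis using assms inl_dl [of X Y Z]
    by (simp del: mul.interchange mul.interchange_seq)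
qed

lemma mA_inr_dl [simp]: assumes "f \<in> Ar" "Y \<in> Ob" "Z \<in> Ob" "X = tgt f"
  shows "(f \<^bold>\<otimes> inr Y Z) \<cdot> dl X Y Z = (f \<^bold>\<otimes> ide Z) \<cdot> inr (X \<^bold>* Y) (X \<^bold>* Z)"
proof -
  have "f \<^bold>\<otimes> inr Y Z = (f \<^bold>\<otimes> ide Z) \<cdot> (ide X \<^bold>\<otimes> inr Y Z)" using assms by (subst mul.interchange)
    auto
  then show ?thesis using assms inr_dl [of X Y Z]
    by (simp del: mul.interchange mul.interchange_seq)
qed

lemma mA_inl_dl_seq [simp]: "\<lbrakk>f \<in> Ar; Y \<in> Ob; Z \<in> Ob; X = tgt f; k \<in> Ar; src k = X \<^bold>* Y \<^bold>+ X \<^bold>* Z\<rbrakk>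
  \<Longrightarrow> (f \<^bold>\<otimes> inl Y Z) \<cdot> dl X Y Z \<cdot> k = (f \<^bold>\<otimes> ide Y) \<cdot> inl (X \<^bold>* Y) (X \<^bold>* Z) \<cdot> k"
  by (subst add.seq_assoc [symmetric]) auto

lemma mA_inr_dl_seq [simp]: "\<lbrakk>f \<in> Ar; Y \<in> Ob; Z \<in> Ob; X = tgt f; k \<in> Ar; src k = X \<^bold>* Y \<^bold>+ X \<^bold>* Z\<rbrakk>
  \<Longrightarrow> (f \<^bold>\<otimes> inr Y Z) \<cdot> dl X Y Z \<cdot> k = (f \<^bold>\<otimes> ide Z) \<cdot> inr (X \<^bold>* Y) (X \<^bold>* Z) \<cdot> k"
  by (subst add.seq_assoc [symmetric]) auto

lemma mA_inl_dl' [simp]: assumes "f \<in> Ar" "g \<in> Ar" "tgt g = Y" "Y \<in> Ob" "Z \<in> Ob" "X = tgt f"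
  shows "(f \<^bold>\<otimes> (g \<cdot> inl Y Z)) \<cdot> dl X Y Z = (f \<^bold>\<otimes> g) \<cdot> inl (X \<^bold>* Y) (X \<^bold>* Z)"
  using assms by (simp add: mA_factor del: mul.interchange)

lemma mA_inr_dl' [simp]: assumes "f \<in> Ar" "g \<in> Ar" "tgt g = Z" "Y \<in> Ob" "Z \<in> Ob" "X = tgt f"
  shows "(f \<^bold>\<otimes> (g \<cdot> inr Y Z)) \<cdot> dl X Y Z = (f \<^bold>\<otimes> g) \<cdot> inr (X \<^bold>* Y) (X \<^bold>* Z)"
  using assms by (simp add: mA_factor del: mul.interchange)

lemma inl_dli [simp]: assumes "X \<in> Ob" "Y \<in> Ob" "Z \<in> Ob"
  shows "inl (X \<^bold>* Y) (X \<^bold>* Z) \<cdot> dli X Y Z = ide X \<^bold>\<otimes> inl Y Z"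
  using assms by (subst inl_dl [symmetric]) (simp_all del: mA_inl_dl)

lemma inr_dli [simp]: assumes "X \<in> Ob" "Y \<in> Ob" "Z \<in> Ob"
  shows "inr (X \<^bold>* Y) (X \<^bold>* Z) \<cdot> dli X Y Z = ide X \<^bold>\<otimes> inr Y Z"
  using assms by (subst inr_dl [symmetric]) (simp_all del: mA_inr_dl)

lemma inl_dli_seq [simp]: assumes "X \<in> Ob" "Y \<in> Ob" "Z \<in> Ob" "k \<in> Ar" "src k = X \<^bold>* (Y \<^bold>+ Z)"
  shows "inl (X \<^bold>* Y) (X \<^bold>* Z) \<cdot> dli X Y Z \<cdot> k = (ide X \<^bold>\<otimes> inl Y Z) \<cdot> k"
  using assms by (subst add.seq_assoc [symmetric]) auto

lemma inr_dli_seq [simp]: assumes "X \<in> Ob" "Y \<in> Ob" "Z \<in> Ob" "k \<in> Ar" "src k = X \<^bold>* (Y \<^bold>+ Z)"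
  shows "inr (X \<^bold>* Y) (X \<^bold>* Z) \<cdot> dli X Y Z \<cdot> k = (ide X \<^bold>\<otimes> inr Y Z) \<cdot> k"
  using assms by (subst add.seq_assoc [symmetric]) auto

text \<open>Since \<open>dl\<close> is invertible, X (Y + Z) is a coproduct of XY and XZ as well,
  and its injections are those of Y + Z multiplied by X.\<close>

lemma extl: assumes "f \<in> Ar" "g \<in> Ar" "src f = X \<^bold>* (Y \<^bold>+ Z)" "src g = X \<^bold>* (Y \<^bold>+ Z)" "tgt f
  = tgt g"
    and [simp]: "X \<in> Ob" "Y \<in> Ob" "Z \<in> Ob"
    and "(ide X \<^bold>\<otimes> inl Y Z) \<cdot> f = (ide X \<^bold>\<otimes> inl Y Z) \<cdot> g"
    "(ide X \<^bold>\<otimes> inr Y Z) \<cdot> f = (ide X \<^bold>\<otimes> inr Y Z) \<cdot> g"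
  shows "f = g"
proof -
  have "dli X Y Z \<cdot> f = dli X Y Z \<cdot> g"
    by (rule add.ext2 [of _ _ "X \<^bold>* Y" "X \<^bold>* Z"]) (use assms in simp_all)
  then have "dl X Y Z \<cdot> dli X Y Z \<cdot> f = dl X Y Z \<cdot> dli X Y Z \<cdot> g" by simp
  then show ?thesis using assms by simp
qed

lemma inl_sm [simp]: assumes "X \<in> Ob" "Y \<in> Ob" "Z \<in> Ob"
  shows "inl (X \<^bold>* Z) (Y \<^bold>* Z) \<cdot> sm (X \<^bold>+ Y) Z = sm X Z \<cdot> (ide Z \<^bold>\<otimes> inl X Y)"
  using mul.sy_nat' [of "inl X Y" "ide Z" X "X \<^bold>+ Y" Z Z] assms by simp

lemma inr_sm [simp]: assumes "X \<in> Ob" "Y \<in> Ob" "Z \<in> Ob"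
  shows "inr (X \<^bold>* Z) (Y \<^bold>* Z) \<cdot> sm (X \<^bold>+ Y) Z = sm Y Z \<cdot> (ide Z \<^bold>\<otimes> inr X Y)"
  using mul.sy_nat' [of "inr X Y" "ide Z" Y "X \<^bold>+ Y" Z Z] assms by simp

lemma inl_sm_seq [simp]: assumes "X \<in> Ob" "Y \<in> Ob" "Z \<in> Ob" "k \<in> Ar" "src k = Z \<^bold>* (X \<^bold>+ Y)"
  shows "inl (X \<^bold>* Z) (Y \<^bold>* Z) \<cdot> sm (X \<^bold>+ Y) Z \<cdot> k = sm X Z \<cdot> (ide Z \<^bold>\<otimes> inl X Y) \<cdot> k"
  using assms by (subst add.seq_assoc [symmetric]) auto

lemma inr_sm_seq [simp]: assumes "X \<in> Ob" "Y \<in> Ob" "Z \<in> Ob" "k \<in> Ar" "src k = Z \<^bold>* (X \<^bold>+ Y)"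
  shows "inr (X \<^bold>* Z) (Y \<^bold>* Z) \<cdot> sm (X \<^bold>+ Y) Z \<cdot> k = sm Y Z \<cdot> (ide Z \<^bold>\<otimes> inr X Y) \<cdot> k"
  using assms by (subst add.seq_assoc [symmetric]) auto

lemma dl_natural: assumes "f \<in> Ar" "g \<in> Ar" "h \<in> Ar"
  shows "(f \<^bold>\<otimes> (g \<^bold>\<oplus> h)) \<cdot> dl (tgt f) (tgt g) (tgt h) = dl (src f) (src g) (src h)
    \<cdot> (f \<^bold>\<otimes> g \<^bold>\<oplus> f \<^bold>\<otimes> h)"
  by (rule extl [of _ _ "src f" "src g" "src h"]) (use assms in simp_all)

lemma dl_z1 [simp]: "\<lbrakk>X \<in> Ob; Y \<in> Ob\<rbrakk> \<Longrightarrow> dl z X Y = ide z"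
  by (rule add.ext0) simp_all

lemma dl_z2 [simp]: "\<lbrakk>X \<in> Ob; Y \<in> Ob\<rbrakk> \<Longrightarrow> dl X z Y = ide (X \<^bold>* Y)"
  using inr_dl [of X z Y] by (simp del: mA_inr_dl)

lemma dl_z3 [simp]: "\<lbrakk>X \<in> Ob; Y \<in> Ob\<rbrakk> \<Longrightarrow> dl X Y z = ide (X \<^bold>* Y)"
  using inl_dl [of X Y z] by (simp del: mA_inl_dl)

lemma dl_one [simp]: "\<lbrakk>X \<in> Ob; Y \<in> Ob\<rbrakk> \<Longrightarrow> dl one X Y = ide (X \<^bold>+ Y)"
  by (rule add.ext2 [of _ _ X Y]) (use inl_dl [of one X Y] inr_dl [of one X Y] in \<open>simp_all
    del: mA_inl_dl mA_inr_dl\<close>)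

section \<open>Laplaza's axioms in the strict setting\<close>

lemma lap1: assumes "X \<in> Ob" "Y \<in> Ob" "Z \<in> Ob"
  shows "dl X Y Z \<cdot> sa (X \<^bold>* Y) (X \<^bold>* Z) = (ide X \<^bold>\<otimes> sa Y Z) \<cdot> dl X Z Y"
  by (rule extl [of _ _ X Y Z]) (use assms in simp_all)

lemma lap2: assumes "X \<in> Ob" "Y \<in> Ob" "Z \<in> Ob"
  shows "sm (X \<^bold>+ Y) Z \<cdot> dl Z X Y = sm X Z \<^bold>\<oplus> sm Y Z"
  by (rule add.ext2 [of _ _ "X \<^bold>* Z" "Y \<^bold>* Z"]) (use assms in simp_all)

lemma lap3: assumes "X \<in> Ob" "Y \<in> Ob" "Z \<in> Ob"
  shows "sa (X \<^bold>* Z) (Y \<^bold>* Z) = sa X Y \<^bold>\<otimes> ide Z"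
proof (rule add.ext2 [of _ _ "X \<^bold>* Z" "Y \<^bold>* Z"])
  have "inl X Y \<^bold>\<otimes> ide Z = inl (X \<^bold>* Z) (Y \<^bold>* Z)" "inr X Y \<^bold>\<otimes> ide Z = inr (X \<^bold>* Z) (Y \<^bold>* Z)"
    using assms by simp_all
  from this [symmetric] show
    "inl (X \<^bold>* Z) (Y \<^bold>* Z) \<cdot> sa (X \<^bold>* Z) (Y \<^bold>* Z) = inl (X \<^bold>* Z) (Y \<^bold>* Z) \<cdot> (sa X Y \<^bold>\<otimes> ide Z)"
    "inr (X \<^bold>* Z) (Y \<^bold>* Z) \<cdot> sa (X \<^bold>* Z) (Y \<^bold>* Z) = inr (X \<^bold>* Z) (Y \<^bold>* Z) \<cdot> (sa X Y \<^bold>\<otimes> ide Z)"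
    using assms by (simp_all del: inl_mA inr_mA) simp_all
qed (use assms in simp_all)

text \<open>The sum Y + Z + W is tested on Y and on Z + W, the latter again on Z and W. The
  right-hand side groups the three summands the other way, and the equations between iterated
  injections convert one grouping into the other.\<close>

lemma lap5: assumes [simp]: "X \<in> Ob" "Y \<in> Ob" "Z \<in> Ob" "W \<in> Ob"
  shows "dl X Y (Z \<^bold>+ W) \<cdot> (ide (X \<^bold>* Y) \<^bold>\<oplus> dl X Z W) = dl X (Y \<^bold>+ Z) W
    \<cdot> (dl X Y Z \<^bold>\<oplus> ide (X \<^bold>* W))"
proof (rule extl [of _ _ X Y "Z \<^bold>+ W"])
  have *: "(ide X \<^bold>\<otimes> inl Y (Z \<^bold>+ W)) = (ide X \<^bold>\<otimes> inl Y Z) \<cdot> (ide X \<^bold>\<otimes> inl (Y \<^bold>+ Z) W)" by simp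
  show "(ide X \<^bold>\<otimes> inl Y (Z \<^bold>+ W)) \<cdot> dl X Y (Z \<^bold>+ W) \<cdot> (ide (X \<^bold>* Y) \<^bold>\<oplus> dl X Z W)
     = (ide X \<^bold>\<otimes> inl Y (Z \<^bold>+ W)) \<cdot> dl X (Y \<^bold>+ Z) W \<cdot> (dl X Y Z \<^bold>\<oplus> ide (X \<^bold>* W))"
    (is "?l = ?r")
  proof -
    have "?r = inl (X \<^bold>* Y) (X \<^bold>* (Z \<^bold>+ W)) \<cdot> (ide (X \<^bold>* Y) \<^bold>\<oplus> dl X Z W)"
      unfolding * by (simp del: mul.interchange mul.interchange_seq)
    then show ?thesis by simp
  qed
  show "(ide X \<^bold>\<otimes> inr Y (Z \<^bold>+ W)) \<cdot> dl X Y (Z \<^bold>+ W) \<cdot> (ide (X \<^bold>* Y) \<^bold>\<oplus> dl X Z W)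
     = (ide X \<^bold>\<otimes> inr Y (Z \<^bold>+ W)) \<cdot> dl X (Y \<^bold>+ Z) W \<cdot> (dl X Y Z \<^bold>\<oplus> ide (X \<^bold>* W))"
    (is "?l = ?r")
  proof (rule extl [of _ _ X Z W])
    have *: "(ide X \<^bold>\<otimes> inl Z W) \<cdot> (ide X \<^bold>\<otimes> inr Y (Z \<^bold>+ W)) = (ide X \<^bold>\<otimes> inr Y Z)
      \<cdot> (ide X \<^bold>\<otimes> inl (Y \<^bold>+ Z) W)"
      "(ide X \<^bold>\<otimes> inr Z W) \<cdot> (ide X \<^bold>\<otimes> inr Y (Z \<^bold>+ W)) = (ide X \<^bold>\<otimes> inr (Y \<^bold>+ Z) W)"
      by (simp_all flip: add.inr_expand)
    note ** = this [THEN add.seq_eq]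
    have "(ide X \<^bold>\<otimes> inl Z W) \<cdot> ?r = inr (X \<^bold>* Y) (X \<^bold>* Z) \<cdot> inl (X \<^bold>* Y \<^bold>+ X \<^bold>* Z) (X \<^bold>* W)"
      by (subst **) (simp_all del: mul.interchange mul.interchange_seq)
    then show "(ide X \<^bold>\<otimes> inl Z W) \<cdot> ?l = (ide X \<^bold>\<otimes> inl Z W) \<cdot> ?r"
      by (simp del: mul.interchange mul.interchange_seq)
    have "(ide X \<^bold>\<otimes> inr Z W) \<cdot> ?r = inr (X \<^bold>* Y \<^bold>+ X \<^bold>* Z) (X \<^bold>* W)"
      by (subst **) (simp_all del: mul.interchange mul.interchange_seq)
    then show "(ide X \<^bold>\<otimes> inr Z W) \<cdot> ?l = (ide X \<^bold>\<otimes> inr Z W) \<cdot> ?r"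
      by (simp del: mul.interchange mul.interchange_seq add: add.inr_expand)
  qed simp_all
qed simp_all

lemma lap6: assumes "X \<in> Ob" "Y \<in> Ob" "Z \<in> Ob" "W \<in> Ob"
  shows "dl (X \<^bold>* Y) Z W = (ide X \<^bold>\<otimes> dl Y Z W) \<cdot> dl X (Y \<^bold>* Z) (Y \<^bold>* W)"
proof -
  have *: "ide (X \<^bold>* Y) \<^bold>\<otimes> f = ide X \<^bold>\<otimes> ide Y \<^bold>\<otimes> f" if "f \<in> Ar" for f
    using that assms by (metis mul.tA_assoc mul.tA_ide add.ide_Ar)
  have **: "(ide X \<^bold>\<otimes> ide Y \<^bold>\<otimes> f) \<cdot> (ide X \<^bold>\<otimes> g) \<cdot> h = (ide X \<^bold>\<otimes> ((ide Y \<^bold>\<otimes> f) \<cdot> g)) \<cdot> h"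
    if "f \<in> Ar" "g \<in> Ar" "h \<in> Ar" "Y \<^bold>* tgt f = src g" "X \<^bold>* tgt g = src h" for f g h
    using that assms by simp
  show ?thesis
  proof (rule extl [of _ _ "X \<^bold>* Y" Z W])
    show "(ide (X \<^bold>* Y) \<^bold>\<otimes> inl Z W) \<cdot> dl (X \<^bold>* Y) Z W =
      (ide (X \<^bold>* Y) \<^bold>\<otimes> inl Z W) \<cdot> (ide X \<^bold>\<otimes> dl Y Z W) \<cdot> dl X (Y \<^bold>* Z) (Y \<^bold>* W)"
      "(ide (X \<^bold>* Y) \<^bold>\<otimes> inr Z W) \<cdot> dl (X \<^bold>* Y) Z W =
      (ide (X \<^bold>* Y) \<^bold>\<otimes> inr Z W) \<cdot> (ide X \<^bold>\<otimes> dl Y Z W) \<cdot> dl X (Y \<^bold>* Z) (Y \<^bold>* W)"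
      using assms by (simp_all add: * ** del: mul.interchange_seq) (simp_all flip: *)
  qed (use assms in simp_all)
qed

lemma lap8: assumes "X \<in> Ob" "Y \<in> Ob" "Z \<in> Ob" "W \<in> Ob"
  shows "dl X (Y \<^bold>* W) (Z \<^bold>* W) = dl X Y Z \<^bold>\<otimes> ide W"
proof -
  have *: "ide X \<^bold>\<otimes> inl (Y \<^bold>* W) (Z \<^bold>* W) = (ide X \<^bold>\<otimes> inl Y Z) \<^bold>\<otimes> ide W"
    "ide X \<^bold>\<otimes> inr (Y \<^bold>* W) (Z \<^bold>* W) = (ide X \<^bold>\<otimes> inr Y Z) \<^bold>\<otimes> ide W" using assms by simp_all
  show ?thesis
  proof (rule extl [of _ _ X "Y \<^bold>* W" "Z \<^bold>* W"])
    show "(ide X \<^bold>\<otimes> inl (Y \<^bold>* W) (Z \<^bold>* W)) \<cdot> dl X (Y \<^bold>* W) (Z \<^bold>* W) =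
        (ide X \<^bold>\<otimes> inl (Y \<^bold>* W) (Z \<^bold>* W)) \<cdot> (dl X Y Z \<^bold>\<otimes> ide W)"
      unfolding *(1) by (subst mul.interchange) (use assms in simp_all)
    show "(ide X \<^bold>\<otimes> inr (Y \<^bold>* W) (Z \<^bold>* W)) \<cdot> dl X (Y \<^bold>* W) (Z \<^bold>* W) =
        (ide X \<^bold>\<otimes> inr (Y \<^bold>* W) (Z \<^bold>* W)) \<cdot> (dl X Y Z \<^bold>\<otimes> ide W)"
      unfolding *(2) by (subst mul.interchange) (use assms in simp_all)
  qed (use assms in simp_all)
qed

text \<open>The middle symmetry sorts the summands XZ, XW, YZ, YW into XZ, YZ, XW, YW. When the
  distributor at X is an identity this is exactly the recursion of \<open>tdl\<close>, and it is how
  \<open>tdl\<close> will be interpreted.\<close>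

lemma lap9: assumes [simp]: "X \<in> Ob" "Y \<in> Ob" "Z \<in> Ob" "W \<in> Ob"
  shows "dl (X \<^bold>+ Y) Z W = (dl X Z W \<^bold>\<oplus> dl Y Z W) \<cdot> (ide (X \<^bold>* Z) \<^bold>\<oplus> sa (X \<^bold>* W) (Y \<^bold>* Z) \<^bold>\<oplus> ide
    (Y \<^bold>* W))"
proof (rule extl [of _ _ "X \<^bold>+ Y" Z W])
  let ?r = "(dl X Z W \<^bold>\<oplus> dl Y Z W) \<cdot> (ide (X \<^bold>* Z) \<^bold>\<oplus> sa (X \<^bold>* W) (Y \<^bold>* Z) \<^bold>\<oplus> ide (Y \<^bold>* W))"
  have *: "ide (X \<^bold>+ Y) \<^bold>\<otimes> f = ide X \<^bold>\<otimes> f \<^bold>\<oplus> ide Y \<^bold>\<otimes> f" if "f \<in> Ar" for f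
    using that by (simp flip: add.tA_ide)
  have L: "(ide (X \<^bold>+ Y) \<^bold>\<otimes> inl Z W) \<cdot> dl (X \<^bold>+ Y) Z W = inl (X \<^bold>* Z \<^bold>+ Y \<^bold>* Z) (X \<^bold>* W \<^bold>+ Y \<^bold>*
    W)"
    "(ide (X \<^bold>+ Y) \<^bold>\<otimes> inr Z W) \<cdot> dl (X \<^bold>+ Y) Z W = inr (X \<^bold>* Z \<^bold>+ Y \<^bold>* Z) (X \<^bold>* W \<^bold>+ Y \<^bold>* W)"
    using inl_dl [of "X \<^bold>+ Y" Z W] inr_dl [of "X \<^bold>+ Y" Z W] by (simp_all del: mA_inl_dl mA_inr_dl)
  show "(ide (X \<^bold>+ Y) \<^bold>\<otimes> inl Z W) \<cdot> dl (X \<^bold>+ Y) Z W = (ide (X \<^bold>+ Y) \<^bold>\<otimes> inl Z W) \<cdot> ?r"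
    unfolding L by (rule add.ext2 [of _ _ "X \<^bold>* Z" "Y \<^bold>* Z"]) (simp_all add: * add.inr_expand)
  show "(ide (X \<^bold>+ Y) \<^bold>\<otimes> inr Z W) \<cdot> dl (X \<^bold>+ Y) Z W = (ide (X \<^bold>+ Y) \<^bold>\<otimes> inr Z W) \<cdot> ?r"
    unfolding L by (rule add.ext2 [of _ _ "X \<^bold>* W" "Y \<^bold>* W"]) (simp_all add: * add.inr_expand)
qed simp_all

end

section \<open>Strict structures as records\<close>

lemma in_hom_iff: "f \<in> hom C X Y \<longleftrightarrow> f \<in> arr C \<and> src C f = X \<and> tgt C f = Y"
  by (auto simp: hom_def)

lemma category_iff_scat:
  "category C \<longleftrightarrow> scat (obj C) (arr C) (src C) (tgt C) (ide C) (seq C)"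
proof
  assume "category C"
  then interpret category C .
  show "scat (obj C) (arr C) (src C) (tgt C) (ide C) (seq C)"
    using src_obj tgt_obj ide_hom seq_hom ide_seq seq_ide seq_assoc
    by unfold_locales (auto simp: in_hom_iff)
next
  assume "scat (obj C) (arr C) (src C) (tgt C) (ide C) (seq C)"
  then interpret scat "obj C" "arr C" "src C" "tgt C" "ide C" "seq C" .
  show "category C" by unfold_locales (auto simp: in_hom_iff)
qed

context category
begin

interpretation scat "obj C" "arr C" "src C" "tgt C" "ide C" "seq C"
  using category_axioms category_iff_scat by blast

lemma inv_arr_eq: assumes "inverse_arrows C f g" shows "inv_arr C f = g"
  unfolding inv_arr_def
proof (rule the_equality)
  fix h assume "inverse_arrows C f h"
  with assms show "h = g" unfolding inverse_arrows_def in_hom_iff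
    by (metis ide_seq seq_ide seq_assoc)
qed (rule assms)

lemma inverse_arrows_ide: "X \<in> obj C \<Longrightarrow> inverse_arrows C (ide C X) (ide C X)"
  unfolding inverse_arrows_def in_hom_iff by simp

lemma inv_arr_ide: "X \<in> obj C \<Longrightarrow> inv_arr C (ide C X) = ide C X"
  by (rule inv_arr_eq [OF inverse_arrows_ide])

lemma iso_ide: "X \<in> obj C \<Longrightarrow> iso C (ide C X)"
  using inverse_arrows_ide unfolding iso_def by blast

lemma iso_inv_arr: assumes "iso C f"
  shows "inverse_arrows C f (inv_arr C f)"
  using assms inv_arr_eq unfolding iso_def by metis

lemma is_ide_eq: "\<lbrakk>is_ide C f; f \<in> hom C X Y\<rbrakk> \<Longrightarrow> f = ide C X \<and> X = Y"
  unfolding is_ide_def in_hom_iff by auto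

lemma is_ide_ide: "X \<in> obj C \<Longrightarrow> is_ide C (ide C X)"
  unfolding is_ide_def by blast

end

text \<open>An identity arrow with source X and target Y forces X = Y. Associators and unitors that
  are identities thus make the product of objects associative and unital on the nose, and their
  naturality becomes the same laws for arrows.\<close>

lemma ssm_of_strict:
  assumes "strict_sym_monoidal_category C M"
  shows "ssm (obj C) (arr C) (src C) (tgt C) (ide C) (seq C) (tenO M) (tenA M) (unO M) (symm M)"
    and "\<lbrakk>X \<in> obj C; Y \<in> obj C; Z \<in> obj C\<rbrakk> \<Longrightarrow> asc M X Y Z = ide C (tenO M X (tenO M Y Z))"
    and "X \<in> obj C \<Longrightarrow> lun M X = ide C X"
    and "X \<in> obj C \<Longrightarrow> run M X = ide C X"
proof -
  interpret strict_sym_monoidal_category C M by fact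
  interpret scat "obj C" "arr C" "src C" "tgt C" "ide C" "seq C"
    using category_axioms category_iff_scat by blast
  have a: "asc M X Y Z = ide C (tenO M X (tenO M Y Z)) \<and> tenO M (tenO M X Y) Z
    = tenO M X (tenO M Y Z)"
    if "X \<in> obj C" "Y \<in> obj C" "Z \<in> obj C" for X Y Z
    using is_ide_eq [OF asc_ide asc_hom] that by metis
  have l: "lun M X = ide C X \<and> tenO M (unO M) X = X" if "X \<in> obj C" for X
    using is_ide_eq [OF lun_ide lun_hom] that by metis
  have r: "run M X = ide C X \<and> tenO M X (unO M) = X" if "X \<in> obj C" for X
    using is_ide_eq [OF run_ide run_hom] that by metis
  note [simp] = un_obj tenO_obj
  have tA: "tenA M f g \<in> arr C" "src C (tenA M f g) = tenO M (src C f) (src C g)"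
      "tgt C (tenA M f g) = tenO M (tgt C f) (tgt C g)" if "f \<in> arr C" "g \<in> arr C" for f g
    using tenA_hom [of f _ _ g] that by (auto simp: in_hom_iff)
  have s: "symm M X Y \<in> arr C" "src C (symm M X Y) = tenO M X Y" "tgt C (symm M X Y) = tenO M Y X"
    if "X \<in> obj C" "Y \<in> obj C" for X Y
    using sym_hom [of X Y] that by (auto simp: in_hom_iff)
  show "ssm (obj C) (arr C) (src C) (tgt C) (ide C) (seq C) (tenO M) (tenA M) (unO M) (symm M)"
  proof unfold_locales
    fix f g h assume f: "f \<in> arr C" "g \<in> arr C" "h \<in> arr C"
    show "tenA M (tenA M f g) h = tenA M f (tenA M g h)"
      using asc_nat [of f "src C f" "tgt C f" g "src C g" "tgt C g" h "src C h" "tgt C h"] f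
      by (simp add: in_hom_iff a tA)
  next
    fix f assume f: "f \<in> arr C"
    show "tenA M (ide C (unO M)) f = f" "tenA M f (ide C (unO M)) = f"
      using lun_nat [of f "src C f" "tgt C f"] run_nat [of f "src C f" "tgt C f"] f
      by (simp_all add: in_hom_iff l r tA)
  next
    fix f f' g g' assume "f \<in> arr C" "f' \<in> arr C" "g \<in> arr C" "g' \<in> arr C" "tgt C f = src C f'"
      "tgt C g = src C g'"
    then show "seq C (tenA M f g) (tenA M f' g') = tenA M (seq C f f') (seq C g g')"
      using interchange [of f "src C f" "tgt C f" f' "tgt C f'" g "src C g" "tgt C g" g'
        "tgt C g'"]
      by (simp add: in_hom_iff)
  next
    fix f g assume "f \<in> arr C" "g \<in> arr C"
    then show "seq C (tenA M f g) (symm M (tgt C f) (tgt C g))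
      = seq C (symm M (src C f) (src C g)) (tenA M g f)"
      using sym_nat [of f "src C f" "tgt C f" g "src C g" "tgt C g"] by (simp add: in_hom_iff)
  next
    fix X Y Z assume X: "X \<in> obj C" "Y \<in> obj C" "Z \<in> obj C"
    show "symm M X (tenO M Y Z) = seq C (tenA M (symm M X Y) (ide C Z)) (tenA M (ide C Y)
      (symm M X Z))"
      using hexagon [of X Y Z] X by (simp add: in_hom_iff a tA s)
  qed (auto simp: tA s l r a sym_sym tenA_ide)
  show "\<lbrakk>X \<in> obj C; Y \<in> obj C; Z \<in> obj C\<rbrakk> \<Longrightarrow> asc M X Y Z = ide C (tenO M X (tenO M Y Z))"
    "X \<in> obj C \<Longrightarrow> lun M X = ide C X"
    "X \<in> obj C \<Longrightarrow> run M X = ide C X"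
    using a l r by auto
qed

lemma strict_of_ssm:
  assumes "ssm (obj C) (arr C) (src C) (tgt C) (ide C) (seq C) (tenO M) (tenA M) (unO M) (symm M)"
    and a: "\<And>X Y Z. \<lbrakk>X \<in> obj C; Y \<in> obj C; Z \<in> obj C\<rbrakk> \<Longrightarrow> asc M X Y Z
      = ide C (tenO M X (tenO M Y Z))"
    and l: "\<And>X. X \<in> obj C \<Longrightarrow> lun M X = ide C X"
    and r: "\<And>X. X \<in> obj C \<Longrightarrow> run M X = ide C X"
  shows "strict_sym_monoidal_category C M"
proof -
  interpret s: ssm "obj C" "arr C" "src C" "tgt C" "ide C" "seq C" "tenO M" "tenA M" "unO M"
    "symm M" by fact
  interpret category C using category_iff_scat s.scat_axioms by blast
  show ?thesis
  proof unfold_locales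
    fix X Y Z assume X [simp]: "X \<in> obj C" "Y \<in> obj C" "Z \<in> obj C"
    show "seq C (seq C (asc M X Y Z) (symm M X (tenO M Y Z))) (asc M Y Z X)
      = seq C (seq C (tenA M (symm M X Y) (ide C Z)) (asc M Y X Z)) (tenA M (ide C Y)
        (symm M X Z))"
      using s.sy_hex [of X Y Z] by (simp add: a)
  qed (auto simp: a l r in_hom_iff s.sy_nat iso_ide is_ide_ide intro: s.sy_nat')
qed

lemma mid4_strict:
  assumes "strict_sym_monoidal_category C M" and X: "X \<in> obj C" "Y \<in> obj C" "Z \<in> obj C"
    "W \<in> obj C"
  shows "mid4 C M X Y Z W = tenA M (ide C X) (tenA M (symm M Y Z) (ide C W))"
proof -
  interpret strict_sym_monoidal_category C M by fact
  note st = ssm_of_strict [OF assms(1)]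
  interpret s: ssm "obj C" "arr C" "src C" "tgt C" "ide C" "seq C" "tenO M" "tenA M" "unO M"
    "symm M" by (fact st)
  show ?thesis using X by (simp add: mid4_def st inv_arr_ide)
qed

text \<open>The work lies in \<open>nab_incl\<close>: expand \<open>nab\<close> at the sum by the
  coherence axiom, let the middle symmetry exchange the two arrows \<open>bng\<close>, and apply the
  unit laws of X and Y side by side.\<close>

lemma sfc_of_fc_category:
  assumes "strict_sym_monoidal_category C M" "fc_category C M nb bn"
  shows "sfc (obj C) (arr C) (src C) (tgt C) (ide C) (seq C) (tenO M) (tenA M) (unO M) (symm M) nb
    bn"
proof -
  interpret strict_sym_monoidal_category C M by fact
  interpret f: fc_category C M nb bn by fact
  note st = ssm_of_strict [OF assms(1)]
  interpret s: ssm "obj C" "arr C" "src C" "tgt C" "ide C" "seq C" "tenO M" "tenA M" "unO M"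
    "symm M" by (fact st)
  have n: "nb X \<in> arr C" "src C (nb X) = tenO M X X" "tgt C (nb X) = X" if "X \<in> obj C" for X
    using f.nab_hom [OF that] by (auto simp: in_hom_iff)
  have b: "bn X \<in> arr C" "src C (bn X) = unO M" "tgt C (bn X) = X" if "X \<in> obj C" for X
    using f.bng_hom [OF that] by (auto simp: in_hom_iff)
  have lu: "seq C (tenA M (bn X) (ide C X)) (nb X) = ide C X" if "X \<in> obj C" for X
    using f.nab_lunit [OF that] that by (simp add: st)
  have ru: "seq C (tenA M (ide C X) (bn X)) (nb X) = ide C X" if "X \<in> obj C" for X
    using f.nab_runit [OF that] that by (simp add: st)
  have bt: "bn (tenO M X Y) = tenA M (bn X) (bn Y)" if "X \<in> obj C" "Y \<in> obj C" for X Y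
    using f.bng_ten [OF that] that by (simp add: st inv_arr_ide b)
  have bnat: "seq C (bn (src C g)) g = bn (tgt C g)" if "g \<in> arr C" for g
    using f.bng_nat [of g "src C g" "tgt C g"] that by (simp add: in_hom_iff)
  show ?thesis
  proof unfold_locales
    fix X Y assume X [simp]: "X \<in> obj C" "Y \<in> obj C"
    note [simp] = n b
    have "tenA M (ide C X) (tenA M (bn (tenO M Y X)) (ide C Y))
      = tenA M (ide C X) (tenA M (tenA M (bn Y) (bn X)) (ide C Y))"
      by (simp add: bt)
    also have "seq C \<dots> (nb (tenO M X Y)) =
      seq C (tenA M (ide C X) (tenA M (seq C (tenA M (bn Y) (bn X)) (symm M Y X)) (ide C Y)))
        (tenA M (nb X) (nb Y))"
      by (simp add: f.nab_ten mid4_strict assms(1) del: s.tA_assoc)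
    also have "seq C (tenA M (bn Y) (bn X)) (symm M Y X) = tenA M (bn X) (bn Y)"
      using s.sy_nat [of "bn Y" "bn X"] by simp
    also have "tenA M (ide C X) (tenA M (tenA M (bn X) (bn Y)) (ide C Y)) =
       tenA M (tenA M (ide C X) (bn X)) (tenA M (bn Y) (ide C Y))" by simp
    also have "seq C \<dots> (tenA M (nb X) (nb Y)) = ide C (tenO M X Y)"
      by (subst s.interchange) (simp_all del: s.tA_assoc add: lu ru)
    finally show "seq C (tenA M (ide C X) (tenA M (bn (tenO M Y X)) (ide C Y))) (nb (tenO M X Y))
      = ide C (tenO M X Y)" .
  next
    fix g assume "g \<in> arr C"
    then show "seq C (nb (src C g)) g = seq C (tenA M g g) (nb (tgt C g))"
      using f.nab_nat [of g "src C g" "tgt C g"] by (simp add: in_hom_iff)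
  qed (auto simp: n b lu ru bnat f.bng_un)
qed

lemma fc_category_of_sfc:
  assumes "strict_sym_monoidal_category C M"
    and "sfc (obj C) (arr C) (src C) (tgt C) (ide C) (seq C) (tenO M) (tenA M) (unO M) (symm M) nb
      bn"
  shows "fc_category C M nb bn"
proof -
  interpret strict_sym_monoidal_category C M by fact
  interpret s: sfc "obj C" "arr C" "src C" "tgt C" "ide C" "seq C" "tenO M" "tenA M" "unO M"
    "symm M" nb bn by fact
  note st = ssm_of_strict [OF assms(1)]
  have un: "nb (unO M) = ide C (unO M)" by (rule s.ext0) auto
  show ?thesis
    by unfold_locales (auto simp: st inv_arr_ide in_hom_iff s.nab_assoc s.nab_lun s.nab_run
      s.nab_comm
        s.nab_natural s.nab_tO mid4_strict [OF assms(1)] s.bng_tO un)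
qed

locale scd = ssm Ob Ar src tgt ide seq tO tA un sy
  for Ob :: "'o set" and Ar :: "'a set" and src tgt :: "'a \<Rightarrow> 'o" and ide :: "'o \<Rightarrow> 'a"
    and seq :: "'a \<Rightarrow> 'a \<Rightarrow> 'a" (infixr "\<cdot>" 55)
    and tO :: "'o \<Rightarrow> 'o \<Rightarrow> 'o" (infixr "\<^bold>+" 65)
    and tA :: "'a \<Rightarrow> 'a \<Rightarrow> 'a" (infixr "\<^bold>\<oplus>" 65)
    and un :: 'o and sy :: "'o \<Rightarrow> 'o \<Rightarrow> 'a" +
  fixes copy disc :: "'o \<Rightarrow> 'a"
  assumes copy_type [simp]: "X \<in> Ob \<Longrightarrow> copy X \<in> Ar" "X \<in> Ob \<Longrightarrow> src (copy X) = X" "X \<in> Ob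
    \<Longrightarrow> tgt (copy X) = X \<^bold>+ X"
    and disc_type [simp]: "X \<in> Ob \<Longrightarrow> disc X \<in> Ar" "X \<in> Ob \<Longrightarrow> src (disc X) = X" "X \<in> Ob
      \<Longrightarrow> tgt (disc X) = un"
    and coassoc: "X \<in> Ob \<Longrightarrow> copy X \<cdot> (copy X \<^bold>\<oplus> ide X) = copy X \<cdot> (ide X \<^bold>\<oplus> copy X)"
    and lcounit: "X \<in> Ob \<Longrightarrow> copy X \<cdot> (disc X \<^bold>\<oplus> ide X) = ide X"
    and rcounit: "X \<in> Ob \<Longrightarrow> copy X \<cdot> (ide X \<^bold>\<oplus> disc X) = ide X"
    and cocomm: "X \<in> Ob \<Longrightarrow> copy X \<cdot> sy X X = copy X"
    and copy_tO: "\<lbrakk>X \<in> Ob; Y \<in> Ob\<rbrakk> \<Longrightarrow> copy (X \<^bold>+ Y) = (copy X \<^bold>\<oplus> copy Y)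
      \<cdot> (ide X \<^bold>\<oplus> sy X Y \<^bold>\<oplus> ide Y)"
    and disc_tO: "\<lbrakk>X \<in> Ob; Y \<in> Ob\<rbrakk> \<Longrightarrow> disc (X \<^bold>+ Y) = disc X \<^bold>\<oplus> disc Y"
    and copy_unit [simp]: "copy un = ide un"
    and disc_unit [simp]: "disc un = ide un"

lemma scd_of_cd_category:
  assumes "strict_sym_monoidal_category C M" "cd_category C M cpy dsc"
  shows "scd (obj C) (arr C) (src C) (tgt C) (ide C) (seq C) (tenO M) (tenA M) (unO M) (symm M)
    cpy dsc"
proof -
  interpret strict_sym_monoidal_category C M by fact
  interpret f: cd_category C M cpy dsc by fact
  note st = ssm_of_strict [OF assms(1)]
  interpret s: ssm "obj C" "arr C" "src C" "tgt C" "ide C" "seq C" "tenO M" "tenA M" "unO M"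
    "symm M" by (fact st)
  have n: "cpy X \<in> arr C" "src C (cpy X) = X" "tgt C (cpy X) = tenO M X X" if "X \<in> obj C" for X
    using f.copy_hom [OF that] by (auto simp: in_hom_iff)
  have b: "dsc X \<in> arr C" "src C (dsc X) = X" "tgt C (dsc X) = unO M" if "X \<in> obj C" for X
    using f.disc_hom [OF that] by (auto simp: in_hom_iff)
  show ?thesis
  proof unfold_locales
    fix X assume X [simp]: "X \<in> obj C"
    note [simp] = n b
    show "seq C (cpy X) (tenA M (cpy X) (ide C X)) = seq C (cpy X) (tenA M (ide C X) (cpy X))"
      using f.copy_coassoc [of X] by (simp add: st)
    show "seq C (cpy X) (tenA M (dsc X) (ide C X)) = ide C X"
      using f.copy_lcounit [of X] by (simp add: st)
    show "seq C (cpy X) (tenA M (ide C X) (dsc X)) = ide C X"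
      using f.copy_rcounit [of X] by (simp add: st)
  qed (auto simp: n b f.copy_cocomm f.copy_ten f.disc_ten f.copy_un f.disc_un st mid4_strict
    [OF assms(1)] inv_arr_ide)
qed

lemma cd_category_of_scd:
  assumes "strict_sym_monoidal_category C M"
    and "scd (obj C) (arr C) (src C) (tgt C) (ide C) (seq C) (tenO M) (tenA M) (unO M) (symm M)
      cpy dsc"
  shows "cd_category C M cpy dsc"
proof -
  interpret strict_sym_monoidal_category C M by fact
  interpret s: scd "obj C" "arr C" "src C" "tgt C" "ide C" "seq C" "tenO M" "tenA M" "unO M"
    "symm M" cpy dsc by fact
  note st = ssm_of_strict [OF assms(1)]
  show ?thesis
    by unfold_locales (auto simp: st inv_arr_ide in_hom_iff s.coassoc s.lcounit s.rcounit s.cocomm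
        s.copy_tO s.disc_tO mid4_strict [OF assms(1)])
qed

section \<open>Translation between rig categories and \<open>srig\<close>\<close>

abbreviation srig_of :: "('o, 'a, 'z) fccd_rig_scheme \<Rightarrow> ('o \<Rightarrow> 'o \<Rightarrow> 'o \<Rightarrow> 'a) \<Rightarrow> bool" where
  "srig_of R \<equiv> srig (obj R) (arr R) (src R) (tgt R) (ide R) (seq R)
     (tenO (add R)) (tenA (add R)) (unO (add R)) (symm (add R)) (nab R) (bng R)
     (tenO (mul R)) (tenA (mul R)) (unO (mul R)) (symm (mul R)) (dl R)"

text \<open>Laplaza's unit axioms make \<open>dl\<close> trivial when a summand is zero. Naturality
  of \<open>dl\<close> at \<open>bng\<close> into the other summand then gives its values on the two
  injections.\<close>

lemma srig_of_rig:
  fixes R :: "('o, 'a, 'z) fccd_rig_scheme" (structure)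
  assumes "right_strict_rig_category R" "fc_category R (add R) (nab R) (bng R)"
  shows "srig_of R (\<lambda>X Y Z. inv_arr R (dl R X Y Z))"
proof -
  interpret right_strict_rig_category R by fact
  note sa = ssm_of_strict [OF add.strict_sym_monoidal_category_axioms]
  note sm = ssm_of_strict [OF mul.strict_sym_monoidal_category_axioms]
  interpret a: sfc "obj R" "arr R" "src R" "tgt R" "ide R" "seq R"
     "tenO (add R)" "tenA (add R)" "unO (add R)" "symm (add R)" "nab R" "bng R"
    by (rule sfc_of_fc_category [OF add.strict_sym_monoidal_category_axioms assms(2)])
  interpret m: ssm "obj R" "arr R" "src R" "tgt R" "ide R" "seq R"
     "tenO (mul R)" "tenA (mul R)" "unO (mul R)" "symm (mul R)"
    by (rule sm)
  have lz: "lz R X = \<iota> \<zero> \<and> \<zero> \<otimes> X = \<zero>" if "X \<in> obj R" for X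
    using add.is_ide_eq [OF lz_ide lz_hom] that by metis
  have rz: "rz R X = \<iota> \<zero> \<and> X \<otimes> \<zero> = \<zero>" if "X \<in> obj R" for X
    using add.is_ide_eq [OF rz_ide rz_hom] that by metis
  have dr: "dr R X Y Z = \<iota> (X \<otimes> Z \<oplus> Y \<otimes> Z) \<and> (X \<oplus> Y) \<otimes> Z = X \<otimes> Z \<oplus> Y \<otimes> Z"
    if "X \<in> obj R" "Y \<in> obj R" "Z \<in> obj R" for X Y Z
    using add.is_ide_eq [OF dr_ide dr_hom] that by metis
  have d: "dl R X Y Z \<in> arr R" "src R (dl R X Y Z) = X \<otimes> (Y \<oplus> Z)" "tgt R (dl R X Y Z)
    = X \<otimes> Y \<oplus> X \<otimes> Z"
    if "X \<in> obj R" "Y \<in> obj R" "Z \<in> obj R" for X Y Z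
    using dl_hom [OF that] by (auto simp: in_hom_iff)
  have di: "inverse_arrows R (dl R X Y Z) (inv_arr R (dl R X Y Z))"
    if "X \<in> obj R" "Y \<in> obj R" "Z \<in> obj R" for X Y Z
    using add.iso_inv_arr [OF dl_iso] that by simp
  show ?thesis
  proof unfold_locales
    fix f g h assume "f \<in> arr R" "g \<in> arr R" "h \<in> arr R"
    then show "(f \<boxplus> g) \<boxtimes> h = f \<boxtimes> h \<boxplus> g \<boxtimes> h"
      using dr_nat [of f "src R f" "tgt R f" g "src R g" "tgt R g" h "src R h" "tgt R h"] dr
      by (simp add: in_hom_iff)
  next
    fix X Y Z assume X [simp]: "X \<in> obj R" "Y \<in> obj R" "Z \<in> obj R"
    note [simp] = d
    have 1: "dl R X Y \<zero> = \<iota> (X \<otimes> Y)" using laplaza_21 [of X Y] by (simp add: sa rz)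
    have 2: "dl R X \<zero> Z = \<iota> (X \<otimes> Z)" using laplaza_19 [of X Z] by (simp add: sa rz)
    have 3: "\<iota> X \<boxtimes> bng R Y = bng R (X \<otimes> Y)" "\<iota> X \<boxtimes> bng R Z = bng R (X \<otimes> Z)"
      by (rule a.ext0; simp add: rz)+
    show "(\<iota> X \<boxtimes> a.inl Y Z) \<Zsemi> dl R X Y Z = a.inl (X \<otimes> Y) (X \<otimes> Z)"
      using dl_nat [of "\<iota> X" X X "\<iota> Y" Y Y "bng R Z" \<zero> Z] by (simp add: in_hom_iff 1 3 a.inl_def
        rz)
    show "(\<iota> X \<boxtimes> a.inr Y Z) \<Zsemi> dl R X Y Z = a.inr (X \<otimes> Y) (X \<otimes> Z)"
      using dl_nat [of "\<iota> X" X X "bng R Y" \<zero> Y "\<iota> Z" Z Z ] by (simp add: in_hom_iff 2 3 a.inr_def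
        rz)
  qed (use di in \<open>auto simp: lz rz dr d inverse_arrows_def in_hom_iff\<close>)
qed

lemma rig_of_srig:
  fixes R :: "('o, 'a, 'z) fccd_rig_scheme" (structure)
  assumes "srig_of R dli"
    and a: "strict_sym_monoidal_category R (add R)"
    and m: "strict_sym_monoidal_category R (mul R)"
    and dr: "\<And>X Y Z. \<lbrakk>X \<in> obj R; Y \<in> obj R; Z \<in> obj R\<rbrakk> \<Longrightarrow> dr R X Y Z = \<iota> ((X \<oplus> Y) \<otimes> Z)"
    and lz: "\<And>X. X \<in> obj R \<Longrightarrow> lz R X = \<iota> \<zero>"
    and rz: "\<And>X. X \<in> obj R \<Longrightarrow> rz R X = \<iota> \<zero>"
  shows "right_strict_rig_category R"
    and "\<lbrakk>X \<in> obj R; Y \<in> obj R; Z \<in> obj R\<rbrakk> \<Longrightarrow> inv_arr R (dl R X Y Z) = dli X Y Z"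
proof -
  interpret s: srig "obj R" "arr R" "src R" "tgt R" "ide R" "seq R"
     "tenO (add R)" "tenA (add R)" "unO (add R)" "symm (add R)" "nab R" "bng R"
     "tenO (mul R)" "tenA (mul R)" "unO (mul R)" "symm (mul R)" "dl R" dli by fact
  interpret add: strict_sym_monoidal_category R "add R" by fact
  interpret mul: strict_sym_monoidal_category R "mul R" by fact
  have di: "inverse_arrows R (dl R X Y Z) (dli X Y Z)"
    if "X \<in> obj R" "Y \<in> obj R" "Z \<in> obj R" for X Y Z
    using that by (auto simp: inverse_arrows_def in_hom_iff)
  then show "\<lbrakk>X \<in> obj R; Y \<in> obj R; Z \<in> obj R\<rbrakk> \<Longrightarrow> inv_arr R (dl R X Y Z) = dli X Y Z"
    using add.inv_arr_eq by blast
  note sa = ssm_of_strict [OF a]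
  note sm = ssm_of_strict [OF m]
  have smz: "X \<in> obj R \<Longrightarrow> symm (mul R) X \<zero> = \<iota> \<zero>" for X
    by (rule s.add.ext0) auto
  show "right_strict_rig_category R"
  proof unfold_locales
    fix X Y Z W assume X [simp]: "X \<in> obj R" "Y \<in> obj R" "Z \<in> obj R" "W \<in> obj R"
    show "iso R (dl R X Y Z)" using di unfolding iso_def by force
    show "dl R X Y Z \<Zsemi> symm (add R) (X \<otimes> Y) (X \<otimes> Z) = (\<iota> X \<boxtimes> symm (add R) Y Z) \<Zsemi> dl R X Z Y"
      by (simp add: s.lap1)
    show "symm (mul R) (X \<oplus> Y) Z \<Zsemi> dl R Z X Y = dr R X Y Z
      \<Zsemi> (symm (mul R) X Z \<boxplus> symm (mul R) Y Z)"
      using s.lap2 [of X Y Z] by (simp add: dr)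
    show "dr R X Y Z \<Zsemi> symm (add R) (X \<otimes> Z) (Y \<otimes> Z) = (symm (add R) X Y \<boxtimes> \<iota> Z) \<Zsemi> dr R Y X Z"
      using s.lap3 [of X Y Z] by (simp add: dr)
    show "(\<iota> X \<boxtimes> asc (add R) Y Z W) \<Zsemi> dl R X Y (Z \<oplus> W) \<Zsemi> (\<iota> (X \<otimes> Y) \<boxplus> dl R X Z W)
        = dl R X (Y \<oplus> Z) W \<Zsemi> (dl R X Y Z \<boxplus> \<iota> (X \<otimes> W)) \<Zsemi> asc (add R) (X \<otimes> Y) (X \<otimes> Z) (X \<otimes> W)"
      using s.lap5 [of X Y Z W] by (simp add: sa)
    show "dl R (X \<otimes> Y) Z W \<Zsemi> (asc (mul R) X Y Z \<boxplus> asc (mul R) X Y W)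
        = asc (mul R) X Y (Z \<oplus> W) \<Zsemi> (\<iota> X \<boxtimes> dl R Y Z W) \<Zsemi> dl R X (Y \<otimes> Z) (Y \<otimes> W)"
      by (simp add: sm s.lap6)
    show "asc (mul R) X (Y \<oplus> Z) W \<Zsemi> (\<iota> X \<boxtimes> dr R Y Z W) \<Zsemi> dl R X (Y \<otimes> W) (Z \<otimes> W)
        = (dl R X Y Z \<boxtimes> \<iota> W) \<Zsemi> dr R (X \<otimes> Y) (X \<otimes> Z) W \<Zsemi> (asc (mul R) X Y W \<boxplus> asc (mul R) X Z W)"
      by (simp add: sm dr s.lap8)
    show "dl R (X \<oplus> Y) Z W \<Zsemi> (dr R X Y Z \<boxplus> dr R X Y W)
        = dr R X Y (Z \<oplus> W) \<Zsemi> (dl R X Z W \<boxplus> dl R Y Z W)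
          \<Zsemi> mid4 R (add R) (X \<otimes> Z) (X \<otimes> W) (Y \<otimes> Z) (Y \<otimes> W)"
      using s.lap9 [of X Y Z W] by (simp add: dr mid4_strict [OF a])
  next
    fix f X X' g Y Y' h Z Z' assume "f \<in> hom R X X'" "g \<in> hom R Y Y'" "h \<in> hom R Z Z'"
    then show "(f \<boxtimes> (g \<boxplus> h)) \<Zsemi> dl R X' Y' Z' = dl R X Y Z \<Zsemi> (f \<boxtimes> g \<boxplus> f \<boxtimes> h)"
      using s.dl_natural [of f g h] by (auto simp: in_hom_iff)
  \<comment> \<open>In the other coherence axioms every arrow is an identity once \<open>dl\<close>
    is evaluated at zero or at one.\<close>
  qed (auto simp: dr lz rz in_hom_iff add.iso_ide add.is_ide_ide sa sm smz)
qed

lemma fccd_rig_of_srig: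
  fixes R :: "('o, 'a, 'z) fccd_rig_scheme" (structure)
  assumes s: "srig_of R dli"
    and a: "strict_sym_monoidal_category R (add R)"
    and m: "strict_sym_monoidal_category R (mul R)"
    and dr: "\<And>X Y Z. \<lbrakk>X \<in> obj R; Y \<in> obj R; Z \<in> obj R\<rbrakk> \<Longrightarrow> dr R X Y Z = \<iota> ((X \<oplus> Y) \<otimes> Z)"
    and lz: "\<And>X. X \<in> obj R \<Longrightarrow> lz R X = \<iota> \<zero>"
    and rz: "\<And>X. X \<in> obj R \<Longrightarrow> rz R X = \<iota> \<zero>"
    and cd: "scd (obj R) (arr R) (src R) (tgt R) (ide R) (seq R) (tenO (mul R)) (tenA (mul R))
      (unO (mul R)) (symm (mul R)) (copy R) (disc R)"
    and disc_add: "\<And>X Y. \<lbrakk>X \<in> obj R; Y \<in> obj R\<rbrakk> \<Longrightarrow> disc R (X \<oplus> Y) = (disc R X \<boxplus> disc R Y)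
      \<Zsemi> nab R \<one>"
    and copy_add: "\<And>X Y. \<lbrakk>X \<in> obj R; Y \<in> obj R\<rbrakk> \<Longrightarrow> copy R (X \<oplus> Y)
      = ((copy R X \<boxplus> bng R (X \<otimes> Y)) \<boxplus> (bng R (Y \<otimes> X) \<boxplus> copy R Y)) \<Zsemi> (dli X X Y \<boxplus> dli Y X Y)"
  shows "fccd_rig_category R"
proof -
  interpret s: srig "obj R" "arr R" "src R" "tgt R" "ide R" "seq R"
     "tenO (add R)" "tenA (add R)" "unO (add R)" "symm (add R)" "nab R" "bng R"
     "tenO (mul R)" "tenA (mul R)" "unO (mul R)" "symm (mul R)" "dl R" dli by fact
  note rs = rig_of_srig [OF s a m dr lz rz]
  interpret right_strict_rig_category R by (rule rs)
  interpret fc: fc_category R "add R" "nab R" "bng R"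
    by (rule fc_category_of_sfc [OF a s.add.sfc_axioms])
  interpret cd: cd_category R "mul R" "copy R" "disc R"
    by (rule cd_category_of_scd [OF m cd])
  interpret scd "obj R" "arr R" "src R" "tgt R" "ide R" "seq R" "tenO (mul R)" "tenA (mul R)"
    "unO (mul R)" "symm (mul R)" "copy R" "disc R"
    by fact
  note sa = ssm_of_strict [OF a]
  show ?thesis
  proof unfold_locales
    fix X Y assume X [simp]: "X \<in> obj R" "Y \<in> obj R"
    show "copy R (X \<oplus> Y) =
        (inv_arr R (run (add R) X) \<boxplus> inv_arr R (lun (add R) Y))
        \<Zsemi> ((copy R X \<boxplus> bng R (X \<otimes> Y)) \<boxplus> (bng R (Y \<otimes> X) \<boxplus> copy R Y))
        \<Zsemi> (inv_arr R (dl R X X Y) \<boxplus> inv_arr R (dl R Y X Y))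
        \<Zsemi> inv_arr R (dr R X Y (X \<oplus> Y))"
      using copy_add [of X Y] by (simp add: rs sa dr add.inv_arr_ide)
    show "disc R (X \<oplus> Y) = (disc R X \<boxplus> disc R Y) \<Zsemi> nab R \<one>" by (simp add: disc_add)
  qed
qed

section \<open>Monoidal categories with words as objects\<close>

text \<open>The letters are the sorts for circuits, and the monomials for tapes under the sum.\<close>

locale words = stm "lists L" Ar src tgt ide seq "(@)" tA "[]"
  for L :: "'l set" and Ar :: "'a set" and src tgt :: "'a \<Rightarrow> 'l list" and ide :: "'l list \<Rightarrow> 'a"
    and seq :: "'a \<Rightarrow> 'a \<Rightarrow> 'a" (infixr "\<cdot>" 55)
    and tA :: "'a \<Rightarrow> 'a \<Rightarrow> 'a" (infixr "\<^bold>\<oplus>" 65) +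
  fixes s :: "'l \<Rightarrow> 'l \<Rightarrow> 'a" and wsy1 :: "'l \<Rightarrow> 'l list \<Rightarrow> 'a" and wsy :: "'l list \<Rightarrow> 'l list \<Rightarrow> 'a"
  assumes s_type [simp]: "\<lbrakk>A \<in> L; B \<in> L\<rbrakk> \<Longrightarrow> s A B \<in> Ar" "\<lbrakk>A \<in> L; B \<in> L\<rbrakk> \<Longrightarrow> src (s A B) = [A, B]"
      "\<lbrakk>A \<in> L; B \<in> L\<rbrakk> \<Longrightarrow> tgt (s A B) = [B, A]"
    and s_s [simp]: "\<lbrakk>A \<in> L; B \<in> L\<rbrakk> \<Longrightarrow> s A B \<cdot> s B A = ide [A, B]"
    and wsy1_Nil: "A \<in> L \<Longrightarrow> wsy1 A [] = ide [A]"
    and wsy1_Cons: "\<lbrakk>A \<in> L; B \<in> L; V \<in> lists L\<rbrakk> \<Longrightarrow> wsy1 A (B # V) = (s A B \<^bold>\<oplus> ide V)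
      \<cdot> (ide [B] \<^bold>\<oplus> wsy1 A V)"
    and wsy_Nil: "V \<in> lists L \<Longrightarrow> wsy [] V = ide V"
    and wsy_Cons: "\<lbrakk>A \<in> L; U \<in> lists L; V \<in> lists L\<rbrakk>
      \<Longrightarrow> wsy (A # U) V = (ide [A] \<^bold>\<oplus> wsy U V) \<cdot> (wsy1 A V \<^bold>\<oplus> ide U)"
begin

lemma wsy1_type [simp]: "\<lbrakk>A \<in> L; V \<in> lists L\<rbrakk> \<Longrightarrow> wsy1 A V \<in> Ar \<and> src (wsy1 A V) = A # V
  \<and> tgt (wsy1 A V) = V @ [A]"
  by (induct V) (auto simp: wsy1_Nil wsy1_Cons)

lemma wsy_type [simp]: "\<lbrakk>U \<in> lists L; V \<in> lists L\<rbrakk> \<Longrightarrow> wsy U V \<in> Ar \<and> src (wsy U V) = U @ V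
  \<and> tgt (wsy U V) = V @ U"
  by (induct U) (auto simp: wsy_Nil wsy_Cons)

lemma wsy1_hex: "\<lbrakk>A \<in> L; V \<in> lists L; W \<in> lists L\<rbrakk>
  \<Longrightarrow> wsy1 A (V @ W) = (wsy1 A V \<^bold>\<oplus> ide W) \<cdot> (ide V \<^bold>\<oplus> wsy1 A W)"
proof (induct V)
  case Nil
  then show ?case by (simp add: wsy1_Nil)
next
  case (Cons B V)
  then show ?case by (simp add: wsy1_Cons whisk del: interchange)
qed

text \<open>The new letter crosses V while the rest of U crosses W; these crossings act on disjoint
  strands and may be exchanged.\<close>

lemma wsy_hex: "\<lbrakk>U \<in> lists L; V \<in> lists L; W \<in> lists L\<rbrakk>
  \<Longrightarrow> wsy U (V @ W) = (wsy U V \<^bold>\<oplus> ide W) \<cdot> (ide V \<^bold>\<oplus> wsy U W)"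
proof (induct U)
  case Nil
  then show ?case by (simp add: wsy_Nil)
next
  case (Cons A U)
  then have [simp]: "A \<in> L" "U \<in> lists L" "V \<in> lists L" "W \<in> lists L" by auto
  have "(ide (A # V) \<^bold>\<oplus> wsy U W) \<cdot> (wsy1 A V \<^bold>\<oplus> ide (W @ U)) = (wsy1 A V \<^bold>\<oplus> ide (U @ W))
    \<cdot> (ide (V @ [A]) \<^bold>\<oplus> wsy U W)"
    by (rule slide) auto
  note * = this [THEN seq_eq]
  show ?case using Cons by (simp add: wsy_Cons wsy1_hex whisk * del: interchange interchange_seq)
qed

lemma wsy_single: "\<lbrakk>A \<in> L; V \<in> lists L\<rbrakk> \<Longrightarrow> wsy [A] V = wsy1 A V"
  by (simp add: wsy_Cons wsy_Nil)

lemma wsy1_single: "\<lbrakk>A \<in> L; B \<in> L\<rbrakk> \<Longrightarrow> wsy1 A [B] = s A B"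
  by (simp add: wsy1_Cons wsy1_Nil)

lemma wsy1_inv: "\<lbrakk>A \<in> L; V \<in> lists L\<rbrakk> \<Longrightarrow> wsy1 A V \<cdot> wsy V [A] = ide (A # V) \<and> wsy V [A] \<cdot> wsy1 A V
  = ide (V @ [A])"
proof (induct V)
  case Nil
  then show ?case by (simp add: wsy1_Nil wsy_Nil)
next
  case (Cons B V)
  then have [simp]: "A \<in> L" "B \<in> L" "V \<in> lists L" by auto
  have a: "A # B # V = [A, B] @ V" by simp
  have "wsy1 A V \<cdot> wsy V [A] = ide (A # V)" "wsy V [A] \<cdot> wsy1 A V = ide (V @ [A])" using Cons
    by auto
  then show ?case
    by (simp add: wsy1_Cons wsy_Cons wsy1_Nil)
qed

lemma wsy_wsy: "\<lbrakk>U \<in> lists L; V \<in> lists L\<rbrakk> \<Longrightarrow> wsy U V \<cdot> wsy V U = ide (U @ V)"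
proof (induct U)
  case Nil
  have "wsy V [] = ide V" using Nil(2) by (induct V) (simp_all add: wsy_Nil wsy_Cons wsy1_Nil)
  then show ?case using Nil by (simp add: wsy_Nil)
next
  case (Cons A U)
  then have [simp]: "A \<in> L" "U \<in> lists L" "V \<in> lists L" by auto
  have "wsy V (A # U) = (wsy V [A] \<^bold>\<oplus> ide U) \<cdot> (ide [A] \<^bold>\<oplus> wsy V U)"
    using wsy_hex [of V "[A]" U] by simp
  then show ?case using Cons wsy1_inv [of A V] by (simp add: wsy_Cons)
qed

end

text \<open>Naturality is assumed in the first variable only, which is the form of the symmetry
  axiom for circuits and for tapes. The second variable follows by conjugation with the inverse
  symmetry (\<open>wsy_natural2\<close>).\<close>

locale words_natural = words L Ar src tgt ide seq tA s wsy1 wsy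
  for L :: "'l set" and Ar :: "'a set" and src tgt :: "'a \<Rightarrow> 'l list" and ide :: "'l list \<Rightarrow> 'a"
    and seq :: "'a \<Rightarrow> 'a \<Rightarrow> 'a" (infixr "\<cdot>" 55)
    and tA :: "'a \<Rightarrow> 'a \<Rightarrow> 'a" (infixr "\<^bold>\<oplus>" 65)
    and s :: "'l \<Rightarrow> 'l \<Rightarrow> 'a" and wsy1 :: "'l \<Rightarrow> 'l list \<Rightarrow> 'a" and wsy :: "'l list \<Rightarrow> 'l list \<Rightarrow> 'a" +
  assumes wsy_natural1: "\<lbrakk>f \<in> Ar; W \<in> lists L\<rbrakk>
    \<Longrightarrow> (f \<^bold>\<oplus> ide W) \<cdot> wsy (tgt f) W = wsy (src f) W \<cdot> (ide W \<^bold>\<oplus> f)"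
begin

lemma wsy_natural2: assumes f: "f \<in> Ar" "W \<in> lists L"
  shows "(ide W \<^bold>\<oplus> f) \<cdot> wsy W (tgt f) = wsy W (src f) \<cdot> (f \<^bold>\<oplus> ide W)"
proof -
  have [simp]: "src f \<in> lists L" "tgt f \<in> lists L" using f src_Ob tgt_Ob by blast+
  have "wsy W (src f) \<cdot> (f \<^bold>\<oplus> ide W) = (wsy W (src f) \<cdot> (f \<^bold>\<oplus> ide W)) \<cdot> (wsy (tgt f) W
    \<cdot> wsy W (tgt f))"
    using f by (simp add: wsy_wsy)
  also have "\<dots> = wsy W (src f) \<cdot> ((f \<^bold>\<oplus> ide W) \<cdot> wsy (tgt f) W) \<cdot> wsy W (tgt f)"
    using f by simp
  also have "\<dots> = (wsy W (src f) \<cdot> wsy (src f) W) \<cdot> (ide W \<^bold>\<oplus> f) \<cdot> wsy W (tgt f)"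
    unfolding wsy_natural1 [OF f] using f by simp
  finally show ?thesis using f by (simp add: wsy_wsy)
qed

lemma ssm_words: "ssm (lists L) Ar src tgt ide seq (@) tA [] wsy"
proof
  fix f g assume f [simp]: "f \<in> Ar" "g \<in> Ar"
  then have [simp]: "src f \<in> lists L" "tgt f \<in> lists L" "src g \<in> lists L" "tgt g \<in> lists L"
    using src_Ob tgt_Ob by blast+
  have "(f \<^bold>\<oplus> g) = (f \<^bold>\<oplus> ide (src g)) \<cdot> (ide (tgt f) \<^bold>\<oplus> g)" by simp
  also have "\<dots> \<cdot> wsy (tgt f) (tgt g) = (f \<^bold>\<oplus> ide (src g)) \<cdot> wsy (tgt f) (src g)
    \<cdot> (g \<^bold>\<oplus> ide (tgt f))"
    by (simp add: wsy_natural2 del: interchange interchange_seq)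
  also have "\<dots> = ((f \<^bold>\<oplus> ide (src g)) \<cdot> wsy (tgt f) (src g)) \<cdot> (g \<^bold>\<oplus> ide (tgt f))" by simp
  also have "\<dots> = wsy (src f) (src g) \<cdot> (g \<^bold>\<oplus> f)"
    unfolding wsy_natural1 [OF f(1) \<open>src g \<in> lists L\<close>] by simp
  finally show "(f \<^bold>\<oplus> g) \<cdot> wsy (tgt f) (tgt g) = wsy (src f) (src g) \<cdot> (g \<^bold>\<oplus> f)" .
qed (auto simp: wsy_wsy wsy_hex)

end

locale words_cd = words_natural L Ar src tgt ide seq tA s wsy1 wsy
  for L :: "'l set" and Ar :: "'a set" and src tgt :: "'a \<Rightarrow> 'l list" and ide :: "'l list \<Rightarrow> 'a"
    and seq :: "'a \<Rightarrow> 'a \<Rightarrow> 'a" (infixr "\<cdot>" 55)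
    and tA :: "'a \<Rightarrow> 'a \<Rightarrow> 'a" (infixr "\<^bold>\<oplus>" 65)
    and s :: "'l \<Rightarrow> 'l \<Rightarrow> 'a" and wsy1 :: "'l \<Rightarrow> 'l list \<Rightarrow> 'a" and wsy :: "'l list \<Rightarrow> 'l list \<Rightarrow> 'a" +
  fixes c1 d1 :: "'l \<Rightarrow> 'a" and wc wd :: "'l list \<Rightarrow> 'a"
  assumes c1_type [simp]: "A \<in> L \<Longrightarrow> c1 A \<in> Ar" "A \<in> L \<Longrightarrow> src (c1 A) = [A]" "A \<in> L \<Longrightarrow> tgt (c1 A)
    = [A, A]"
    and d1_type [simp]: "A \<in> L \<Longrightarrow> d1 A \<in> Ar" "A \<in> L \<Longrightarrow> src (d1 A) = [A]" "A \<in> L \<Longrightarrow> tgt (d1 A) = []"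
    and c1_coassoc: "A \<in> L \<Longrightarrow> c1 A \<cdot> (c1 A \<^bold>\<oplus> ide [A]) = c1 A \<cdot> (ide [A] \<^bold>\<oplus> c1 A)"
    and c1_lcounit: "A \<in> L \<Longrightarrow> c1 A \<cdot> (d1 A \<^bold>\<oplus> ide [A]) = ide [A]"
    and c1_rcounit: "A \<in> L \<Longrightarrow> c1 A \<cdot> (ide [A] \<^bold>\<oplus> d1 A) = ide [A]"
    and c1_cocomm: "A \<in> L \<Longrightarrow> c1 A \<cdot> s A A = c1 A"
    and wc_Nil: "wc [] = ide []"
    and wc_Cons: "\<lbrakk>A \<in> L; U \<in> lists L\<rbrakk>
      \<Longrightarrow> wc (A # U) = (c1 A \<^bold>\<oplus> wc U) \<cdot> (ide [A] \<^bold>\<oplus> wsy1 A U \<^bold>\<oplus> ide U)"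
    and wd_Nil: "wd [] = ide []"
    and wd_Cons: "\<lbrakk>A \<in> L; U \<in> lists L\<rbrakk> \<Longrightarrow> wd (A # U) = d1 A \<^bold>\<oplus> wd U"
begin

sublocale S: ssm "lists L" Ar src tgt ide seq "(@)" tA "[]" wsy
  by (rule ssm_words)

lemma wc_type [simp]: "U \<in> lists L \<Longrightarrow> wc U \<in> Ar \<and> src (wc U) = U \<and> tgt (wc U) = U @ U"
  by (induct U) (auto simp: wc_Nil wc_Cons)

lemma wd_type [simp]: "U \<in> lists L \<Longrightarrow> wd U \<in> Ar \<and> src (wd U) = U \<and> tgt (wd U) = []"
  by (induct U) (auto simp: wd_Nil wd_Cons)

text \<open>Each step is \<open>comonoid_product\<close> for the first letter and the remaining
  word.\<close>

lemma wc_comonoid: "U \<in> lists L \<Longrightarrow> wc U \<cdot> (wc U \<^bold>\<oplus> ide U) = wc U \<cdot> (ide U \<^bold>\<oplus> wc U)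
  \<and> wc U \<cdot> (wd U \<^bold>\<oplus> ide U) = ide U \<and> wc U \<cdot> (ide U \<^bold>\<oplus> wd U) = ide U \<and> wc U \<cdot> wsy U U = wc U"
proof (induct U)
  case Nil
  then show ?case by (simp add: wc_Nil wd_Nil wsy_Nil)
next
  case (Cons A U)
  then have AU: "A \<in> L" "U \<in> lists L" by auto
  have W: "A # U = [A] @ U" by simp
  have "wc ([A] @ U) = (c1 A \<^bold>\<oplus> wc U) \<cdot> (ide [A] \<^bold>\<oplus> wsy [A] U \<^bold>\<oplus> ide U)" "wd ([A] @ U)
    = d1 A \<^bold>\<oplus> wd U"
    using AU by (simp_all add: wc_Cons wd_Cons wsy_single)
  note p = this AU c1_coassoc [OF AU(1)] c1_lcounit [OF AU(1)] c1_rcounit [OF AU(1)]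
  have p1: "c1 A \<cdot> wsy [A] [A] = c1 A" using AU by (simp add: c1_cocomm wsy_single wsy1_single)
  have p2: "wc U \<cdot> (wc U \<^bold>\<oplus> ide U) = wc U \<cdot> (ide U \<^bold>\<oplus> wc U)" "wc U \<cdot> (wd U \<^bold>\<oplus> ide U) = ide U"
    "wc U \<cdot> (ide U \<^bold>\<oplus> wd U) = ide U" "wc U \<cdot> wsy U U = wc U" using Cons by auto
  note q = S.comonoid_product [of "[A]" "c1 A" "d1 A" U "wc U" "wd U" "wc ([A] @ U)"
    "wd ([A] @ U)"]
  show ?case unfolding W
  proof (intro conjI)
    show "wc ([A] @ U) \<cdot> (wc ([A] @ U) \<^bold>\<oplus> ide ([A] @ U)) = wc ([A] @ U)
      \<cdot> (ide ([A] @ U) \<^bold>\<oplus> wc ([A] @ U))"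
      by (rule q(1); (fact p p1 p2 | simp add: AU))
    show "wc ([A] @ U) \<cdot> (wd ([A] @ U) \<^bold>\<oplus> ide ([A] @ U)) = ide ([A] @ U)"
      by (rule q(2); (fact p p1 p2 | simp add: AU))
    show "wc ([A] @ U) \<cdot> (ide ([A] @ U) \<^bold>\<oplus> wd ([A] @ U)) = ide ([A] @ U)"
      by (rule q(3); (fact p p1 p2 | simp add: AU))
    show "wc ([A] @ U) \<cdot> wsy ([A] @ U) ([A] @ U) = wc ([A] @ U)"
      by (rule q(4); (fact p p1 p2 | simp add: AU))
  qed
qed

lemma wd_append: "\<lbrakk>U \<in> lists L; V \<in> lists L\<rbrakk> \<Longrightarrow> wd (U @ V) = wd U \<^bold>\<oplus> wd V"
  by (induct U) (auto simp: wd_Nil wd_Cons)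

text \<open>The recursion peels off one letter. Splitting a word anywhere else is possible because
  the crossing of that letter with one copy of U and the crossing of the other copy of U with V move
  disjoint strands.\<close>

lemma wc_append: "\<lbrakk>U \<in> lists L; V \<in> lists L\<rbrakk> \<Longrightarrow> wc (U @ V) = (wc U \<^bold>\<oplus> wc V)
  \<cdot> (ide U \<^bold>\<oplus> wsy U V \<^bold>\<oplus> ide V)"
proof (induct U)
  case Nil
  then show ?case by (simp add: wc_Nil wsy_Nil)
next
  case (Cons A U)
  then have [simp]: "A \<in> L" "U \<in> lists L" "V \<in> lists L" by auto
  have "(ide (A # A # U) \<^bold>\<oplus> (wsy U V \<^bold>\<oplus> ide V)) \<cdot> ((ide [A] \<^bold>\<oplus> wsy1 A U) \<^bold>\<oplus> ide (V @ U @ V))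
     = ((ide [A] \<^bold>\<oplus> wsy1 A U) \<^bold>\<oplus> ide (U @ V @ V)) \<cdot> (ide (A # U @ [A]) \<^bold>\<oplus> (wsy U V \<^bold>\<oplus> ide V))"
    by (rule slide) auto
  then have *: "(ide (A # A # U) \<^bold>\<oplus> wsy U V \<^bold>\<oplus> ide V) \<cdot> (ide [A] \<^bold>\<oplus> wsy1 A U \<^bold>\<oplus> ide (V @ U @ V))
     = (ide [A] \<^bold>\<oplus> wsy1 A U \<^bold>\<oplus> ide (U @ V @ V)) \<cdot> (ide (A # U @ [A]) \<^bold>\<oplus> wsy U V \<^bold>\<oplus> ide V)"
    by (simp del: interchange)
  have "wc ((A # U) @ V) = (c1 A \<^bold>\<oplus> ((wc U \<^bold>\<oplus> wc V) \<cdot> (ide U \<^bold>\<oplus> wsy U V \<^bold>\<oplus> ide V)))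
    \<cdot> (ide [A] \<^bold>\<oplus> wsy1 A (U @ V) \<^bold>\<oplus> ide (U @ V))"
    using Cons.hyps by (simp add: wc_Cons)
  also have "c1 A \<^bold>\<oplus> ((wc U \<^bold>\<oplus> wc V) \<cdot> (ide U \<^bold>\<oplus> wsy U V \<^bold>\<oplus> ide V)) = (c1 A \<^bold>\<oplus> wc U \<^bold>\<oplus> wc V)
    \<cdot> (ide [A, A] \<^bold>\<oplus> ide U \<^bold>\<oplus> wsy U V \<^bold>\<oplus> ide V)"
    by (simp del: tA_assoc)
  also have "\<dots> \<cdot> (ide [A] \<^bold>\<oplus> wsy1 A (U @ V) \<^bold>\<oplus> ide (U @ V))
    = (c1 A \<^bold>\<oplus> wc U \<^bold>\<oplus> wc V) \<cdot> (ide [A] \<^bold>\<oplus> wsy1 A U \<^bold>\<oplus> ide (U @ V @ V))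
      \<cdot> (ide (A # U @ [A]) \<^bold>\<oplus> wsy U V \<^bold>\<oplus> ide V) \<cdot> (ide (A # U) \<^bold>\<oplus> wsy1 A V \<^bold>\<oplus> ide (U @ V))"
    by (simp add: whisk wsy1_hex * [THEN seq_eq] del: interchange interchange_seq)
  also have "\<dots> = (((c1 A \<^bold>\<oplus> wc U) \<^bold>\<oplus> wc V) \<cdot> ((ide [A] \<^bold>\<oplus> wsy1 A U \<^bold>\<oplus> ide U) \<^bold>\<oplus> ide (V @ V)))
    \<cdot> (ide (A # U) \<^bold>\<oplus> wsy (A # U) V \<^bold>\<oplus> ide V)"
    by (simp add: whisk wsy_Cons del: interchange interchange_seq)
  also have "\<dots> = (wc (A # U) \<^bold>\<oplus> wc V) \<cdot> (ide (A # U) \<^bold>\<oplus> wsy (A # U) V \<^bold>\<oplus> ide V)"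
    by (subst interchange) (simp_all add: wc_Cons del: tA_assoc)
  finally show ?case .
qed

end

section \<open>Circuits\<close>

locale msignature =
  fixes G :: "('s, 'g) msig"
  assumes G: "monoidal_signature G"
begin

declare in_listsD [rule del] in_listsI [rule del]

lemma gar_sorts [simp]: "s \<in> gens G \<Longrightarrow> gar G s \<in> lists (sorts G)" "s \<in> gens G
  \<Longrightarrow> gcoar G s \<in> lists (sorts G)"
  using G unfolding monoidal_signature_def by auto

lemma circ_sorts [simp]: "wf_circ G c \<Longrightarrow> cdom G c \<in> lists (sorts G) \<and> ccod G c \<in> lists (sorts G)"
  by (induct c) (auto)

lemma cid_wf [simp]: "cdom G (cid U) = U" "ccod G (cid U) = U" "wf_circ G (cid U)
  \<longleftrightarrow> U \<in> lists (sorts G)"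
  by (induct U) auto

lemma csym1_wf [simp]: "cdom G (csym1 A V) = A # V" "ccod G (csym1 A V) = V @ [A]"
  "wf_circ G (csym1 A V) \<longleftrightarrow> A \<in> sorts G \<and> V \<in> lists (sorts G)"
  by (induct V) auto

lemma csym_wf [simp]: "cdom G (csym U V) = U @ V" "ccod G (csym U V) = V @ U"
  "V \<in> lists (sorts G) \<Longrightarrow> U \<in> lists (sorts G) \<Longrightarrow> wf_circ G (csym U V)"
  by (induct U) auto

lemma ccopy_wf [simp]: "cdom G (ccopy U) = U" "ccod G (ccopy U) = U @ U"
  "U \<in> lists (sorts G) \<Longrightarrow> wf_circ G (ccopy U)"
  by (induct U) auto

lemma cdisc_wf [simp]: "cdom G (cdisc U) = U" "ccod G (cdisc U) = []"
  "U \<in> lists (sorts G) \<Longrightarrow> wf_circ G (cdisc U)"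
  by (induct U) auto

lemma circ_eq_wf: "circ_eq G c d \<Longrightarrow> wf_circ G c \<and> wf_circ G d \<and> cdom G c = cdom G d \<and> ccod G c
  = ccod G d"
  by (induct rule: circ_eq.induct) (auto simp: circ_sorts)

text \<open>Domain and codomain are stored beside the class, as in \<open>tape_class\<close>, so
  that source and target are plain projections.\<close>

definition kc :: "('s, 'g) circ \<Rightarrow> 's list \<times> 's list \<times> ('s, 'g) circ set" where
  "kc c = (cdom G c, ccod G c, {d. circ_eq G c d})"

definition krep :: "'s list \<times> 's list \<times> ('s, 'g) circ set \<Rightarrow> ('s, 'g) circ" where
  "krep = (\<lambda>(_, _, x). rep x)"

definition KAr where "KAr = {kc c | c. wf_circ G c}"
definition ksrc :: "'s list \<times> 's list \<times> ('s, 'g) circ set \<Rightarrow> 's list" where "ksrc = fst"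
definition ktgt :: "'s list \<times> 's list \<times> ('s, 'g) circ set \<Rightarrow> 's list" where "ktgt = fst \<circ> snd"
definition kseq (infixr "\<cdot>\<^sub>K" 55) where "kseq a b = kc (CSeq (krep a) (krep b))"
definition kten (infixr "\<oplus>\<^sub>K" 65) where "kten a b = kc (CTen (krep a) (krep b))"

lemma kc_eqI: "circ_eq G c d \<Longrightarrow> kc c = kc d"
  unfolding kc_def using circ_eq_wf [of c d] by (auto intro: circ_eq.sym circ_eq.trans)

lemma kc_eqD: "kc c = kc d \<Longrightarrow> wf_circ G c \<Longrightarrow> circ_eq G c d"
  unfolding kc_def by (auto dest: circ_eq.refl intro: circ_eq.sym)

lemma krep: "wf_circ G c \<Longrightarrow> circ_eq G c (krep (kc c))"
  unfolding krep_def kc_def rep_def by (auto intro: someI [of _ c] circ_eq.refl)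

lemma kc_KAr [simp]: "wf_circ G c \<Longrightarrow> kc c \<in> KAr"
  unfolding KAr_def by auto

lemma ksrc_kc [simp]: "ksrc (kc c) = cdom G c" by (simp add: ksrc_def kc_def)

lemma ktgt_kc [simp]: "ktgt (kc c) = ccod G c" by (simp add: ktgt_def kc_def)

lemma kseq_kc [simp]: "\<lbrakk>wf_circ G c; wf_circ G d; ccod G c = cdom G d\<rbrakk> \<Longrightarrow> kc c \<cdot>\<^sub>K kc d
  = kc (CSeq c d)"
  unfolding kseq_def using krep [of c] krep [of d] by (metis circ_eq.cong_seq circ_eq.sym kc_eqI)

lemma kten_kc [simp]: "\<lbrakk>wf_circ G c; wf_circ G d\<rbrakk> \<Longrightarrow> kc c \<oplus>\<^sub>K kc d = kc (CTen c d)"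
  unfolding kten_def using krep [of c] krep [of d] by (metis circ_eq.cong_ten circ_eq.sym kc_eqI)

declare split_paired_All [simp del] split_paired_Ex [simp del]

lemma KAr_E: assumes "f \<in> KAr" obtains c where "f = kc c" "wf_circ G c"
  using assms unfolding KAr_def by auto

lemma KAr_scat: "scat (lists (sorts G)) KAr ksrc ktgt (\<lambda>U. kc (cid U)) (\<cdot>\<^sub>K)"
proof
  fix f g h assume "f \<in> KAr" "g \<in> KAr" "h \<in> KAr" "ktgt f = ksrc g" "ktgt g = ksrc h"
  then show "(f \<cdot>\<^sub>K g) \<cdot>\<^sub>K h = f \<cdot>\<^sub>K g \<cdot>\<^sub>K h"
    by (elim KAr_E) (simp add: kc_eqI circ_eq.seq_assoc)
qed (auto elim!: KAr_E simp: kc_eqI [OF circ_eq.id_seq] kc_eqI [OF circ_eq.seq_id])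

lemma cid_append: "\<lbrakk>U \<in> lists (sorts G); V \<in> lists (sorts G)\<rbrakk> \<Longrightarrow> circ_eq G (CTen (cid U) (cid V))
  (cid (U @ V))"
proof (induct U)
  case Nil
  then show ?case by (simp add: circ_eq.one_ten)
next
  case (Cons A U)
  then have "circ_eq G (CTen (CTen (CId A) (cid U)) (cid V)) (CTen (CId A) (CTen (cid U)
    (cid V)))"
    by (intro circ_eq.ten_assoc) auto
  moreover have "circ_eq G (CTen (CId A) (CTen (cid U) (cid V))) (CTen (CId A) (cid (U @ V)))"
    using Cons by (intro circ_eq.cong_ten circ_eq.refl) auto
  ultimately show ?case by (auto intro: circ_eq.trans)
qed

lemma KAr_stm: "stm (lists (sorts G)) KAr ksrc ktgt (\<lambda>U. kc (cid U)) (\<cdot>\<^sub>K) (@) (\<oplus>\<^sub>K) []"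
proof -
  interpret scat "lists (sorts G)" KAr ksrc ktgt "\<lambda>U. kc (cid U)" "(\<cdot>\<^sub>K)" by (rule KAr_scat)
  show ?thesis
  proof
    fix f g h assume "f \<in> KAr" "g \<in> KAr" "h \<in> KAr"
    then show "(f \<oplus>\<^sub>K g) \<oplus>\<^sub>K h = f \<oplus>\<^sub>K g \<oplus>\<^sub>K h"
      by (elim KAr_E) (simp add: kc_eqI circ_eq.ten_assoc)
  next
    fix f f' g g' assume "f \<in> KAr" "f' \<in> KAr" "g \<in> KAr" "g' \<in> KAr" "ktgt f = ksrc f'" "ktgt g
      = ksrc g'"
    then show "(f \<oplus>\<^sub>K g) \<cdot>\<^sub>K (f' \<oplus>\<^sub>K g') = (f \<cdot>\<^sub>K f') \<oplus>\<^sub>K (g \<cdot>\<^sub>K g')"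
      by (elim KAr_E) (simp add: kc_eqI circ_eq.interchange circ_eq.sym)
  next
    fix X Y assume "X \<in> lists (sorts G)" "Y \<in> lists (sorts G)"
    then show "kc (cid X) \<oplus>\<^sub>K kc (cid Y) = kc (cid (X @ Y))" using cid_append
      by (simp add: kc_eqI)
  qed (auto elim!: KAr_E simp: kc_eqI [OF circ_eq.one_ten] kc_eqI [OF circ_eq.ten_one])
qed

lemma kc_CId: "A \<in> sorts G \<Longrightarrow> kc (CTen (CId A) CId1) = kc (CId A)"
  by (simp add: kc_eqI circ_eq.ten_one)

lemma KAr_cd: "words_cd (sorts G) KAr ksrc ktgt (\<lambda>U. kc (cid U)) (\<cdot>\<^sub>K) (\<oplus>\<^sub>K)
   (\<lambda>A B. kc (CSym A B)) (\<lambda>A V. kc (csym1 A V)) (\<lambda>U V. kc (csym U V))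
   (\<lambda>A. kc (CCopy A)) (\<lambda>A. kc (CDisc A)) (\<lambda>U. kc (ccopy U)) (\<lambda>U. kc (cdisc U))"
proof -
  interpret stm "lists (sorts G)" KAr ksrc ktgt "\<lambda>U. kc (cid U)" "(\<cdot>\<^sub>K)" "(@)" "(\<oplus>\<^sub>K)" "[]"
    by (rule KAr_stm)
  show ?thesis
  proof
    fix f W assume "f \<in> KAr" "W \<in> lists (sorts G)"
    then show "(f \<oplus>\<^sub>K kc (cid W)) \<cdot>\<^sub>K kc (csym (ktgt f) W) = kc (csym (ksrc f) W)
      \<cdot>\<^sub>K (kc (cid W) \<oplus>\<^sub>K f)"
      by (elim KAr_E) (simp add: kc_eqI circ_eq.sym_nat)
  next
    fix A U assume "A \<in> sorts G" "U \<in> lists (sorts G)"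
    then show "kc (ccopy (A # U)) = (kc (CCopy A) \<oplus>\<^sub>K kc (ccopy U))
      \<cdot>\<^sub>K (kc (cid [A]) \<oplus>\<^sub>K kc (csym1 A U) \<oplus>\<^sub>K kc (cid U))"
      by (subst tA_assoc [symmetric]) (auto simp: kc_CId)
  qed (auto simp: kc_CId circ_eq.sym_sym [THEN kc_eqI, simplified] circ_eq.copy_assoc
    circ_eq.copy_lunit
      circ_eq.copy_runit circ_eq.copy_comm kc_eqI)
qed

end

section \<open>The sum of tapes\<close>

lemma pten_Nil [simp]: "pten [] Q = []" by (simp add: pten_def)

lemma pten_Cons [simp]: "pten (U # P) Q = map ((@) U) Q @ pten P Q" by (simp add: pten_def)

lemma pten_append [simp]: "pten (P @ P') Q = pten P Q @ pten P' Q" by (simp add: pten_def)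

lemma pten_Nil2 [simp]: "pten P [] = []" by (induct P) auto

lemma pten_one [simp]: "pten P [[]] = P" by (induct P) auto

lemma pten_single: "pten P [V] = map (\<lambda>U. U @ V) P" by (induct P) auto

lemma pten_map: "pten (map ((@) U) P) Q = map ((@) U) (pten P Q)" by (induct P) auto

lemma pten_assoc [simp]: "pten (pten P Q) R = pten P (pten Q R)"
  by (induct P) (auto simp: pten_map)

lemma pten_replicate: "pten (replicate n []) P = concat (replicate n P)"
  by (induct n) (auto simp: map_idI)

lemma pten_replicate1: "pten (replicate n []) [U] = replicate n U" by (induct n) auto

locale tapes = msignature G
  for G :: "('s, 'g) msig" +
  fixes T :: "'f alg_theory"
  assumes T: "algebraic_theory T"
begin

declare in_listsD [rule del] in_listsI [rule del]

abbreviation "Wd \<equiv> lists (sorts G)"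
abbreviation "Pol \<equiv> lists Wd"
abbreviation td :: "('s, 'g, 'f) tape \<Rightarrow> 's poly" where "td \<equiv> tdom G"
abbreviation tc where "tc \<equiv> tcod T G"
abbreviation wf where "wf \<equiv> wf_tape T G"

lemma map_Wd [simp]: "\<lbrakk>U \<in> Wd; P \<in> Pol\<rbrakk> \<Longrightarrow> map ((@) U) P \<in> Pol"
  by (induct P) auto

lemma map_Wd2 [simp]: "\<lbrakk>U \<in> Wd; P \<in> Pol\<rbrakk> \<Longrightarrow> map (\<lambda>V. V @ U) P \<in> Pol"
  by (induct P) auto

lemma pten_Pol [simp]: "\<lbrakk>P \<in> Pol; Q \<in> Pol\<rbrakk> \<Longrightarrow> pten P Q \<in> Pol"
  by (induct P) auto

lemma replicate_Pol [simp]: "U \<in> Wd \<Longrightarrow> replicate n U \<in> Pol"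
  by (induct n) auto

lemma tape_Pol [simp]: "wf t \<Longrightarrow> td t \<in> Pol \<and> tc t \<in> Pol"
  by (induct t) auto

lemma tid_wf [simp]: "td (tid P) = P" "tc (tid P) = P" "wf (tid P) \<longleftrightarrow> P \<in> Pol"
  by (induct P) auto

lemma tsym1_wf [simp]: "td (tsym1 U Q) = U # Q" "tc (tsym1 U Q) = Q @ [U]" "wf (tsym1 U Q)
  \<longleftrightarrow> U \<in> Wd \<and> Q \<in> Pol"
  by (induct Q) auto

lemma tsym_wf [simp]: "td (tsym P Q) = P @ Q" "tc (tsym P Q) = Q @ P" "\<lbrakk>P \<in> Pol; Q \<in> Pol\<rbrakk>
  \<Longrightarrow> wf (tsym P Q)"
  by (induct P) auto

lemma tbng_wf [simp]: "td (tbng P) = []" "tc (tbng P) = P" "wf (tbng P) \<longleftrightarrow> P \<in> Pol"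
  by (induct P) auto

lemma tnab_wf [simp]: "td (tnab P) = P @ P" "tc (tnab P) = P" "P \<in> Pol \<Longrightarrow> wf (tnab P)"
  by (induct P) auto

lemma tnabn_wf [simp]: "td (tnabn n P) = concat (replicate n P)" "tc (tnabn n P) = P" "P \<in> Pol
  \<Longrightarrow> wf (tnabn n P)"
  by (induct n) auto

lemma tdl_wf [simp]: "td (tdl P Q R) = pten P (Q @ R)" "tc (tdl P Q R) = pten P Q @ pten P R"
  "\<lbrakk>P \<in> Pol; Q \<in> Pol; R \<in> Pol\<rbrakk> \<Longrightarrow> wf (tdl P Q R)"
  by (induct P) auto

lemma tdli_wf [simp]: "td (tdl_inv P Q R) = pten P Q @ pten P R" "tc (tdl_inv P Q R)
  = pten P (Q @ R)"
  "\<lbrakk>P \<in> Pol; Q \<in> Pol; R \<in> Pol\<rbrakk> \<Longrightarrow> wf (tdl_inv P Q R)"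
  by (induct P) auto

lemma tsum_Nil [simp]: "tsum [] = TId0" by (simp add: tsum_def)

lemma tsum_Cons [simp]: "tsum (t # ts) = TSum t (tsum ts)" by (simp add: tsum_def)

lemma tsum_wf [simp]: "td (tsum ts) = concat (map td ts)" "tc (tsum ts) = concat (map tc ts)"
  "wf (tsum ts) \<longleftrightarrow> (\<forall>t \<in> set ts. wf t)"
  by (induct ts) auto

lemma lists_Ball [simp]: "P \<in> lists A \<Longrightarrow> x \<in> set P \<Longrightarrow> x \<in> A"
  by (simp add: in_lists_conv_set)

lemma tsymm_wf [simp]: "td (tsymm P Q) = pten P Q" "tc (tsymm P Q) = pten Q P" "\<lbrakk>P \<in> Pol; Q \<in> Pol\<rbrakk>
  \<Longrightarrow> wf (tsymm P Q)"
  by (induct Q) (auto simp: o_def pten_single)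

lemma top_poly_wf [simp]: "td (top_poly T f P) = P" "tc (top_poly T f P)
  = pten (replicate (arity T f) []) P"
  "f \<in> ops T \<Longrightarrow> P \<in> Pol \<Longrightarrow> wf (top_poly T f P)"
  by (induct P) (auto simp: pten_replicate1)

lemma ttrm_dom [simp]: "td (ttrm n t U) = [U]" "wf_trm T n t \<Longrightarrow> tc (ttrm n t U) = replicate n U"
  by (cases t; auto simp flip: replicate_Suc replicate_add replicate_append_same)+

lemma concat_replicate_cong: "(\<And>t. t \<in> set ts \<Longrightarrow> f t = x) \<Longrightarrow> concat (map f ts)
  = concat (replicate (length ts) x)"
  by (induct ts) auto

lemma ttrm_wf [simp]: "\<lbrakk>U \<in> Wd; wf_trm T n t\<rbrakk> \<Longrightarrow> wf (ttrm n t U)"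
proof (induct n t U rule: ttrm.induct)
  case (2 n f ts U)
  then have "concat (map (\<lambda>x. tc (ttrm n x U)) ts)
    = concat (replicate (length ts) (replicate n U))"
    by (intro concat_replicate_cong) auto
  then show ?case using 2 by (auto simp: o_def map_replicate_const)
qed auto

lemma lwhisk1_wf [simp]: "td (lwhisk1 U t) = map ((@) U) (td t)" "tc (lwhisk1 U t)
  = map ((@) U) (tc t)"
  "U \<in> Wd \<Longrightarrow> wf t \<Longrightarrow> wf (lwhisk1 U t)"
  by (induct t) auto

lemma rwhisk1_wf [simp]: "td (rwhisk1 U t) = map (\<lambda>V. V @ U) (td t)" "tc (rwhisk1 U t)
  = map (\<lambda>V. V @ U) (tc t)"
  "U \<in> Wd \<Longrightarrow> wf t \<Longrightarrow> wf (rwhisk1 U t)"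
  by (induct t) auto

lemma lwhisk_wf [simp]: "td (lwhisk P t) = pten P (td t)" "tc (lwhisk P t) = pten P (tc t)"
  "P \<in> Pol \<Longrightarrow> wf t \<Longrightarrow> wf (lwhisk P t)"
  by (induct P) auto

lemma rwhisk_wf [simp]: assumes "wf t"
  shows "S \<in> Pol \<Longrightarrow> wf (rwhisk T G S t) \<and> td (rwhisk T G S t) = pten (td t) S \<and> tc (rwhisk T G S t)
    = pten (tc t) S"
  using assms by (induct S) (auto simp: pten_single)

lemma tten_wf [simp]: assumes "wf t" "wf u"
  shows "wf (tten T G t u)" "td (tten T G t u) = pten (td t) (td u)" "tc (tten T G t u)
    = pten (tc t) (tc u)"
  using assms by (auto simp: tten_def)

lemma tcopy_wf [simp]: "P \<in> Pol \<Longrightarrow> wf (tcopy P)" "td (tcopy P) = P" "tc (tcopy P) = pten P P"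
  by (induct P) auto

lemma tdisc_wf [simp]: "P \<in> Pol \<Longrightarrow> wf (tdisc P)" "td (tdisc P) = P" "tc (tdisc P) = [[]]"
  by (induct P) auto

lemma tape_eq_wf: "tape_eq T G t u \<Longrightarrow> wf t \<and> wf u \<and> td t = td u \<and> tc t = tc u"
proof (induct rule: tape_eq.induct)
  case (circ c d)
  then show ?case using circ_eq_wf by auto
next
  case (thy_ax n t t' U)
  then have "wf_trm T n t" "wf_trm T n t'" using T unfolding algebraic_theory_def by auto
  then show ?case using thy_ax by auto
qed (auto simp: map_replicate_const pten_replicate)

section \<open>The category of classes of tapes\<close>

abbreviation cl where "cl \<equiv> tape_class T G"
abbreviation TC where "TC \<equiv> tape_cat T G"
abbreviation sq (infixr "\<cdot>" 55) where "sq \<equiv> seq TC"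
abbreviation pl (infixr "\<^bold>\<oplus>" 65) where "pl \<equiv> tenA (add TC)"
abbreviation ml (infixr "\<^bold>\<otimes>" 70) where "ml \<equiv> tenA (mul TC)"
abbreviation I where "I P \<equiv> cl (tid P)"

lemma TC_simps [simp]: "obj TC = Pol" "ide TC = (\<lambda>P. cl (tid P))" "tenO (add TC)
  = (@)" "unO (add TC) = []"
  "symm (add TC) = (\<lambda>P Q. cl (tsym P Q))" "tenO (mul TC) = pten" "unO (mul TC) = [[]]"
  "symm (mul TC) = (\<lambda>P Q. cl (tsymm P Q))" "nab TC = (\<lambda>P. cl (tnab P))" "bng TC
    = (\<lambda>P. cl (tbng P))"
  "dl TC = (\<lambda>P Q R. cl (tdl P Q R))" "dr TC = (\<lambda>P Q R. cl (tid (pten (P @ Q) R)))" "lz TC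
    = (\<lambda>P. cl TId0)"
  "rz TC = (\<lambda>P. cl TId0)" "copy TC = (\<lambda>P. cl (tcopy P))" "disc TC = (\<lambda>P. cl (tdisc P))"
  by (auto simp: tape_cat_def tape_add_def tape_mul_def)

lemma arr_cl [simp]: "wf t \<Longrightarrow> cl t \<in> arr TC"
  by (auto simp: tape_cat_def)

lemma src_cl [simp]: "src TC (cl t) = td t"
  by (simp add: tape_cat_def tape_class_def)

lemma tgt_cl [simp]: "tgt TC (cl t) = tc t"
  by (simp add: tape_cat_def tape_class_def)

lemma arrE: assumes "f \<in> arr TC" obtains t where "f = cl t" "wf t"
  using assms by (auto simp: tape_cat_def)

lemma cl_eqI: "tape_eq T G c d \<Longrightarrow> cl c = cl d"
  unfolding tape_class_def using tape_eq_wf [of c d] by (auto intro: tape_eq.sym tape_eq.trans)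

lemma tape_rep: "wf c \<Longrightarrow> tape_eq T G c (tape_rep (cl c))"
  unfolding tape_rep_def tape_class_def rep_def by (auto intro: someI [of _ c] tape_eq.refl)

lemma cl_seq: "\<lbrakk>wf c; wf d; tc c = td d\<rbrakk> \<Longrightarrow> cl (TSeq c d) = cl c \<cdot> cl d"
  using tape_rep [of c] tape_rep [of d] by (auto simp: tape_cat_def intro!: cl_eqI
    tape_eq.cong_seq)

lemma cl_sum: "\<lbrakk>wf c; wf d\<rbrakk> \<Longrightarrow> cl (TSum c d) = cl c \<^bold>\<oplus> cl d"
  using tape_rep [of c] tape_rep [of d] by (auto simp: tape_cat_def tape_add_def intro!: cl_eqI
    tape_eq.cong_sum)

lemma cl_ten: "\<lbrakk>wf c; wf d\<rbrakk> \<Longrightarrow> cl (tten T G c d) = cl c \<^bold>\<otimes> cl d"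
  using tape_rep [of c] tape_rep [of d] by (auto simp: tape_cat_def tape_mul_def intro!: cl_eqI
    tape_eq.cong_ten)

lemma TC_scat: "scat Pol (arr TC) (src TC) (tgt TC) (\<lambda>P. I P) (\<cdot>)"
proof
  fix f g h assume "f \<in> arr TC" "g \<in> arr TC" "h \<in> arr TC" "tgt TC f = src TC g" "tgt TC g
    = src TC h"
  then show "(f \<cdot> g) \<cdot> h = f \<cdot> g \<cdot> h"
    by (elim arrE) (simp add: cl_eqI tape_eq.seq_assoc flip: cl_seq)
qed (auto elim!: arrE simp: cl_eqI [OF tape_eq.id_seq] cl_eqI [OF tape_eq.seq_id] simp
  flip: cl_seq)

lemma tid_append: "\<lbrakk>U \<in> Pol; V \<in> Pol\<rbrakk> \<Longrightarrow> tape_eq T G (TSum (tid U) (tid V)) (tid (U @ V))"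
proof (induct U)
  case Nil
  then show ?case by (simp add: tape_eq.zero_sum)
next
  case (Cons A U)
  then have "tape_eq T G (TSum (TSum (TId A) (tid U)) (tid V)) (TSum (TId A) (TSum (tid U)
    (tid V)))"
    by (intro tape_eq.sum_assoc) auto
  moreover have "tape_eq T G (TSum (TId A) (TSum (tid U) (tid V))) (TSum (TId A) (tid (U @ V)))"
    using Cons by (intro tape_eq.cong_sum tape_eq.refl) auto
  ultimately show ?case by (auto intro: tape_eq.trans)
qed

lemma TC_stm: "stm Pol (arr TC) (src TC) (tgt TC) (\<lambda>P. I P) (\<cdot>) (@) (\<^bold>\<oplus>) []"
proof -
  interpret scat Pol "arr TC" "src TC" "tgt TC" "\<lambda>P. I P" "(\<cdot>)" by (rule TC_scat)
  show ?thesis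
  proof
    fix f g h assume "f \<in> arr TC" "g \<in> arr TC" "h \<in> arr TC"
    then show "(f \<^bold>\<oplus> g) \<^bold>\<oplus> h = f \<^bold>\<oplus> g \<^bold>\<oplus> h"
      by (elim arrE) (simp add: cl_eqI tape_eq.sum_assoc flip: cl_sum)
  next
    fix f f' g g' assume "f \<in> arr TC" "f' \<in> arr TC" "g \<in> arr TC" "g' \<in> arr TC" "tgt TC f
      = src TC f'" "tgt TC g = src TC g'"
    then show "(f \<^bold>\<oplus> g) \<cdot> (f' \<^bold>\<oplus> g') = (f \<cdot> f') \<^bold>\<oplus> (g \<cdot> g')"
      by (elim arrE) (simp add: cl_eqI [OF tape_eq.interchange] flip: cl_sum cl_seq)
  next
    fix X Y assume "X \<in> Pol" "Y \<in> Pol"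
    then show "I X \<^bold>\<oplus> I Y = I (X @ Y)" using tid_append by (simp add: cl_eqI flip: cl_sum)
  qed (auto elim!: arrE simp: cl_eqI [OF tape_eq.zero_sum] cl_eqI [OF tape_eq.sum_zero] simp
    flip: cl_sum)
qed

sublocale Z: stm Pol "arr TC" "src TC" "tgt TC" "\<lambda>P. I P" "(\<cdot>)" "(@)" "(\<^bold>\<oplus>)" "[]"
  by (rule TC_stm)

lemma cl_TId0: "cl TId0 = I []" by simp

lemma cl_TId: "U \<in> Wd \<Longrightarrow> cl (TId U) = I [U]"
  by (simp add: cl_eqI [OF tape_eq.sum_zero])
declare tid.simps [simp del]

lemmas cl_simps = cl_seq cl_sum tid.simps(1) [symmetric] cl_TId

lemma TC_words: "words_natural Wd (arr TC) (src TC) (tgt TC) (\<lambda>P. I P) (\<cdot>) (\<^bold>\<oplus>)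
   (\<lambda>U V. cl (TSym U V)) (\<lambda>U Q. cl (tsym1 U Q)) (\<lambda>P Q. cl (tsym P Q))"
proof
  fix f W assume "f \<in> arr TC" "W \<in> Pol"
  then show "(f \<^bold>\<oplus> I W) \<cdot> cl (tsym (tgt TC f) W) = cl (tsym (src TC f) W) \<cdot> (I W \<^bold>\<oplus> f)"
    by (elim arrE) (simp add: cl_eqI [OF tape_eq.sym_nat] flip: cl_seq cl_sum)
next
  fix U V assume "U \<in> Wd" "V \<in> Wd"
  then show "cl (TSym U V) \<cdot> cl (TSym V U) = I [U, V]"
    using tape_eq.sym_sym [THEN cl_eqI, of U V] by (simp add: cl_seq)
qed (auto simp: cl_simps)

sublocale W: words_natural Wd "arr TC" "src TC" "tgt TC" "\<lambda>P. I P" "(\<cdot>)" "(\<^bold>\<oplus>)"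
   "\<lambda>U V. cl (TSym U V)" "\<lambda>U Q. cl (tsym1 U Q)" "\<lambda>P Q. cl (tsym P Q)"
  by (rule TC_words)

sublocale Y: ssm Pol "arr TC" "src TC" "tgt TC" "\<lambda>P. I P" "(\<cdot>)" "(@)" "(\<^bold>\<oplus>)" "[]"
  "\<lambda>P Q. cl (tsym P Q)"
  by (rule W.ssm_words)

abbreviation N where "N P \<equiv> cl (tnab P)"
abbreviation B where "B P \<equiv> cl (tbng P)"
abbreviation S where "S P Q \<equiv> cl (tsym P Q)"

text \<open>The monoids are comonoids in the opposite category, where \<open>words_cd\<close> applies.\<close>

lemma TC_op: "words_cd Wd (arr TC) (tgt TC) (src TC) (\<lambda>P. I P) (\<lambda>f g. g \<cdot> f) (\<^bold>\<oplus>)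
   (\<lambda>U V. cl (TSym V U)) (\<lambda>U Q. S Q [U]) (\<lambda>P Q. S Q P)
   (\<lambda>U. cl (TNab U)) (\<lambda>U. cl (TBng U)) (\<lambda>P. N P) (\<lambda>P. B P)"
proof
  fix U V :: "'s list" and P Q :: "'s poly" assume UP [simp]: "U \<in> Wd" "V \<in> Wd" "P \<in> Pol"
    "Q \<in> Pol"
  show "S (V # P) [U] = (I [V] \<^bold>\<oplus> S P [U]) \<cdot> (cl (TSym V U) \<^bold>\<oplus> I P)"
    using W.wsy_Cons [of V P "[U]"] by (simp add: W.wsy1_single del: tsym1.simps tsym.simps)
  show "S Q (U # P) = (S Q [U] \<^bold>\<oplus> I P) \<cdot> (I [U] \<^bold>\<oplus> S Q P)"
    using W.wsy_hex [of Q "[U]" P] by simp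
  show "N (U # P) = (I [U] \<^bold>\<oplus> S P [U] \<^bold>\<oplus> I P) \<cdot> (cl (TNab U) \<^bold>\<oplus> N P)"
    by (simp add: cl_simps)
next
  fix U assume [simp]: "U \<in> Wd"
  show "(cl (TNab U) \<^bold>\<oplus> I [U]) \<cdot> cl (TNab U) = (I [U] \<^bold>\<oplus> cl (TNab U)) \<cdot> cl (TNab U)"
    using tape_eq.nab_assoc [THEN cl_eqI, of U] by (simp add: cl_simps)
  show "(cl (TBng U) \<^bold>\<oplus> I [U]) \<cdot> cl (TNab U) = I [U]"
    using tape_eq.nab_lunit [THEN cl_eqI, of U] by (simp add: cl_simps)
  show "(I [U] \<^bold>\<oplus> cl (TBng U)) \<cdot> cl (TNab U) = I [U]"
    using tape_eq.nab_runit [THEN cl_eqI, of U] by (simp add: cl_simps)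
  show "cl (TSym U U) \<cdot> cl (TNab U) = cl (TNab U)"
    using tape_eq.nab_comm [THEN cl_eqI, of U] by (simp add: cl_simps)
next
  fix f W assume f [simp]: "f \<in> arr TC" "W \<in> Pol"
  then show "S W (src TC f) \<cdot> (f \<^bold>\<oplus> I W) = (I W \<^bold>\<oplus> f) \<cdot> S W (tgt TC f)"
    by (simp add: W.wsy_natural2)
qed (auto simp: cl_simps)

section \<open>Commutative monoids on polynomials\<close>

lemma N_Nil: "N [] = I []" and B_Nil: "B [] = I []" by (simp_all add: tid.simps(1))

lemma N_units: "P \<in> Pol \<Longrightarrow> (B P \<^bold>\<oplus> I P) \<cdot> N P = I P" "P \<in> Pol \<Longrightarrow> (I P \<^bold>\<oplus> B P) \<cdot> N P = I P"
  using words_cd.wc_comonoid [OF TC_op, of P] by auto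

lemma N_assoc: "P \<in> Pol \<Longrightarrow> (N P \<^bold>\<oplus> I P) \<cdot> N P = (I P \<^bold>\<oplus> N P) \<cdot> N P"
  using words_cd.wc_comonoid [OF TC_op, of P] by auto

lemma N_comm: "P \<in> Pol \<Longrightarrow> S P P \<cdot> N P = N P"
  using words_cd.wc_comonoid [OF TC_op, of P] by auto

lemma N_append: "\<lbrakk>P \<in> Pol; Q \<in> Pol\<rbrakk> \<Longrightarrow> N (P @ Q) = (I P \<^bold>\<oplus> S Q P \<^bold>\<oplus> I Q) \<cdot> (N P \<^bold>\<oplus> N Q)"
  using words_cd.wc_append [OF TC_op] by simp

lemma B_append: "\<lbrakk>P \<in> Pol; Q \<in> Pol\<rbrakk> \<Longrightarrow> B (P @ Q) = B P \<^bold>\<oplus> B Q"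
  by (rule words_cd.wd_append [OF TC_op])

lemma N_single: "U \<in> Wd \<Longrightarrow> N [U] = cl (TNab U)"
  by (simp add: cl_simps del: tsym1.simps)

lemma B_single: "U \<in> Wd \<Longrightarrow> B [U] = cl (TBng U)"
  by (simp add: cl_simps)

declare tnab.simps [simp del] tbng.simps [simp del] tsym.simps [simp del] tsym1.simps [simp del]

text \<open>The multiplication of a commutative monoid is a homomorphism. The fourfold product is
  rebracketed so that the two inner factors are multiplied first; there commutativity absorbs the
  crossing in the multiplication of P + P.\<close>

lemma N_N: assumes [simp]: "P \<in> Pol" shows "N (P @ P) \<cdot> N P = (N P \<^bold>\<oplus> N P) \<cdot> N P"
proof -
  have 1: "(N P \<^bold>\<oplus> N P) \<cdot> N P = (I P \<^bold>\<oplus> N P \<^bold>\<oplus> I P) \<cdot> (N P \<^bold>\<oplus> I P) \<cdot> N P"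
  proof -
    have "(N P \<^bold>\<oplus> N P) \<cdot> N P = (I (P @ P) \<^bold>\<oplus> N P) \<cdot> (N P \<^bold>\<oplus> I P) \<cdot> N P" by simp
    also have "\<dots> = (I (P @ P) \<^bold>\<oplus> N P) \<cdot> (I P \<^bold>\<oplus> N P) \<cdot> N P" by (simp only: N_assoc assms)
    also have "\<dots> = (I P \<^bold>\<oplus> ((I P \<^bold>\<oplus> N P) \<cdot> N P)) \<cdot> N P" by (simp add: Z.whisk del: Z.interchange
      Z.interchange_seq)
    also have "\<dots> = (I P \<^bold>\<oplus> ((N P \<^bold>\<oplus> I P) \<cdot> N P)) \<cdot> N P" by (simp only: N_assoc assms)
    also have "\<dots> = (I P \<^bold>\<oplus> N P \<^bold>\<oplus> I P) \<cdot> (I P \<^bold>\<oplus> N P) \<cdot> N P"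
      by (simp add: Z.whisk del: Z.interchange Z.interchange_seq)
    also have "\<dots> = (I P \<^bold>\<oplus> N P \<^bold>\<oplus> I P) \<cdot> (N P \<^bold>\<oplus> I P) \<cdot> N P" by (simp only: N_assoc assms)
    finally show ?thesis .
  qed
  have "N (P @ P) \<cdot> N P = (I P \<^bold>\<oplus> S P P \<^bold>\<oplus> I P) \<cdot> (N P \<^bold>\<oplus> N P) \<cdot> N P" by (simp add: N_append)
  also have "\<dots> = ((I P \<^bold>\<oplus> S P P \<^bold>\<oplus> I P) \<cdot> (I P \<^bold>\<oplus> N P \<^bold>\<oplus> I P)) \<cdot> (N P \<^bold>\<oplus> I P) \<cdot> N P" unfolding 1
    by simp
  also have "(I P \<^bold>\<oplus> S P P \<^bold>\<oplus> I P) \<cdot> (I P \<^bold>\<oplus> N P \<^bold>\<oplus> I P) = I P \<^bold>\<oplus> N P \<^bold>\<oplus> I P"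
    by (simp add: N_comm)
  finally show ?thesis unfolding 1 .
qed

text \<open>The congruence contains these equations for circuits and operations. At the remaining
  generators they follow from the theory of commutative monoids: \<open>mid_sy\<close> at a
  symmetry, \<open>N_N\<close> at \<open>TNab\<close>, the unit law at \<open>TBng\<close>.\<close>

lemma N_natural: "wf t \<Longrightarrow> N (td t) \<cdot> cl t = (cl t \<^bold>\<oplus> cl t) \<cdot> N (tc t) \<and> B (td t) \<cdot> cl t = B (tc t)"
proof (induct t)
  case (TSym U V)
  then have [simp]: "U \<in> Wd" "V \<in> Wd" by auto
  have s: "cl (TSym U V) = S [U] [V]" by (simp add: W.wsy_single W.wsy1_single)
  have "N ([U] @ [V]) \<cdot> S [U] [V] = (I [U] \<^bold>\<oplus> S [V] [U] \<^bold>\<oplus> I [V]) \<cdot> (N [U] \<^bold>\<oplus> N [V]) \<cdot> S [U] [V]"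
    by (simp add: N_append [of "[U]" "[V]", simplified])
  also have "(N [U] \<^bold>\<oplus> N [V]) \<cdot> S [U] [V] = S ([U] @ [U]) ([V] @ [V]) \<cdot> (N [V] \<^bold>\<oplus> N [U])"
    using Y.sy_nat [of "N [U]" "N [V]"] by simp
  also have "(I [U] \<^bold>\<oplus> S [V] [U] \<^bold>\<oplus> I [V]) \<cdot> S ([U] @ [U]) ([V] @ [V]) \<cdot> (N [V] \<^bold>\<oplus> N [U]) =
      (S [U] [V] \<^bold>\<oplus> S [U] [V]) \<cdot> (I [V] \<^bold>\<oplus> S [U] [V] \<^bold>\<oplus> I [U]) \<cdot> (N [V] \<^bold>\<oplus> N [U])"
    using Y.mid_sy [of "[U]" "[V]", THEN Z.seq_eq, of "N [V] \<^bold>\<oplus> N [U]"]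
      by (simp del: Z.interchange Z.interchange_seq)
  also have "\<dots> = (S [U] [V] \<^bold>\<oplus> S [U] [V]) \<cdot> N ([V] @ [U])"
    by (simp add: N_append [of "[V]" "[U]", simplified])
  finally have 1: "N ([U] @ [V]) \<cdot> S [U] [V] = (S [U] [V] \<^bold>\<oplus> S [U] [V]) \<cdot> N ([V] @ [U])" .
  have 2: "B ([U] @ [V]) \<cdot> S [U] [V] = B ([V] @ [U])"
    using B_append [of "[U]" "[V]"] B_append [of "[V]" "[U]"]
    using Y.sy_nat [of "B [U]" "B [V]"] by (simp add: W.wsy_Nil)
  show ?case using 1 2 by (simp add: s)
next
  case (TSeq t u)
  then have [simp]: "wf t" "wf u" "tc t = td u" by auto
  have t: "N (td t) \<cdot> cl t = (cl t \<^bold>\<oplus> cl t) \<cdot> N (tc t)" "B (td t) \<cdot> cl t = B (tc t)"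
    "N (td u) \<cdot> cl u = (cl u \<^bold>\<oplus> cl u) \<cdot> N (tc u)" "B (td u) \<cdot> cl u = B (tc u)" using TSeq by auto
  have "N (td t) \<cdot> cl t \<cdot> cl u = (N (td t) \<cdot> cl t) \<cdot> cl u" by simp
  also have "\<dots> = (cl t \<^bold>\<oplus> cl t) \<cdot> N (td u) \<cdot> cl u" by (subst t) simp
  also have "\<dots> = ((cl t \<cdot> cl u) \<^bold>\<oplus> (cl t \<cdot> cl u)) \<cdot> N (tc u)" by (subst t(3)) simp
  finally have 1: "N (td t) \<cdot> cl t \<cdot> cl u = ((cl t \<cdot> cl u) \<^bold>\<oplus> (cl t \<cdot> cl u)) \<cdot> N (tc u)" .
  have "B (td t) \<cdot> cl t \<cdot> cl u = (B (td t) \<cdot> cl t) \<cdot> cl u" by simp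
  then show ?case using 1 t by (simp add: cl_seq)
next
  case (TSum t u)
  then have [simp]: "wf t" "wf u" by auto
  have t: "N (td t) \<cdot> cl t = (cl t \<^bold>\<oplus> cl t) \<cdot> N (tc t)" "B (td t) \<cdot> cl t = B (tc t)"
    "N (td u) \<cdot> cl u = (cl u \<^bold>\<oplus> cl u) \<cdot> N (tc u)" "B (td u) \<cdot> cl u = B (tc u)" using TSum by auto
  have "N (td t @ td u) \<cdot> (cl t \<^bold>\<oplus> cl u) = (I (td t) \<^bold>\<oplus> S (td u) (td t) \<^bold>\<oplus> I (td u))
    \<cdot> ((N (td t) \<cdot> cl t) \<^bold>\<oplus> (N (td u) \<cdot> cl u))"
    by (simp add: N_append)
  also have "\<dots> = (I (td t) \<^bold>\<oplus> S (td u) (td t) \<^bold>\<oplus> I (td u)) \<cdot> ((cl t \<^bold>\<oplus> cl t) \<^bold>\<oplus> (cl u \<^bold>\<oplus> cl u))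
    \<cdot> (N (tc t) \<^bold>\<oplus> N (tc u))"
    unfolding t by (subst Z.interchange) simp_all
  also have "((cl t \<^bold>\<oplus> cl t) \<^bold>\<oplus> (cl u \<^bold>\<oplus> cl u)) = cl t \<^bold>\<oplus> (cl t \<^bold>\<oplus> cl u) \<^bold>\<oplus> cl u" by simp
  also have "(I (td t) \<^bold>\<oplus> S (td u) (td t) \<^bold>\<oplus> I (td u)) \<cdot> (cl t \<^bold>\<oplus> (cl t \<^bold>\<oplus> cl u) \<^bold>\<oplus> cl u)
    \<cdot> (N (tc t) \<^bold>\<oplus> N (tc u))
     = (cl t \<^bold>\<oplus> (S (td u) (td t) \<cdot> (cl t \<^bold>\<oplus> cl u)) \<^bold>\<oplus> cl u) \<cdot> (N (tc t) \<^bold>\<oplus> N (tc u))"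
     by (simp del: Z.tA_assoc)
  also have "S (td u) (td t) \<cdot> (cl t \<^bold>\<oplus> cl u) = (cl u \<^bold>\<oplus> cl t) \<cdot> S (tc u) (tc t)"
    using Y.sy_nat [of "cl u" "cl t"] by simp
  also have "(cl t \<^bold>\<oplus> ((cl u \<^bold>\<oplus> cl t) \<cdot> S (tc u) (tc t)) \<^bold>\<oplus> cl u) \<cdot> (N (tc t) \<^bold>\<oplus> N (tc u))
    = (cl t \<^bold>\<oplus> (cl u \<^bold>\<oplus> cl t) \<^bold>\<oplus> cl u) \<cdot> (I (tc t) \<^bold>\<oplus> S (tc u) (tc t) \<^bold>\<oplus> I (tc u))
      \<cdot> (N (tc t) \<^bold>\<oplus> N (tc u))"
     by (simp del: Z.tA_assoc)
  also have "\<dots> = ((cl t \<^bold>\<oplus> cl u) \<^bold>\<oplus> (cl t \<^bold>\<oplus> cl u)) \<cdot> N (tc t @ tc u)" by (simp add: N_append)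
  finally show ?case using t by (simp add: cl_sum B_append)
next
  case (TBng U)
  then have [simp]: "U \<in> Wd" by auto
  have "(B [U] \<^bold>\<oplus> B [U]) \<cdot> N [U] = B [U] \<cdot> (B [U] \<^bold>\<oplus> I [U]) \<cdot> N [U]"
  proof -
    have "B [U] \<^bold>\<oplus> B [U] = (I [] \<^bold>\<oplus> B [U]) \<cdot> (B [U] \<^bold>\<oplus> I [U])" by (subst Z.interchange) simp_all
    then show ?thesis by (simp del: Z.interchange)
  qed
  then show ?case by (simp add: N_units N_Nil B_Nil flip: B_single)
next
  case (TNab U)
  then have [simp]: "U \<in> Wd" by auto
  have "(B [U] \<^bold>\<oplus> B [U]) \<cdot> N [U] = B [U] \<cdot> (B [U] \<^bold>\<oplus> I [U]) \<cdot> N [U]"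
  proof -
    have "B [U] \<^bold>\<oplus> B [U] = (I [] \<^bold>\<oplus> B [U]) \<cdot> (B [U] \<^bold>\<oplus> I [U])" by (subst Z.interchange) simp_all
    then show ?thesis by (simp del: Z.interchange)
  qed
  then show ?case using N_N [of "[U]"] B_append [of "[U]" "[U]"]
    by (simp add: N_units flip: N_single)
next
  case (TCirc c)
  then show ?case using tape_eq.nab_circ [THEN cl_eqI, of c] tape_eq.bng_circ [THEN cl_eqI, of c]
    by (simp add: cl_seq cl_sum N_single B_single)
next
  case (TOp f U)
  then show ?case using tape_eq.nab_op [THEN cl_eqI, of f U] tape_eq.bng_op [THEN cl_eqI, of f U]
    by (simp add: cl_seq cl_sum N_single B_single)
qed (simp_all add: cl_TId N_Nil B_Nil tid.simps(1) [symmetric])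

sublocale A: sfc Pol "arr TC" "src TC" "tgt TC" "\<lambda>P. I P" "(\<cdot>)" "(@)" "(\<^bold>\<oplus>)" "[]" "\<lambda>P Q. S P Q"
  "\<lambda>P. N P" "\<lambda>P. B P"
proof
  fix f assume "f \<in> arr TC"
  then obtain t where t: "f = cl t" "wf t" by (rule arrE)
  show "N (src TC f) \<cdot> f = (f \<^bold>\<oplus> f) \<cdot> N (tgt TC f)" "B (src TC f) \<cdot> f = B (tgt TC f)"
    using t N_natural [of t] by auto
next
  fix X Y assume [simp]: "X \<in> Pol" "Y \<in> Pol"
  have 1: "B (Y @ X) \<cdot> S Y X = B (X @ Y)" using Y.sy_nat [of "B Y" "B X"]
    by (simp add: B_append W.wsy_Nil)
  have "(I X \<^bold>\<oplus> B (Y @ X) \<^bold>\<oplus> I Y) \<cdot> N (X @ Y) = (I X \<^bold>\<oplus> (B (Y @ X) \<cdot> S Y X) \<^bold>\<oplus> I Y)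
    \<cdot> (N X \<^bold>\<oplus> N Y)"
    by (simp add: N_append)
  also have "\<dots> = ((I X \<^bold>\<oplus> B X) \<^bold>\<oplus> (B Y \<^bold>\<oplus> I Y)) \<cdot> (N X \<^bold>\<oplus> N Y)"
    unfolding 1 by (simp add: B_append)
  also have "\<dots> = I (X @ Y)" by (simp del: Z.tA_assoc add: N_units)
  finally show "(I X \<^bold>\<oplus> B (Y @ X) \<^bold>\<oplus> I Y) \<cdot> N (X @ Y) = I (X @ Y)" .
qed (auto simp: N_units B_Nil)

end

section \<open>The product of tapes\<close>

context tapes
begin

text \<open>In the category of tapes the source of a composite depends on its first factor only, even
  for arrows that are not composable; with these rules the simplifier computes sources and
  targets in linear time.\<close>

lemma seq_TC: "f \<cdot> g = cl (TSeq (tape_rep f) (tape_rep g))"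
  by (simp add: tape_cat_def)

lemma src_seq_tape [simp]: "f \<in> arr TC \<Longrightarrow> src TC (f \<cdot> g) = src TC f"
  using tape_rep [THEN tape_eq_wf] by (auto elim!: arrE simp: seq_TC)

lemma tgt_seq_tape [simp]: "g \<in> arr TC \<Longrightarrow> tgt TC (f \<cdot> g) = tgt TC g"
  using tape_rep [THEN tape_eq_wf] by (auto elim!: arrE simp: seq_TC)
declare Z.src_seq [simp del] Z.tgt_seq [simp del]

section \<open>Distributors and whiskerings on classes\<close>

abbreviation D where "D P Q R \<equiv> cl (tdl P Q R)"
abbreviation Di where "Di P Q R \<equiv> cl (tdl_inv P Q R)"
abbreviation M where "M P Q \<equiv> cl (tsymm P Q)"

lemma D_Nil: "D [] Q R = I []" "Di [] Q R = I []"
  by (simp_all add: tid.simps(1))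

lemma D_Cons: "\<lbrakk>U \<in> Wd; P \<in> Pol; Q \<in> Pol; R \<in> Pol\<rbrakk> \<Longrightarrow> D (U # P) Q R =
    (I (map ((@) U) (Q @ R)) \<^bold>\<oplus> D P Q R) \<cdot> (I (map ((@) U) Q) \<^bold>\<oplus> S (map ((@) U) R) (pten P Q) \<^bold>\<oplus> I
      (pten P R))"
  "\<lbrakk>U \<in> Wd; P \<in> Pol; Q \<in> Pol; R \<in> Pol\<rbrakk> \<Longrightarrow> Di (U # P) Q R =
    (I (map ((@) U) Q) \<^bold>\<oplus> S (pten P Q) (map ((@) U) R) \<^bold>\<oplus> I (pten P R))
      \<cdot> (I (map ((@) U) (Q @ R)) \<^bold>\<oplus> Di P Q R)"
  by (simp_all add: cl_seq cl_sum)

declare tdl.simps [simp del] tdl_inv.simps [simp del]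

lemma D_Di [simp]: "\<lbrakk>P \<in> Pol; Q \<in> Pol; R \<in> Pol\<rbrakk> \<Longrightarrow> D P Q R \<cdot> Di P Q R = I (pten P (Q @ R))"
proof (induct P)
  case (Cons U P)
  then show ?case by (simp add: D_Cons)
qed (simp add: D_Nil)

lemma Di_D [simp]: "\<lbrakk>P \<in> Pol; Q \<in> Pol; R \<in> Pol\<rbrakk> \<Longrightarrow> Di P Q R \<cdot> D P Q R = I (pten P Q @ pten P R)"
proof (induct P)
  case (Cons U P)
  then show ?case by (simp add: D_Cons)
qed (simp add: D_Nil)

lemma D_Di_seq [simp]: "\<lbrakk>P \<in> Pol; Q \<in> Pol; R \<in> Pol; k \<in> arr TC; src TC k = pten P (Q @ R)\<rbrakk>
  \<Longrightarrow> D P Q R \<cdot> Di P Q R \<cdot> k = k"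
  by (subst Z.seq_assoc [symmetric]) simp_all

lemma Di_D_seq [simp]: "\<lbrakk>P \<in> Pol; Q \<in> Pol; R \<in> Pol; k \<in> arr TC; src TC k = pten P Q @ pten P R\<rbrakk>
  \<Longrightarrow> Di P Q R \<cdot> D P Q R \<cdot> k = k"
  by (subst Z.seq_assoc [symmetric]) simp_all

lemma D_zero [simp]: "\<lbrakk>P \<in> Pol; Q \<in> Pol\<rbrakk> \<Longrightarrow> D P Q [] = I (pten P Q)"
  by (induct P) (simp_all add: D_Nil D_Cons W.wsy_Nil)

lemma Di_zero [simp]: "\<lbrakk>P \<in> Pol; Q \<in> Pol\<rbrakk> \<Longrightarrow> Di P Q [] = I (pten P Q)"
  using D_Di [of P Q "[]"] by simp

lemma lwhisk1_tid [simp]: "lwhisk1 U (tid P) = tid (map ((@) U) P)"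
  by (induct P) (simp_all add: tid.simps)

lemma rwhisk1_tid [simp]: "rwhisk1 U (tid P) = tid (map (\<lambda>V. V @ U) P)"
  by (induct P) (simp_all add: tid.simps)

lemma cl_lwhisk_Cons: "\<lbrakk>W \<in> Wd; P \<in> Pol; wf t\<rbrakk> \<Longrightarrow> cl (lwhisk (W # P) t)
  = cl (lwhisk1 W t) \<^bold>\<oplus> cl (lwhisk P t)"
  by (simp add: cl_sum)

lemma cl_rwhisk_Cons: "\<lbrakk>W \<in> Wd; P \<in> Pol; wf t\<rbrakk> \<Longrightarrow> cl (rwhisk T G (W # P) t)
   = D (td t) [W] P \<cdot> (cl (rwhisk1 W t) \<^bold>\<oplus> cl (rwhisk T G P t)) \<cdot> Di (tc t) [W] P"
  by (simp add: cl_sum cl_seq pten_single)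

lemma cl_whisk_Nil: "cl (lwhisk [] t) = I []" "cl (rwhisk T G [] t) = I []"
  by (simp_all add: tid.simps(1))
declare lwhisk.simps [simp del] rwhisk.simps [simp del]

lemma lwhisk_tid: "\<lbrakk>P \<in> Pol; Q \<in> Pol\<rbrakk> \<Longrightarrow> cl (lwhisk P (tid Q)) = I (pten P Q)"
  by (induct P) (simp_all add: cl_lwhisk_Cons cl_whisk_Nil)

lemma rwhisk_tid: "\<lbrakk>P \<in> Pol; Q \<in> Pol\<rbrakk> \<Longrightarrow> cl (rwhisk T G Q (tid P)) = I (pten P Q)"
proof (induct Q)
  case (Cons U Q)
  then show ?case using D_Di [of P "[U]" Q] by (simp add: cl_rwhisk_Cons flip: pten_single)
qed (simp add: cl_whisk_Nil)

lemma ml_arr [simp]: "\<lbrakk>f \<in> arr TC; g \<in> arr TC\<rbrakk> \<Longrightarrow> f \<^bold>\<otimes> g \<in> arr TC"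
  "\<lbrakk>f \<in> arr TC; g \<in> arr TC\<rbrakk> \<Longrightarrow> src TC (f \<^bold>\<otimes> g) = pten (src TC f) (src TC g)"
  "\<lbrakk>f \<in> arr TC; g \<in> arr TC\<rbrakk> \<Longrightarrow> tgt TC (f \<^bold>\<otimes> g) = pten (tgt TC f) (tgt TC g)"
  by (auto elim!: arrE simp flip: cl_ten)

text \<open>Whiskering is defined on tapes, and that it respects their equations is not evident. As
  a product with an identity it does, since the congruence is closed under products; each clause in
  the recursion of whiskering then becomes a law for the product of classes.\<close>

lemma cl_lwhisk: "\<lbrakk>P \<in> Pol; wf t\<rbrakk> \<Longrightarrow> cl (lwhisk P t) = I P \<^bold>\<otimes> cl t"
  by (subst cl_ten [symmetric]) (simp_all add: tten_def cl_seq rwhisk_tid)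

lemma cl_rwhisk: "\<lbrakk>P \<in> Pol; wf t\<rbrakk> \<Longrightarrow> cl (rwhisk T G P t) = cl t \<^bold>\<otimes> I P"
  by (subst cl_ten [symmetric]) (simp_all add: tten_def cl_seq lwhisk_tid)

lemma cl_lwhisk1: "\<lbrakk>U \<in> Wd; wf t\<rbrakk> \<Longrightarrow> cl (lwhisk1 U t) = I [U] \<^bold>\<otimes> cl t"
  by (subst cl_lwhisk [symmetric]) (simp_all add: cl_lwhisk_Cons cl_whisk_Nil)

lemma cl_rwhisk1: "\<lbrakk>U \<in> Wd; wf t\<rbrakk> \<Longrightarrow> cl (rwhisk1 U t) = cl t \<^bold>\<otimes> I [U]"
  by (subst cl_rwhisk [symmetric]) (simp_all add: cl_rwhisk_Cons cl_whisk_Nil pten_single)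

lemma I_ml_I [simp]: "\<lbrakk>P \<in> Pol; Q \<in> Pol\<rbrakk> \<Longrightarrow> I P \<^bold>\<otimes> I Q = I (pten P Q)"
  by (simp flip: cl_lwhisk add: lwhisk_tid)

text \<open>The definition of \<open>tten\<close> read on classes. Until sliding is proved, the
  order of the two factors matters.\<close>

lemma ml_decomp: "\<lbrakk>f \<in> arr TC; g \<in> arr TC\<rbrakk> \<Longrightarrow> f \<^bold>\<otimes> g = (I (src TC f) \<^bold>\<otimes> g) \<cdot> (f \<^bold>\<otimes> I (tgt TC g))"
proof (elim arrE)
  fix t u assume [simp]: "f = cl t" "wf t" "g = cl u" "wf u"
  have "cl t \<^bold>\<otimes> cl u = cl (tten T G t u)" by (simp add: cl_ten)
  then show ?thesis by (simp add: tten_def cl_seq cl_lwhisk cl_rwhisk)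
qed

lemma I_append_ml: "\<lbrakk>P \<in> Pol; Q \<in> Pol; f \<in> arr TC\<rbrakk> \<Longrightarrow> I (P @ Q) \<^bold>\<otimes> f = I P \<^bold>\<otimes> f \<^bold>\<oplus> I Q \<^bold>\<otimes> f"
proof (elim arrE, simp flip: cl_lwhisk, goal_cases)
  case (1 t)
  then show ?case by (induct P) (simp_all add: cl_lwhisk_Cons cl_whisk_Nil)
qed

lemma I_Cons_ml: "\<lbrakk>U \<in> Wd; Q \<in> Pol; f \<in> arr TC\<rbrakk> \<Longrightarrow> I (U # Q) \<^bold>\<otimes> f = I [U] \<^bold>\<otimes> f \<^bold>\<oplus> I Q \<^bold>\<otimes> f"
  using I_append_ml [of "[U]" Q f] by simp

lemma I_Nil_ml [simp]: "f \<in> arr TC \<Longrightarrow> I [] \<^bold>\<otimes> f = I []" "f \<in> arr TC \<Longrightarrow> f \<^bold>\<otimes> I [] = I []"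
  by (auto intro!: A.ext0)

text \<open>Functoriality in one variable, with a monomial in the other, is built into the recursion
  of whiskering.\<close>

lemma I1_seq_ml: "\<lbrakk>U \<in> Wd; f \<in> arr TC; g \<in> arr TC; tgt TC f = src TC g\<rbrakk> \<Longrightarrow> I [U] \<^bold>\<otimes> (f \<cdot> g)
  = (I [U] \<^bold>\<otimes> f) \<cdot> (I [U] \<^bold>\<otimes> g)"
  by (elim arrE) (simp flip: cl_seq cl_lwhisk1)

lemma I_seq_ml: "\<lbrakk>P \<in> Pol; f \<in> arr TC; g \<in> arr TC; tgt TC f = src TC g\<rbrakk> \<Longrightarrow> I P \<^bold>\<otimes> (f \<cdot> g)
  = (I P \<^bold>\<otimes> f) \<cdot> (I P \<^bold>\<otimes> g)"
proof (induct P)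
  case (Cons U P)
  then show ?case by (simp add: I_Cons_ml [of U P] I1_seq_ml)
qed simp

lemma I1_sum_ml: "\<lbrakk>U \<in> Wd; f \<in> arr TC; g \<in> arr TC\<rbrakk> \<Longrightarrow> I [U] \<^bold>\<otimes> (f \<^bold>\<oplus> g) = I [U] \<^bold>\<otimes> f \<^bold>\<oplus> I [U] \<^bold>\<otimes> g"
  by (elim arrE) (simp flip: cl_sum cl_lwhisk1)

lemma ml_I1_seq: "\<lbrakk>U \<in> Wd; f \<in> arr TC; g \<in> arr TC; tgt TC f = src TC g\<rbrakk> \<Longrightarrow> (f \<cdot> g) \<^bold>\<otimes> I [U]
  = (f \<^bold>\<otimes> I [U]) \<cdot> (g \<^bold>\<otimes> I [U])"
  by (elim arrE) (simp flip: cl_seq cl_rwhisk1)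

lemma ml_I1_sum: "\<lbrakk>U \<in> Wd; f \<in> arr TC; g \<in> arr TC\<rbrakk> \<Longrightarrow> (f \<^bold>\<oplus> g) \<^bold>\<otimes> I [U] = f \<^bold>\<otimes> I [U] \<^bold>\<oplus> g \<^bold>\<otimes> I [U]"
  by (elim arrE) (simp flip: cl_sum cl_rwhisk1)

lemma ml_I_Cons: "\<lbrakk>U \<in> Wd; P \<in> Pol; f \<in> arr TC\<rbrakk> \<Longrightarrow> f \<^bold>\<otimes> I (U # P)
  = D (src TC f) [U] P \<cdot> (f \<^bold>\<otimes> I [U] \<^bold>\<oplus> f \<^bold>\<otimes> I P) \<cdot> Di (tgt TC f) [U] P"
proof (elim arrE)
  fix t assume [simp]: "f = cl t" "wf t" "U \<in> Wd" "P \<in> Pol"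
  have "cl t \<^bold>\<otimes> I (U # P) = cl (rwhisk T G (U # P) t)" by (simp add: cl_rwhisk)
  also have "\<dots> = D (td t) [U] P \<cdot> (cl t \<^bold>\<otimes> I [U] \<^bold>\<oplus> cl t \<^bold>\<otimes> I P) \<cdot> Di (tc t) [U] P"
    by (subst cl_rwhisk_Cons) (simp_all add: cl_rwhisk cl_rwhisk1)
  finally show ?thesis by simp
qed

lemma ml_I_seq: "\<lbrakk>P \<in> Pol; f \<in> arr TC; g \<in> arr TC; tgt TC f = src TC g\<rbrakk> \<Longrightarrow> (f \<cdot> g) \<^bold>\<otimes> I P
  = (f \<^bold>\<otimes> I P) \<cdot> (g \<^bold>\<otimes> I P)"
proof (induct P)
  case (Cons U P)
  then show ?case by (simp add: ml_I_Cons [of U P] ml_I1_seq)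
qed simp

lemma ml_B [simp]: "\<lbrakk>f \<in> arr TC; P \<in> Pol\<rbrakk> \<Longrightarrow> f \<^bold>\<otimes> B P = B (pten (tgt TC f) P)"
   "\<lbrakk>f \<in> arr TC; P \<in> Pol\<rbrakk> \<Longrightarrow> B P \<^bold>\<otimes> f = B (pten P (tgt TC f))"
  by (auto intro!: A.ext0)

abbreviation "inl \<equiv> A.inl"
abbreviation "inr \<equiv> A.inr"

lemma I1_inl: "\<lbrakk>U \<in> Wd; P \<in> Pol; Q \<in> Pol\<rbrakk> \<Longrightarrow> I [U] \<^bold>\<otimes> inl P Q
  = inl (map ((@) U) P) (map ((@) U) Q)"
  by (simp add: A.inl_def I1_sum_ml)

lemma I1_inr: "\<lbrakk>U \<in> Wd; P \<in> Pol; Q \<in> Pol\<rbrakk> \<Longrightarrow> I [U] \<^bold>\<otimes> inr P Q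
  = inr (map ((@) U) P) (map ((@) U) Q)"
  by (simp add: A.inr_def I1_sum_ml)

text \<open>On the summands coming from the first monomial of P there is nothing to distribute; on
  the others the induction hypothesis applies, and the symmetry in \<open>tdl\<close> puts both into
  place.\<close>

lemma inl_D: "\<lbrakk>P \<in> Pol; Q \<in> Pol; R \<in> Pol\<rbrakk> \<Longrightarrow> (I P \<^bold>\<otimes> inl Q R) \<cdot> D P Q R
  = inl (pten P Q) (pten P R)"
proof (induct P)
  case (Cons U P)
  then have [simp]: "U \<in> Wd" "P \<in> Pol" "Q \<in> Pol" "R \<in> Pol" by auto
  have IH: "(I P \<^bold>\<otimes> inl Q R) \<cdot> D P Q R = inl (pten P Q) (pten P R)" using Cons by simp
  show ?case
    by (rule A.ext2 [of _ _ "map ((@) U) Q" "pten P Q"]) (simp_all add: I_Cons_ml [of U P] I1_inl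
      D_Cons IH A.inr_expand)
qed (simp add: D_Nil)

lemma inr_D: "\<lbrakk>P \<in> Pol; Q \<in> Pol; R \<in> Pol\<rbrakk> \<Longrightarrow> (I P \<^bold>\<otimes> inr Q R) \<cdot> D P Q R
  = inr (pten P Q) (pten P R)"
proof (induct P)
  case (Cons U P)
  then have [simp]: "U \<in> Wd" "P \<in> Pol" "Q \<in> Pol" "R \<in> Pol" by auto
  have IH: "(I P \<^bold>\<otimes> inr Q R) \<cdot> D P Q R = inr (pten P Q) (pten P R)" using Cons by simp
  show ?case
    by (rule A.ext2 [of _ _ "map ((@) U) R" "pten P R"]) (simp_all add: I_Cons_ml [of U P] I1_inr
      D_Cons IH A.inr_expand)
qed (simp add: D_Nil)

lemma inl_Di: assumes "P \<in> Pol" "Q \<in> Pol" "R \<in> Pol"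
  shows "inl (pten P Q) (pten P R) \<cdot> Di P Q R = I P \<^bold>\<otimes> inl Q R"
  using assms by (simp flip: inl_D)

lemma inr_Di: assumes "P \<in> Pol" "Q \<in> Pol" "R \<in> Pol"
  shows "inr (pten P Q) (pten P R) \<cdot> Di P Q R = I P \<^bold>\<otimes> inr Q R"
  using assms by (simp flip: inr_D)

text \<open>The argument of \<open>extl\<close>. The locale \<open>srig\<close> is not yet
  available, because it presupposes that the product is functorial.\<close>

lemma extL: assumes "f \<in> arr TC" "g \<in> arr TC" "src TC f = pten P (Q @ R)" "src TC g
  = pten P (Q @ R)" "tgt TC f = tgt TC g"
    and [simp]: "P \<in> Pol" "Q \<in> Pol" "R \<in> Pol"
    and "(I P \<^bold>\<otimes> inl Q R) \<cdot> f = (I P \<^bold>\<otimes> inl Q R) \<cdot> g"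
    "(I P \<^bold>\<otimes> inr Q R) \<cdot> f = (I P \<^bold>\<otimes> inr Q R) \<cdot> g"
  shows "f = g"
proof -
  have "Di P Q R \<cdot> f = Di P Q R \<cdot> g"
    by (rule A.ext2 [of _ _ "pten P Q" "pten P R"])
      (use assms inl_Di [THEN Z.seq_eq, of P Q R] inr_Di [THEN Z.seq_eq, of P Q R] in simp_all)
  then have "D P Q R \<cdot> Di P Q R \<cdot> f = D P Q R \<cdot> Di P Q R \<cdot> g" by simp
  then show ?thesis using assms by simp
qed

lemma extLC: assumes "f \<in> arr TC" "g \<in> arr TC" "src TC f = pten P (U # R)" "src TC g
  = pten P (U # R)" "tgt TC f = tgt TC g"
    and "P \<in> Pol" "U \<in> Wd" "R \<in> Pol"
    and "(I P \<^bold>\<otimes> inl [U] R) \<cdot> f = (I P \<^bold>\<otimes> inl [U] R) \<cdot> g"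
    "(I P \<^bold>\<otimes> inr [U] R) \<cdot> f = (I P \<^bold>\<otimes> inr [U] R) \<cdot> g"
  shows "f = g"
  by (rule extL [of f g P "[U]" R]) (use assms in simp_all)

text \<open>For a single leading monomial this is the recursion of right whiskering: its first
  distributor turns the multiplied injection into an injection of a sum, its second one turns it
  back.\<close>

lemma slide1_inl: assumes "f \<in> arr TC" "src TC f = P" "tgt TC f = Q" "W \<in> Wd" "R \<in> Pol" "P \<in> Pol"
  "Q \<in> Pol"
  shows "(I P \<^bold>\<otimes> inl [W] R) \<cdot> (f \<^bold>\<otimes> I (W # R)) = (f \<^bold>\<otimes> I [W]) \<cdot> (I Q \<^bold>\<otimes> inl [W] R)"
  using assms inl_D [THEN Z.seq_eq, of P "[W]" R] inl_Di [of Q "[W]" R]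
    by (simp add: ml_I_Cons [of W R])

lemma slide1_inr: assumes "f \<in> arr TC" "src TC f = P" "tgt TC f = Q" "W \<in> Wd" "R \<in> Pol" "P \<in> Pol"
  "Q \<in> Pol"
  shows "(I P \<^bold>\<otimes> inr [W] R) \<cdot> (f \<^bold>\<otimes> I (W # R)) = (f \<^bold>\<otimes> I R) \<cdot> (I Q \<^bold>\<otimes> inr [W] R)"
  using assms inr_D [THEN Z.seq_eq, of P "[W]" R] inr_Di [of Q "[W]" R]
    by (simp add: ml_I_Cons [of W R])

text \<open>By induction on R: an injection into W + R + R' is composed of injections that split off
  the leading monomial, which slide by \<open>slide1_inl\<close> and \<open>slide1_inr\<close>, and
  of those into R + R'.\<close>

lemma slide_in: assumes [simp]: "f \<in> arr TC" "src TC f = P" "tgt TC f = Q" "R' \<in> Pol" "P \<in> Pol"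
  "Q \<in> Pol"
  shows "R \<in> Pol \<Longrightarrow> (I P \<^bold>\<otimes> inl R R') \<cdot> (f \<^bold>\<otimes> I (R @ R')) = (f \<^bold>\<otimes> I R) \<cdot> (I Q \<^bold>\<otimes> inl R R')
    \<and> (I P \<^bold>\<otimes> inr R R') \<cdot> (f \<^bold>\<otimes> I (R @ R')) = (f \<^bold>\<otimes> I R') \<cdot> (I Q \<^bold>\<otimes> inr R R')"
proof (induct R)
  case (Cons W R)
  then have [simp]: "W \<in> Wd" "R \<in> Pol" by auto
  have IH: "(I P \<^bold>\<otimes> inl R R') \<cdot> (f \<^bold>\<otimes> I (R @ R')) = (f \<^bold>\<otimes> I R) \<cdot> (I Q \<^bold>\<otimes> inl R R')"
    "(I P \<^bold>\<otimes> inr R R') \<cdot> (f \<^bold>\<otimes> I (R @ R')) = (f \<^bold>\<otimes> I R') \<cdot> (I Q \<^bold>\<otimes> inr R R')" using Cons by auto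
  have e: "inl [W] R \<cdot> inl (W # R) R' = inl [W] (R @ R')" "inr [W] R \<cdot> inl (W # R) R' = inl R R'
    \<cdot> inr [W] (R @ R')"
    "inr (W # R) R' = inr R R' \<cdot> inr [W] (R @ R')"
    using A.inl_inl [of "[W]" R R'] A.inr_inl [of "[W]" R R'] A.inr_expand [of "[W]" R R']
      by simp_all
  have a: "(I X \<^bold>\<otimes> inl [W] R) \<cdot> (I X \<^bold>\<otimes> inl (W # R) R') = I X \<^bold>\<otimes> inl [W] (R @ R')"
     "(I X \<^bold>\<otimes> inr [W] R) \<cdot> (I X \<^bold>\<otimes> inl (W # R) R') = (I X \<^bold>\<otimes> inl R R')
       \<cdot> (I X \<^bold>\<otimes> inr [W] (R @ R'))"
     "I X \<^bold>\<otimes> inr (W # R) R' = (I X \<^bold>\<otimes> inr R R') \<cdot> (I X \<^bold>\<otimes> inr [W] (R @ R'))" if [simp]: "X \<in> Pol"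
       for X
    using e by (simp_all flip: I_seq_ml)
  have i: "(I P \<^bold>\<otimes> inl (W # R) R') \<cdot> (f \<^bold>\<otimes> I (W # R @ R')) = (f \<^bold>\<otimes> I (W # R))
    \<cdot> (I Q \<^bold>\<otimes> inl (W # R) R')"
  proof (rule extLC [of _ _ P W R])
    show "(I P \<^bold>\<otimes> inl [W] R) \<cdot> (I P \<^bold>\<otimes> inl (W # R) R') \<cdot> (f \<^bold>\<otimes> I (W # R @ R'))
      = (I P \<^bold>\<otimes> inl [W] R) \<cdot> (f \<^bold>\<otimes> I (W # R)) \<cdot> (I Q \<^bold>\<otimes> inl (W # R) R')"
      by (simp add: a a(1,2) [THEN Z.seq_eq] slide1_inl slide1_inl [THEN Z.seq_eq])
    show "(I P \<^bold>\<otimes> inr [W] R) \<cdot> (I P \<^bold>\<otimes> inl (W # R) R') \<cdot> (f \<^bold>\<otimes> I (W # R @ R'))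
      = (I P \<^bold>\<otimes> inr [W] R) \<cdot> (f \<^bold>\<otimes> I (W # R)) \<cdot> (I Q \<^bold>\<otimes> inl (W # R) R')"
      by (simp add: a a(1,2) [THEN Z.seq_eq] slide1_inr slide1_inr [THEN Z.seq_eq] IH
        [THEN Z.seq_eq])
  qed simp_all
  then show ?case
    by (simp add: a slide1_inr IH [THEN Z.seq_eq])
qed simp

lemma slide_inl: assumes "f \<in> arr TC" "src TC f = P" "tgt TC f = Q" "R' \<in> Pol" "R \<in> Pol"
  shows "(I P \<^bold>\<otimes> inl R R') \<cdot> (f \<^bold>\<otimes> I (R @ R')) = (f \<^bold>\<otimes> I R) \<cdot> (I Q \<^bold>\<otimes> inl R R')"
  using slide_in [of f P Q R' R] assms Z.src_Ob [of f] Z.tgt_Ob [of f] by simp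

lemma slide_inr: assumes "f \<in> arr TC" "src TC f = P" "tgt TC f = Q" "R' \<in> Pol" "R \<in> Pol"
  shows "(I P \<^bold>\<otimes> inr R R') \<cdot> (f \<^bold>\<otimes> I (R @ R')) = (f \<^bold>\<otimes> I R') \<cdot> (I Q \<^bold>\<otimes> inr R R')"
  using slide_in [of f P Q R' R] assms Z.src_Ob [of f] Z.tgt_Ob [of f] by simp

end

section \<open>Circuits as tapes, and the symmetry of the product\<close>

context tapes
begin

abbreviation Ci where "Ci c \<equiv> cl (TCirc c)"

lemma Ci_seq: "\<lbrakk>wf_circ G c; wf_circ G d; ccod G c = cdom G d\<rbrakk> \<Longrightarrow> Ci c \<cdot> Ci d = Ci (CSeq c d)"
  by (simp add: cl_eqI [OF tape_eq.circ_seq] flip: cl_seq)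

lemma Ci_cid: "U \<in> Wd \<Longrightarrow> Ci (cid U) = I [U]"
  by (simp add: cl_eqI [OF tape_eq.circ_id] cl_TId)

text \<open>The bridge by which an equation computed in the quotient \<open>KAr\<close> of circuits
  is transported to tapes.\<close>

lemma Ci_eq: "\<lbrakk>kc c = kc d; wf_circ G c\<rbrakk> \<Longrightarrow> Ci c = Ci d"
  by (intro cl_eqI tape_eq.circ kc_eqD)

lemma I_Ci: "\<lbrakk>U \<in> Wd; wf_circ G c\<rbrakk> \<Longrightarrow> I [U] \<^bold>\<otimes> Ci c = Ci (CTen (cid U) c)"
  by (simp flip: cl_lwhisk1)

lemma Ci_I: "\<lbrakk>U \<in> Wd; wf_circ G c\<rbrakk> \<Longrightarrow> Ci c \<^bold>\<otimes> I [U] = Ci (CTen c (cid U))"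
  by (simp flip: cl_rwhisk1)

context
begin

interpretation K: words_cd "sorts G" KAr ksrc ktgt "\<lambda>U. kc (cid U)" "(\<cdot>\<^sub>K)" "(\<oplus>\<^sub>K)"
   "\<lambda>A B. kc (CSym A B)" "\<lambda>A V. kc (csym1 A V)" "\<lambda>U V. kc (csym U V)"
   "\<lambda>A. kc (CCopy A)" "\<lambda>A. kc (CDisc A)" "\<lambda>U. kc (ccopy U)" "\<lambda>U. kc (cdisc U)"
  by (rule KAr_cd)

lemma Ci_slide: assumes [simp]: "wf_circ G c" "wf_circ G d"
  shows "(I [cdom G d] \<^bold>\<otimes> Ci c) \<cdot> (Ci d \<^bold>\<otimes> I [ccod G c]) = (Ci d \<^bold>\<otimes> I [cdom G c])
    \<cdot> (I [ccod G d] \<^bold>\<otimes> Ci c)"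
proof -
  have "kc (CSeq (CTen (cid (cdom G d)) c) (CTen d (cid (ccod G c))))
    = kc (CSeq (CTen d (cid (cdom G c))) (CTen (cid (ccod G d)) c))"
    using K.slide [of "kc d" "kc c" "cdom G d" "ccod G d" "cdom G c" "ccod G c"] by simp
  from Ci_eq [OF this] show ?thesis by (simp add: I_Ci Ci_I Ci_seq)
qed

lemma Ci_csym_inv: assumes [simp]: "U \<in> Wd" "V \<in> Wd" shows "Ci (csym U V) \<cdot> Ci (csym V U)
  = I [U @ V]"
proof -
  have "kc (CSeq (csym U V) (csym V U)) = kc (cid (U @ V))" using K.S.sy_sy [of U V] by simp
  then have "Ci (CSeq (csym U V) (csym V U)) = Ci (cid (U @ V))" by (rule Ci_eq) simp
  then show ?thesis by (simp add: Ci_seq Ci_cid)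
qed

lemma Ci_csym_nat: assumes [simp]: "wf_circ G c" "W \<in> Wd"
  shows "(Ci c \<^bold>\<otimes> I [W]) \<cdot> Ci (csym (ccod G c) W) = Ci (csym (cdom G c) W) \<cdot> (I [W] \<^bold>\<otimes> Ci c)"
proof -
  have "kc (CSeq (CTen c (cid W)) (csym (ccod G c) W))
    = kc (CSeq (csym (cdom G c) W) (CTen (cid W) c))"
    using K.wsy_natural1 [of "kc c" W] by simp
  from Ci_eq [OF this] show ?thesis by (simp add: I_Ci Ci_I Ci_seq)
qed

lemma Ci_csym_hex: assumes [simp]: "U \<in> Wd" "V \<in> Wd" "W \<in> Wd"
  shows "Ci (csym U (V @ W)) = (Ci (csym U V) \<^bold>\<otimes> I [W]) \<cdot> (I [V] \<^bold>\<otimes> Ci (csym U W))"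
proof -
  have "kc (csym U (V @ W)) = kc (CSeq (CTen (csym U V) (cid W)) (CTen (cid V) (csym U W)))"
    using K.S.sy_hex [of U V W] by simp
  from Ci_eq [OF this] show ?thesis by (simp add: I_Ci Ci_I Ci_seq)
qed

lemma Ci_assoc: assumes [simp]: "wf_circ G c" "wf_circ G d" "wf_circ G e"
  shows "Ci (CTen (CTen c d) e) = Ci (CTen c (CTen d e))"
  by (intro cl_eqI tape_eq.circ circ_eq.ten_assoc) simp_all

lemma Ci_cid_append: assumes [simp]: "U \<in> Wd" "V \<in> Wd" "wf_circ G c"
  shows "Ci (CTen (cid U) (CTen (cid V) c)) = Ci (CTen (cid (U @ V)) c)"
    "Ci (CTen (CTen c (cid U)) (cid V)) = Ci (CTen c (cid (U @ V)))"
proof -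
  have "kc (CTen (cid U) (CTen (cid V) c)) = kc (CTen (cid (U @ V)) c)"
    "kc (CTen (CTen c (cid U)) (cid V)) = kc (CTen c (cid (U @ V)))"
  proof -
    show "kc (CTen (cid U) (CTen (cid V) c)) = kc (CTen (cid (U @ V)) c)"
      using K.whisk(3) [of "kc c" U V] by simp
    have "kc (CTen c (CTen (cid U) (cid V))) = kc c \<oplus>\<^sub>K kc (CTen (cid U) (cid V))" by simp
    also have "kc (CTen (cid U) (cid V)) = kc (cid (U @ V))" using K.tA_ide [of U V]
      by (simp del: K.tA_ide)
    finally show "kc (CTen (CTen c (cid U)) (cid V)) = kc (CTen c (cid (U @ V)))"
      using K.tA_assoc [of "kc c" "kc (cid U)" "kc (cid V)"] by (simp del: K.tA_assoc)
  qed
  from this [THEN Ci_eq] show "Ci (CTen (cid U) (CTen (cid V) c)) = Ci (CTen (cid (U @ V)) c)"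
    "Ci (CTen (CTen c (cid U)) (cid V)) = Ci (CTen c (cid (U @ V)))"
    by simp_all
qed

lemma Ci_unit: assumes "wf_circ G c" shows "Ci (CTen CId1 c) = Ci c" "Ci (CTen c CId1) = Ci c"
  using assms by (auto intro!: cl_eqI tape_eq.circ circ_eq.one_ten circ_eq.ten_one)

end

lemma one_ml [simp]: assumes "f \<in> arr TC" shows "I [[]] \<^bold>\<otimes> f = f"
proof -
  have "cl (lwhisk1 [] t) = cl t" if "wf t" for t
    using that by (induct t) (simp_all add: cl_seq cl_sum Ci_unit)
  with assms show ?thesis by (auto elim!: arrE simp flip: cl_lwhisk1)
qed

lemma ml_one [simp]: assumes "f \<in> arr TC" shows "f \<^bold>\<otimes> I [[]] = f"
proof -
  have "cl (rwhisk1 [] t) = cl t" if "wf t" for t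
    using that by (induct t) (simp_all add: cl_seq cl_sum Ci_unit)
  with assms show ?thesis by (auto elim!: arrE simp flip: cl_rwhisk1)
qed

text \<open>An n-fold sum of a tape is its product with the sum of n units. In this form the axiom
  on operations relates operations to the product, see \<open>op_natural\<close>.\<close>

lemma tsum_replicate: assumes "wf t" shows "cl (tsum (replicate n t)) = I (replicate n []) \<^bold>\<otimes> cl
  t"
proof (induct n)
  case (Suc n)
  then show ?case using assms by (simp add: cl_sum I_Cons_ml [of "[]" "replicate n []"])
qed (use assms in \<open>simp add: tid.simps(1) [symmetric]\<close>)

lemma top_single: "\<lbrakk>f \<in> ops T; U \<in> Wd\<rbrakk> \<Longrightarrow> cl (top_poly T f [U]) = cl (TOp f U)"
  by (simp add: cl_sum cl_seq pten_replicate1 flip: tid.simps(1))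

lemma top_Cons: "\<lbrakk>f \<in> ops T; U \<in> Wd; P \<in> Pol\<rbrakk> \<Longrightarrow>
  cl (top_poly T f (U # P)) = (cl (TOp f U) \<^bold>\<oplus> cl (top_poly T f P))
    \<cdot> Di (replicate (arity T f) []) [U] P"
  by (simp add: cl_sum cl_seq pten_replicate1)
declare top_poly.simps [simp del]

lemma op_natural: assumes "f \<in> ops T" "a \<in> arr TC"
  shows "a \<cdot> cl (top_poly T f (tgt TC a)) = cl (top_poly T f (src TC a))
    \<cdot> (I (replicate (arity T f) []) \<^bold>\<otimes> a)"
  using assms(2)
proof (elim arrE)
  fix t assume [simp]: "a = cl t" "wf t"
  show ?thesis using tape_eq.op_nat [THEN cl_eqI, of f t] assms(1)
    by (simp add: cl_seq tsum_replicate map_replicate_const pten_replicate)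
qed

text \<open>The symmetry of a polynomial with a single monomial V. Multiplication by V on the right
  distributes strictly, so the monomials of P are swapped with V one by one; \<open>M_single\<close>
  identifies the result.\<close>

definition Cs where "Cs P V = cl (tsum (map (\<lambda>U. TCirc (csym U V)) P))"

lemma Cs_Nil: "Cs [] V = I []" by (simp add: Cs_def tid.simps)

lemma Cs_Cons: "\<lbrakk>U \<in> Wd; P \<in> Pol; V \<in> Wd\<rbrakk> \<Longrightarrow> Cs (U # P) V = Ci (csym U V) \<^bold>\<oplus> Cs P V"
  by (simp add: Cs_def cl_sum)

lemma Cs_type [simp]: assumes "P \<in> Pol" "V \<in> Wd" shows "Cs P V \<in> arr TC" "src TC (Cs P V)
  = pten P [V]" "tgt TC (Cs P V) = map ((@) V) P"
  using assms by (auto simp: Cs_def pten_single o_def)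

lemma Cs_append: "\<lbrakk>P \<in> Pol; Q \<in> Pol; V \<in> Wd\<rbrakk> \<Longrightarrow> Cs (P @ Q) V = Cs P V \<^bold>\<oplus> Cs Q V"
  by (induct P) (simp_all add: Cs_Nil Cs_Cons)

lemma Cs_single: "\<lbrakk>U \<in> Wd; V \<in> Wd\<rbrakk> \<Longrightarrow> Cs [U] V = Ci (csym U V)"
  by (simp add: Cs_Nil Cs_Cons)

lemma Cs_replicate: "\<lbrakk>U \<in> Wd; V \<in> Wd\<rbrakk> \<Longrightarrow> Cs (replicate n U) V = I (replicate n []) \<^bold>\<otimes> Ci
  (csym U V)"
proof (induct n)
  case (Suc n)
  then show ?case by (simp add: Cs_Cons I_Cons_ml [of "[]" "replicate n []"])
qed (simp add: Cs_Nil)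

lemma M_Nil: "M P [] = I []" by (simp add: tid.simps)

lemma M_Cons: "\<lbrakk>P \<in> Pol; Q \<in> Pol; V \<in> Wd\<rbrakk> \<Longrightarrow> M P (V # Q) = D P [V] Q \<cdot> (Cs P V \<^bold>\<oplus> M P Q)"
  by (simp add: Cs_def cl_seq cl_sum pten_single o_def)
declare tsymm.simps [simp del]

lemma M_single: "\<lbrakk>P \<in> Pol; V \<in> Wd\<rbrakk> \<Longrightarrow> M P [V] = Cs P V"
  by (simp add: M_Cons M_Nil)

lemma M_Nil' : "P \<in> Pol \<Longrightarrow> M [] P = I []"
  by (intro A.ext0) simp_all

lemma inl_I_append: assumes "A \<in> Pol" "B' \<in> Pol" "f \<in> arr TC"
  shows "inl (pten A (src TC f)) (pten B' (src TC f)) \<cdot> (I (A @ B') \<^bold>\<otimes> f) = (I A \<^bold>\<otimes> f)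
    \<cdot> inl (pten A (tgt TC f)) (pten B' (tgt TC f))"
    "inr (pten A (src TC f)) (pten B' (src TC f)) \<cdot> (I (A @ B') \<^bold>\<otimes> f) = (I B' \<^bold>\<otimes> f)
      \<cdot> inr (pten A (tgt TC f)) (pten B' (tgt TC f))"
  using assms by (simp_all add: I_append_ml)

lemma Cs_inv: "\<lbrakk>P \<in> Pol; U \<in> Wd\<rbrakk> \<Longrightarrow> M [U] P \<cdot> Cs P U = I (pten [U] P)"
proof (induct P)
  case (Cons V P)
  then have [simp]: "V \<in> Wd" "P \<in> Pol" "U \<in> Wd" by auto
  have "D [U] [V] P = I (map ((@) U) (V # P))" using \<open>U \<in> Wd\<close> \<open>V \<in> Wd\<close> \<open>P \<in> Pol\<close>
    by (simp add: D_Cons D_Nil W.wsy_Nil)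
  then show ?case using Cons by (simp add: M_Cons Cs_Cons Cs_Nil Ci_csym_inv)
qed (simp add: M_Nil' Cs_Nil M_Nil)

text \<open>Naturality of the symmetry at the injections into its first argument, on which the
  recursion of \<open>tsymm\<close> says nothing. Both sides are tested on the summands V and Q of
  the second argument, where that recursion unfolds.\<close>

lemma M_inl_inr: "\<lbrakk>A \<in> Pol; B' \<in> Pol; Q \<in> Pol\<rbrakk> \<Longrightarrow>
    inl (pten A Q) (pten B' Q) \<cdot> M (A @ B') Q = M A Q \<cdot> (I Q \<^bold>\<otimes> inl A B')
  \<and> inr (pten A Q) (pten B' Q) \<cdot> M (A @ B') Q = M B' Q \<cdot> (I Q \<^bold>\<otimes> inr A B')"
proof (induct Q)
  case Nil
  then show ?case by (intro conjI A.ext0) simp_all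
next
  case (Cons V Q)
  then have [simp]: "A \<in> Pol" "B' \<in> Pol" "V \<in> Wd" "Q \<in> Pol" by auto
  have IH: "inl (pten A Q) (pten B' Q) \<cdot> M (A @ B') Q = M A Q \<cdot> (I Q \<^bold>\<otimes> inl A B')"
    "inr (pten A Q) (pten B' Q) \<cdot> M (A @ B') Q = M B' Q \<cdot> (I Q \<^bold>\<otimes> inr A B')" using Cons by auto
  have 1: "(I X \<^bold>\<otimes> inl [V] Q) \<cdot> M X (V # Q) = Cs X V \<cdot> inl (map ((@) V) X) (pten Q X)"
    "(I X \<^bold>\<otimes> inr [V] Q) \<cdot> M X (V # Q) = M X Q \<cdot> inr (map ((@) V) X) (pten Q X)" if [simp]:
      "X \<in> Pol" for X
    using inl_D [THEN Z.seq_eq, of X "[V]" Q] inr_D [THEN Z.seq_eq, of X "[V]" Q]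
      by (simp_all add: M_Cons)
  note iA = inl_I_append(1) [of A B' "inl [V] Q", simplified] inl_I_append(1)
    [of A B' "inr [V] Q", simplified]
    inl_I_append(2) [of A B' "inl [V] Q", simplified] inl_I_append(2) [of A B' "inr [V] Q",
      simplified]
  \<comment> \<open>The four restrictions: a summand of the first argument together with a summand
    of the second.\<close>
  have 2: "(I A \<^bold>\<otimes> inl [V] Q) \<cdot> inl (pten A (V # Q)) (pten B' (V # Q)) \<cdot> M (A @ B') (V # Q)
      = Cs A V \<cdot> inl (map ((@) V) A) (map ((@) V) B') \<cdot> inl (map ((@) V) (A @ B'))
        (pten Q (A @ B'))"
    "(I A \<^bold>\<otimes> inr [V] Q) \<cdot> inl (pten A (V # Q)) (pten B' (V # Q)) \<cdot> M (A @ B') (V # Q)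
      = M A Q \<cdot> (I Q \<^bold>\<otimes> inl A B') \<cdot> inr (map ((@) V) (A @ B')) (pten Q (A @ B'))"
    "(I B' \<^bold>\<otimes> inl [V] Q) \<cdot> inr (pten A (V # Q)) (pten B' (V # Q)) \<cdot> M (A @ B') (V # Q)
      = Cs B' V \<cdot> inr (map ((@) V) A) (map ((@) V) B') \<cdot> inl (map ((@) V) (A @ B'))
        (pten Q (A @ B'))"
    "(I B' \<^bold>\<otimes> inr [V] Q) \<cdot> inr (pten A (V # Q)) (pten B' (V # Q)) \<cdot> M (A @ B') (V # Q)
      = M B' Q \<cdot> (I Q \<^bold>\<otimes> inr A B') \<cdot> inr (map ((@) V) (A @ B')) (pten Q (A @ B'))"
    using iA [symmetric, THEN Z.seq_eq, of "M (A @ B') (V # Q)"] 1 [of "A @ B'"] IH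
      [THEN Z.seq_eq]
    by (simp_all add: Cs_append del: A.inl_inl A.inr_inl)
  have 3: "I (V # Q) \<^bold>\<otimes> inl A B' = inl (map ((@) V) A) (map ((@) V) B') \<^bold>\<oplus> (I Q \<^bold>\<otimes> inl A B')"
    "I (V # Q) \<^bold>\<otimes> inr A B' = inr (map ((@) V) A) (map ((@) V) B') \<^bold>\<oplus> (I Q \<^bold>\<otimes> inr A B')"
    by (simp_all add: I_Cons_ml [of V Q] I1_inl I1_inr)
  have 4: "inl (pten A (V # Q)) (pten B' (V # Q)) \<cdot> M (A @ B') (V # Q) = M A (V # Q)
    \<cdot> (I (V # Q) \<^bold>\<otimes> inl A B')"
    by (rule extLC [of _ _ A V Q]) (simp_all add: 1 [THEN Z.seq_eq], simp_all add: 2 3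
      del: A.inl_inl A.inr_inl)
  have 5: "inr (pten A (V # Q)) (pten B' (V # Q)) \<cdot> M (A @ B') (V # Q) = M B' (V # Q)
    \<cdot> (I (V # Q) \<^bold>\<otimes> inr A B')"
    by (rule extLC [of _ _ B' V Q]) (simp_all add: 1 [THEN Z.seq_eq], simp_all add: 2 3
      del: A.inl_inl A.inr_inl)
  show ?case using 4 5 by blast
qed

lemmas M_inl = M_inl_inr [THEN conjunct1] and M_inr = M_inl_inr [THEN conjunct2]

text \<open>One symmetry is expanded by recursion in its second argument, the other by
  \<open>M_inl_inr\<close> in its first. On the two summands \<open>Cs_inv\<close> and the induction
  hypothesis remain.\<close>

lemma M_inv: "\<lbrakk>P \<in> Pol; Q \<in> Pol\<rbrakk> \<Longrightarrow> M P Q \<cdot> M Q P = I (pten P Q)"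
proof (induct P)
  case (Cons U P)
  then have [simp]: "U \<in> Wd" "P \<in> Pol" "Q \<in> Pol" by auto
  have IH: "M P Q \<cdot> M Q P = I (pten P Q)" using Cons by simp
  have 1: "inl (map ((@) U) Q) (pten P Q) \<cdot> M (U # P) Q = M [U] Q \<cdot> (I Q \<^bold>\<otimes> inl [U] P)"
    "inr (map ((@) U) Q) (pten P Q) \<cdot> M (U # P) Q = M P Q \<cdot> (I Q \<^bold>\<otimes> inr [U] P)"
    using M_inl [of "[U]" P Q] M_inr [of "[U]" P Q] by simp_all
  have 2: "M Q (U # P) = D Q [U] P \<cdot> (Cs Q U \<^bold>\<oplus> M Q P)" by (simp add: M_Cons)
  have 3: "M [U] Q \<cdot> Cs Q U = I (map ((@) U) Q)" using Cs_inv [of Q U] by simp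
  show ?case
    by (rule A.ext2 [of _ _ "map ((@) U) Q" "pten P Q"])
      (simp_all add: 1 [THEN Z.seq_eq] 2 inl_D [THEN Z.seq_eq] inr_D [THEN Z.seq_eq] 3
        [THEN Z.seq_eq] IH [THEN Z.seq_eq])
qed (simp add: M_Nil M_Nil')

lemma ml_I1_TOp: "\<lbrakk>f \<in> ops T; U \<in> Wd; W \<in> Wd\<rbrakk> \<Longrightarrow> cl (TOp f U) \<^bold>\<otimes> I [W] = cl (TOp f (U @ W))"
  by (simp flip: cl_rwhisk1)

lemma I1_ml_TOp: "\<lbrakk>f \<in> ops T; U \<in> Wd; W \<in> Wd\<rbrakk> \<Longrightarrow> I [W] \<^bold>\<otimes> cl (TOp f U) = cl (TOp f (W @ U))"
  by (simp flip: cl_lwhisk1)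

lemma TSym_S: "\<lbrakk>U \<in> Wd; V \<in> Wd\<rbrakk> \<Longrightarrow> cl (TSym U V) = S [U] [V]"
  by (simp add: W.wsy_single W.wsy1_single)

lemma ml_I1_TSym: "\<lbrakk>U \<in> Wd; V \<in> Wd; W \<in> Wd\<rbrakk> \<Longrightarrow> S [U] [V] \<^bold>\<otimes> I [W] = S [U @ W] [V @ W]"
  by (simp flip: cl_rwhisk1 TSym_S)

lemma I1_ml_TSym: "\<lbrakk>U \<in> Wd; V \<in> Wd; W \<in> Wd\<rbrakk> \<Longrightarrow> I [W] \<^bold>\<otimes> S [U] [V] = S [W @ U] [W @ V]"
  by (simp flip: cl_lwhisk1 TSym_S)

lemma ml_I1_TNab: "\<lbrakk>U \<in> Wd; W \<in> Wd\<rbrakk> \<Longrightarrow> N [U] \<^bold>\<otimes> I [W] = N [U @ W]"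
  by (simp add: N_single flip: cl_rwhisk1)

lemma I1_ml_TNab: "\<lbrakk>U \<in> Wd; W \<in> Wd\<rbrakk> \<Longrightarrow> I [W] \<^bold>\<otimes> N [U] = N [W @ U]"
  by (simp add: N_single flip: cl_lwhisk1)

lemma op_natural1: assumes "f \<in> ops T" "wf_circ G c"
  shows "Ci c \<cdot> cl (TOp f (ccod G c)) = cl (TOp f (cdom G c))
    \<cdot> (I (replicate (arity T f) []) \<^bold>\<otimes> Ci c)"
  using op_natural [of f "Ci c"] assms by (simp add: top_single)

text \<open>Pasting of two naturality squares, for the case of a composite tape.\<close>

lemma seq_chain: "\<lbrakk>f \<cdot> h = h' \<cdot> k; g \<cdot> h2 = h \<cdot> m; f \<in> arr TC; g \<in> arr TC; h \<in> arr TC; h' \<in> arr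
  TC; k \<in> arr TC; m \<in> arr TC; h2 \<in> arr TC;
   tgt TC f = src TC g; tgt TC g = src TC h2; src TC h = tgt TC f; tgt TC h = src TC m; tgt TC h'
     = src TC k; tgt TC k = tgt TC h\<rbrakk>
  \<Longrightarrow> (f \<cdot> g) \<cdot> h2 = h' \<cdot> k \<cdot> m"
  by (metis Z.seq_assoc)

text \<open>By induction on the tape. For an operation this is the operation axiom at the circuit
  \<open>csym U W\<close>; for \<open>TNab\<close> it is naturality of the monoids at that
  circuit.\<close>

lemma Cs_natural: "\<lbrakk>wf t; W \<in> Wd\<rbrakk> \<Longrightarrow> (cl t \<^bold>\<otimes> I [W]) \<cdot> Cs (tc t) W = Cs (td t) W \<cdot> (I [W] \<^bold>\<otimes> cl t)"
proof (induct t)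
  case (TCirc c)
  then show ?case by (simp add: Cs_single Ci_csym_nat)
next
  case (TSym U V)
  then show ?case using Y.sy_nat [of "Ci (csym U W)" "Ci (csym V W)"]
    by (simp add: TSym_S ml_I1_TSym I1_ml_TSym Cs_Cons Cs_Nil)
next
  case (TSeq t u)
  then show ?case
    by (simp add: cl_seq ml_I1_seq I1_seq_ml del: Z.seq_assoc) (rule seq_chain, auto)
next
  case (TSum t u)
  then show ?case by (simp add: cl_sum ml_I1_sum I1_sum_ml Cs_append)
next
  case (TBng U)
  then show ?case by (intro A.ext0) simp_all
next
  case (TNab U)
  then show ?case using A.nab_natural [of "Ci (csym U W)"]
    by (simp add: ml_I1_TNab I1_ml_TNab Cs_Cons Cs_Nil flip: N_single)
next
  case (TOp f U)
  then show ?case using op_natural1 [of f "csym U W"]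
    by (simp add: ml_I1_TOp I1_ml_TOp Cs_single Cs_replicate)
qed (simp_all add: cl_TId Cs_Nil tid.simps(1) [symmetric])

text \<open>On the leading monomial of R this is \<open>Cs_natural\<close>, on the rest the
  induction hypothesis. The proof slides only injections past f, not arbitrary tapes, so that it may
  be used in proving the latter.\<close>

lemma M_natural1: assumes f: "f \<in> arr TC"
  shows "R \<in> Pol \<Longrightarrow> (f \<^bold>\<otimes> I R) \<cdot> M (tgt TC f) R = M (src TC f) R \<cdot> (I R \<^bold>\<otimes> f)"
proof (induct R)
  case Nil
  then show ?case using f by (simp add: M_Nil)
next
  case (Cons W R)
  then have [simp]: "W \<in> Wd" "R \<in> Pol" using Cons by auto
  have IH: "(f \<^bold>\<otimes> I R) \<cdot> M (tgt TC f) R = M (src TC f) R \<cdot> (I R \<^bold>\<otimes> f)" using Cons by simp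
  have c: "(f \<^bold>\<otimes> I [W]) \<cdot> Cs (tgt TC f) W = Cs (src TC f) W \<cdot> (I [W] \<^bold>\<otimes> f)"
    using f by (auto elim!: arrE simp: Cs_natural)
  note [simp] = f
  have 1: "(I X \<^bold>\<otimes> inl [W] R) \<cdot> M X (W # R) = Cs X W \<cdot> inl (map ((@) W) X) (pten R X)"
    "(I X \<^bold>\<otimes> inr [W] R) \<cdot> M X (W # R) = M X R \<cdot> inr (map ((@) W) X) (pten R X)" if [simp]:
      "X \<in> Pol" for X
    using inl_D [THEN Z.seq_eq, of X "[W]" R] inr_D [THEN Z.seq_eq, of X "[W]" R]
      by (simp_all add: M_Cons)
  have 2: "I (W # R) \<^bold>\<otimes> f = (I [W] \<^bold>\<otimes> f) \<^bold>\<oplus> (I R \<^bold>\<otimes> f)" by (simp add: I_Cons_ml [of W R])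
  show ?case
  proof (rule extLC [of _ _ "src TC f" W R])
    show "(I (src TC f) \<^bold>\<otimes> inl [W] R) \<cdot> (f \<^bold>\<otimes> I (W # R)) \<cdot> M (tgt TC f) (W # R)
      = (I (src TC f) \<^bold>\<otimes> inl [W] R) \<cdot> M (src TC f) (W # R) \<cdot> (I (W # R) \<^bold>\<otimes> f)"
      using c [THEN Z.seq_eq] by (simp add: slide1_inl [THEN Z.seq_eq] 1 1 [THEN Z.seq_eq] 2)
    show "(I (src TC f) \<^bold>\<otimes> inr [W] R) \<cdot> (f \<^bold>\<otimes> I (W # R)) \<cdot> M (tgt TC f) (W # R)
      = (I (src TC f) \<^bold>\<otimes> inr [W] R) \<cdot> M (src TC f) (W # R) \<cdot> (I (W # R) \<^bold>\<otimes> f)"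
      using IH [THEN Z.seq_eq] by (simp add: slide1_inr [THEN Z.seq_eq] 1 1 [THEN Z.seq_eq] 2)
  qed simp_all
qed

text \<open>Iterated whiskering by monomials is compared on the syntax, where only unit and
  associativity laws of circuits enter. The following lemmas replace the monomials by polynomials
  one factor at a time.\<close>

lemma I1_I1_ml: "\<lbrakk>U \<in> Wd; V \<in> Wd; f \<in> arr TC\<rbrakk> \<Longrightarrow> I [U] \<^bold>\<otimes> I [V] \<^bold>\<otimes> f = I [U @ V] \<^bold>\<otimes> f"
proof (elim arrE)
  fix t assume "U \<in> Wd" "V \<in> Wd" "f = cl t" "wf t"
  then have "cl (lwhisk1 U (lwhisk1 V t)) = cl (lwhisk1 (U @ V) t)"
    by (induct t arbitrary: f) (simp_all add: cl_seq cl_sum Ci_cid_append)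
  then show ?thesis using \<open>U \<in> Wd\<close> \<open>V \<in> Wd\<close> \<open>f = cl t\<close> \<open>wf t\<close> by (simp add: cl_lwhisk1)
qed

lemma ml_I1_I1: "\<lbrakk>U \<in> Wd; V \<in> Wd; f \<in> arr TC\<rbrakk> \<Longrightarrow> (f \<^bold>\<otimes> I [U]) \<^bold>\<otimes> I [V] = f \<^bold>\<otimes> I [U @ V]"
proof (elim arrE)
  fix t assume "U \<in> Wd" "V \<in> Wd" "f = cl t" "wf t"
  then have "cl (rwhisk1 V (rwhisk1 U t)) = cl (rwhisk1 (U @ V) t)"
    by (induct t arbitrary: f) (simp_all add: cl_seq cl_sum Ci_cid_append)
  then show ?thesis using \<open>U \<in> Wd\<close> \<open>V \<in> Wd\<close> \<open>f = cl t\<close> \<open>wf t\<close> by (simp add: cl_rwhisk1)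
qed

lemma I1_ml_I1: "\<lbrakk>U \<in> Wd; V \<in> Wd; f \<in> arr TC\<rbrakk> \<Longrightarrow> (I [U] \<^bold>\<otimes> f) \<^bold>\<otimes> I [V] = I [U] \<^bold>\<otimes> f \<^bold>\<otimes> I [V]"
proof (elim arrE)
  fix t assume "U \<in> Wd" "V \<in> Wd" "f = cl t" "wf t"
  then have "cl (rwhisk1 V (lwhisk1 U t)) = cl (lwhisk1 U (rwhisk1 V t))"
    by (induct t arbitrary: f) (simp_all add: cl_seq cl_sum Ci_assoc)
  then show ?thesis using \<open>U \<in> Wd\<close> \<open>V \<in> Wd\<close> \<open>f = cl t\<close> \<open>wf t\<close> by (simp add: cl_rwhisk1 cl_lwhisk1)
qed

lemma I1_I_ml: "\<lbrakk>U \<in> Wd; Q \<in> Pol; f \<in> arr TC\<rbrakk> \<Longrightarrow> I [U] \<^bold>\<otimes> I Q \<^bold>\<otimes> f = I (map ((@) U) Q) \<^bold>\<otimes> f"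
proof (induct Q)
  case (Cons V Q)
  then show ?case by (simp add: I_Cons_ml [of V Q] I1_sum_ml I1_I1_ml I_Cons_ml
    [of "U @ V" "map ((@) U) Q"])
qed simp

lemma I_I_ml: "\<lbrakk>P \<in> Pol; Q \<in> Pol; f \<in> arr TC\<rbrakk> \<Longrightarrow> I P \<^bold>\<otimes> I Q \<^bold>\<otimes> f = I (pten P Q) \<^bold>\<otimes> f"
proof (induct P)
  case (Cons V P)
  then show ?case by (simp add: I_Cons_ml [of V P] I1_I_ml I_append_ml)
qed simp

text \<open>The two sides contain different distributors, so their recursions are not compared
  directly; instead both are restricted to the summands of R and slid past the injections.\<close>

lemma ml_I1_I: "\<lbrakk>V \<in> Wd; R \<in> Pol; f \<in> arr TC\<rbrakk> \<Longrightarrow> (f \<^bold>\<otimes> I [V]) \<^bold>\<otimes> I R = f \<^bold>\<otimes> I (map ((@) V) R)"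
proof (induct R)
  case (Cons W R)
  then have [simp]: "W \<in> Wd" "R \<in> Pol" "V \<in> Wd" "f \<in> arr TC" by auto
  let ?P = "src TC f" and ?Q = "tgt TC f"
  have 1: "I (pten X [V]) \<^bold>\<otimes> inl [W] R = I X \<^bold>\<otimes> inl [V @ W] (map ((@) V) R)"
    "I (pten X [V]) \<^bold>\<otimes> inr [W] R = I X \<^bold>\<otimes> inr [V @ W] (map ((@) V) R)" if [simp]: "X \<in> Pol" for X
    by (simp_all add: I1_inl I1_inr flip: I_I_ml)
  show ?case
  proof (rule extLC [of _ _ "pten ?P [V]" W R])
    show "(I (pten ?P [V]) \<^bold>\<otimes> inl [W] R) \<cdot> ((f \<^bold>\<otimes> I [V]) \<^bold>\<otimes> I (W # R)) =
      (I (pten ?P [V]) \<^bold>\<otimes> inl [W] R) \<cdot> (f \<^bold>\<otimes> I (map ((@) V) (W # R)))"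
      by (subst slide1_inl [where Q = "pten ?Q [V]"]) (simp_all add: 1 slide1_inl ml_I1_I1)
    show "(I (pten ?P [V]) \<^bold>\<otimes> inr [W] R) \<cdot> ((f \<^bold>\<otimes> I [V]) \<^bold>\<otimes> I (W # R)) =
      (I (pten ?P [V]) \<^bold>\<otimes> inr [W] R) \<cdot> (f \<^bold>\<otimes> I (map ((@) V) (W # R)))"
      using Cons by (subst slide1_inr [where Q = "pten ?Q [V]"]) (simp_all add: 1 slide1_inr)
  qed simp_all
qed simp

end

section \<open>Sliding of tapes, and the monoidal laws of the product\<close>

context tapes
begin

text \<open>By induction on the tape that the circuit passes. At an operation it is the operation
  axiom for the circuit c with an identity on its left.\<close>

lemma slide_circ: assumes c [simp]: "wf_circ G c"
  shows "wf t \<Longrightarrow> (I (td t) \<^bold>\<otimes> Ci c) \<cdot> (cl t \<^bold>\<otimes> I [ccod G c]) = (cl t \<^bold>\<otimes> I [cdom G c])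
    \<cdot> (I (tc t) \<^bold>\<otimes> Ci c)"
proof (induct t)
  case (TCirc d)
  then show ?case by (simp add: Ci_slide)
next
  case (TSym U V)
  then show ?case using Y.sy_nat [of "I [U] \<^bold>\<otimes> Ci c" "I [V] \<^bold>\<otimes> Ci c"]
    by (simp add: TSym_S ml_I1_TSym I_Cons_ml [of _ "[_]"])
next
  case (TSeq t u)
  then have [simp]: "wf t" "wf u" "tc t = td u" by auto
  have IH: "(I (td t) \<^bold>\<otimes> Ci c) \<cdot> (cl t \<^bold>\<otimes> I [ccod G c]) = (cl t \<^bold>\<otimes> I [cdom G c])
    \<cdot> (I (td u) \<^bold>\<otimes> Ci c)"
    "(I (td u) \<^bold>\<otimes> Ci c) \<cdot> (cl u \<^bold>\<otimes> I [ccod G c]) = (cl u \<^bold>\<otimes> I [cdom G c]) \<cdot> (I (tc u) \<^bold>\<otimes> Ci c)"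
      using TSeq by auto
  show ?case by (simp add: cl_seq ml_I1_seq IH IH(1) [THEN Z.seq_eq])
next
  case (TSum t u)
  then show ?case by (simp add: cl_sum ml_I1_sum I_append_ml)
next
  case (TBng U)
  then show ?case by (intro A.ext0) simp_all
next
  case (TNab U)
  then show ?case using A.nab_natural [of "I [U] \<^bold>\<otimes> Ci c"]
    by (simp add: ml_I1_TNab I_Cons_ml [of _ "[_]"] flip: N_single)
next
  case (TOp f U)
  have 1: "I (replicate n U) \<^bold>\<otimes> Ci c = I (replicate n []) \<^bold>\<otimes> I [U] \<^bold>\<otimes> Ci c" for n
    using TOp by (simp add: I_I_ml pten_replicate1)
  show ?case using TOp op_natural1 [of f "CTen (cid U) c"]
    by (simp add: ml_I1_TOp 1) (simp add: I_Ci)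
qed (simp_all add: cl_TId tid.simps(1) [symmetric])

text \<open>An operation of arity n at P ends in n copies of P, that is in n times P, whereas the
  product on the left ends in P times n; the symmetry mediates. The recursions of
  \<open>top_poly\<close> and \<open>tsymm\<close> match step by step.\<close>

lemma I_ml_op: assumes [simp]: "g \<in> ops T"
  shows "P \<in> Pol \<Longrightarrow> I P \<^bold>\<otimes> cl (TOp g []) = cl (top_poly T g P) \<cdot> M (replicate (arity T g) []) P"
proof (induct P)
  case Nil
  then show ?case by (intro A.ext0) (simp_all add: top_poly.simps(1))
next
  case (Cons U P)
  then have [simp]: "U \<in> Wd" "P \<in> Pol" by auto
  have "Cs (replicate (arity T g) []) U = I (replicate (arity T g) U)"
    by (simp add: Cs_replicate Ci_cid pten_replicate1)
  then show ?case using Cons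
    by (simp add: I_Cons_ml [of U P] I1_ml_TOp top_Cons M_Cons pten_replicate1)
qed

text \<open>Conjugation with symmetries turns f times n into n times f, by
  \<open>M_natural1\<close>. After \<open>I_ml_op\<close> the claim is the operation axiom for f,
  here used for an arbitrary arrow.\<close>

lemma slide_op: assumes [simp]: "g \<in> ops T" "f \<in> arr TC"
  shows "(I (src TC f) \<^bold>\<otimes> cl (TOp g [])) \<cdot> (f \<^bold>\<otimes> I (replicate (arity T g) [])) = f
    \<cdot> (I (tgt TC f) \<^bold>\<otimes> cl (TOp g []))"
proof -
  let ?N = "replicate (arity T g) []" and ?P = "src TC f" and ?Q = "tgt TC f"
  have "f \<^bold>\<otimes> I ?N = (f \<^bold>\<otimes> I ?N) \<cdot> M ?Q ?N \<cdot> M ?N ?Q" by (simp add: M_inv)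
  also have "\<dots> = M ?P ?N \<cdot> (I ?N \<^bold>\<otimes> f) \<cdot> M ?N ?Q"
    using M_natural1 [of f ?N, THEN Z.seq_eq, of "M ?N ?Q"] by simp
  finally have 1: "f \<^bold>\<otimes> I ?N = M ?P ?N \<cdot> (I ?N \<^bold>\<otimes> f) \<cdot> M ?N ?Q" .
  have 2: "M ?N ?P \<cdot> M ?P ?N = I (pten ?N ?P)" by (simp add: M_inv)
  show ?thesis
    using op_natural [of g f, THEN Z.seq_eq, of "M ?N ?Q"]
      by (simp add: 1 I_ml_op 2 [THEN Z.seq_eq])
qed

text \<open>Induction on the tape u that moves past f. Symmetries, codiagonals and sums are
  determined by their composites with injections, and injections slide already. An operation at V is
  reduced to one at the unit by letting V act on f as a right whiskering.\<close>

lemma slide_tape: "wf u \<Longrightarrow> f \<in> arr TC \<Longrightarrow> src TC f = P \<Longrightarrow> tgt TC f = Q \<Longrightarrow> P \<in> Pol \<Longrightarrow> Q \<in> Pol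
  \<Longrightarrow> (I P \<^bold>\<otimes> cl u) \<cdot> (f \<^bold>\<otimes> I (tc u)) = (f \<^bold>\<otimes> I (td u)) \<cdot> (I Q \<^bold>\<otimes> cl u)"
proof (induct u)
  case (TId U)
  then show ?case by (simp add: cl_TId)
next
  case TId0
  then show ?case by (simp add: cl_TId0)
next
  case (TCirc c)
  then show ?case using slide_circ [of c] by (auto elim!: arrE)
next
  case (TSym U V)
  then have [simp]: "U \<in> Wd" "V \<in> Wd" by auto
  have e: "inl [U] [V] \<cdot> S [U] [V] = inr [V] [U]" "inr [U] [V] \<cdot> S [U] [V] = inl [V] [U]"
    by simp_all
  have 1: "(I X \<^bold>\<otimes> inl [U] [V]) \<cdot> (I X \<^bold>\<otimes> S [U] [V]) = I X \<^bold>\<otimes> inr [V] [U]"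
    "(I X \<^bold>\<otimes> inr [U] [V]) \<cdot> (I X \<^bold>\<otimes> S [U] [V]) = I X \<^bold>\<otimes> inl [V] [U]" if [simp]: "X \<in> Pol" for X
    using e by (simp_all flip: I_seq_ml)
  show ?case unfolding TSym_S [OF \<open>U \<in> Wd\<close> \<open>V \<in> Wd\<close>]
    by (rule extLC [of _ _ P U "[V]"]) (use TSym(2-) in \<open>simp_all add: 1 1 [THEN Z.seq_eq]
      slide1_inl slide1_inr slide1_inl [THEN Z.seq_eq] slide1_inr [THEN Z.seq_eq]\<close>)
next
  case (TSeq u v)
  then have [simp]: "wf u" "wf v" "tc u = td v" "f \<in> arr TC" "P \<in> Pol" "Q \<in> Pol" "src TC f
    = P" "tgt TC f = Q" by auto
  have IH: "(I P \<^bold>\<otimes> cl u) \<cdot> (f \<^bold>\<otimes> I (td v)) = (f \<^bold>\<otimes> I (td u)) \<cdot> (I Q \<^bold>\<otimes> cl u)"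
    "(I P \<^bold>\<otimes> cl v) \<cdot> (f \<^bold>\<otimes> I (tc v)) = (f \<^bold>\<otimes> I (td v)) \<cdot> (I Q \<^bold>\<otimes> cl v)" using TSeq by auto
  show ?case by (simp add: cl_seq I_seq_ml IH IH(1) [THEN Z.seq_eq])
next
  case (TSum u v)
  then have [simp]: "wf u" "wf v" "f \<in> arr TC" "P \<in> Pol" "Q \<in> Pol" "src TC f = P" "tgt TC f = Q"
    by auto
  have IH: "(I P \<^bold>\<otimes> cl u) \<cdot> (f \<^bold>\<otimes> I (tc u)) = (f \<^bold>\<otimes> I (td u)) \<cdot> (I Q \<^bold>\<otimes> cl u)"
    "(I P \<^bold>\<otimes> cl v) \<cdot> (f \<^bold>\<otimes> I (tc v)) = (f \<^bold>\<otimes> I (td v)) \<cdot> (I Q \<^bold>\<otimes> cl v)" using TSum by auto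
  have e: "inl (td u) (td v) \<cdot> (cl u \<^bold>\<oplus> cl v) = cl u \<cdot> inl (tc u) (tc v)"
    "inr (td u) (td v) \<cdot> (cl u \<^bold>\<oplus> cl v) = cl v \<cdot> inr (tc u) (tc v)" by simp_all
  have 1: "(I X \<^bold>\<otimes> inl (td u) (td v)) \<cdot> (I X \<^bold>\<otimes> (cl u \<^bold>\<oplus> cl v)) = (I X \<^bold>\<otimes> cl u)
    \<cdot> (I X \<^bold>\<otimes> inl (tc u) (tc v))"
    "(I X \<^bold>\<otimes> inr (td u) (td v)) \<cdot> (I X \<^bold>\<otimes> (cl u \<^bold>\<oplus> cl v)) = (I X \<^bold>\<otimes> cl v)
      \<cdot> (I X \<^bold>\<otimes> inr (tc u) (tc v))"
    if [simp]: "X \<in> Pol" for X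
    using e by (simp_all flip: I_seq_ml)
  show ?case
  proof (rule extL [of _ _ P "td u" "td v"])
    show "(I P \<^bold>\<otimes> inl (td u) (td v)) \<cdot> (I P \<^bold>\<otimes> cl (TSum u v)) \<cdot> (f \<^bold>\<otimes> I (tc (TSum u v))) =
       (I P \<^bold>\<otimes> inl (td u) (td v)) \<cdot> (f \<^bold>\<otimes> I (td (TSum u v))) \<cdot> (I Q \<^bold>\<otimes> cl (TSum u v))"
      by (simp add: cl_sum 1 1 [THEN Z.seq_eq] slide_inl slide_inl [THEN Z.seq_eq] IH IH
        [THEN Z.seq_eq])
    show "(I P \<^bold>\<otimes> inr (td u) (td v)) \<cdot> (I P \<^bold>\<otimes> cl (TSum u v)) \<cdot> (f \<^bold>\<otimes> I (tc (TSum u v))) =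
       (I P \<^bold>\<otimes> inr (td u) (td v)) \<cdot> (f \<^bold>\<otimes> I (td (TSum u v))) \<cdot> (I Q \<^bold>\<otimes> cl (TSum u v))"
      by (simp add: cl_sum 1 1 [THEN Z.seq_eq] slide_inr slide_inr [THEN Z.seq_eq] IH IH
        [THEN Z.seq_eq])
  qed (simp_all add: cl_sum)
next
  case (TBng U)
  then show ?case by (intro A.ext0) simp_all
next
  case (TNab U)
  then have [simp]: "U \<in> Wd" by auto
  have e: "inl [U] [U] \<cdot> N [U] = I [U]" "inr [U] [U] \<cdot> N [U] = I [U]" by simp_all
  have 1: "(I X \<^bold>\<otimes> inl [U] [U]) \<cdot> (I X \<^bold>\<otimes> N [U]) = I (pten X [U])"
    "(I X \<^bold>\<otimes> inr [U] [U]) \<cdot> (I X \<^bold>\<otimes> N [U]) = I (pten X [U])" if [simp]: "X \<in> Pol" for X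
    using e by (simp_all flip: I_seq_ml)
  show ?case unfolding N_single [symmetric, OF \<open>U \<in> Wd\<close>]
    by (rule extLC [of _ _ P U "[U]"]) (use TNab(2-) in \<open>simp_all add: 1 1 [THEN Z.seq_eq]
      slide1_inl slide1_inr slide1_inl [THEN Z.seq_eq] slide1_inr [THEN Z.seq_eq]\<close>)
next
  case (TOp g V)
  then have [simp]: "g \<in> ops T" "V \<in> Wd" "f \<in> arr TC" "P \<in> Pol" "Q \<in> Pol" "src TC f = P" "tgt TC f
    = Q" by auto
  have 1: "cl (TOp g V) = I [V] \<^bold>\<otimes> cl (TOp g [])" by (simp add: I1_ml_TOp)
  have 2: "f \<^bold>\<otimes> I (replicate (arity T g) V) = (f \<^bold>\<otimes> I [V]) \<^bold>\<otimes> I (replicate (arity T g) [])"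
    by (simp add: ml_I1_I)
  show ?case using slide_op [of g "f \<^bold>\<otimes> I [V]"] by (simp add: 1 2 I_I_ml)
qed

lemma slide: assumes "f \<in> arr TC" "g \<in> arr TC"
  shows "(I (src TC f) \<^bold>\<otimes> g) \<cdot> (f \<^bold>\<otimes> I (tgt TC g)) = (f \<^bold>\<otimes> I (src TC g)) \<cdot> (I (tgt TC f) \<^bold>\<otimes> g)"
proof -
  obtain u where [simp]: "g = cl u" "wf u" using assms(2) by (rule arrE)
  show ?thesis using slide_tape [of u f "src TC f" "tgt TC f"] assms(1) by simp
qed

lemma I_ml_I1: "\<lbrakk>P \<in> Pol; W \<in> Wd; f \<in> arr TC\<rbrakk> \<Longrightarrow> (I P \<^bold>\<otimes> f) \<^bold>\<otimes> I [W] = I P \<^bold>\<otimes> f \<^bold>\<otimes> I [W]"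
proof (induct P)
  case (Cons U P)
  then show ?case by (simp add: I_Cons_ml [of U P] ml_I1_sum I1_ml_I1)
qed simp

text \<open>Associativity with the nontrivial arrow in the middle. The right factor is tested on its
  summands; for a monomial there, the left factor splits as a sum (\<open>I_ml_I1\<close>).\<close>

lemma I_ml_I_assoc: "\<lbrakk>P \<in> Pol; R \<in> Pol; f \<in> arr TC\<rbrakk> \<Longrightarrow> (I P \<^bold>\<otimes> f) \<^bold>\<otimes> I R = I P \<^bold>\<otimes> f \<^bold>\<otimes> I R"
proof (induct R)
  case (Cons W R)
  then have [simp]: "W \<in> Wd" "R \<in> Pol" "P \<in> Pol" "f \<in> arr TC" by auto
  let ?A = "src TC f" and ?B = "tgt TC f"
  have IH: "(I P \<^bold>\<otimes> f) \<^bold>\<otimes> I R = I P \<^bold>\<otimes> f \<^bold>\<otimes> I R" using Cons by simp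
  have 1: "(I (pten P ?A) \<^bold>\<otimes> inl [W] R) \<cdot> (I P \<^bold>\<otimes> f \<^bold>\<otimes> I (W # R)) = (I P \<^bold>\<otimes> f \<^bold>\<otimes> I [W])
    \<cdot> (I (pten P ?B) \<^bold>\<otimes> inl [W] R)"
    "(I (pten P ?A) \<^bold>\<otimes> inr [W] R) \<cdot> (I P \<^bold>\<otimes> f \<^bold>\<otimes> I (W # R)) = (I P \<^bold>\<otimes> f \<^bold>\<otimes> I R)
      \<cdot> (I (pten P ?B) \<^bold>\<otimes> inr [W] R)"
    by (simp_all add: slide1_inl slide1_inr flip: I_I_ml I_seq_ml)
  show ?case
    by (rule extLC [of _ _ "pten P ?A" W R])
      (simp_all add: 1 slide1_inl [where Q = "pten P ?B"] slide1_inr [where Q = "pten P ?B"] IH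
        I_ml_I1)
qed simp

lemma ml_I_sum: "\<lbrakk>f \<in> arr TC; g \<in> arr TC; R \<in> Pol\<rbrakk> \<Longrightarrow> (f \<^bold>\<oplus> g) \<^bold>\<otimes> I R = f \<^bold>\<otimes> I R \<^bold>\<oplus> g \<^bold>\<otimes> I R"
proof (induct R)
  case (Cons W R)
  then have [simp]: "W \<in> Wd" "R \<in> Pol" "f \<in> arr TC" "g \<in> arr TC" by auto
  have IH: "(f \<^bold>\<oplus> g) \<^bold>\<otimes> I R = f \<^bold>\<otimes> I R \<^bold>\<oplus> g \<^bold>\<otimes> I R" using Cons by simp
  note s = slide1_inl [of "f \<^bold>\<oplus> g" "src TC f @ src TC g" "tgt TC f @ tgt TC g" W R]
    slide1_inr [of "f \<^bold>\<oplus> g" "src TC f @ src TC g" "tgt TC f @ tgt TC g" W R]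
    slide1_inl [of f "src TC f" "tgt TC f" W R] slide1_inr [of f "src TC f" "tgt TC f" W R]
    slide1_inl [of g "src TC g" "tgt TC g" W R] slide1_inr [of g "src TC g" "tgt TC g" W R]
  show ?case
  proof (rule extLC [of _ _ "src TC f @ src TC g" W R])
    show "(I (src TC f @ src TC g) \<^bold>\<otimes> inl [W] R) \<cdot> ((f \<^bold>\<oplus> g) \<^bold>\<otimes> I (W # R)) =
      (I (src TC f @ src TC g) \<^bold>\<otimes> inl [W] R) \<cdot> (f \<^bold>\<otimes> I (W # R) \<^bold>\<oplus> g \<^bold>\<otimes> I (W # R))"
      using s by (simp add: ml_I1_sum I_append_ml)
    show "(I (src TC f @ src TC g) \<^bold>\<otimes> inr [W] R) \<cdot> ((f \<^bold>\<oplus> g) \<^bold>\<otimes> I (W # R)) =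
      (I (src TC f @ src TC g) \<^bold>\<otimes> inr [W] R) \<cdot> (f \<^bold>\<otimes> I (W # R) \<^bold>\<oplus> g \<^bold>\<otimes> I (W # R))"
      using s by (simp add: IH I_append_ml)
  qed simp_all
qed simp

lemma inl_ml_I: "\<lbrakk>P \<in> Pol; Q \<in> Pol; R \<in> Pol\<rbrakk> \<Longrightarrow> inl P Q \<^bold>\<otimes> I R = inl (pten P R) (pten Q R)"
  "\<lbrakk>P \<in> Pol; Q \<in> Pol; R \<in> Pol\<rbrakk> \<Longrightarrow> inr P Q \<^bold>\<otimes> I R = inr (pten P R) (pten Q R)"
  by (simp_all add: A.inl_def A.inr_def ml_I_sum)

text \<open>The injections into (V + Q) R are those into V + Q multiplied by R, so they slide first
  past the inner whiskering and then past the outer one.\<close>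

lemma ml_I_I: "\<lbrakk>Q \<in> Pol; R \<in> Pol; f \<in> arr TC\<rbrakk> \<Longrightarrow> (f \<^bold>\<otimes> I Q) \<^bold>\<otimes> I R = f \<^bold>\<otimes> I (pten Q R)"
proof (induct Q)
  case Nil
  then show ?case by (intro A.ext0) simp_all
next
  case (Cons V Q)
  then have [simp]: "V \<in> Wd" "Q \<in> Pol" "R \<in> Pol" "f \<in> arr TC" by auto
  let ?P = "src TC f" and ?Q = "tgt TC f"
  have IH: "(f \<^bold>\<otimes> I Q) \<^bold>\<otimes> I R = f \<^bold>\<otimes> I (pten Q R)" using Cons by simp
  have 0: "inl (map ((@) V) R) (pten Q R) = inl [V] Q \<^bold>\<otimes> I R" "inr (map ((@) V) R) (pten Q R)
    = inr [V] Q \<^bold>\<otimes> I R"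
    by (simp_all add: inl_ml_I)
  have 1: "(I ?P \<^bold>\<otimes> inl (map ((@) V) R) (pten Q R)) \<cdot> ((f \<^bold>\<otimes> I (V # Q)) \<^bold>\<otimes> I R)
    = ((f \<^bold>\<otimes> I [V]) \<^bold>\<otimes> I R) \<cdot> (I ?Q \<^bold>\<otimes> inl (map ((@) V) R) (pten Q R))"
    "(I ?P \<^bold>\<otimes> inr (map ((@) V) R) (pten Q R)) \<cdot> ((f \<^bold>\<otimes> I (V # Q)) \<^bold>\<otimes> I R) = ((f \<^bold>\<otimes> I Q) \<^bold>\<otimes> I R)
      \<cdot> (I ?Q \<^bold>\<otimes> inr (map ((@) V) R) (pten Q R))"
    unfolding 0 by (simp_all flip: I_ml_I_assoc ml_I_seq add: slide1_inl slide1_inr)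
  note s = slide_inl [of f ?P ?Q "pten Q R" "map ((@) V) R"] slide_inr [of f ?P ?Q "pten Q R"
    "map ((@) V) R"]
  show ?case
    by (rule extL [of _ _ ?P "map ((@) V) R" "pten Q R"]) (use 1 s in \<open>simp_all add: IH ml_I1_I\<close>)
qed

text \<open>After \<open>ml_decomp\<close> the two sides differ only in the order of f and g', which
  \<open>slide\<close> exchanges.\<close>

lemma ml_interchange: assumes [simp]: "f \<in> arr TC" "f' \<in> arr TC" "g \<in> arr TC" "g' \<in> arr TC"
  "tgt TC f = src TC f'" "tgt TC g = src TC g'"
  shows "(f \<^bold>\<otimes> g) \<cdot> (f' \<^bold>\<otimes> g') = (f \<cdot> f') \<^bold>\<otimes> (g \<cdot> g')"
proof -
  have "(f \<cdot> f') \<^bold>\<otimes> (g \<cdot> g') = (I (src TC f) \<^bold>\<otimes> g) \<cdot> (I (src TC f) \<^bold>\<otimes> g') \<cdot> (f \<^bold>\<otimes> I (tgt TC g'))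
    \<cdot> (f' \<^bold>\<otimes> I (tgt TC g'))"
    by (subst ml_decomp) (simp_all add: I_seq_ml ml_I_seq)
  also have "\<dots> = (I (src TC f) \<^bold>\<otimes> g) \<cdot> (f \<^bold>\<otimes> I (tgt TC g)) \<cdot> (I (tgt TC f) \<^bold>\<otimes> g')
    \<cdot> (f' \<^bold>\<otimes> I (tgt TC g'))"
    using slide [of f g', THEN Z.seq_eq] by simp
  finally show ?thesis using ml_decomp [of f g] ml_decomp [of f' g'] by simp
qed

lemma ml_assoc: assumes [simp]: "f \<in> arr TC" "g \<in> arr TC" "h \<in> arr TC"
  shows "(f \<^bold>\<otimes> g) \<^bold>\<otimes> h = f \<^bold>\<otimes> g \<^bold>\<otimes> h"
proof -
  let ?P = "src TC f" and ?R = "src TC g" and ?S = "tgt TC g" and ?V = "tgt TC h"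
  have "(f \<^bold>\<otimes> g) \<^bold>\<otimes> h = (I (pten ?P ?R) \<^bold>\<otimes> h) \<cdot> ((I ?P \<^bold>\<otimes> g) \<^bold>\<otimes> I ?V) \<cdot> ((f \<^bold>\<otimes> I ?S) \<^bold>\<otimes> I ?V)"
    by (subst ml_decomp) (simp_all add: ml_decomp [of f g] ml_I_seq)
  also have "\<dots> = (I ?P \<^bold>\<otimes> ((I ?R \<^bold>\<otimes> h) \<cdot> (g \<^bold>\<otimes> I ?V))) \<cdot> (f \<^bold>\<otimes> I (pten ?S ?V))"
    by (simp add: I_seq_ml I_I_ml I_ml_I_assoc ml_I_I)
  also have "\<dots> = f \<^bold>\<otimes> g \<^bold>\<otimes> h"
    by (subst (2) ml_decomp) (simp_all flip: ml_decomp)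
  finally show ?thesis .
qed

lemma M_letter_Cons: assumes [simp]: "U \<in> Wd" "V \<in> Wd" "Q \<in> Pol" shows "M [U] (V # Q)
  = Ci (csym U V) \<^bold>\<oplus> M [U] Q"
  by (simp add: M_Cons Cs_single D_Cons D_Nil W.wsy_Nil)

lemma M_letter_append: assumes [simp]: "U \<in> Wd" shows "P \<in> Pol \<Longrightarrow> Q \<in> Pol \<Longrightarrow> M [U] (P @ Q)
  = M [U] P \<^bold>\<oplus> M [U] Q"
  by (induct P) (simp_all add: M_letter_Cons M_Nil)

lemma letter_ml_I_Cons: assumes [simp]: "f \<in> arr TC" "src TC f = [U]" "tgt TC f = [V]" "U \<in> Wd"
  "V \<in> Wd" "W \<in> Wd" "R \<in> Pol"
  shows "f \<^bold>\<otimes> I (W # R) = f \<^bold>\<otimes> I [W] \<^bold>\<oplus> f \<^bold>\<otimes> I R"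
  by (simp add: ml_I_Cons [of W R] D_Cons D_Nil W.wsy_Nil)

text \<open>The hexagon is built up from circuits: here two arguments are monomials, in
  \<open>hex2\<close> only the one that is moved, in \<open>hex3\<close> none.\<close>

lemma hex1: assumes [simp]: "U \<in> Wd" "V \<in> Wd"
  shows "R \<in> Pol \<Longrightarrow> M [U] (map ((@) V) R) = (Ci (csym U V) \<^bold>\<otimes> I R) \<cdot> (I [V] \<^bold>\<otimes> M [U] R)"
proof (induct R)
  case (Cons W R)
  then show ?case
    by (simp add: M_letter_Cons letter_ml_I_Cons [of _ "U @ V" "V @ U" W R] I1_sum_ml Ci_csym_hex)
qed (simp add: M_Nil)

lemma hex2: assumes [simp]: "U \<in> Wd" "R \<in> Pol"
  shows "P \<in> Pol \<Longrightarrow> M [U] (pten P R) = (M [U] P \<^bold>\<otimes> I R) \<cdot> (I P \<^bold>\<otimes> M [U] R)"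
proof (induct P)
  case (Cons V P)
  then show ?case
    by (simp add: M_letter_append M_letter_Cons hex1 ml_I_sum I_Cons_ml [of V P])
qed (simp add: M_Nil)

lemma hex3: assumes [simp]: "P \<in> Pol" "R \<in> Pol"
  shows "Q \<in> Pol \<Longrightarrow> M Q (pten P R) = (M Q P \<^bold>\<otimes> I R) \<cdot> (I P \<^bold>\<otimes> M Q R)"
proof (induct Q)
  case (Cons U Q)
  then have [simp]: "U \<in> Wd" "Q \<in> Pol" by auto
  have IH: "M Q (pten P R) = (M Q P \<^bold>\<otimes> I R) \<cdot> (I P \<^bold>\<otimes> M Q R)" using Cons by simp
  have m: "inl (map ((@) U) X) (pten Q X) \<cdot> M (U # Q) X = M [U] X \<cdot> (I X \<^bold>\<otimes> inl [U] Q)"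
    "inr (map ((@) U) X) (pten Q X) \<cdot> M (U # Q) X = M Q X \<cdot> (I X \<^bold>\<otimes> inr [U] Q)" if "X \<in> Pol" for X
    using M_inl [of "[U]" Q X] M_inr [of "[U]" Q X] that by simp_all
  have 0: "inl (pten (map ((@) U) P) R) (pten (pten Q P) R) = inl (map ((@) U) P) (pten Q P) \<^bold>\<otimes> I
    R"
    "inr (pten (map ((@) U) P) R) (pten (pten Q P) R) = inr (map ((@) U) P) (pten Q P) \<^bold>\<otimes> I R"
    using inl_ml_I by simp_all
  have i: "inl (pten (map ((@) U) P) R) (pten (pten Q P) R) \<cdot> (M (U # Q) P \<^bold>\<otimes> I R)
    = (M [U] P \<^bold>\<otimes> I R) \<cdot> (I P \<^bold>\<otimes> inl (map ((@) U) R) (pten Q R))"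
    "inr (pten (map ((@) U) P) R) (pten (pten Q P) R) \<cdot> (M (U # Q) P \<^bold>\<otimes> I R) = (M Q P \<^bold>\<otimes> I R)
      \<cdot> (I P \<^bold>\<otimes> inr (map ((@) U) R) (pten Q R))"
    unfolding 0 by (simp_all add: m flip: ml_I_seq) (simp_all add: ml_I_seq I_ml_I_assoc inl_ml_I)
  have j: "(I P \<^bold>\<otimes> inl (map ((@) U) R) (pten Q R)) \<cdot> (I P \<^bold>\<otimes> M (U # Q) R) = (I P \<^bold>\<otimes> M [U] R)
    \<cdot> (I (pten P R) \<^bold>\<otimes> inl [U] Q)"
    "(I P \<^bold>\<otimes> inr (map ((@) U) R) (pten Q R)) \<cdot> (I P \<^bold>\<otimes> M (U # Q) R) = (I P \<^bold>\<otimes> M Q R)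
      \<cdot> (I (pten P R) \<^bold>\<otimes> inr [U] Q)"
    by (simp_all add: m flip: I_seq_ml) (simp_all add: I_seq_ml I_I_ml)
  note i' = i [simplified pten_map pten_assoc]
  show ?case
    by (rule A.ext2 [of _ _ "map ((@) U) (pten P R)" "pten Q (pten P R)"])
      (simp_all add: m i' [THEN Z.seq_eq] j hex2 IH pten_map)
qed (simp add: M_Nil')

text \<open>Naturality in the second argument follows from that in the first, because swapping the
  arguments inverts the symmetry.\<close>

lemma M_natural: assumes [simp]: "f \<in> arr TC" "g \<in> arr TC"
  shows "(f \<^bold>\<otimes> g) \<cdot> M (tgt TC f) (tgt TC g) = M (src TC f) (src TC g) \<cdot> (g \<^bold>\<otimes> f)"
proof -
  let ?P = "src TC f" and ?R = "src TC g" and ?S = "tgt TC g"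
  have 1: "(I ?P \<^bold>\<otimes> g) \<cdot> M ?P ?S = M ?P ?R \<cdot> (g \<^bold>\<otimes> I ?P)"
  proof -
    have "(I ?P \<^bold>\<otimes> g) \<cdot> M ?P ?S = (M ?P ?R \<cdot> M ?R ?P) \<cdot> (I ?P \<^bold>\<otimes> g) \<cdot> M ?P ?S"
      by (simp add: M_inv)
    also have "\<dots> = M ?P ?R \<cdot> (M ?R ?P \<cdot> (I ?P \<^bold>\<otimes> g)) \<cdot> M ?P ?S" by simp
    also have "\<dots> = M ?P ?R \<cdot> (g \<^bold>\<otimes> I ?P) \<cdot> M ?S ?P \<cdot> M ?P ?S" using M_natural1 [of g ?P]
      by (simp flip: M_natural1)
    finally show ?thesis by (simp add: M_inv)
  qed
  have "(f \<^bold>\<otimes> g) \<cdot> M (tgt TC f) ?S = (I ?P \<^bold>\<otimes> g) \<cdot> (f \<^bold>\<otimes> I ?S) \<cdot> M (tgt TC f) ?S"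
    by (subst ml_decomp) simp_all
  also have "\<dots> = M ?P ?R \<cdot> (g \<^bold>\<otimes> I ?P) \<cdot> (I ?S \<^bold>\<otimes> f)"
    by (simp add: M_natural1 1 [THEN Z.seq_eq])
  also have "\<dots> = M ?P ?R \<cdot> (g \<^bold>\<otimes> f)" by (simp add: ml_interchange)
  finally show ?thesis .
qed

lemma ml_ssm: "ssm Pol (arr TC) (src TC) (tgt TC) (\<lambda>P. I P) (\<cdot>) pten (\<^bold>\<otimes>) [[]] (\<lambda>P Q. M P Q)"
  by unfold_locales (auto simp: ml_interchange ml_assoc M_inv hex3 M_natural map_idI)

lemma srig_tapes: "srig Pol (arr TC) (src TC) (tgt TC) (\<lambda>P. I P) (\<cdot>) (@) (\<^bold>\<oplus>) [] (\<lambda>P Q. S P Q)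
  (\<lambda>P. N P) (\<lambda>P. B P)
   pten (\<^bold>\<otimes>) [[]] (\<lambda>P Q. M P Q) (\<lambda>P Q R. D P Q R) (\<lambda>P Q R. Di P Q R)"
proof -
  interpret ssm Pol "arr TC" "src TC" "tgt TC" "\<lambda>P. I P" "(\<cdot>)" pten "(\<^bold>\<otimes>)" "[[]]" "\<lambda>P Q. M P Q"
    by (rule ml_ssm)
  show ?thesis
  proof
    fix f g h assume [simp]: "f \<in> arr TC" "g \<in> arr TC" "h \<in> arr TC"
    show "(f \<^bold>\<oplus> g) \<^bold>\<otimes> h = f \<^bold>\<otimes> h \<^bold>\<oplus> g \<^bold>\<otimes> h"
      by (simp add: ml_decomp [of "f \<^bold>\<oplus> g" h] ml_decomp [of f h] ml_decomp [of g h] I_append_ml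
        ml_I_sum del: interchange)
  qed (simp_all add: inl_D inr_D)
qed

end

section \<open>Comonoids and sums\<close>

lemma (in ssm) mid_nat:
  assumes [simp]: "f \<in> Ar" "g \<in> Ar" "src f = X" "tgt f = X'" "src g = Y" "tgt g = Y'" "X \<in> Ob"
    "X' \<in> Ob" "Y \<in> Ob" "Y' \<in> Ob"
  shows "((f \<^bold>\<oplus> f) \<^bold>\<oplus> (g \<^bold>\<oplus> g)) \<cdot> (ide X' \<^bold>\<oplus> sy X' Y' \<^bold>\<oplus> ide Y') = (ide X \<^bold>\<oplus> sy X Y \<^bold>\<oplus> ide Y)
    \<cdot> ((f \<^bold>\<oplus> g) \<^bold>\<oplus> (f \<^bold>\<oplus> g))"
proof -
  have "((f \<^bold>\<oplus> f) \<^bold>\<oplus> (g \<^bold>\<oplus> g)) = f \<^bold>\<oplus> (f \<^bold>\<oplus> g) \<^bold>\<oplus> g" "((f \<^bold>\<oplus> g) \<^bold>\<oplus> (f \<^bold>\<oplus> g)) = f \<^bold>\<oplus> (g \<^bold>\<oplus> f) \<^bold>\<oplus> g"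
    by simp_all
  then show ?thesis using sy_nat' [of f g X X' Y Y'] by (simp del: tA_assoc)
qed

text \<open>The axioms on copy and discard say that injections are homomorphisms of comonoids. They
  determine both on a sum and can be used as rewriting steps; the closed formula with distributors
  is recovered in \<open>copy_add\<close>.\<close>

locale srig_copy = srig Ob Ar src tgt ide seq aO aA z sa nab bng mO mA one sm dl dli
  for Ob :: "'o set" and Ar :: "'a set" and src tgt :: "'a \<Rightarrow> 'o" and ide :: "'o \<Rightarrow> 'a"
    and seq :: "'a \<Rightarrow> 'a \<Rightarrow> 'a" (infixr "\<cdot>" 55)
    and aO :: "'o \<Rightarrow> 'o \<Rightarrow> 'o" (infixr "\<^bold>+" 65)
    and aA :: "'a \<Rightarrow> 'a \<Rightarrow> 'a" (infixr "\<^bold>\<oplus>" 65)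
    and z :: 'o and sa :: "'o \<Rightarrow> 'o \<Rightarrow> 'a" and nab bng :: "'o \<Rightarrow> 'a"
    and mO :: "'o \<Rightarrow> 'o \<Rightarrow> 'o" (infixr "\<^bold>*" 70)
    and mA :: "'a \<Rightarrow> 'a \<Rightarrow> 'a" (infixr "\<^bold>\<otimes>" 70)
    and one :: 'o and sm :: "'o \<Rightarrow> 'o \<Rightarrow> 'a"
    and dl dli :: "'o \<Rightarrow> 'o \<Rightarrow> 'o \<Rightarrow> 'a" +
  fixes copy disc :: "'o \<Rightarrow> 'a"
  assumes copy_type [simp]: "X \<in> Ob \<Longrightarrow> copy X \<in> Ar" "X \<in> Ob \<Longrightarrow> src (copy X) = X" "X \<in> Ob
    \<Longrightarrow> tgt (copy X) = X \<^bold>* X"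
    and disc_type [simp]: "X \<in> Ob \<Longrightarrow> disc X \<in> Ar" "X \<in> Ob \<Longrightarrow> src (disc X) = X" "X \<in> Ob
      \<Longrightarrow> tgt (disc X) = one"
    and copy_inl: "\<lbrakk>X \<in> Ob; Y \<in> Ob\<rbrakk> \<Longrightarrow> inl X Y \<cdot> copy (X \<^bold>+ Y) = copy X \<cdot> (inl X Y \<^bold>\<otimes> inl X Y)"
    and copy_inr: "\<lbrakk>X \<in> Ob; Y \<in> Ob\<rbrakk> \<Longrightarrow> inr X Y \<cdot> copy (X \<^bold>+ Y) = copy Y \<cdot> (inr X Y \<^bold>\<otimes> inr X Y)"
    and disc_inl: "\<lbrakk>X \<in> Ob; Y \<in> Ob\<rbrakk> \<Longrightarrow> inl X Y \<cdot> disc (X \<^bold>+ Y) = disc X"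
    and disc_inr: "\<lbrakk>X \<in> Ob; Y \<in> Ob\<rbrakk> \<Longrightarrow> inr X Y \<cdot> disc (X \<^bold>+ Y) = disc Y"
begin

declare inl_mA [simp del] inr_mA [simp del] inr_mA' [simp del]

definition comonoid :: "'o \<Rightarrow> bool" where
  "comonoid X \<longleftrightarrow> copy X \<cdot> (copy X \<^bold>\<otimes> ide X) = copy X \<cdot> (ide X \<^bold>\<otimes> copy X)
    \<and> copy X \<cdot> (disc X \<^bold>\<otimes> ide X) = ide X \<and> copy X \<cdot> (ide X \<^bold>\<otimes> disc X) = ide X \<and> copy X \<cdot> sm X X
      = copy X"

definition cohom :: "'a \<Rightarrow> bool" where
  "cohom i \<longleftrightarrow> i \<in> Ar \<and> i \<cdot> copy (tgt i) = copy (src i) \<cdot> (i \<^bold>\<otimes> i) \<and> i \<cdot> disc (tgt i)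
    = disc (src i)"

lemma cohom_in: "\<lbrakk>X \<in> Ob; Y \<in> Ob\<rbrakk> \<Longrightarrow> cohom (inl X Y)" "\<lbrakk>X \<in> Ob; Y \<in> Ob\<rbrakk> \<Longrightarrow> cohom (inr X Y)"
  by (simp_all add: cohom_def copy_inl copy_inr disc_inl disc_inr)

lemma cohom_ide: "X \<in> Ob \<Longrightarrow> cohom (ide X)"
  by (simp add: cohom_def)

text \<open>A homomorphism out of a comonoid X carries the laws of X to Z after precomposition. As
  the two injections are jointly epic, the laws pass from the summands to a sum.\<close>

lemma cohom_comonoid:
  assumes i: "cohom i" and X: "comonoid (src i)" and s: "src i = X" "tgt i = Z"
  shows "i \<cdot> copy Z \<cdot> (copy Z \<^bold>\<otimes> ide Z) = i \<cdot> copy Z \<cdot> (ide Z \<^bold>\<otimes> copy Z)"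
    "i \<cdot> copy Z \<cdot> (disc Z \<^bold>\<otimes> ide Z) = i" "i \<cdot> copy Z \<cdot> (ide Z \<^bold>\<otimes> disc Z) = i"
    "i \<cdot> copy Z \<cdot> sm Z Z = i \<cdot> copy Z"
proof -
  note [simp] = s
  have [simp]: "i \<in> Ar" using i by (simp add: cohom_def)
  have [simp]: "X \<in> Ob" "Z \<in> Ob" using add.src_Ob [of i] add.tgt_Ob [of i] by simp_all
  have ic: "i \<cdot> copy Z = copy X \<cdot> (i \<^bold>\<otimes> i)" and id: "i \<cdot> disc Z = disc X" using i
    by (simp_all add: cohom_def)
  note icX = ic [THEN add.seq_eq]
  have c: "copy X \<cdot> (copy X \<^bold>\<otimes> ide X) = copy X \<cdot> (ide X \<^bold>\<otimes> copy X)" "copy X \<cdot> (disc X \<^bold>\<otimes> ide X)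
    = ide X"
    "copy X \<cdot> (ide X \<^bold>\<otimes> disc X) = ide X" "copy X \<cdot> sm X X = copy X" using X
      by (simp_all add: comonoid_def)
  have "i \<cdot> copy Z \<cdot> (copy Z \<^bold>\<otimes> ide Z) = copy X \<cdot> (copy X \<^bold>\<otimes> ide X) \<cdot> (i \<^bold>\<otimes> i \<^bold>\<otimes> i)"
    by (simp add: icX ic del: mul.tA_assoc flip: mul.tA_assoc)
  also have "\<dots> = copy X \<cdot> (ide X \<^bold>\<otimes> copy X) \<cdot> (i \<^bold>\<otimes> i \<^bold>\<otimes> i)"
    using c(1) [THEN add.seq_eq, of "i \<^bold>\<otimes> i \<^bold>\<otimes> i"] by simp
  also have "\<dots> = i \<cdot> copy Z \<cdot> (ide Z \<^bold>\<otimes> copy Z)"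
    by (simp add: icX ic)
  finally show "i \<cdot> copy Z \<cdot> (copy Z \<^bold>\<otimes> ide Z) = i \<cdot> copy Z \<cdot> (ide Z \<^bold>\<otimes> copy Z)" .
  have "i \<cdot> copy Z \<cdot> (disc Z \<^bold>\<otimes> ide Z) = copy X \<cdot> (disc X \<^bold>\<otimes> ide X) \<cdot> (ide one \<^bold>\<otimes> i)"
    by (simp add: icX id del: mul.un_tA)
  then show "i \<cdot> copy Z \<cdot> (disc Z \<^bold>\<otimes> ide Z) = i" using c(2) [THEN add.seq_eq, of i] by simp
  have "i \<cdot> copy Z \<cdot> (ide Z \<^bold>\<otimes> disc Z) = copy X \<cdot> (ide X \<^bold>\<otimes> disc X) \<cdot> (i \<^bold>\<otimes> ide one)"
    by (simp add: icX id del: mul.tA_un)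
  then show "i \<cdot> copy Z \<cdot> (ide Z \<^bold>\<otimes> disc Z) = i" using c(3) [THEN add.seq_eq, of i] by simp
  have "i \<cdot> copy Z \<cdot> sm Z Z = copy X \<cdot> sm X X \<cdot> (i \<^bold>\<otimes> i)"
    using mul.sy_nat' [of i i X Z X Z] by (simp add: icX)
  then show "i \<cdot> copy Z \<cdot> sm Z Z = i \<cdot> copy Z" using c(4) [THEN add.seq_eq, of "i \<^bold>\<otimes> i"]
    by (simp add: ic)
qed

lemma comonoid_sum: assumes X [simp]: "X \<in> Ob" "Y \<in> Ob" and c: "comonoid X" "comonoid Y"
  shows "comonoid (X \<^bold>+ Y)"
proof -
  note l = cohom_comonoid [of "inl X Y" X "X \<^bold>+ Y", OF cohom_in(1) [OF X]]
  note r = cohom_comonoid [of "inr X Y" Y "X \<^bold>+ Y", OF cohom_in(2) [OF X]]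
  let ?Z = "X \<^bold>+ Y"
  have 1: "copy ?Z \<cdot> (copy ?Z \<^bold>\<otimes> ide ?Z) = copy ?Z \<cdot> (ide ?Z \<^bold>\<otimes> copy ?Z)"
    by (rule add.ext2 [of _ _ X Y], simp_all only: l(1) [simplified, OF c(1)] r(1) [simplified, OF
      c(2)]) simp_all
  have 2: "copy ?Z \<cdot> (disc ?Z \<^bold>\<otimes> ide ?Z) = ide ?Z"
    by (rule add.ext2 [of _ _ X Y], simp_all only: l(2) [simplified, OF c(1)] r(2) [simplified, OF
      c(2)]) simp_all
  have 3: "copy ?Z \<cdot> (ide ?Z \<^bold>\<otimes> disc ?Z) = ide ?Z"
    by (rule add.ext2 [of _ _ X Y], simp_all only: l(3) [simplified, OF c(1)] r(3) [simplified, OF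
      c(2)]) simp_all
  have 4: "copy ?Z \<cdot> sm ?Z ?Z = copy ?Z"
    by (rule add.ext2 [of _ _ X Y], simp_all only: l(4) [simplified, OF c(1)] r(4) [simplified, OF
      c(2)]) simp_all
  show ?thesis unfolding comonoid_def using 1 2 3 4 by blast
qed

text \<open>Coherence of the comonoids with the product, stated at one pair of objects so that it
  can be propagated along sums in either argument.\<close>

definition product :: "'o \<Rightarrow> 'o \<Rightarrow> bool" where
  "product X Y \<longleftrightarrow> copy (X \<^bold>* Y) = (copy X \<^bold>\<otimes> copy Y) \<cdot> (ide X \<^bold>\<otimes> sm X Y \<^bold>\<otimes> ide Y) \<and> disc (X \<^bold>* Y)
    = disc X \<^bold>\<otimes> disc Y"

text \<open>As in \<open>cohom_comonoid\<close>, coherence is transported along homomorphisms; they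
  pass the middle symmetry by \<open>mid_nat\<close>.\<close>

lemma cohom_product:
  assumes i: "cohom i" and j: "cohom j" and ij: "cohom (i \<^bold>\<otimes> j)" and p: "product (src i) (src j)"
    and s: "tgt i = Z" "tgt j = W"
  shows "(i \<^bold>\<otimes> j) \<cdot> copy (Z \<^bold>* W) = (i \<^bold>\<otimes> j) \<cdot> (copy Z \<^bold>\<otimes> copy W) \<cdot> (ide Z \<^bold>\<otimes> sm Z W \<^bold>\<otimes> ide W)"
    "(i \<^bold>\<otimes> j) \<cdot> disc (Z \<^bold>* W) = (i \<^bold>\<otimes> j) \<cdot> (disc Z \<^bold>\<otimes> disc W)"
proof -
  define X Y where "X = src i" and "Y = src j"
  have s: "tgt i = Z" "tgt j = W" "src i = X" "src j = Y" using s by (auto simp: X_def Y_def)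
  note [simp] = s
  have [simp]: "i \<in> Ar" "j \<in> Ar" using i j by (simp_all add: cohom_def)
  have [simp]: "X \<in> Ob" "Z \<in> Ob" "Y \<in> Ob" "W \<in> Ob" using add.src_Ob [of i] add.tgt_Ob [of i]
    add.src_Ob [of j] add.tgt_Ob [of j] by simp_all
  have h: "i \<cdot> copy Z = copy X \<cdot> (i \<^bold>\<otimes> i)" "i \<cdot> disc Z = disc X"
    "j \<cdot> copy W = copy Y \<cdot> (j \<^bold>\<otimes> j)" "j \<cdot> disc W = disc Y"
    "(i \<^bold>\<otimes> j) \<cdot> copy (Z \<^bold>* W) = copy (X \<^bold>* Y) \<cdot> ((i \<^bold>\<otimes> j) \<^bold>\<otimes> (i \<^bold>\<otimes> j))"
    "(i \<^bold>\<otimes> j) \<cdot> disc (Z \<^bold>* W) = disc (X \<^bold>* Y)"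
    using i j ij by (simp_all add: cohom_def)
  have q: "copy (X \<^bold>* Y) = (copy X \<^bold>\<otimes> copy Y) \<cdot> (ide X \<^bold>\<otimes> sm X Y \<^bold>\<otimes> ide Y)" "disc (X \<^bold>* Y)
    = disc X \<^bold>\<otimes> disc Y"
    using p by (simp_all add: product_def)
  have "(i \<^bold>\<otimes> j) \<cdot> (copy Z \<^bold>\<otimes> copy W) \<cdot> (ide Z \<^bold>\<otimes> sm Z W \<^bold>\<otimes> ide W)
    = ((copy X \<cdot> (i \<^bold>\<otimes> i)) \<^bold>\<otimes> (copy Y \<cdot> (j \<^bold>\<otimes> j))) \<cdot> (ide Z \<^bold>\<otimes> sm Z W \<^bold>\<otimes> ide W)"
    by (simp add: h del: mul.tA_assoc)
  also have "\<dots> = (copy X \<^bold>\<otimes> copy Y) \<cdot> ((i \<^bold>\<otimes> i) \<^bold>\<otimes> (j \<^bold>\<otimes> j)) \<cdot> (ide Z \<^bold>\<otimes> sm Z W \<^bold>\<otimes> ide W)"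
    by (simp del: mul.tA_assoc)
  also have "((i \<^bold>\<otimes> i) \<^bold>\<otimes> (j \<^bold>\<otimes> j)) \<cdot> (ide Z \<^bold>\<otimes> sm Z W \<^bold>\<otimes> ide W) = (ide X \<^bold>\<otimes> sm X Y \<^bold>\<otimes> ide Y)
    \<cdot> ((i \<^bold>\<otimes> j) \<^bold>\<otimes> (i \<^bold>\<otimes> j))"
    by (rule mul.mid_nat) simp_all
  finally show "(i \<^bold>\<otimes> j) \<cdot> copy (Z \<^bold>* W) = (i \<^bold>\<otimes> j) \<cdot> (copy Z \<^bold>\<otimes> copy W)
    \<cdot> (ide Z \<^bold>\<otimes> sm Z W \<^bold>\<otimes> ide W)"
    unfolding h q by simp
  show "(i \<^bold>\<otimes> j) \<cdot> disc (Z \<^bold>* W) = (i \<^bold>\<otimes> j) \<cdot> (disc Z \<^bold>\<otimes> disc W)"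
    unfolding h q by (simp add: h)
qed

lemma product_sum1: assumes [simp]: "X \<in> Ob" "Y \<in> Ob" "Z \<in> Ob" and p: "product X Z" "product Y Z"
  shows "product (X \<^bold>+ Y) Z"
proof -
  have i: "inl X Y \<^bold>\<otimes> ide Z = inl (X \<^bold>* Z) (Y \<^bold>* Z)" "inr X Y \<^bold>\<otimes> ide Z = inr (X \<^bold>* Z) (Y \<^bold>* Z)"
    by (simp_all add: inl_mA inr_mA)
  have c: "cohom (inl X Y)" "cohom (inr X Y)" "cohom (ide Z)" "cohom (inl X Y \<^bold>\<otimes> ide Z)"
    "cohom (inr X Y \<^bold>\<otimes> ide Z)"
    "product (src (inl X Y)) (src (ide Z))" "product (src (inr X Y)) (src (ide Z))"
    using p unfolding i by (simp_all add: cohom_in cohom_ide)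
  have t: "tgt (inl X Y) = X \<^bold>+ Y" "tgt (inr X Y) = X \<^bold>+ Y" "tgt (ide Z) = Z" by simp_all
  note l = cohom_product [OF c(1,3,4,6) t(1,3), unfolded i] and r
    = cohom_product [OF c(2,3,5,7) t(2,3), unfolded i]
  have 1: "copy ((X \<^bold>+ Y) \<^bold>* Z) = (copy (X \<^bold>+ Y) \<^bold>\<otimes> copy Z)
    \<cdot> (ide (X \<^bold>+ Y) \<^bold>\<otimes> sm (X \<^bold>+ Y) Z \<^bold>\<otimes> ide Z)"
    by (rule add.ext2 [of _ _ "X \<^bold>* Z" "Y \<^bold>* Z"], simp_all only: l(1) r(1)) simp_all
  have 2: "disc ((X \<^bold>+ Y) \<^bold>* Z) = disc (X \<^bold>+ Y) \<^bold>\<otimes> disc Z"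
    by (rule add.ext2 [of _ _ "X \<^bold>* Z" "Y \<^bold>* Z"], simp_all only: l(2) r(2)) simp_all
  show ?thesis unfolding product_def using 1 2 by blast
qed

text \<open>Hypothesis \<open>e\<close> says that Z distributes strictly over this sum, which is the
  case for a monomial Z. General first arguments are then reached by
  \<open>product_sum1\<close>.\<close>

lemma product_sum2: assumes [simp]: "X \<in> Ob" "Y \<in> Ob" "Z \<in> Ob" and p: "product Z X" "product Z Y"
  and e: "ide Z \<^bold>\<otimes> inl X Y = inl (Z \<^bold>* X) (Z \<^bold>* Y)" "ide Z \<^bold>\<otimes> inr X Y = inr (Z \<^bold>* X) (Z \<^bold>* Y)"
  shows "product Z (X \<^bold>+ Y)"
proof -
  have o: "Z \<^bold>* (X \<^bold>+ Y) = Z \<^bold>* X \<^bold>+ Z \<^bold>* Y" using arg_cong [OF e(1), of tgt] by simp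
  have c: "cohom (inl X Y)" "cohom (inr X Y)" "cohom (ide Z)" "cohom (ide Z \<^bold>\<otimes> inl X Y)"
    "cohom (ide Z \<^bold>\<otimes> inr X Y)"
    "product (src (ide Z)) (src (inl X Y))" "product (src (ide Z)) (src (inr X Y))"
    using p unfolding e by (simp_all add: cohom_in cohom_ide)
  have t: "tgt (inl X Y) = X \<^bold>+ Y" "tgt (inr X Y) = X \<^bold>+ Y" "tgt (ide Z) = Z" by simp_all
  note l = cohom_product [OF c(3,1,4,6) t(3,1), unfolded e] and r
    = cohom_product [OF c(3,2,5,7) t(3,2), unfolded e]
  define k where "k = (copy Z \<^bold>\<otimes> copy (X \<^bold>+ Y)) \<cdot> (ide Z \<^bold>\<otimes> sm Z (X \<^bold>+ Y) \<^bold>\<otimes> ide (X \<^bold>+ Y))"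
  have k: "k \<in> Ar" "src k = Z \<^bold>* (X \<^bold>+ Y)" "tgt k = (Z \<^bold>* (X \<^bold>+ Y)) \<^bold>* (Z \<^bold>* (X \<^bold>+ Y))"
    unfolding k_def by simp_all
  have 1: "copy (Z \<^bold>* (X \<^bold>+ Y)) = k"
    by (rule add.ext2 [of _ _ "Z \<^bold>* X" "Z \<^bold>* Y"], simp_all only: l(1) r(1) k_def [symmetric])
      (use k in \<open>simp_all add: o\<close>)
  have 2: "disc (Z \<^bold>* (X \<^bold>+ Y)) = disc Z \<^bold>\<otimes> disc (X \<^bold>+ Y)"
    by (rule add.ext2 [of _ _ "Z \<^bold>* X" "Z \<^bold>* Y"], simp_all only: l(2) r(2)) (simp_all add: o)
  show ?thesis unfolding product_def using 1 [unfolded k_def] 2 by blast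
qed

lemma disc_add: "\<lbrakk>X \<in> Ob; Y \<in> Ob\<rbrakk> \<Longrightarrow> disc (X \<^bold>+ Y) = (disc X \<^bold>\<oplus> disc Y) \<cdot> nab one"
  by (rule add.ext2 [of _ _ X Y]) (simp_all add: disc_inl disc_inr)

text \<open>A copy padded with \<open>bng\<close> is a copy followed by an injection into a sum of
  products, and \<open>dli\<close> turns that injection into a multiplied one.\<close>

lemma copy_add: "\<lbrakk>X \<in> Ob; Y \<in> Ob\<rbrakk> \<Longrightarrow> copy (X \<^bold>+ Y)
      = ((copy X \<^bold>\<oplus> bng (X \<^bold>* Y)) \<^bold>\<oplus> (bng (Y \<^bold>* X) \<^bold>\<oplus> copy Y)) \<cdot> (dli X X Y \<^bold>\<oplus> dli Y X Y)"
proof (rule add.ext2 [of _ _ X Y])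
  assume [simp]: "X \<in> Ob" "Y \<in> Ob"
  have e: "bng (Y \<^bold>* X) \<^bold>\<oplus> copy Y = copy Y \<cdot> inr (Y \<^bold>* X) (Y \<^bold>* Y)"
  proof -
    have "bng (Y \<^bold>* X) \<^bold>\<oplus> copy Y = (ide z \<^bold>\<oplus> copy Y) \<cdot> (bng (Y \<^bold>* X) \<^bold>\<oplus> ide (Y \<^bold>* Y))"
      by (subst add.interchange) simp_all
    then show ?thesis by (simp add: add.inr_def del: add.interchange)
  qed
  have e': "copy X \<^bold>\<oplus> bng (X \<^bold>* Y) = copy X \<cdot> inl (X \<^bold>* X) (X \<^bold>* Y)"
  proof -
    have "copy X \<^bold>\<oplus> bng (X \<^bold>* Y) = (copy X \<^bold>\<oplus> ide z) \<cdot> (ide (X \<^bold>* X) \<^bold>\<oplus> bng (X \<^bold>* Y))"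
      by (subst add.interchange) simp_all
    then show ?thesis by (simp add: add.inl_def del: add.interchange)
  qed
  show "inl X Y \<cdot> copy (X \<^bold>+ Y) = inl X Y \<cdot> ((copy X \<^bold>\<oplus> bng (X \<^bold>* Y)) \<^bold>\<oplus> (bng (Y \<^bold>* X) \<^bold>\<oplus> copy Y))
    \<cdot> (dli X X Y \<^bold>\<oplus> dli Y X Y)"
    unfolding e e' by (simp add: copy_inl inl_mA)
  show "inr X Y \<cdot> copy (X \<^bold>+ Y) = inr X Y \<cdot> ((copy X \<^bold>\<oplus> bng (X \<^bold>* Y)) \<^bold>\<oplus> (bng (Y \<^bold>* X) \<^bold>\<oplus> copy Y))
    \<cdot> (dli X X Y \<^bold>\<oplus> dli Y X Y)"
    unfolding e e' by (simp add: copy_inr inr_mA)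
qed simp_all

end

section \<open>The rig category of tapes\<close>

context tapes
begin

interpretation R: srig Pol "arr TC" "src TC" "tgt TC" "\<lambda>P. I P" "(\<cdot>)" "(@)" "(\<^bold>\<oplus>)" "[]"
  "\<lambda>P Q. S P Q" "\<lambda>P. N P" "\<lambda>P. B P"
   pten "(\<^bold>\<otimes>)" "[[]]" "\<lambda>P Q. M P Q" "\<lambda>P Q R. D P Q R" "\<lambda>P Q R. Di P Q R"
  by (rule srig_tapes)

abbreviation C where "C P \<equiv> cl (tcopy P)"
abbreviation E where "E P \<equiv> cl (tdisc P)"

lemma C_Nil: "C [] = I []" by (simp add: cl_TId0)

lemma C_Cons: "\<lbrakk>U \<in> Wd; P \<in> Pol\<rbrakk> \<Longrightarrow> C (U # P) = (Ci (ccopy U) \<^bold>\<oplus> B (map ((@) U) P)) \<^bold>\<oplus>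
  ((B (pten P [U]) \<^bold>\<oplus> C P) \<cdot> Di P [U] P)"
  by (simp add: cl_seq cl_sum)

lemma E_Nil: "E [] = B [[]]" by (simp add: B_single)

lemma E_Cons: "\<lbrakk>U \<in> Wd; P \<in> Pol\<rbrakk> \<Longrightarrow> E (U # P) = (Ci (cdisc U) \<^bold>\<oplus> E P) \<cdot> N [[]]"
  by (simp add: cl_seq cl_sum N_single)
declare tcopy.simps [simp del] tdisc.simps [simp del]

lemma C_single: "U \<in> Wd \<Longrightarrow> C [U] = Ci (ccopy U)"
  by (simp add: C_Cons C_Nil D_Nil B_Nil)

lemma E_single: "U \<in> Wd \<Longrightarrow> E [U] = Ci (cdisc U)"
  using A.nab_run [of "[[]]"] A.inl_tA [of "Ci (cdisc U)" "B [[]]" "[U]" "[]"]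
    by (simp add: E_Cons E_Nil)

text \<open>\<open>e\<close> and \<open>e'\<close> rewrite the padding of the two summands of
  \<open>tcopy\<close> as composition with an injection; strictness on the left monomial, or the
  inverse distributor, then produces the square of an injection.\<close>

lemma C_letter: assumes [simp]: "U \<in> Wd" "P \<in> Pol"
  shows "inl [U] P \<cdot> C (U # P) = C [U] \<cdot> (inl [U] P \<^bold>\<otimes> inl [U] P)"
    "inr [U] P \<cdot> C (U # P) = C P \<cdot> (inr [U] P \<^bold>\<otimes> inr [U] P)"
proof -
  have e: "B (pten P [U]) \<^bold>\<oplus> C P = C P \<cdot> inr (pten P [U]) (pten P P)"
  proof -
    have "B (pten P [U]) \<^bold>\<oplus> C P = (I [] \<^bold>\<oplus> C P) \<cdot> (B (pten P [U]) \<^bold>\<oplus> I (pten P P))"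
      by (subst Z.interchange) simp_all
    then show ?thesis by (simp add: A.inr_def del: Z.interchange)
  qed
  have e': "Ci (ccopy U) \<^bold>\<oplus> B (map ((@) U) P) = Ci (ccopy U) \<cdot> inl [U @ U] (map ((@) U) P)"
  proof -
    have "Ci (ccopy U) \<^bold>\<oplus> B (map ((@) U) P) = (Ci (ccopy U) \<^bold>\<oplus> I [])
      \<cdot> (I [U @ U] \<^bold>\<oplus> B (map ((@) U) P))" by (subst Z.interchange) simp_all
    then show ?thesis by (simp add: A.inl_def del: Z.interchange)
  qed
  note i = R.inl_mA [of "[U]" P "inl [U] P"] R.inr_mA [of "[U]" P "inr [U] P"]
  show "inl [U] P \<cdot> C (U # P) = C [U] \<cdot> (inl [U] P \<^bold>\<otimes> inl [U] P)"
    unfolding C_Cons [OF assms] e e' C_single [OF assms(1)]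
    using i A.inl_inl [of "[U @ U]" "map ((@) U) P" "map (\<lambda>V. V @ U) P"] by (simp add: I1_inl)
  show "inr [U] P \<cdot> C (U # P) = C P \<cdot> (inr [U] P \<^bold>\<otimes> inr [U] P)"
    unfolding C_Cons [OF assms] e e'
    using i by (simp add: inr_Di inr_Di [THEN Z.seq_eq])
qed

lemma E_letter: assumes [simp]: "U \<in> Wd" "P \<in> Pol"
  shows "inl [U] P \<cdot> E (U # P) = E [U]" "inr [U] P \<cdot> E (U # P) = E P"
  by (simp_all add: E_Cons [of U P] E_single)

lemma C_in: assumes [simp]: "Q \<in> Pol"
  shows "P \<in> Pol \<Longrightarrow> inl P Q \<cdot> C (P @ Q) = C P \<cdot> (inl P Q \<^bold>\<otimes> inl P Q) \<and> inr P Q \<cdot> C (P @ Q) = C Q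
    \<cdot> (inr P Q \<^bold>\<otimes> inr P Q)
    \<and> inl P Q \<cdot> E (P @ Q) = E P \<and> inr P Q \<cdot> E (P @ Q) = E Q"
proof (induct P)
  case Nil
  then show ?case by (auto intro!: A.ext0 simp del: A.inl_un' A.bng_seq)
next
  case (Cons U P)
  then have [simp]: "U \<in> Wd" "P \<in> Pol" by auto
  note [simp del] = R.inl_mA R.inr_mA R.inr_mA'
  have IH: "inl P Q \<cdot> C (P @ Q) = C P \<cdot> (inl P Q \<^bold>\<otimes> inl P Q)" "inr P Q \<cdot> C (P @ Q) = C Q
    \<cdot> (inr P Q \<^bold>\<otimes> inr P Q)"
    "inl P Q \<cdot> E (P @ Q) = E P" "inr P Q \<cdot> E (P @ Q) = E Q" using Cons by auto
  have e: "inl [U] P \<cdot> inl (U # P) Q = inl [U] (P @ Q)" "inr [U] P \<cdot> inl (U # P) Q = inl P Q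
    \<cdot> inr [U] (P @ Q)"
    "inr (U # P) Q = inr P Q \<cdot> inr [U] (P @ Q)"
    using A.inl_inl [of "[U]" P Q] A.inr_inl [of "[U]" P Q] A.inr_expand [of "[U]" P Q]
      by simp_all
  have 1: "inl (U # P) Q \<cdot> C (U # P @ Q) = C (U # P) \<cdot> (inl (U # P) Q \<^bold>\<otimes> inl (U # P) Q)"
  proof (rule A.ext2 [of _ _ "[U]" P])
    show "inl [U] P \<cdot> inl (U # P) Q \<cdot> C (U # P @ Q) = inl [U] P \<cdot> C (U # P)
      \<cdot> (inl (U # P) Q \<^bold>\<otimes> inl (U # P) Q)"
      by (simp add: e e(1,2) [THEN Z.seq_eq] C_letter C_letter [THEN Z.seq_eq])
    show "inr [U] P \<cdot> inl (U # P) Q \<cdot> C (U # P @ Q) = inr [U] P \<cdot> C (U # P)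
      \<cdot> (inl (U # P) Q \<^bold>\<otimes> inl (U # P) Q)"
      by (simp add: e e(1,2) [THEN Z.seq_eq] C_letter C_letter [THEN Z.seq_eq] IH [THEN Z.seq_eq])
  qed simp_all
  have 2: "inl (U # P) Q \<cdot> E (U # P @ Q) = E (U # P)"
    by (rule A.ext2 [of _ _ "[U]" P]) (simp_all add: e e(1,2) [THEN Z.seq_eq] E_letter IH)
  have 3: "inr (U # P) Q \<cdot> C (U # P @ Q) = C Q \<cdot> (inr (U # P) Q \<^bold>\<otimes> inr (U # P) Q)"
    by (simp add: e C_letter IH [THEN Z.seq_eq])
  have 4: "inr (U # P) Q \<cdot> E (U # P @ Q) = E Q"
    by (simp add: e E_letter IH)
  show ?case using 1 2 3 4 by simp
qed

lemma srig_copy_tapes: "srig_copy Pol (arr TC) (src TC) (tgt TC) (\<lambda>P. I P) (\<cdot>) (@) (\<^bold>\<oplus>) []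
  (\<lambda>P Q. S P Q) (\<lambda>P. N P) (\<lambda>P. B P)
   pten (\<^bold>\<otimes>) [[]] (\<lambda>P Q. M P Q) (\<lambda>P Q R. D P Q R) (\<lambda>P Q R. Di P Q R) (\<lambda>P. C P) (\<lambda>P. E P)"
  by unfold_locales (simp_all add: C_in del: R.inl_mA R.inr_mA R.inr_mA')

lemma Ci_ml: assumes [simp]: "wf_circ G c" "wf_circ G d" shows "Ci c \<^bold>\<otimes> Ci d = Ci (CTen c d)"
proof -
  interpret K: words_cd "sorts G" KAr ksrc ktgt "\<lambda>U. kc (cid U)" "(\<cdot>\<^sub>K)" "(\<oplus>\<^sub>K)"
   "\<lambda>A B. kc (CSym A B)" "\<lambda>A V. kc (csym1 A V)" "\<lambda>U V. kc (csym U V)"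
   "\<lambda>A. kc (CCopy A)" "\<lambda>A. kc (CDisc A)" "\<lambda>U. kc (ccopy U)" "\<lambda>U. kc (cdisc U)"
    by (rule KAr_cd)
  have "kc (CSeq (CTen (cid (cdom G c)) d) (CTen c (cid (ccod G d)))) = (kc (cid (cdom G c))
    \<cdot>\<^sub>K kc c) \<oplus>\<^sub>K (kc d \<cdot>\<^sub>K kc (cid (ccod G d)))"
    by (subst K.interchange [symmetric]) simp_all
  also have "\<dots> = kc c \<oplus>\<^sub>K kc d" by (simp del: kseq_kc kten_kc)
  finally have "kc (CSeq (CTen (cid (cdom G c)) d) (CTen c (cid (ccod G d)))) = kc (CTen c d)"
    by simp
  from Ci_eq [OF this] show ?thesis by (subst ml_decomp) (simp_all add: I_Ci Ci_I Ci_seq)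
qed

lemma Ci_comonoid: assumes [simp]: "U \<in> Wd"
  shows "Ci (ccopy U) \<cdot> (Ci (ccopy U) \<^bold>\<otimes> I [U]) = Ci (ccopy U) \<cdot> (I [U] \<^bold>\<otimes> Ci (ccopy U))"
    "Ci (ccopy U) \<cdot> (Ci (cdisc U) \<^bold>\<otimes> I [U]) = I [U]" "Ci (ccopy U) \<cdot> (I [U] \<^bold>\<otimes> Ci (cdisc U))
      = I [U]"
    "Ci (ccopy U) \<cdot> Ci (csym U U) = Ci (ccopy U)"
    "V \<in> Wd \<Longrightarrow> Ci (ccopy (U @ V)) = (Ci (ccopy U) \<^bold>\<otimes> Ci (ccopy V))
      \<cdot> (I [U] \<^bold>\<otimes> Ci (csym U V) \<^bold>\<otimes> I [V])"
    "V \<in> Wd \<Longrightarrow> Ci (cdisc (U @ V)) = Ci (cdisc U) \<^bold>\<otimes> Ci (cdisc V)"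
proof -
  interpret K: words_cd "sorts G" KAr ksrc ktgt "\<lambda>U. kc (cid U)" "(\<cdot>\<^sub>K)" "(\<oplus>\<^sub>K)"
   "\<lambda>A B. kc (CSym A B)" "\<lambda>A V. kc (csym1 A V)" "\<lambda>U V. kc (csym U V)"
   "\<lambda>A. kc (CCopy A)" "\<lambda>A. kc (CDisc A)" "\<lambda>U. kc (ccopy U)" "\<lambda>U. kc (cdisc U)"
    by (rule KAr_cd)
  have "kc (CSeq (ccopy U) (CTen (ccopy U) (cid U)))
    = kc (CSeq (ccopy U) (CTen (cid U) (ccopy U)))"
    "kc (CSeq (ccopy U) (CTen (cdisc U) (cid U))) = kc (cid U)"
      "kc (CSeq (ccopy U) (CTen (cid U) (cdisc U))) = kc (cid U)"
    "kc (CSeq (ccopy U) (csym U U)) = kc (ccopy U)"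
    using K.wc_comonoid [of U] by simp_all
  from this [THEN Ci_eq] show "Ci (ccopy U) \<cdot> (Ci (ccopy U) \<^bold>\<otimes> I [U]) = Ci (ccopy U)
    \<cdot> (I [U] \<^bold>\<otimes> Ci (ccopy U))"
    "Ci (ccopy U) \<cdot> (Ci (cdisc U) \<^bold>\<otimes> I [U]) = I [U]" "Ci (ccopy U) \<cdot> (I [U] \<^bold>\<otimes> Ci (cdisc U))
      = I [U]"
    "Ci (ccopy U) \<cdot> Ci (csym U U) = Ci (ccopy U)"
    by (simp_all add: I_Ci Ci_I Ci_seq Ci_cid)
next
  assume [simp]: "V \<in> Wd"
  interpret K: words_cd "sorts G" KAr ksrc ktgt "\<lambda>U. kc (cid U)" "(\<cdot>\<^sub>K)" "(\<oplus>\<^sub>K)"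
   "\<lambda>A B. kc (CSym A B)" "\<lambda>A V. kc (csym1 A V)" "\<lambda>U V. kc (csym U V)"
   "\<lambda>A. kc (CCopy A)" "\<lambda>A. kc (CDisc A)" "\<lambda>U. kc (ccopy U)" "\<lambda>U. kc (cdisc U)"
    by (rule KAr_cd)
  have "kc (ccopy (U @ V)) = kc (CSeq (CTen (ccopy U) (ccopy V)) (CTen (cid U) (CTen (csym U V)
    (cid V))))"
    "kc (cdisc (U @ V)) = kc (CTen (cdisc U) (cdisc V))"
    using K.wc_append [of U V] K.wd_append [of U V] by simp_all
  from this [THEN Ci_eq] show "Ci (ccopy (U @ V)) = (Ci (ccopy U) \<^bold>\<otimes> Ci (ccopy V))
    \<cdot> (I [U] \<^bold>\<otimes> Ci (csym U V) \<^bold>\<otimes> I [V])"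
    "Ci (cdisc (U @ V)) = Ci (cdisc U) \<^bold>\<otimes> Ci (cdisc V)"
    by (simp_all add: I_Ci Ci_I Ci_seq Ci_ml)
qed

lemma scd_tapes: "scd Pol (arr TC) (src TC) (tgt TC) (\<lambda>P. I P) (\<cdot>) pten (\<^bold>\<otimes>) [[]] (\<lambda>P Q. M P Q)
  (\<lambda>P. C P) (\<lambda>P. E P)"
proof -
  interpret Q: srig_copy Pol "arr TC" "src TC" "tgt TC" "\<lambda>P. I P" "(\<cdot>)" "(@)" "(\<^bold>\<oplus>)" "[]"
    "\<lambda>P Q. S P Q" "\<lambda>P. N P" "\<lambda>P. B P"
   pten "(\<^bold>\<otimes>)" "[[]]" "\<lambda>P Q. M P Q" "\<lambda>P Q R. D P Q R" "\<lambda>P Q R. Di P Q R" "\<lambda>P. C P" "\<lambda>P. E P"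
    by (rule srig_copy_tapes)
  have c: "Q.comonoid P" if "P \<in> Pol" for P
    using that
  proof (induct P)
    case Nil
    show ?case unfolding Q.comonoid_def by (intro conjI A.ext0) simp_all
  next
    case (Cons U P)
    then have [simp]: "U \<in> Wd" "P \<in> Pol" by auto
    have "Q.comonoid [U]" unfolding Q.comonoid_def
      by (simp add: C_single E_single M_single Cs_single Ci_comonoid)
    then show ?case using Q.comonoid_sum [of "[U]" P] Cons by simp
  qed
  have p1: "Q.product [U] P" if [simp]: "U \<in> Wd" and P: "P \<in> Pol" for U P
    using P
  proof (induct P)
    case Nil
    show ?case unfolding Q.product_def by (intro conjI A.ext0) simp_all
  next
    case (Cons V P)
    then have [simp]: "V \<in> Wd" "P \<in> Pol" by auto
    have "Q.product [U] [V]" unfolding Q.product_def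
      by (simp add: C_single E_single M_single Cs_single Ci_comonoid)
    then show ?case using Q.product_sum2 [of "[V]" P "[U]"] Cons by (simp add: I1_inl I1_inr)
  qed
  have p: "Q.product P P'" if "P \<in> Pol" and P': "P' \<in> Pol" for P P'
    using that(1)
  proof (induct P)
    case Nil
    show ?case unfolding Q.product_def using P' by (intro conjI A.ext0) simp_all
  next
    case (Cons U P)
    then show ?case using Q.product_sum1 [of "[U]" P P'] p1 P' by simp
  qed
  show ?thesis
  proof
    show "C [[]] = I [[]]" by (simp add: C_single flip: Ci_cid)
    show "E [[]] = I [[]]" by (simp add: E_single flip: Ci_cid)
  qed (use c p in \<open>auto simp: Q.comonoid_def Q.product_def\<close>)
qed

section \<open>Assembling the rig category of tapes\<close>

lemma strict_add: "strict_sym_monoidal_category TC (add TC)"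
  by (rule strict_of_ssm) (use Y.ssm_axioms in \<open>simp_all add: tape_cat_def [of T G] tape_add_def\<close>)

lemma strict_mul: "strict_sym_monoidal_category TC (mul TC)"
  by (rule strict_of_ssm) (use ml_ssm in \<open>simp_all add: tape_cat_def [of T G] tape_mul_def\<close>)

lemma right_strict_TC: "right_strict_rig_category TC"
  by (rule rig_of_srig(1) [where dli = "\<lambda>P Q R. Di P Q R"])
    (use srig_tapes strict_add strict_mul in \<open>simp_all add: cl_TId0\<close>)

lemma fccd_TC: "fccd_rig_category TC"
proof -
  interpret Q: srig_copy Pol "arr TC" "src TC" "tgt TC" "\<lambda>P. I P" "(\<cdot>)" "(@)" "(\<^bold>\<oplus>)" "[]"
    "\<lambda>P Q. S P Q" "\<lambda>P. N P" "\<lambda>P. B P"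
   pten "(\<^bold>\<otimes>)" "[[]]" "\<lambda>P Q. M P Q" "\<lambda>P Q R. D P Q R" "\<lambda>P Q R. Di P Q R" "\<lambda>P. C P" "\<lambda>P. E P"
    by (rule srig_copy_tapes)
  show ?thesis
    by (rule fccd_rig_of_srig [where dli = "\<lambda>P Q R. Di P Q R"])
      (use srig_tapes strict_add strict_mul scd_tapes Q.disc_add Q.copy_add in \<open>simp_all
        add: cl_TId0\<close>)
qed

text \<open>For a single monomial the recursion of \<open>tdl\<close> ends after one step, in which
  the only symmetry is with the empty sum.\<close>

lemma sesquistrict_TC: "sesquistrict_rig_category (sorts G) tape_sort TC"
proof -
  interpret right_strict_rig_category TC by (rule right_strict_TC)
  show ?thesis
  proof
    fix A X Y assume [simp]: "A \<in> sorts G" and "X \<in> obj TC" "Y \<in> obj TC"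
    then have [simp]: "X \<in> Pol" "Y \<in> Pol" by simp_all
    have "dl TC (tape_sort A) X Y = ide TC (map ((@) [A]) (X @ Y))"
      by (simp add: tape_sort_def D_Cons D_Nil W.wsy_Nil)
    then show "is_ide TC (dl TC (tape_sort A) X Y)"
      using map_Wd [of "[A]" "X @ Y"] unfolding is_ide_def by force
  qed (simp add: tape_sort_def)
qed

end

section \<open>Iterated sums\<close>

context sfc
begin

text \<open>\<open>pw\<close>, \<open>inj\<close> and \<open>cps\<close> play the part of
  \<open>nsum\<close>, \<open>ninj\<close> and \<open>ncopair\<close> for an arbitrary object X and
  arbitrary components, so that sums of units, their multiples and lists of equal monomials are
  treated alike.\<close>

primrec pw :: "'o \<Rightarrow> nat \<Rightarrow> 'o" where
  "pw X 0 = un"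
| "pw X (Suc n) = X \<^bold>+ pw X n"

fun inj :: "'o \<Rightarrow> nat \<Rightarrow> nat \<Rightarrow> 'a" where
  "inj X 0 k = undefined"
| "inj X (Suc n) 0 = inl X (pw X n)"
| "inj X (Suc n) (Suc k) = inj X n k \<cdot> inr X (pw X n)"

primrec cps :: "'o \<Rightarrow> 'a list \<Rightarrow> 'a" where
  "cps Y [] = bng Y"
| "cps Y (f # fs) = cp f (cps Y fs)"

lemma pw_Ob [simp]: "X \<in> Ob \<Longrightarrow> pw X n \<in> Ob"
  by (induct n) auto

lemma pw_add: "X \<in> Ob \<Longrightarrow> pw X (m + n) = pw X m \<^bold>+ pw X n"
  by (induct m) auto

lemma inj_type [simp]: "\<lbrakk>X \<in> Ob; i < n\<rbrakk> \<Longrightarrow> inj X n i \<in> Ar \<and> src (inj X n i) = X \<and> tgt (inj X n i)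
  = pw X n"
  by (induct X n i rule: inj.induct) auto

definition legs :: "'o \<Rightarrow> 'o \<Rightarrow> 'a list \<Rightarrow> bool" where
  "legs X Y fs \<longleftrightarrow> X \<in> Ob \<and> Y \<in> Ob \<and> (\<forall>f \<in> set fs. f \<in> Ar \<and> src f = X \<and> tgt f = Y)"

lemma legs_simps [simp]: "legs X Y [] \<longleftrightarrow> X \<in> Ob \<and> Y \<in> Ob"
  "legs X Y (f # fs) \<longleftrightarrow> f \<in> Ar \<and> src f = X \<and> tgt f = Y \<and> legs X Y fs"
  by (auto simp: legs_def)

lemma cps_type [simp]: "legs X Y fs \<Longrightarrow> cps Y fs \<in> Ar \<and> src (cps Y fs) = pw X (length fs)
  \<and> tgt (cps Y fs) = Y"
  by (induct fs) auto

lemma cps_seq: "\<lbrakk>legs X Y fs; g \<in> Ar; src g = Y\<rbrakk> \<Longrightarrow> cps Y fs \<cdot> g = cps (tgt g) (map (\<lambda>f. f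
  \<cdot> g) fs)"
proof (induct fs)
  case (Cons f fs)
  then have [simp]: "legs X Y fs" "f \<in> Ar" "src f = X" "tgt f = Y" "g \<in> Ar" "src g = Y" "X \<in> Ob"
    "Y \<in> Ob"
    and IH: "cps Y fs \<cdot> g = cps (tgt g) (map (\<lambda>f. f \<cdot> g) fs)" by (auto simp: legs_def)
  have "legs X (tgt g) (map (\<lambda>f. f \<cdot> g) fs)" using Cons by (auto simp: legs_def)
  note [simp] = cps_type [OF this] cps_type [OF \<open>legs X Y fs\<close>]
  show ?case
    by (simp add: cp_def nab_natural [of g, simplified] flip: IH)
qed simp

lemma ext_pw: "\<lbrakk>f \<in> Ar; g \<in> Ar; src f = pw X n; src g = pw X n; tgt f = tgt g; X \<in> Ob;
    \<And>i. i < n \<Longrightarrow> inj X n i \<cdot> f = inj X n i \<cdot> g\<rbrakk> \<Longrightarrow> f = g"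
proof (induct n arbitrary: f g)
  case 0
  then show ?case by (simp add: ext0)
next
  case (Suc n)
  show ?case
  proof (rule ext2 [of f g X "pw X n"])
    show "inl X (pw X n) \<cdot> f = inl X (pw X n) \<cdot> g" using Suc(8) [of 0] by simp
    show "inr X (pw X n) \<cdot> f = inr X (pw X n) \<cdot> g"
    proof (rule Suc(1))
      fix i assume "i < n"
      then show "inj X n i \<cdot> inr X (pw X n) \<cdot> f = inj X n i \<cdot> inr X (pw X n) \<cdot> g"
        using Suc(8) [of "Suc i"] Suc(2-7) by simp
    qed (use Suc in simp_all)
  qed (use Suc in simp_all)
qed

lemma inj_cps [simp]: "\<lbrakk>legs X Y fs; i < length fs; n = length fs\<rbrakk> \<Longrightarrow> inj X n i \<cdot> cps Y fs
  = fs ! i"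
proof (induct X n i arbitrary: fs rule: inj.induct)
  case (2 X n)
  then obtain f gs where "fs = f # gs" by (cases fs) auto
  with 2 show ?case by auto
next
  case (3 X n k)
  then obtain f gs where fs: "fs = f # gs" by (cases fs) auto
  with 3 have "inj X n k \<cdot> cps Y gs = gs ! k" "X \<in> Ob" by (auto simp: legs_def)
  with 3 fs show ?case by auto
qed auto

lemma inj_add: "\<lbrakk>X \<in> Ob; i < m\<rbrakk> \<Longrightarrow> inj X m i \<cdot> inl (pw X m) (pw X n) = inj X (m + n) i"
proof (induct X m i rule: inj.induct)
  case (3 X m k)
  then have "inj X m k \<cdot> inl (pw X m) (pw X n) = inj X (m + n) k" by simp
  from this [THEN seq_eq, of "inr X (pw X (m + n))"] 3 show ?case by (simp add: pw_add)
qed (simp_all add: pw_add)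

lemma inj_add': "\<lbrakk>X \<in> Ob; i < n\<rbrakk> \<Longrightarrow> inj X n i \<cdot> inr (pw X m) (pw X n) = inj X (m + n) (m + i)"
proof (induct m)
  case (Suc m)
  then show ?case by (simp add: inr_expand pw_add flip: Suc(1))
qed simp

text \<open>The left-hand side is the shape that \<open>ttrm\<close> gives to a variable.\<close>

lemma inj_sum: "\<lbrakk>X \<in> Ob; i < n\<rbrakk> \<Longrightarrow> bng (pw X i) \<^bold>\<oplus> ide X \<^bold>\<oplus> bng (pw X (n - Suc i)) = inj X n i"
proof (induct n arbitrary: i)
  case (Suc n)
  show ?case
  proof (cases i)
    case 0
    then show ?thesis using Suc by (simp add: inl_def)
  next
    case (Suc j)
    with Suc.prems have IH: "bng (pw X j) \<^bold>\<oplus> ide X \<^bold>\<oplus> bng (pw X (n - Suc j)) = inj X n j" "j < n"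
      "X \<in> Ob"
      using Suc.hyps [of j] by auto
    have "bng (X \<^bold>+ pw X j) \<^bold>\<oplus> ide X \<^bold>\<oplus> bng (pw X (n - Suc j)) = bng X \<^bold>\<oplus> inj X n j"
      using IH(3) by (simp flip: IH(1) bng_tO)
    also have "\<dots> = (ide un \<^bold>\<oplus> inj X n j) \<cdot> (bng X \<^bold>\<oplus> ide (pw X n))"
      using IH(2,3) by (subst interchange) simp_all
    also have "\<dots> = inj X n j \<cdot> inr X (pw X n)" using IH(2,3)
      by (simp add: inr_def del: interchange)
    finally show ?thesis using Suc by simp
  qed
qed simp

text \<open>Equalities of such maps are equalities of functions on indices.\<close>

definition ixm :: "'o \<Rightarrow> nat \<Rightarrow> nat list \<Rightarrow> 'a" where
  "ixm X m ks = cps (pw X m) (map (inj X m) ks)"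

lemma ixm_legs [simp]: "\<lbrakk>X \<in> Ob; set ks \<subseteq> {..<m}\<rbrakk> \<Longrightarrow> legs X (pw X m) (map (inj X m) ks)"
  by (auto simp: legs_def)

lemma ixm_type [simp]: "\<lbrakk>X \<in> Ob; set ks \<subseteq> {..<m}\<rbrakk> \<Longrightarrow> ixm X m ks \<in> Ar"
   "\<lbrakk>X \<in> Ob; set ks \<subseteq> {..<m}\<rbrakk> \<Longrightarrow> src (ixm X m ks) = pw X (length ks)"
   "\<lbrakk>X \<in> Ob; set ks \<subseteq> {..<m}\<rbrakk> \<Longrightarrow> tgt (ixm X m ks) = pw X m"
  using cps_type [OF ixm_legs, of X ks m] by (auto simp: ixm_def)

lemma inj_ixm: "\<lbrakk>X \<in> Ob; set ks \<subseteq> {..<m}; i < length ks; n = length ks\<rbrakk> \<Longrightarrow> inj X n i \<cdot> ixm X m ks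
  = inj X m (ks ! i)"
  by (simp add: ixm_def)

lemma ixm_eqI: "\<lbrakk>f \<in> Ar; src f = pw X (length ks); tgt f = pw X m; X \<in> Ob; set ks \<subseteq> {..<m};
    \<And>i. i < length ks \<Longrightarrow> inj X (length ks) i \<cdot> f = inj X m (ks ! i)\<rbrakk> \<Longrightarrow> ixm X m ks = f"
  by (rule ext_pw [of _ _ X "length ks"]) (simp_all add: inj_ixm)

lemma ixm_ide: "X \<in> Ob \<Longrightarrow> ixm X n [0..<n] = ide (pw X n)"
  by (rule ixm_eqI) auto

lemma ixm_inl: "X \<in> Ob \<Longrightarrow> ixm X (m + n) [0..<m] = inl (pw X m) (pw X n)"
  by (rule ixm_eqI) (auto simp: inj_add pw_add)

lemma ixm_inr: "X \<in> Ob \<Longrightarrow> ixm X (m + n) [m..<m + n] = inr (pw X m) (pw X n)"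
  by (rule ixm_eqI) (auto simp: inj_add' pw_add)

lemma cps_append: "\<lbrakk>legs X Y fs; legs X Y gs\<rbrakk> \<Longrightarrow> cps Y (fs @ gs) = cp (cps Y fs) (cps Y gs)"
proof (induct fs)
  case (Cons f fs)
  then have IH: "cps Y (fs @ gs) = cp (cps Y fs) (cps Y gs)" and [simp]: "f \<in> Ar" "src f
    = X" "tgt f = Y" "legs X Y fs" "legs X Y gs" "X \<in> Ob" "Y \<in> Ob"
    by (auto simp: legs_def)
  note [simp] = cps_type [OF \<open>legs X Y fs\<close>] cps_type [OF \<open>legs X Y gs\<close>]
  have "cp f (cp (cps Y fs) (cps Y gs)) = cp (cp f (cps Y fs)) (cps Y gs)"
  proof (rule ext2 [of _ _ "X \<^bold>+ pw X (length fs)" "pw X (length gs)"])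
    have "inr (X \<^bold>+ pw X (length fs)) (pw X (length gs)) \<cdot> cp f (cp (cps Y fs) (cps Y gs))
      = cps Y gs"
      by (simp add: inr_expand)
    then show "inr (X \<^bold>+ pw X (length fs)) (pw X (length gs)) \<cdot> cp f (cp (cps Y fs) (cps Y gs))
      = inr (X \<^bold>+ pw X (length fs)) (pw X (length gs)) \<cdot> cp (cp f (cps Y fs)) (cps Y gs)" by simp
    show "inl (X \<^bold>+ pw X (length fs)) (pw X (length gs)) \<cdot> cp f (cp (cps Y fs) (cps Y gs))
      = inl (X \<^bold>+ pw X (length fs)) (pw X (length gs)) \<cdot> cp (cp f (cps Y fs)) (cps Y gs)"
      by (rule ext2 [of _ _ X "pw X (length fs)"]) simp_all
  qed simp_all
  then show ?case by (simp add: IH)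
next
  case Nil
  note [simp] = cps_type [OF Nil(2)]
  have "bng Y \<^bold>\<oplus> cps Y gs = cps Y gs \<cdot> (bng Y \<^bold>\<oplus> ide Y)"
  proof -
    have "bng Y \<^bold>\<oplus> cps Y gs = (ide un \<^bold>\<oplus> cps Y gs) \<cdot> (bng Y \<^bold>\<oplus> ide Y)" using Nil
      by (subst interchange) (auto simp: legs_def)
    then show ?thesis using Nil by (auto simp del: interchange)
  qed
  then show ?case using Nil by (auto simp: cp_def nab_lun legs_def)
qed

lemma cps_single [simp]: "\<lbrakk>f \<in> Ar; tgt f = Y\<rbrakk> \<Longrightarrow> cps Y [f] = f"
  using inl_cp [of f "bng Y" "src f" un] by (auto simp: cp_def simp del: inl_cp)

lemma cp_sum: "\<lbrakk>f \<in> Ar; g \<in> Ar\<rbrakk> \<Longrightarrow> cp (f \<cdot> inl (tgt f) (tgt g)) (g \<cdot> inr (tgt f) (tgt g)) = f \<^bold>\<oplus> g"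
  by (rule ext2 [of _ _ "src f" "src g"]) simp_all

end

section \<open>The Lawvere theory\<close>

lemma trm_induct [case_names Var App]:
  assumes "\<And>i. P (Var i)" "\<And>f ts. (\<And>t. t \<in> set ts \<Longrightarrow> P t) \<Longrightarrow> P (App f ts)"
  shows "P t"
  using assms by (induct t) auto

lemma subst_Var [simp]: "subst Var t = t"
  by (induct t rule: trm_induct) (auto simp: map_idI)

lemma subst_subst [simp]: "subst s (subst s' t) = subst (\<lambda>i. subst s (s' i)) t"
  by (induct t rule: trm_induct) auto

lemma subst_cong: "wf_trm T n t \<Longrightarrow> (\<And>i. i < n \<Longrightarrow> s i = s' i) \<Longrightarrow> subst s t = subst s' t"
  by (induct t rule: trm_induct) auto

lemma subst_wf [simp]: "wf_trm T n t \<Longrightarrow> (\<And>i. i < n \<Longrightarrow> wf_trm T m (s i)) \<Longrightarrow> wf_trm T m (subst s t)"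
  by (induct t rule: trm_induct) auto

lemma trm_eq_subst_right:
  "wf_trm T n t \<Longrightarrow> (\<And>i. i < n \<Longrightarrow> trm_eq T m (s i) (s' i)) \<Longrightarrow> trm_eq T m (subst s t) (subst s' t)"
  by (induct t rule: trm_induct) (auto intro!: trm_eq.cong simp: list_all2_conv_all_nth)

lemma subst_wf_nth [simp]: "\<lbrakk>wf_trm T (length us) t; \<forall>u \<in> set us. wf_trm T m u\<rbrakk>
  \<Longrightarrow> wf_trm T m (subst ((!) us) t)"
  by auto

lemma wf_shift [simp]: "wf_trm T k t \<Longrightarrow> wf_trm T (n + k) (subst (\<lambda>i. Var (n + i)) t)"
  by (rule subst_wf) auto

locale lawvere_theory =
  fixes T :: "'f alg_theory"
  assumes T: "algebraic_theory T"
begin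

lemma eqs_wf: "(n, t, t') \<in> eqs T \<Longrightarrow> wf_trm T n t \<and> wf_trm T n t'"
  using T by (auto simp: algebraic_theory_def)

lemma trm_eq_wf: "trm_eq T n t u \<Longrightarrow> wf_trm T n t \<and> wf_trm T n u"
proof (induct rule: trm_eq.induct)
  case (ax k t t' s)
  then show ?case using eqs_wf subst_wf by blast
qed (auto simp: list_all2_conv_all_nth in_set_conv_nth)

lemma trm_eq_subst_left:
  "trm_eq T n t u \<Longrightarrow> (\<And>i. i < n \<Longrightarrow> wf_trm T m (s i)) \<Longrightarrow> trm_eq T m (subst s t) (subst s u)"
proof (induct rule: trm_eq.induct)
  case (ax k t t' s')
  have "wf_trm T m (subst s (s' i))" if "i < k" for i
    using ax that by (intro subst_wf [of T n]) auto
  from trm_eq.ax [OF ax(1) this] show ?case by simp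
next
  case (cong f ts us)
  then show ?case by (auto intro!: trm_eq.cong simp: list_all2_conv_all_nth)
qed (auto intro: trm_eq.refl trm_eq.sym trm_eq.trans)

text \<open>Arrows are handled through tuples of terms. In the opposite category a tuple goes from
  its length to the number n of its variables.\<close>

definition la :: "nat \<Rightarrow> 'f trm list \<Rightarrow> 'f larr" where
  "la n ts = (n, length ts, map (trm_class T n) ts)"

lemma class_eqI: "trm_eq T n t u \<Longrightarrow> trm_class T n t = trm_class T n u"
  by (auto simp: trm_class_def intro: trm_eq.sym trm_eq.trans)

lemma class_rep: "wf_trm T n t \<Longrightarrow> trm_eq T n t (rep (trm_class T n t))"
  by (auto simp: trm_class_def rep_def intro: someI trm_eq.refl)

abbreviation "LO \<equiv> law_op T"

lemma LO_simps: "obj LO = UNIV" "src LO (la n ts) = length ts" "tgt LO (la n ts) = n"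
  "f \<in> arr LO \<longleftrightarrow> (\<exists>n ts. f = la n ts \<and> (\<forall>t \<in> set ts. wf_trm T n t))"
  "ide LO n = la n (map Var [0..<n])"
  by (auto simp: law_op_def op_cat_def lawvere_def la_def)

text \<open>Composition is defined by chosen representatives. Another choice changes the term and
  the terms substituted into it by provable equality, which \<open>trm_eq_subst_left\<close> and
  \<open>trm_eq_subst_right\<close> absorb.\<close>

lemma LO_seq: assumes "\<forall>t \<in> set ts. wf_trm T n t" "\<forall>u \<in> set us. wf_trm T k u" "length us = n"
  shows "seq LO (la n ts) (la k us) = la k (map (subst ((!) us)) ts)"
proof -
  have "trm_class T k (subst (\<lambda>i. rep (map (trm_class T k) us ! i)) (rep (trm_class T n t)))
    = trm_class T k (subst ((!) us) t)"
    if "t \<in> set ts" for t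
  proof (rule class_eqI [OF trm_eq.trans])
    have t: "wf_trm T n t" using that assms by auto
    have u: "trm_eq T k (rep (map (trm_class T k) us ! i)) (us ! i)" if "i < n" for i
      using class_rep [of k "us ! i", THEN trm_eq.sym] that assms by auto
    show "trm_eq T k (subst (\<lambda>i. rep (map (trm_class T k) us ! i)) (rep (trm_class T n t)))
      (subst (\<lambda>i. rep (map (trm_class T k) us ! i)) t)"
      using u trm_eq_wf by (intro trm_eq_subst_left [of n] trm_eq.sym [OF class_rep [OF t]]) blast
    show "trm_eq T k (subst (\<lambda>i. rep (map (trm_class T k) us ! i)) t) (subst ((!) us) t)"
      using u by (intro trm_eq_subst_right [OF t])
  qed
  then show ?thesis by (simp add: law_op_def op_cat_def lawvere_def la_def)
qed

lemma LO_ten: assumes "\<forall>t \<in> set ts. wf_trm T n t" "\<forall>u \<in> set us. wf_trm T k u"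
  shows "tenA (law_op_add T) (la n ts) (la k us) = la (n + k) (ts @ map (subst (\<lambda>i. Var (n + i)))
    us)"
proof -
  \<comment> \<open>Weakening from n to n + k variables is the substitution
    \<open>Var\<close>.\<close>
  have "trm_class T (n + k) (rep (trm_class T n t)) = trm_class T (n + k) t" if "t \<in> set ts" for t
    using trm_eq_subst_left [OF trm_eq.sym [OF class_rep], of n t "n + k" Var] that assms
      by (auto intro!: class_eqI)
  moreover have "trm_class T (n + k) (subst (\<lambda>i. Var (n + i)) (rep (trm_class T k u)))
    = trm_class T (n + k) (subst (\<lambda>i. Var (n + i)) u)"
    if "u \<in> set us" for u
    using trm_eq_subst_left [OF trm_eq.sym [OF class_rep], of k u "n + k" "\<lambda>i. Var (n + i)"] that
      assms by (auto intro!: class_eqI)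
  ultimately show ?thesis by (simp add: law_op_add_def la_def)
qed

lemma law_incl_la: "length ks = n \<Longrightarrow> law_incl T (n, m, ks) = la m (map Var ks)"
  by (simp add: law_incl_def la_def)

lemma LO_simps2: "unO (law_op_add T) = 0" "tenO (law_op_add T) = (+)"
  "symm (law_op_add T) m n = la (n + m) (map Var ([n..<n + m] @ [0..<n]))"
  "law_op_nab T n = la n (map Var ([0..<n] @ [0..<n]))" "law_op_bng T n = la n []"
  by (simp_all add: law_op_add_def law_incl_la law_op_nab_def law_op_bng_def)

lemma map_subst_ide: "\<forall>t \<in> set ts. wf_trm T n t \<Longrightarrow> map (subst ((!) (map Var [0..<n]))) ts = ts"
  by (rule map_idI) (subst subst_cong [where s' = Var and n = n and T = T], auto)

lemma nth_ide: "length us = n \<Longrightarrow> map ((!) us) [0..<n] = us"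
  using map_nth [of us] by simp

lemma nth_shift: "length vs = n \<Longrightarrow> map ((!) (us @ vs)) [length us..<length us + n] = vs"
  "map ((!) (us @ vs)) [0..<length us] = us"
  by (auto intro!: nth_equalityI simp: nth_append)

lemma LO_E: assumes "f \<in> arr LO" obtains n ts where "f = la n ts" "\<forall>t \<in> set ts. wf_trm T n t"
  using assms by (auto simp: LO_simps)

lemma LO_arr: "\<forall>t \<in> set ts. wf_trm T n t \<Longrightarrow> la n ts \<in> arr LO"
  by (auto simp: LO_simps)

lemma la_map_eqI: "(\<And>t. t \<in> set ts \<Longrightarrow> g t = h t) \<Longrightarrow> la k (map g ts) = la k (map h ts)"
  by (simp add: la_def)

lemma LO_scat: "scat (obj LO) (arr LO) (src LO) (tgt LO) (ide LO) (seq LO)"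
proof
  fix f g h assume "f \<in> arr LO" "g \<in> arr LO" "h \<in> arr LO" and c: "tgt LO f = src LO g" "tgt LO g
    = src LO h"
  obtain n ts where [simp]: "f = la n ts" and w0: "\<forall>t \<in> set ts. wf_trm T n t" using \<open>f \<in> arr LO\<close>
    by (rule LO_E)
  obtain k us where [simp]: "g = la k us" and w1: "\<forall>t \<in> set us. wf_trm T k t" using \<open>g \<in> arr LO\<close>
    by (rule LO_E)
  obtain m vs where [simp]: "h = la m vs" and w2: "\<forall>t \<in> set vs. wf_trm T m t" using \<open>h \<in> arr LO\<close>
    by (rule LO_E)
  note w = w0 w1 w2
  have l: "n = length us" "k = length vs" using c by (auto simp: LO_simps)
  have "la m (map (\<lambda>t. subst ((!) vs) (subst ((!) us) t)) ts)
    = la m (map (\<lambda>t. subst ((!) (map (subst ((!) vs)) us)) t) ts)"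
    using w unfolding l subst_subst by (intro la_map_eqI subst_cong [of T "length us"]) auto
  then show "seq LO (seq LO f g) h = seq LO f (seq LO g h)"
    using w by (simp add: LO_seq l o_def)
next
  fix f g assume "f \<in> arr LO" "g \<in> arr LO" and c: "tgt LO f = src LO g"
  obtain n ts where [simp]: "f = la n ts" and w0: "\<forall>t \<in> set ts. wf_trm T n t" using \<open>f \<in> arr LO\<close>
    by (rule LO_E)
  obtain k us where [simp]: "g = la k us" and w1: "\<forall>t \<in> set us. wf_trm T k t" using \<open>g \<in> arr LO\<close>
    by (rule LO_E)
  note w = w0 w1
  have l: "n = length us" using c by (auto simp: LO_simps)
  show "seq LO f g \<in> arr LO" using w by (simp add: l LO_seq LO_arr)
  show "src LO (seq LO f g) = src LO f" "tgt LO (seq LO f g) = tgt LO g" using w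
    by (simp_all add: l LO_seq LO_simps)
next
  fix X show "ide LO X \<in> arr LO" by (simp add: LO_simps(5) LO_arr)
qed (auto simp: LO_simps LO_seq map_subst_ide nth_ide o_def)

lemma LO_stm: "stm (obj LO) (arr LO) (src LO) (tgt LO) (ide LO) (seq LO) (tenO (law_op_add T))
  (tenA (law_op_add T)) (unO (law_op_add T))"
proof -
  interpret scat "obj LO" "arr LO" "src LO" "tgt LO" "ide LO" "seq LO" by (rule LO_scat)
  show ?thesis
  proof
    fix f f' g g' assume "f \<in> arr LO" "f' \<in> arr LO" "g \<in> arr LO" "g' \<in> arr LO" and c: "tgt LO f
      = src LO f'" "tgt LO g = src LO g'"
    obtain n ts where [simp]: "f = la n ts" and w0: "\<forall>t \<in> set ts. wf_trm T n t" using \<open>f \<in> arr LO\<close>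
      by (rule LO_E)
    obtain k us where [simp]: "g = la k us" and w1: "\<forall>t \<in> set us. wf_trm T k t" using \<open>g \<in> arr LO\<close>
      by (rule LO_E)
    obtain n' vs where [simp]: "f' = la n' vs" and w2: "\<forall>t \<in> set vs. wf_trm T n' t"
      using \<open>f' \<in> arr LO\<close> by (rule LO_E)
    obtain k' ws where [simp]: "g' = la k' ws" and w3: "\<forall>t \<in> set ws. wf_trm T k' t"
      using \<open>g' \<in> arr LO\<close> by (rule LO_E)
    note w = w0 w1 w2 w3
    have l: "n = length vs" "k = length ws" using c by (auto simp: LO_simps)
    let ?sh = "map (subst (\<lambda>i. Var (n' + i))) ws"
    have 1: "subst ((!) (vs @ ?sh)) t = subst ((!) vs) t" if "t \<in> set ts" for t
      using that w by (intro subst_cong [of T n]) (auto simp: nth_append l)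
    have 2: "subst (\<lambda>i. (vs @ ?sh) ! (n + i)) u = subst (\<lambda>i. subst (\<lambda>i. Var (n' + i)) (ws ! i)) u"
      if "u \<in> set us" for u
      using that w by (intro subst_cong [of T k]) (auto simp: nth_append l)
    have w': "\<forall>t \<in> set vs. wf_trm T (n' + k') t"
      using w subst_wf [of T n' _ "n' + k'" Var] by auto
    have w'': "\<forall>t \<in> set ts. wf_trm T (n + k) t"
      using w subst_wf [of T n _ "n + k" Var] by auto
    let ?r = "la (n' + k') (map (subst ((!) vs)) ts @ map (subst (\<lambda>i. subst (\<lambda>i. Var (n' + i))
      (ws ! i))) us)"
    have 5: "seq LO (la (n + k) (ts @ map (subst (\<lambda>i. Var (n + i))) us)) (la (n' + k') (vs @ ?sh))
      = ?r"
      using w w' w'' subst_wf [of T k _ "n + k" "\<lambda>i. Var (n + i)"] subst_wf [of T k' _ "n' + k'"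
        "\<lambda>i. Var (n' + i)"]
      by (subst LO_seq) (auto simp: l(1,2)[symmetric] 1 2 intro!: arg_cong2
        [of _ _ _ _ "\<lambda>xs ys. la (n' + k') (xs @ ys)"])
    have 6: "tenA (law_op_add T) (la n' (map (subst ((!) vs)) ts)) (la k' (map (subst ((!) ws))
      us)) = ?r"
      using w by (subst LO_ten) (auto simp: l o_def)
    show "seq LO (tenA (law_op_add T) f g) (tenA (law_op_add T) f' g')
      = tenA (law_op_add T) (seq LO f f') (seq LO g g')"
      using w 5 6 by (simp add: LO_ten LO_seq l)
  next
    fix f g h assume "f \<in> arr LO" "g \<in> arr LO" "h \<in> arr LO"
    obtain n ts where [simp]: "f = la n ts" and w0: "\<forall>t \<in> set ts. wf_trm T n t" using \<open>f \<in> arr LO\<close>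
      by (rule LO_E)
    obtain k us where [simp]: "g = la k us" and w1: "\<forall>t \<in> set us. wf_trm T k t" using \<open>g \<in> arr LO\<close>
      by (rule LO_E)
    obtain m vs where [simp]: "h = la m vs" and w2: "\<forall>t \<in> set vs. wf_trm T m t" using \<open>h \<in> arr LO\<close>
      by (rule LO_E)
    note w = w0 w1 w2
    have w': "\<forall>t \<in> set ts. wf_trm T (n + k) t" "\<forall>t \<in> set us. wf_trm T (k + m) t"
      using w subst_wf [of T n _ "n + k" Var] subst_wf [of T k _ "k + m" Var] by auto
    show "tenA (law_op_add T) (tenA (law_op_add T) f g) h
      = tenA (law_op_add T) f (tenA (law_op_add T) g h)"
      using w w' by (simp add: LO_ten o_def add.assoc ball_Un)
  next
    fix f g assume "f \<in> arr LO" "g \<in> arr LO"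
    obtain n ts where [simp]: "f = la n ts" and w0: "\<forall>t \<in> set ts. wf_trm T n t" using \<open>f \<in> arr LO\<close>
      by (rule LO_E)
    obtain k us where [simp]: "g = la k us" and w1: "\<forall>t \<in> set us. wf_trm T k t" using \<open>g \<in> arr LO\<close>
      by (rule LO_E)
    note w = w0 w1
    have w': "\<forall>t \<in> set ts. wf_trm T (n + k) t" using w subst_wf [of T n _ "n + k" Var] by auto
    show "tenA (law_op_add T) f g \<in> arr LO" "src LO (tenA (law_op_add T) f g)
      = tenO (law_op_add T) (src LO f) (src LO g)"
      "tgt LO (tenA (law_op_add T) f g) = tenO (law_op_add T) (tgt LO f) (tgt LO g)"
      using w w' by (auto simp: LO_ten LO_simps(2,3) LO_simps2 intro!: LO_arr)
  next
    fix X Y show "tenA (law_op_add T) (ide LO X) (ide LO Y) = ide LO (tenO (law_op_add T) X Y)"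
      by (auto simp: LO_simps LO_simps2 LO_ten intro!: arg_cong [of _ _ "la _"] nth_equalityI
        simp: nth_append)
  next
    fix f assume "f \<in> arr LO"
    obtain n ts where [simp]: "f = la n ts" and w0: "\<forall>t \<in> set ts. wf_trm T n t" using \<open>f \<in> arr LO\<close>
      by (rule LO_E)
    note w = w0
    show "tenA (law_op_add T) (ide LO (unO (law_op_add T))) f = f" "tenA (law_op_add T) f
      (ide LO (unO (law_op_add T))) = f"
      using w by (simp_all add: LO_simps LO_simps2 LO_ten map_idI)
  qed (auto simp: LO_simps LO_simps2)
qed

section \<open>Tuples of variables and the coproduct structure\<close>

lemma list_all_upt [simp]: "list_all (\<lambda>k. k < n) [a..<b] \<longleftrightarrow> b \<le> n \<or> b \<le> a"
proof (cases b)
  case (Suc c)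
  then have "a < b \<Longrightarrow> c \<in> {a..<b}" by auto
  then show ?thesis using Suc by (fastforce simp: list_all_iff)
qed simp

text \<open>Symmetries, codiagonals and identities are tuples of variables, so that equations among
  them are equations between lists of indices. The bounds use \<open>list_all\<close> because it
  simplifies on concatenations and intervals.\<close>

lemma LO_ten_Var: "\<lbrakk>list_all (\<lambda>k. k < n) ks; list_all (\<lambda>k. k < m) ls\<rbrakk>
  \<Longrightarrow> tenA (law_op_add T) (la n (map Var ks)) (la m (map Var ls))
    = la (n + m) (map Var (ks @ map ((+) n) ls))"
  by (simp add: LO_ten list_all_iff o_def)

lemma LO_ten_Nil: "list_all (\<lambda>k. k < m) ls \<Longrightarrow> tenA (law_op_add T) (la n []) (la m (map Var ls))
  = la (n + m) (map Var (map ((+) n) ls))"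
  "list_all (\<lambda>k. k < n) ks \<Longrightarrow> tenA (law_op_add T) (la n (map Var ks)) (la m [])
    = la (n + m) (map Var ks)"
  using LO_ten_Var [of n "[]" m ls] LO_ten_Var [of n ks m "[]"] by simp_all

lemma LO_seq_Var: "\<lbrakk>list_all (\<lambda>k. k < n) ks; list_all (\<lambda>k. k < m) ls; length ls = n\<rbrakk>
  \<Longrightarrow> seq LO (la n (map Var ks)) (la m (map Var ls)) = la m (map Var (map ((!) ls) ks))"
  by (auto simp: LO_seq list_all_iff o_def intro!: la_map_eqI)

lemma map_add_upt': "map ((+) n) [a..<b] = [n + a..<n + b]"
  by (rule nth_equalityI) auto

text \<open>Naturality involves arbitrary terms and is computed by substitution; the other equations
  are about lists of variables.\<close>

lemma LO_sfc: "sfc (obj LO) (arr LO) (src LO) (tgt LO) (ide LO) (seq LO) (tenO (law_op_add T))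
  (tenA (law_op_add T))
   (unO (law_op_add T)) (symm (law_op_add T)) (law_op_nab T) (law_op_bng T)"
proof -
  interpret stm "obj LO" "arr LO" "src LO" "tgt LO" "ide LO" "seq LO" "tenO (law_op_add T)"
    "tenA (law_op_add T)" "unO (law_op_add T)"
    by (rule LO_stm)
  note s = LO_simps LO_simps2
  show ?thesis
  proof
    fix f g assume "f \<in> arr LO" "g \<in> arr LO"
    obtain n ts where [simp]: "f = la n ts" and w0: "\<forall>t \<in> set ts. wf_trm T n t" using \<open>f \<in> arr LO\<close>
      by (rule LO_E)
    obtain k us where [simp]: "g = la k us" and w1: "\<forall>t \<in> set us. wf_trm T k t" using \<open>g \<in> arr LO\<close>
      by (rule LO_E)
    note w = w0 w1
    have w': "\<forall>t \<in> set ts. wf_trm T (n + k) t" "\<forall>t \<in> set us. wf_trm T (k + n) t"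
      using w subst_wf [of T n _ "n + k" Var] subst_wf [of T k _ "k + n" Var] by auto
    have 1: "subst ((!) (map Var [k..<k + n] @ map Var [0..<k])) t = subst (\<lambda>i. Var (k + i)) t" if
      "t \<in> set ts" for t
      using that w by (intro subst_cong [of T n]) (auto simp: nth_append)
    have 2: "subst (\<lambda>i. (map Var [k..<k + n] @ map Var [0..<k]) ! (n + i)) u = u" if "u \<in> set us"
      for u
      using that w subst_cong [of T k u "\<lambda>i. (map Var [k..<k + n] @ map Var [0..<k]) ! (n + i)"
        Var] by (auto simp: nth_append)
    have 3: "map ((!) (us @ map (subst (\<lambda>i. Var (k + i))) ts)) ([length us..<length us + length
      ts] @ [0..<length us]) = map (subst (\<lambda>i. Var (k + i))) ts @ us"
      using nth_shift [where us = us and vs = "map (subst (\<lambda>i. Var (k + i))) ts"] by simp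
    have 4: "map (subst (\<lambda>i. (map Var [k..<k + n] @ map Var [0..<k]) ! (n + i))) us = us"
      using 2 by (intro map_idI) auto
    have w'': "\<forall>t \<in> set us. wf_trm T (k + n) (subst (\<lambda>i. Var (n + i)) t)" "\<forall>t \<in> set ts. wf_trm T
      (k + n) (subst (\<lambda>i. Var (k + i)) t)"
      using w subst_wf [of T k _ "k + n" "\<lambda>i. Var (n + i)"] subst_wf [of T n _ "k + n"
        "\<lambda>i. Var (k + i)"] by auto
    have 5: "seq LO (la (k + n) (ts @ map (subst (\<lambda>i. Var (n + i))) us))
      (la (k + n) (map Var [k..<k + n] @ map Var [0..<k]))
       = la (k + n) (map (subst (\<lambda>i. Var (k + i))) ts @ us)"
      using w' w'' 1 4 by (subst LO_seq) (auto simp: o_def add.commute [of n k] cong: map_cong)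
    have 6: "seq LO (la (length us + length ts) (map Var [length us..<length us + length ts] @ map
      Var [0..<length us])) (la (k + n) (us @ map (subst (\<lambda>i. Var (k + i))) ts))
       = la (k + n) (map (subst (\<lambda>i. Var (k + i))) ts @ us)"
      using w' w'' 3 by (subst LO_seq) (auto simp: o_def)
    show "seq LO (tenA (law_op_add T) f g) (symm (law_op_add T) (tgt LO f) (tgt LO g))
      = seq LO (symm (law_op_add T) (src LO f) (src LO g)) (tenA (law_op_add T) g f)"
      using w 5 6 by (simp add: s LO_ten add.commute [of n k])
  next
    fix f assume "f \<in> arr LO"
    obtain n ts where [simp]: "f = la n ts" and w0: "\<forall>t \<in> set ts. wf_trm T n t" using \<open>f \<in> arr LO\<close>
      by (rule LO_E)
    note w = w0
    have w': "\<forall>t \<in> set ts. wf_trm T (n + n) t" using w subst_wf [of T n _ "n + n" Var] by auto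
    have 1: "subst ((!) (map Var [0..<n] @ map Var [0..<n])) t = t" if "t \<in> set ts" for t
      using that w subst_cong [of T n t "(!) (map Var [0..<n] @ map Var [0..<n])" Var]
        by (auto simp: nth_append)
    have 2: "subst (\<lambda>i. (map Var [0..<n] @ map Var [0..<n]) ! (n + i)) t = t" if "t \<in> set ts" for
      t
      using that w subst_cong [of T n t "\<lambda>i. (map Var [0..<n] @ map Var [0..<n]) ! (n + i)" Var]
        by (auto simp: nth_append)
    have w'': "\<forall>t \<in> set ts. wf_trm T (n + n) (subst (\<lambda>i. Var (n + i)) t)"
      using w subst_wf [of T n _ "n + n" "\<lambda>i. Var (n + i)"] by auto
    have 3: "map (subst ((!) (map Var [0..<n] @ map Var [0..<n]))) ts = ts"
      "map (subst (\<lambda>i. (map Var [0..<n] @ map Var [0..<n]) ! (n + i))) ts = ts"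
      using 1 2 by (auto intro: map_idI)
    have 5: "seq LO (la (length ts) (map Var [0..<length ts] @ map Var [0..<length ts])) (la n ts)
      = la n (ts @ ts)"
      using w by (subst LO_seq) (auto simp: o_def nth_ide)
    have 6: "seq LO (la (n + n) (ts @ map (subst (\<lambda>i. Var (n + i))) ts)) (la n (map Var [0..<n] @
      map Var [0..<n])) = la n (ts @ ts)"
      using w' w'' 3 by (subst LO_seq) (auto simp: o_def)
    show "seq LO (law_op_nab T (src LO f)) f = seq LO (tenA (law_op_add T) f f) (law_op_nab T
      (tgt LO f))"
      using w 5 6 by (simp add: s LO_ten)
    show "seq LO (law_op_bng T (src LO f)) f = law_op_bng T (tgt LO f)"
      using w by (simp add: s LO_seq)
  next
    fix X Y Z
    show "symm (law_op_add T) X (tenO (law_op_add T) Y Z)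
      = seq LO (tenA (law_op_add T) (symm (law_op_add T) X Y) (ide LO Z)) (tenA (law_op_add T)
      (ide LO Y) (symm (law_op_add T) X Z))"
      by (auto simp: s LO_ten_Var LO_ten_Nil LO_seq_Var map_add_upt' map_append [of "(+) _"]
        list.pred_map add.assoc intro!: arg_cong [of _ _ "\<lambda>x. la _ (map Var x)"] nth_equalityI
        simp: nth_append simp del: map_map map_append)
    show "seq LO (symm (law_op_add T) X Y) (symm (law_op_add T) Y X)
      = ide LO (tenO (law_op_add T) X Y)"
      by (auto simp: s LO_ten_Var LO_ten_Nil LO_seq_Var map_add_upt' map_append [of "(+) _"]
        list.pred_map add.assoc intro!: arg_cong [of _ _ "\<lambda>x. la _ (map Var x)"] nth_equalityI
        simp: nth_append simp del: map_map map_append)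
    show "seq LO (tenA (law_op_add T) (ide LO X) (tenA (law_op_add T) (law_op_bng T
      (tenO (law_op_add T) Y X)) (ide LO Y))) (law_op_nab T (tenO (law_op_add T) X Y))
      = ide LO (tenO (law_op_add T) X Y)"
      by (auto simp: s LO_ten_Var LO_ten_Nil LO_seq_Var map_add_upt' map_append [of "(+) _"]
        list.pred_map add.assoc intro!: arg_cong [of _ _ "\<lambda>x. la _ (map Var x)"] nth_equalityI
        simp: nth_append simp del: map_map map_append)
    show "seq LO (tenA (law_op_add T) (law_op_bng T X) (ide LO X)) (law_op_nab T X) = ide LO X"
      "seq LO (tenA (law_op_add T) (ide LO X) (law_op_bng T X)) (law_op_nab T X) = ide LO X"
      by (auto simp: s LO_ten_Var LO_ten_Nil LO_seq_Var map_add_upt' map_append [of "(+) _"]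
        list.pred_map add.assoc intro!: arg_cong [of _ _ "\<lambda>x. la _ (map Var x)"] nth_equalityI
        simp: nth_append simp del: map_map map_append)
  next
    fix X Y
    show "symm (law_op_add T) X Y \<in> arr LO" "law_op_nab T X \<in> arr LO" "law_op_bng T X \<in> arr LO"
      by (auto simp: LO_simps2 intro!: LO_arr)
  qed (auto simp: s)
qed

lemma LO_strict: "strict_sym_monoidal_category LO (law_op_add T)"
proof (rule strict_of_ssm)
  show "ssm (obj LO) (arr LO) (src LO) (tgt LO) (ide LO) (seq LO) (tenO (law_op_add T))
    (tenA (law_op_add T)) (unO (law_op_add T)) (symm (law_op_add T))"
    using LO_sfc by (simp add: sfc_def)
qed (simp_all add: law_op_add_def add.assoc)

lemma LO_fc: "fc_category LO (law_op_add T) (law_op_nab T) (law_op_bng T)"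
  by (rule fc_category_of_sfc [OF LO_strict LO_sfc])

end

section \<open>The functor from the Lawvere theory\<close>

locale fc_rig =
  fixes R :: "('o, 'a, 'z) fccd_rig_scheme" (structure)
  assumes strict: "strict_sym_monoidal_category R (add R)"
    and fc: "fc_category R (add R) (nab R) (bng R)"
    and one: "\<one> \<in> obj R"
begin

sublocale A: sfc "obj R" "arr R" "src R" "tgt R" "ide R" "seq R" "tenO (add R)" "tenA (add R)"
  "unO (add R)" "symm (add R)" "nab R" "bng R"
  by (rule sfc_of_fc_category [OF strict fc])

lemma nsum_pw: "nsum R n = A.pw \<one> n"
  by (induct n) auto

text \<open>The unitors in \<open>ninj\<close> are identities here, and padding with
  \<open>bng\<close> on the left is composition with the second injection.\<close>

lemma ninj_inj: "k < n \<Longrightarrow> ninj R n k = A.inj \<one> n k"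
proof -
  interpret strict_sym_monoidal_category R "add R" by (rule strict)
  note s = ssm_of_strict [OF strict]
  note [simp] = one
  show "k < n \<Longrightarrow> ninj R n k = A.inj \<one> n k"
  proof (induct n arbitrary: k)
    case (Suc m)
    show ?case
    proof (cases k)
      case 0
      then show ?thesis by (simp add: s inv_arr_ide nsum_pw A.inl_def)
    next
      case (Suc j)
      with Suc.prems Suc.hyps have IH: "ninj R m j = A.inj \<one> m j" "j < m" by auto
      have "bng R \<one> \<boxplus> A.inj \<one> m j = (\<iota> \<zero> \<boxplus> A.inj \<one> m j) \<Zsemi> (bng R \<one> \<boxplus> \<iota> (A.pw \<one> m))"
        using IH(2) by (subst A.interchange) simp_all
      also have "\<dots> = A.inj \<one> m j \<Zsemi> A.inr \<one> (A.pw \<one> m)" using IH(2)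
        by (simp add: A.inr_def del: A.interchange)
      finally show ?thesis using IH Suc by (simp add: s inv_arr_ide)
    qed
  qed simp
qed

lemma ncopair_ixm: "set ks \<subseteq> {..<m} \<Longrightarrow> ncopair R m ks = A.ixm \<one> m ks"
proof (induct ks)
  case Nil
  then show ?case by (simp add: A.ixm_def nsum_pw)
next
  case (Cons k ks)
  then have "ncopair R m ks = A.ixm \<one> m ks" by simp
  with Cons show ?case using A.cps_type [OF A.ixm_legs [of \<one> ks m]] one
    by (simp add: A.ixm_def nsum_pw ninj_inj A.cp_def)
qed

end

section \<open>Terms as tapes, and the functor from the Lawvere theory\<close>

context tapes
begin

interpretation L: lawvere_theory T
  by (rule lawvere_theory.intro) (rule T)

abbreviation X where "X n t U \<equiv> cl (ttrm n t U)"

lemma pw_tape: "U \<in> Wd \<Longrightarrow> A.pw [U] n = replicate n U"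
  by (induct n) auto

lemma X_Var: "\<lbrakk>U \<in> Wd; i < n\<rbrakk> \<Longrightarrow> X n (Var i) U = A.inj [U] n i"
  using A.inj_sum [of "[U]" i n] by (simp add: cl_sum cl_TId pw_tape)

text \<open>A sum of tapes followed by the iterated codiagonal is a copairing. This links the syntax
  of \<open>ttrm\<close> and \<open>tape_thy\<close> to \<open>cps\<close>.\<close>

lemma tsum_tnabn: "\<lbrakk>Q \<in> Pol; U \<in> Wd; \<forall>t \<in> set ts. wf t \<and> td t = [U] \<and> tc t = Q\<rbrakk>
  \<Longrightarrow> cl (tsum ts) \<cdot> cl (tnabn (length ts) Q) = A.cps Q (map cl ts)"
proof (induct ts)
  case Nil
  then show ?case by (simp add: cl_TId0)
next
  case (Cons t ts)
  then have [simp]: "wf t" "td t = [U]" "tc t = Q" "Q \<in> Pol" "wf (tsum ts)" "\<forall>t\<in>set ts. wf t"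
    "U \<in> Wd" by auto
  have [simp]: "concat (map tc ts) = concat (replicate (length ts) Q)" using Cons
    by (intro concat_replicate_cong) auto
  have IH: "cl (tsum ts) \<cdot> cl (tnabn (length ts) Q) = A.cps Q (map cl ts)" using Cons by auto
  show ?case by (simp add: cl_sum cl_seq A.cp_def flip: IH)
qed

lemma X_legs: "\<lbrakk>U \<in> Wd; \<forall>t \<in> set ts. wf_trm T n t\<rbrakk> \<Longrightarrow> A.legs [U] (replicate n U) (map (\<lambda>t. X n t U)
  ts)"
  by (auto simp: A.legs_def)

lemma X_App: assumes "U \<in> Wd" "f \<in> ops T" "length ts = arity T f" "\<forall>t \<in> set ts. wf_trm T n t"
  shows "X n (App f ts) U = cl (TOp f U) \<cdot> A.cps (replicate n U) (map (\<lambda>t. X n t U) ts)"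
proof -
  have "concat (map (\<lambda>t. tc (ttrm n t U)) ts) = concat (replicate (length ts) (replicate n U))"
    using assms by (intro concat_replicate_cong) auto
  then show ?thesis using assms tsum_tnabn [of "replicate n U" U "map (\<lambda>t. ttrm n t U) ts"]
    by (simp add: cl_seq o_def map_replicate_const)
qed

declare ttrm.simps [simp del]

text \<open>The k outputs of the tape of t stand for its variables, so substituting means composing
  with the copairing of the substituted terms. At an operation symbol the copairing of the arguments
  absorbs this factor by \<open>cps_seq\<close>.\<close>

lemma X_subst: "\<lbrakk>wf_trm T k t; U \<in> Wd; \<And>i. i < k \<Longrightarrow> wf_trm T n (s i)\<rbrakk>
  \<Longrightarrow> X n (subst s t) U = X k t U \<cdot> A.cps (replicate n U) (map (\<lambda>i. X n (s i) U) [0..<k])"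
proof (induct t rule: trm_induct)
  case (Var i)
  then show ?case
    using X_legs [of U "map s [0..<k]" n] by (simp add: X_Var o_def)
next
  case (App f ts)
  have l: "A.legs [U] (replicate n U) (map (\<lambda>i. X n (s i) U) [0..<k])"
    using App X_legs [of U "map s [0..<k]" n] by (simp add: o_def)
  note lt [simp] = A.cps_type [OF l, simplified]
  have l2: "A.legs [U] (replicate k U) (map (\<lambda>t. X k t U) ts)" using App by (intro X_legs) auto
  note lt2 [simp] = A.cps_type [OF l2, simplified]
  have IH: "map (\<lambda>t. X n t U) (map (subst s) ts) = map (\<lambda>f. f
    \<cdot> A.cps (replicate n U) (map (\<lambda>i. X n (s i) U) [0..<k])) (map (\<lambda>t. X k t U) ts)"
    using App by auto
  have "X n (subst s (App f ts)) U = cl (TOp f U) \<cdot> A.cps (replicate n U) (map (\<lambda>t. X n t U)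
    (map (subst s) ts))"
    using App by (simp only: subst.simps) (subst X_App, auto)
  also have "\<dots> = cl (TOp f U) \<cdot> (A.cps (replicate k U) (map (\<lambda>t. X k t U) ts)
    \<cdot> A.cps (replicate n U) (map (\<lambda>i. X n (s i) U) [0..<k]))"
    unfolding IH using App by (subst A.cps_seq [OF l2]) (simp_all add: pw_tape)
  also have "\<dots> = X k (App f ts) U \<cdot> A.cps (replicate n U) (map (\<lambda>i. X n (s i) U) [0..<k])"
    using App by (subst X_App) (auto simp: pw_tape)
  finally show ?case .
qed

text \<open>The axioms of tapes contain the equations of the theory themselves; their substitution
  instances are supplied by \<open>X_subst\<close>.\<close>

lemma X_sound: "trm_eq T n t u \<Longrightarrow> U \<in> Wd \<Longrightarrow> X n t U = X n u U"
proof (induct rule: trm_eq.induct)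
  case (ax k t t' s)
  then have "X k t U = X k t' U" by (intro cl_eqI tape_eq.thy_ax)
  then show ?case using ax L.eqs_wf [OF ax(1)] by (simp add: X_subst [where k = k])
next
  case (cong f ts us)
  then have e: "map (\<lambda>t. X n t U) ts = map (\<lambda>t. X n t U) us"
    by (auto simp: list_all2_conv_all_nth intro!: nth_equalityI)
  have "\<forall>t \<in> set ts. wf_trm T n t" "\<forall>t \<in> set us. wf_trm T n t"
  proof -
    have "list_all2 (trm_eq T n) ts us" using cong(3) by (rule list_all2_mono) auto
    then show "\<forall>t \<in> set ts. wf_trm T n t" "\<forall>t \<in> set us. wf_trm T n t"
      by (induct rule: list_all2_induct) (auto dest: L.trm_eq_wf)
  qed
  moreover have "length us = arity T f" using cong by (auto dest: list_all2_lengthD)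
  ultimately show ?case using cong(1,2) e \<open>U \<in> Wd\<close> by (subst (1 2) X_App) auto
qed auto

abbreviation "H \<equiv> tape_thy T G :: (nat, 'f larr, 's poly, ('s, 'g, 'f) tarr) func"

lemma H_O: "onO H n = replicate n []"
  by (simp add: tape_thy_def)

text \<open>\<open>tape_thy\<close> draws chosen representatives; by \<open>X_sound\<close> any
  tuple of the same classes gives the same tape.\<close>

lemma H_la: assumes "\<forall>t \<in> set ts. wf_trm T n t"
  shows "onA H (L.la n ts) = A.cps (replicate n []) (map (\<lambda>t. X n t []) ts)"
proof -
  let ?r = "\<lambda>t. rep (trm_class T n t)"
  have w: "\<forall>t \<in> set ts. wf_trm T n (?r t)" using assms L.class_rep L.trm_eq_wf by blast
  have e: "map (\<lambda>t. X n (?r t) []) ts = map (\<lambda>t. X n t []) ts"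
    using assms X_sound [OF L.class_rep [THEN trm_eq.sym], of n _ "[]"] by auto
  have c: "concat (map (\<lambda>t. tc (ttrm n (?r t) [])) ts)
    = concat (replicate (length ts) (replicate n []))"
    using w by (intro concat_replicate_cong) auto
  have "onA H (L.la n ts) = cl (TSeq (tsum (map (\<lambda>t. ttrm n (?r t) []) ts)) (tnabn (length ts)
    (replicate n [])))"
    by (simp add: tape_thy_def L.la_def o_def)
  also have "\<dots> = A.cps (replicate n []) (map (\<lambda>t. X n (?r t) []) ts)"
    using tsum_tnabn [of "replicate n []" "[]" "map (\<lambda>t. ttrm n (?r t) []) ts"] w c
      by (simp add: cl_seq o_def)
  finally show ?thesis unfolding e .
qed

lemma H_la_type: assumes "\<forall>t \<in> set ts. wf_trm T n t"
  shows "onA H (L.la n ts) \<in> arr TC" "src TC (onA H (L.la n ts)) = replicate (length ts) []"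
    "tgt TC (onA H (L.la n ts)) = replicate n []"
  using A.cps_type [OF X_legs [of "[]" ts n]] assms by (simp_all add: H_la pw_tape)

lemma H_vars: assumes "list_all (\<lambda>k. k < n) ks"
  shows "onA H (L.la n (map Var ks)) = A.ixm [[]] n ks"
  using assms unfolding A.ixm_def
  by (subst H_la) (auto simp: list_all_iff pw_tape X_Var intro!: arg_cong [of _ _ "A.cps _"])

lemma H_seq: assumes "\<forall>t \<in> set ts. wf_trm T n t" "\<forall>t \<in> set us. wf_trm T k t" "length us = n"
  shows "onA H (seq L.LO (L.la n ts) (L.la k us)) = onA H (L.la n ts) \<cdot> onA H (L.la k us)"
proof -
  have "map (\<lambda>i. X k (us ! i) []) [0..<n] = map (\<lambda>u. X k u []) us"
    using assms by (auto intro!: nth_equalityI)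
  then have 1: "X k (subst ((!) us) t) [] = X n t [] \<cdot> onA H (L.la k us)" if "t \<in> set ts" for t
    using X_subst [of n t "[]" k "(!) us"] that assms by (simp add: H_la)
  have "A.cps (replicate n []) (map (\<lambda>t. X n t []) ts) \<cdot> onA H (L.la k us)
    = A.cps (replicate k []) (map (\<lambda>f. f \<cdot> onA H (L.la k us)) (map (\<lambda>t. X n t []) ts))"
    using A.cps_seq [OF X_legs [of "[]" ts n], of "onA H (L.la k us)"] assms H_la_type [of us k]
      by simp
  then show ?thesis using assms 1
    by (simp add: L.LO_seq H_la [of ts] H_la [of "map (subst ((!) us)) ts"] o_def cong: map_cong)
qed

lemma X_vars: "\<lbrakk>U \<in> Wd; n \<le> m\<rbrakk> \<Longrightarrow> map (\<lambda>i. X m (Var i) U) [0..<n] = map (A.inj [U] m) [0..<n]"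
  by (auto simp: X_Var)

lemma H_functor: "cat_functor L.LO TC H"
proof -
  interpret C: scat "obj L.LO" "arr L.LO" "src L.LO" "tgt L.LO" "ide L.LO" "seq L.LO"
    by (rule L.LO_scat)
  interpret C: category L.LO using category_iff_scat C.scat_axioms by blast
  interpret D: category TC using category_iff_scat [of TC] TC_scat by simp
  show ?thesis
  proof
    fix f M N assume "f \<in> hom L.LO M N"
    then show "onA H f \<in> hom TC (onO H M) (onO H N)"
      using H_la_type by (auto simp: in_hom_iff L.LO_simps H_O)
  next
    fix f M N g K assume "f \<in> hom L.LO M N" "g \<in> hom L.LO N K"
    then show "onA H (seq L.LO f g) = seq TC (onA H f) (onA H g)"
      using H_seq by (auto simp: in_hom_iff L.LO_simps)
  next
    fix N
    show "onA H (ide L.LO N) = ide TC (onO H N)" by (simp add: L.LO_simps H_vars A.ixm_ide pw_tape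
      H_O)
  qed (simp add: H_O)
qed

text \<open>Juxtaposition reads the first tuple in the first n variables and the second in the last
  k. On tapes these renamings are compositions with the two injections, so the copairing of all
  components is the sum of the two copairings.\<close>

lemma H_ten: assumes ts: "\<forall>t \<in> set ts. wf_trm T n t" and us: "\<forall>t \<in> set us. wf_trm T k t"
  shows "onA H (tenA (law_op_add T) (L.la n ts) (L.la k us)) = onA H (L.la n ts) \<^bold>\<oplus> onA H
    (L.la k us)"
proof -
  have 1: "X (n + k) t [] = X n t [] \<cdot> inl (replicate n []) (replicate k [])" if "t \<in> set ts" for
    t
    using X_subst [of n t "[]" "n + k" Var] ts that A.ixm_inl [of "[[]]" n k]
    by (simp add: A.ixm_def pw_tape X_vars)
  have 2: "X (n + k) (subst (\<lambda>i. Var (n + i)) t) [] = X k t []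
    \<cdot> inr (replicate n []) (replicate k [])" if "t \<in> set us" for t
  proof -
    have "map (\<lambda>i. X (n + k) (Var (n + i)) []) [0..<k] = map (A.inj [[]] (n + k)) [n..<n + k]"
      by (auto simp: X_Var intro!: nth_equalityI)
    then show ?thesis
      using X_subst [of k t "[]" "n + k" "\<lambda>i. Var (n + i)"] us that A.ixm_inr [of "[[]]" n k]
        by (simp add: A.ixm_def pw_tape)
  qed
  have w: "\<forall>t \<in> set (ts @ map (subst (\<lambda>i. Var (n + i))) us). wf_trm T (n + k) t"
    using ts us subst_wf [of T n _ "n + k" Var] subst_wf [of T k _ "n + k" "\<lambda>i. Var (n + i)"]
      by auto
  note lt = X_legs [of "[]" ts n, simplified, OF ts] and lu = X_legs [of "[]" us k, simplified, OF
    us]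
  let ?F = "onA H (L.la n ts)" and ?G = "onA H (L.la k us)"
  have "onA H (tenA (law_op_add T) (L.la n ts) (L.la k us))
    = A.cps (replicate (n + k) []) (map (\<lambda>f. f \<cdot> inl (replicate n []) (replicate k []))
      (map (\<lambda>t. X n t []) ts) @ map (\<lambda>f. f \<cdot> inr (replicate n []) (replicate k []))
      (map (\<lambda>t. X k t []) us))"
    using 1 2 by (simp add: L.LO_ten ts us H_la [OF w] o_def cong: map_cong)
  also have "\<dots> = A.cp (?F \<cdot> inl (replicate n []) (replicate k [])) (?G
    \<cdot> inr (replicate n []) (replicate k []))"
    using A.cps_seq [OF lt, of "inl (replicate n []) (replicate k [])"] A.cps_seq
      [OF lu, of "inr (replicate n []) (replicate k [])"] ts us
    by (subst A.cps_append [where X = "[[]]"]) (auto simp: H_la replicate_add A.legs_def)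
  also have "\<dots> = ?F \<^bold>\<oplus> ?G" using A.cp_sum [of ?F ?G] H_la_type [OF ts] H_la_type [OF us] by simp
  finally show ?thesis .
qed

lemma H_sym: "onA H (symm (law_op_add T) m n) = S (replicate m []) (replicate n [])"
proof -
  have 1: "A.ixm [[]] (n + m) ([n..<n + m] @ [0..<n]) = A.cp (A.ixm [[]] (n + m) [n..<n + m])
    (A.ixm [[]] (n + m) [0..<n])"
    unfolding A.ixm_def by (simp, rule A.cps_append [where X = "[[]]"]) (auto simp: A.legs_def)
  show ?thesis
    by (simp add: L.LO_simps2 H_vars 1 A.ixm_inl A.ixm_inr pw_tape flip: map_append)
      (rule A.ext2 [of _ _ "replicate m []" "replicate n []"], simp_all)
qed

text \<open>Lists of m and of n units concatenate to the list of m + n units, so identities serve as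
  comparison isomorphisms.\<close>

lemma H_fc: "fc_morphism L.LO (law_op_add T) (law_op_nab T) (law_op_bng T) TC (add TC) (nab TC)
  (bng TC) H"
proof -
  interpret C: strict_sym_monoidal_category L.LO "law_op_add T" by (rule L.LO_strict)
  interpret D: strict_sym_monoidal_category TC "add TC" by (rule strict_add)
  interpret cat_functor L.LO TC H by (rule H_functor)
  note sC = ssm_of_strict [OF L.LO_strict] and sD = ssm_of_strict [OF strict_add]
  let ?mu = "\<lambda>m n. I (replicate (m + n) [])"
  have fc: "fc_category TC (add TC) (nab TC) (bng TC)"
    by (rule fc_category_of_sfc [OF strict_add]) (use A.sfc_axioms in simp)
  have "strong_sym_monoidal_functor L.LO (law_op_add T) TC (add TC) H ?mu (I [])"
  proof
    fix f M M' g N N' assume "f \<in> hom L.LO M M'" "g \<in> hom L.LO N N'"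
    then show "seq TC (tenA (add TC) (onA H f) (onA H g)) (?mu M' N')
      = seq TC (?mu M N) (onA H (tenA (law_op_add T) f g))"
      using H_ten H_la_type by (auto simp: in_hom_iff L.LO_simps replicate_add)
  next
    fix M N
    show "seq TC (?mu M N) (onA H (symm (law_op_add T) M N))
      = seq TC (symm (add TC) (onO H M) (onO H N)) (?mu N M)"
      by (simp add: H_sym H_O replicate_add)
  qed (auto simp: in_hom_iff H_O sC sD L.LO_simps2 replicate_add onA_ide D.iso_ide [simplified]
    simp: L.LO_simps(1))
  moreover have "seq TC (?mu n n) (onA H (law_op_nab T n)) = nab TC (onO H n)" for n
  proof -
    have 1: "A.ixm [[]] n ([0..<n] @ [0..<n]) = A.cp (A.ixm [[]] n [0..<n]) (A.ixm [[]] n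
      [0..<n])"
      unfolding A.ixm_def by (simp, rule A.cps_append [where X = "[[]]"]) (auto simp: A.legs_def)
    show ?thesis
      by (simp add: L.LO_simps2 H_vars 1 A.ixm_ide pw_tape H_O A.cp_def replicate_add
        flip: map_append)
  qed
  moreover have "seq TC (I []) (onA H (law_op_bng T n)) = bng TC (onO H n)" for n
    using H_la [of "[]" n] by (simp add: L.LO_simps2 H_O)
  ultimately show ?thesis unfolding fc_morphism_def using L.LO_fc fc by (auto simp: L.LO_simps2)
qed

lemma thy_TC: "thy TC = H" by (simp add: tape_cat_def)

text \<open>The arguments of the generic operation are the variables in order, and their copairing
  is the identity.\<close>

lemma H_gen: "f \<in> ops T \<Longrightarrow> onA H (law_gen T f) = cl (TOp f [])"
proof -
  assume f: "f \<in> ops T"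
  have "law_gen T f = L.la (arity T f) [App f (map Var [0..<arity T f])]"
    by (simp add: law_gen_def L.la_def)
  moreover have "A.cps (replicate (arity T f) []) (map (\<lambda>i. X (arity T f) (Var i) []) [0..<arity T
    f]) = I (replicate (arity T f) [])"
    using A.ixm_ide [of "[[]]" "arity T f"] by (simp add: X_vars A.ixm_def pw_tape)
  ultimately show ?thesis using f A.cps_single [of "cl (TOp f [])" "replicate (arity T f) []"]
    by (simp add: H_la X_App o_def del: A.cps_single A.cps.simps)
qed

lemma tcd_TC: "tcd_rig_category T TC"
proof -
  interpret fccd_rig_category TC by (rule fccd_TC)
  interpret F: fc_rig TC
    by (rule fc_rig.intro [OF strict_add fc.fc_category_axioms]) simp
  show ?thesis
  proof
    show "fc_morphism L.LO (law_op_add T) (law_op_nab T) (law_op_bng T) TC (add TC) (nab TC)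
      (bng TC) (thy TC)"
      using H_fc by (simp add: thy_TC)
    show "onO (thy TC) n = nsum TC n" for n
      using F.nsum_pw [of n] by (simp add: thy_TC H_O pw_tape)
    show "onA (thy TC) (law_incl T h) = one_incl TC h" if "h \<in> arr aleph0" for h
    proof -
      obtain n m ks where h: "h = (n, m, ks)" by (cases h)
      with that have ks: "length ks = n" "set ks \<subseteq> {..<m}" by (auto simp: aleph0_def)
      with h have "onA H (law_incl T h) = A.ixm [[]] m ks"
        by (simp add: L.law_incl_la H_vars list_all_iff subset_iff)
      then show ?thesis using F.ncopair_ixm [OF ks(2)] by (simp add: thy_TC one_incl_def h)
    qed
  qed
qed

lemma sesquistrict_tcd_TC: "sesquistrict_tcd_rig_category T (sorts G) tape_sort TC"
  using sesquistrict_TC tcd_TC by (rule sesquistrict_tcd_rig_category.intro)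

lemma sharp_TC: "U \<in> Wd \<Longrightarrow> sharp TC (tape_sort \<circ> (\<lambda>A. A)) U = [U]"
proof (induct TC "tape_sort \<circ> (\<lambda>A. A) :: 's \<Rightarrow> 's poly" U rule: sharp.induct)
qed (simp_all add: tape_sort_def)

lemma interp_TC: "sig_interp G (sorts G) tape_sort TC (\<lambda>A. A) (tape_gen T G)"
  unfolding sig_interp_def in_hom_iff by (auto simp: sharp_TC tape_gen_def)

end

section \<open>Interpretation of tapes\<close>

context srig
begin

lemma nab_mA: assumes [simp]: "X \<in> Ob" "Y \<in> Ob" shows "nab X \<^bold>\<otimes> ide Y = nab (X \<^bold>* Y)"
proof (rule add.ext2 [of _ _ "X \<^bold>* Y" "X \<^bold>* Y"])
  have "inl (X \<^bold>* Y) (X \<^bold>* Y) \<cdot> (nab X \<^bold>\<otimes> ide Y) = (inl X X \<^bold>\<otimes> ide Y) \<cdot> (nab X \<^bold>\<otimes> ide Y)"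
    by (simp del: mul.interchange)
  also have "\<dots> = ide (X \<^bold>* Y)" by (subst mul.interchange) simp_all
  finally show "inl (X \<^bold>* Y) (X \<^bold>* Y) \<cdot> (nab X \<^bold>\<otimes> ide Y) = inl (X \<^bold>* Y) (X \<^bold>* Y) \<cdot> nab (X \<^bold>* Y)"
    by simp
  have "inr (X \<^bold>* Y) (X \<^bold>* Y) \<cdot> (nab X \<^bold>\<otimes> ide Y) = (inr X X \<^bold>\<otimes> ide Y) \<cdot> (nab X \<^bold>\<otimes> ide Y)"
    by (simp del: mul.interchange)
  also have "\<dots> = ide (X \<^bold>* Y)" by (subst mul.interchange) simp_all
  finally show "inr (X \<^bold>* Y) (X \<^bold>* Y) \<cdot> (nab X \<^bold>\<otimes> ide Y) = inr (X \<^bold>* Y) (X \<^bold>* Y) \<cdot> nab (X \<^bold>* Y)"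
    by simp
qed simp_all

lemma mA_nab: "\<lbrakk>X \<in> Ob; Y \<in> Ob\<rbrakk> \<Longrightarrow> ide X \<^bold>\<otimes> nab Y = dl X Y Y \<cdot> nab (X \<^bold>* Y)"
  by (rule extl [of _ _ X Y Y]) simp_all

lemma pw_mA: "\<lbrakk>X \<in> Ob; Y \<in> Ob\<rbrakk> \<Longrightarrow> add.pw X n \<^bold>* Y = add.pw (X \<^bold>* Y) n"
  by (induct n) simp_all

lemma inj_mA: "\<lbrakk>X \<in> Ob; Y \<in> Ob; i < n\<rbrakk> \<Longrightarrow> add.inj X n i \<^bold>\<otimes> ide Y = add.inj (X \<^bold>* Y) n i"
  by (induct X n i rule: add.inj.induct) (simp_all add: pw_mA)

lemma cps_mA: "\<lbrakk>add.legs X Y fs; Z \<in> Ob\<rbrakk> \<Longrightarrow> add.cps Y fs \<^bold>\<otimes> ide Z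
  = add.cps (Y \<^bold>* Z) (map (\<lambda>f. f \<^bold>\<otimes> ide Z) fs)"
proof (induct fs)
  case (Cons f fs)
  then have [simp]: "f \<in> Ar" "src f = X" "tgt f = Y" "add.legs X Y fs" "Y \<in> Ob" "X \<in> Ob" "Z \<in> Ob"
    by (auto simp: add.legs_def)
  note [simp] = add.cps_type [OF \<open>add.legs X Y fs\<close>]
  show ?case using Cons.hyps by (simp add: add.cp_def mA_factor' nab_mA del: mul.interchange)
qed simp

text \<open>The inverse of \<open>lap9\<close>; with the distributor at X trivial it is the
  recursion of \<open>tdl_inv\<close>.\<close>

lemma dli_add: assumes [simp]: "X \<in> Ob" "Y \<in> Ob" "Z \<in> Ob" "W \<in> Ob"
  shows "dli (X \<^bold>+ Y) Z W = (ide (X \<^bold>* Z) \<^bold>\<oplus> sa (Y \<^bold>* Z) (X \<^bold>* W) \<^bold>\<oplus> ide (Y \<^bold>* W))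
    \<cdot> (dli X Z W \<^bold>\<oplus> dli Y Z W)" (is "_ = ?r")
proof -
  have "dl (X \<^bold>+ Y) Z W \<cdot> ?r = ide ((X \<^bold>+ Y) \<^bold>* (Z \<^bold>+ W))" by (simp add: lap9)
  then have "dli (X \<^bold>+ Y) Z W \<cdot> dl (X \<^bold>+ Y) Z W \<cdot> ?r = dli (X \<^bold>+ Y) Z W" by (simp del: dli_dl_seq)
  then show ?thesis by simp
qed

text \<open>The recursion of \<open>tsymm\<close> in a general strict rig category, obtained by
  inverting \<open>lap2\<close>.\<close>

lemma sm_add: assumes [simp]: "X \<in> Ob" "Y \<in> Ob" "Z \<in> Ob"
  shows "sm X (Y \<^bold>+ Z) = dl X Y Z \<cdot> (sm X Y \<^bold>\<oplus> sm X Z)"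
proof (rule mul.sy_cancel [of "Y \<^bold>+ Z" X])
  show "sm (Y \<^bold>+ Z) X \<cdot> sm X (Y \<^bold>+ Z) = sm (Y \<^bold>+ Z) X \<cdot> dl X Y Z \<cdot> (sm X Y \<^bold>\<oplus> sm X Z)"
    using lap2 [of Y Z X] by (simp add: lap2 [THEN add.seq_eq])
qed simp_all

end

locale tape_model = tapes G T + Q: sesquistrict_tcd_rig_category T Mo Ho R
  for G :: "('s, 'g) msig" and T :: "'f alg_theory" and Mo :: "'m set" and Ho :: "'m \<Rightarrow> 'o"
    and R :: "('f, 'o, 'a, 'z) tcd_rig_scheme" (structure) +
  fixes aS :: "'s \<Rightarrow> 'm" and aG :: "'g \<Rightarrow> 'a"
  assumes interp: "sig_interp G Mo Ho R aS aG"
begin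

declare tid.simps [simp] tsym1.simps [simp] tsym.simps [simp] tbng.simps [simp] tnab.simps [simp]
  tnabn.simps [simp] tdl.simps [simp] tdl_inv.simps [simp]
  tsymm.simps [simp] top_poly.simps [simp] lwhisk.simps [simp] rwhisk.simps [simp] tcopy.simps
    [simp] tdisc.simps [simp]

abbreviation rsq (infixr "\<bullet>" 55) where "rsq \<equiv> seq R"
abbreviation "dli \<equiv> \<lambda>x y z. inv_arr R (dl R x y z)"

lemma strictR: "strict_sym_monoidal_category R (add R)" "strict_sym_monoidal_category R (mul R)"
  "right_strict_rig_category R"
  by unfold_locales

sublocale V: srig "obj R" "arr R" "src R" "tgt R" "ide R" "seq R" "tenO (add R)" "tenA (add R)"
  "unO (add R)" "symm (add R)" "nab R" "bng R"
  "tenO (mul R)" "tenA (mul R)" "unO (mul R)" "symm (mul R)" "dl R" dli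
  by (rule srig_of_rig [OF strictR(3) Q.fc.fc_category_axioms])

sublocale K: scd "obj R" "arr R" "src R" "tgt R" "ide R" "seq R" "tenO (mul R)" "tenA (mul R)"
  "unO (mul R)" "symm (mul R)" "copy R" "disc R"
  by (rule scd_of_cd_category [OF strictR(2) Q.cd.cd_category_axioms])

sublocale F: fc_rig R
  by (rule fc_rig.intro [OF strictR(1) Q.fc.fc_category_axioms]) simp

lemma struct: "\<lbrakk>x \<in> obj R; y \<in> obj R; z \<in> obj R\<rbrakk> \<Longrightarrow> asc (add R) x y z = \<iota> (x \<oplus> y \<oplus> z)"
  "x \<in> obj R \<Longrightarrow> lun (add R) x = \<iota> x" "x \<in> obj R \<Longrightarrow> run (add R) x = \<iota> x"
  "\<lbrakk>x \<in> obj R; y \<in> obj R; z \<in> obj R\<rbrakk> \<Longrightarrow> asc (mul R) x y z = \<iota> (x \<otimes> y \<otimes> z)"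
  "x \<in> obj R \<Longrightarrow> lun (mul R) x = \<iota> x" "x \<in> obj R \<Longrightarrow> run (mul R) x = \<iota> x"
  using ssm_of_strict [OF strictR(1)] ssm_of_strict [OF strictR(2)] by auto

lemma dr_ide: "\<lbrakk>x \<in> obj R; y \<in> obj R; z \<in> obj R\<rbrakk> \<Longrightarrow> dr R x y z = \<iota> ((x \<oplus> y) \<otimes> z)"
  using Q.add.is_ide_eq [OF Q.dr_ide Q.dr_hom] by blast

text \<open>The axiom \<open>copy_add\<close> regrouped into two summands, as in the recursion of
  \<open>tcopy\<close>.\<close>

lemma copy_plus: assumes [simp]: "x \<in> obj R" "y \<in> obj R"
  shows "copy R (x \<oplus> y) = ((copy R x \<boxplus> bng R (x \<otimes> y)) \<bullet> dli x x y) \<boxplus> ((bng R (y \<otimes> x) \<boxplus> copy R y)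
    \<bullet> dli y x y)"
proof -
  have "((copy R x \<boxplus> bng R (x \<otimes> y)) \<boxplus> (bng R (y \<otimes> x) \<boxplus> copy R y)) \<bullet> (dli x x y \<boxplus> dli y x y)
    = ((copy R x \<boxplus> bng R (x \<otimes> y)) \<bullet> dli x x y) \<boxplus> ((bng R (y \<otimes> x) \<boxplus> copy R y) \<bullet> dli y x y)"
    by (rule V.add.interchange) simp_all
  then show ?thesis using Q.copy_add [of x y] by (simp add: struct dr_ide Q.add.inv_arr_ide)
qed

section \<open>Interpretation of words, polynomials, circuits and tapes\<close>

primrec iW :: "'s list \<Rightarrow> 'o" where
  "iW [] = \<one>"
| "iW (A # U) = Ho (aS A) \<otimes> iW U"

primrec iP :: "'s poly \<Rightarrow> 'o" where
  "iP [] = \<zero>"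
| "iP (U # P) = iW U \<oplus> iP P"

primrec iC :: "('s, 'g) circ \<Rightarrow> 'a" where
  "iC (CId A) = \<iota> (Ho (aS A))"
| "iC CId1 = \<iota> \<one>"
| "iC (CGen s) = aG s"
| "iC (CSym A A') = symm (mul R) (Ho (aS A)) (Ho (aS A'))"
| "iC (CSeq c d) = iC c \<bullet> iC d"
| "iC (CTen c d) = iC c \<boxtimes> iC d"
| "iC (CCopy A) = copy R (Ho (aS A))"
| "iC (CDisc A) = disc R (Ho (aS A))"

text \<open>The operation stands to the left of the identity of U because n times U equals the
  n-fold sum of U strictly (\<open>pw_mA\<close>), which is the codomain of \<open>TOp f U\<close>.
  Right whiskering is then immediate at operations; left whiskering has to move U across.\<close>

primrec iT :: "('s, 'g, 'f) tape \<Rightarrow> 'a" where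
  "iT (TId U) = \<iota> (iW U)"
| "iT TId0 = \<iota> \<zero>"
| "iT (TCirc c) = iC c"
| "iT (TSym U V) = symm (add R) (iW U) (iW V)"
| "iT (TSeq t u) = iT t \<bullet> iT u"
| "iT (TSum t u) = iT t \<boxplus> iT u"
| "iT (TBng U) = bng R (iW U)"
| "iT (TNab U) = nab R (iW U)"
| "iT (TOp f U) = onA (thy R) (law_gen T f) \<boxtimes> \<iota> (iW U)"

lemma aS_obj [simp]: "A \<in> sorts G \<Longrightarrow> Ho (aS A) \<in> obj R"
  using interp Q.H_obj by (auto simp: sig_interp_def)

lemma iW_obj [simp]: "U \<in> Wd \<Longrightarrow> iW U \<in> obj R"
  by (induct U) auto

lemma iP_obj [simp]: "P \<in> Pol \<Longrightarrow> iP P \<in> obj R"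
  by (induct P) auto

lemma iW_append [simp]: "\<lbrakk>U \<in> Wd; V \<in> Wd\<rbrakk> \<Longrightarrow> iW (U @ V) = iW U \<otimes> iW V"
  by (induct U) auto

lemma iP_append [simp]: "\<lbrakk>P \<in> Pol; P' \<in> Pol\<rbrakk> \<Longrightarrow> iP (P @ P') = iP P \<oplus> iP P'"
  by (induct P) auto

lemma iP_replicate: "U \<in> Wd \<Longrightarrow> iP (replicate n U) = V.add.pw (iW U) n"
  by (induct n) auto

text \<open>For letters this is sesquistrictness; \<open>lap6\<close> expresses the distributor at a
  word through those of its letters.\<close>

lemma dl_iW: "\<lbrakk>U \<in> Wd; x \<in> obj R; y \<in> obj R\<rbrakk>
  \<Longrightarrow> dl R (iW U) x y = \<iota> (iW U \<otimes> (x \<oplus> y)) \<and> iW U \<otimes> (x \<oplus> y) = iW U \<otimes> x \<oplus> iW U \<otimes> y"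
proof (induct U)
  case (Cons A U)
  then have [simp]: "A \<in> sorts G" "U \<in> Wd" "x \<in> obj R" "y \<in> obj R" by auto
  have A: "dl R (Ho (aS A)) x' y' = \<iota> (Ho (aS A) \<otimes> (x' \<oplus> y')) \<and> Ho (aS A) \<otimes> (x' \<oplus> y')
    = Ho (aS A) \<otimes> x' \<oplus> Ho (aS A) \<otimes> y'"
    if "x' \<in> obj R" "y' \<in> obj R" for x' y'
    using Q.add.is_ide_eq [OF Q.dl_ide Q.dl_hom] interp that by (auto simp: sig_interp_def)
  show ?case using Cons A [of "iW U \<otimes> x" "iW U \<otimes> y"] by (simp add: V.lap6)
qed simp

lemma iW_distr [simp]: "\<lbrakk>U \<in> Wd; x \<in> obj R; y \<in> obj R\<rbrakk> \<Longrightarrow> iW U \<otimes> (x \<oplus> y) = iW U \<otimes> x \<oplus> iW U \<otimes> y"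
  using dl_iW by blast

lemma dl_iW' [simp]: "\<lbrakk>U \<in> Wd; x \<in> obj R; y \<in> obj R\<rbrakk> \<Longrightarrow> dl R (iW U) x y = \<iota> (iW U \<otimes> x \<oplus> iW U \<otimes> y)"
  using dl_iW by auto

lemma iP_map [simp]: "\<lbrakk>U \<in> Wd; P \<in> Pol\<rbrakk> \<Longrightarrow> iP (map ((@) U) P) = iW U \<otimes> iP P"
  by (induct P) auto

lemma iP_pten [simp]: "\<lbrakk>P \<in> Pol; P' \<in> Pol\<rbrakk> \<Longrightarrow> iP (pten P P') = iP P \<otimes> iP P'"
  by (induct P) auto

text \<open>\<open>iW\<close> ends in a unit factor that \<open>sharp\<close> omits on nonempty
  words; strictness removes the difference.\<close>

lemma sharp_iW: "U \<in> Wd \<Longrightarrow> sharp R (Ho \<circ> aS) U = iW U"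
proof (induct U)
  case (Cons A U)
  then show ?case by (cases U) auto
qed simp

lemma aG_type [simp]: "s \<in> gens G \<Longrightarrow> aG s \<in> arr R \<and> src R (aG s) = iW (gar G s) \<and> tgt R (aG s)
  = iW (gcoar G s)"
  using interp by (auto simp: sig_interp_def in_hom_iff sharp_iW)

lemma iC_type [simp]: "wf_circ G c \<Longrightarrow> iC c \<in> arr R \<and> src R (iC c) = iW (cdom G c) \<and> tgt R (iC c)
  = iW (ccod G c)"
  by (induct c) auto

lemma iC_cid [simp]: "U \<in> Wd \<Longrightarrow> iC (cid U) = \<iota> (iW U)"
  by (induct U) auto

lemma iC_csym1: "\<lbrakk>A \<in> sorts G; U \<in> Wd\<rbrakk> \<Longrightarrow> iC (csym1 A U) = symm (mul R) (Ho (aS A)) (iW U)"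
  by (induct U) (auto simp: V.mul.sy_hex)

lemma iC_csym: "\<lbrakk>U \<in> Wd; V \<in> Wd\<rbrakk> \<Longrightarrow> iC (csym U V) = symm (mul R) (iW U) (iW V)"
  by (induct U) (auto simp: V.mul.sy_hex' iC_csym1)

lemma iC_ccopy: "U \<in> Wd \<Longrightarrow> iC (ccopy U) = copy R (iW U)"
  by (induct U) (auto simp: K.copy_tO iC_csym1)

lemma iC_cdisc: "U \<in> Wd \<Longrightarrow> iC (cdisc U) = disc R (iW U)"
  by (induct U) (auto simp: K.disc_tO)

lemma iC_sound: "circ_eq G c d \<Longrightarrow> iC c = iC d"
proof (induct rule: circ_eq.induct)
  case (sym_nat c W)
  then show ?case using V.mul.sy_nat' [of "iC c" "\<iota> (iW W)"] by (simp add: iC_csym)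
qed (auto simp: K.coassoc K.lcounit K.rcounit K.cocomm)

section \<open>The theory functor of the target\<close>

lemma thyR: "cat_functor (law_op T) R (thy R)"
  using Q.thy_fc unfolding fc_morphism_def strong_sym_monoidal_functor_def by blast

interpretation L: lawvere_theory T
  by (rule lawvere_theory.intro) (rule T)

lemma th_type: assumes "\<forall>t \<in> set ts. wf_trm T n t"
  shows "onA (thy R) (L.la n ts) \<in> arr R \<and> src R (onA (thy R) (L.la n ts))
    = V.add.pw \<one> (length ts) \<and> tgt R (onA (thy R) (L.la n ts)) = V.add.pw \<one> n"
  using cat_functor.onA_hom [OF thyR, of "L.la n ts" "length ts" n] assms
  using L.LO_arr by (auto simp: in_hom_iff L.LO_simps(1-3) Q.thy_onO F.nsum_pw)

lemma th_seq: assumes "\<forall>t \<in> set ts. wf_trm T n t" "\<forall>u \<in> set us. wf_trm T k u" "length us = n"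
  shows "onA (thy R) (L.la n ts) \<bullet> onA (thy R) (L.la k us)
    = onA (thy R) (L.la k (map (subst ((!) us)) ts))"
  using cat_functor.onA_seq [OF thyR, of "L.la n ts" "length ts" n "L.la k us" k] assms L.LO_arr
  by (auto simp: in_hom_iff L.LO_simps(1-3) L.LO_seq)

lemma gen_la: "law_gen T f = L.la (arity T f) [App f (map Var [0..<arity T f])]"
  by (simp add: law_gen_def L.la_def)

lemma th_gen [simp]: "f \<in> ops T \<Longrightarrow> onA (thy R) (law_gen T f) \<in> arr R
  \<and> src R (onA (thy R) (law_gen T f)) = \<one> \<and> tgt R (onA (thy R) (law_gen T f))
  = V.add.pw \<one> (arity T f)"
  using th_type [of "[App f (map Var [0..<arity T f])]" "arity T f"] by (simp add: gen_la)

text \<open>A single variable comes from \<open>aleph0\<close>, where the condition d;i = c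
  prescribes the value of the functor.\<close>

lemma th_Var: assumes "i < n" shows "onA (thy R) (L.la n [Var i]) = V.add.inj \<one> n i"
proof -
  have "onA (thy R) (law_incl T (1, n, [i])) = ncopair R n [i]"
    using Q.thy_onA [of "(1, n, [i])"] assms by (simp add: aleph0_def one_incl_def)
  also have "\<dots> = V.add.inj \<one> n i" using assms F.ncopair_ixm [of "[i]" n]
    by (simp add: V.add.ixm_def del: ncopair.simps V.add.cps.simps)
  finally show ?thesis by (simp add: L.law_incl_la)
qed

lemma th_legs: "\<forall>t \<in> set ts. wf_trm T n t \<Longrightarrow> V.add.legs \<one> (V.add.pw \<one> n)
  (map (\<lambda>t. onA (thy R) (L.la n [t])) ts)"
  using th_type [of "[t]" n for t] by (auto simp: V.add.legs_def)

text \<open>Composing the i-th variable with a tuple selects its i-th component, and the functor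
  sends that variable to the i-th injection. Functoriality therefore forces a tuple to go to a
  copairing.\<close>

lemma th_cps: assumes "\<forall>t \<in> set ts. wf_trm T n t"
  shows "onA (thy R) (L.la n ts) = V.add.cps (V.add.pw \<one> n) (map (\<lambda>t. onA (thy R) (L.la n [t]))
    ts)"
proof (rule V.add.ext_pw [of _ _ \<one> "length ts"])
  fix i assume i: "i < length ts"
  have "V.add.inj \<one> (length ts) i \<bullet> onA (thy R) (L.la n ts) = onA (thy R) (L.la n [ts ! i])"
    using th_seq [of "[Var i]" "length ts" ts n] assms i by (simp add: th_Var)
  moreover have "V.add.inj \<one> (length ts) i \<bullet> V.add.cps (V.add.pw \<one> n)
    (map (\<lambda>t. onA (thy R) (L.la n [t])) ts) = onA (thy R) (L.la n [ts ! i])"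
    by (subst V.add.inj_cps [OF th_legs [OF assms]]) (simp_all add: i)
  ultimately show "V.add.inj \<one> (length ts) i \<bullet> onA (thy R) (L.la n ts) = V.add.inj \<one> (length ts) i
    \<bullet> V.add.cps (V.add.pw \<one> n) (map (\<lambda>t. onA (thy R) (L.la n [t])) ts)"
    by (simp only:)
qed (use th_type [OF assms] V.add.cps_type [OF th_legs [OF assms]] in simp_all)

section \<open>Interpretation of the derived tapes\<close>

lemma iT_type [simp]: "wf t \<Longrightarrow> iT t \<in> arr R \<and> src R (iT t) = iP (td t) \<and> tgt R (iT t) = iP (tc t)"
  by (induct t) (auto simp: iP_replicate V.pw_mA)

lemma iT_tid [simp]: "P \<in> Pol \<Longrightarrow> iT (tid P) = \<iota> (iP P)"
  by (induct P) auto

lemma iT_tsym1: "\<lbrakk>U \<in> Wd; P \<in> Pol\<rbrakk> \<Longrightarrow> iT (tsym1 U P) = symm (add R) (iW U) (iP P)"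
  by (induct P) (auto simp: V.add.sy_hex)

lemma iT_tsym [simp]: "\<lbrakk>P \<in> Pol; P' \<in> Pol\<rbrakk> \<Longrightarrow> iT (tsym P P') = symm (add R) (iP P) (iP P')"
  by (induct P) (auto simp: V.add.sy_hex' iT_tsym1)

lemma iT_tbng [simp]: "P \<in> Pol \<Longrightarrow> iT (tbng P) = bng R (iP P)"
  by (induct P) (auto simp: V.add.bng_tO)

lemma iT_tnab [simp]: "P \<in> Pol \<Longrightarrow> iT (tnab P) = nab R (iP P)"
proof (induct P)
  case Nil
  show ?case using V.add.ext0 [of "nab R \<zero>" "\<iota> \<zero>"] by simp
qed (simp add: V.add.nab_tO)

lemma iT_tdl [simp]: "\<lbrakk>P \<in> Pol; P' \<in> Pol; P'' \<in> Pol\<rbrakk> \<Longrightarrow> iT (tdl P P' P'')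
  = dl R (iP P) (iP P') (iP P'')"
  by (induct P) (auto simp: V.lap9)

lemma iT_tdl_inv [simp]: "\<lbrakk>P \<in> Pol; P' \<in> Pol; P'' \<in> Pol\<rbrakk> \<Longrightarrow> iT (tdl_inv P P' P'')
  = dli (iP P) (iP P') (iP P'')"
  by (induct P) (auto simp: V.dli_add Q.add.inv_arr_ide)

lemma sm_z [simp]: "x \<in> obj R \<Longrightarrow> symm (mul R) \<zero> x = \<iota> \<zero>" "x \<in> obj R \<Longrightarrow> symm (mul R) x \<zero> = \<iota> \<zero>"
  using V.add.ext0 [of "symm (mul R) \<zero> x" "\<iota> \<zero>"] V.add.ext0 [of "symm (mul R) x \<zero>" "\<iota> \<zero>"]
    by simp_all

text \<open>By \<open>lap2\<close> the units cross the word one at a time: each crossing is trivial,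
  and so is the distributor at the word, by \<open>dl_iW\<close>.\<close>

lemma sm_pw: "U \<in> Wd \<Longrightarrow> symm (mul R) (V.add.pw \<one> n) (iW U) = \<iota> (V.add.pw \<one> n \<otimes> iW U)"
proof (induct n)
  case (Suc n)
  then show ?case using V.lap2 [of \<one> "V.add.pw \<one> n" "iW U"] by simp
qed simp

lemma iW_pw: "U \<in> Wd \<Longrightarrow> iW U \<otimes> V.add.pw \<one> n = V.add.pw (iW U) n"
  by (induct n) auto

text \<open>At symmetries, sums and codiagonals the equation holds because the distributors at the
  word U are identities; at an operation the factor U is moved across by
  \<open>sm_pw\<close>.\<close>

lemma iT_lwhisk1: "\<lbrakk>wf t; U \<in> Wd\<rbrakk> \<Longrightarrow> iT (lwhisk1 U t) = \<iota> (iW U) \<boxtimes> iT t"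
proof (induct t)
  case (TSym V W)
  then show ?case using V.lap1 [of "iW U" "iW V" "iW W"] by simp
next
  case (TSum t u)
  then show ?case using V.dl_natural [of "\<iota> (iW U)" "iT t" "iT u"] by simp
next
  case (TNab V)
  then show ?case using V.mA_nab [of "iW U" "iW V"] by simp
next
  case (TOp f V)
  then have "onA (thy R) (law_gen T f) \<boxtimes> \<iota> (iW U) = \<iota> (iW U) \<boxtimes> onA (thy R) (law_gen T f)"
    using V.mul.sy_nat [of "onA (thy R) (law_gen T f)" "\<iota> (iW U)"] V.pw_mA [of \<one> "iW U"] iW_pw
      by (simp add: sm_pw)
  with TOp show ?case by (simp flip: V.mul.tA_ide V.mul.tA_assoc)
qed auto

lemma iT_rwhisk1: "\<lbrakk>wf t; U \<in> Wd\<rbrakk> \<Longrightarrow> iT (rwhisk1 U t) = iT t \<boxtimes> \<iota> (iW U)"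
  by (induct t) (auto simp: V.lap3 V.nab_mA)

lemma iT_lwhisk: "\<lbrakk>wf t; P \<in> Pol\<rbrakk> \<Longrightarrow> iT (lwhisk P t) = \<iota> (iP P) \<boxtimes> iT t"
proof (induct P)
  case (Cons U P)
  then show ?case by (simp add: iT_lwhisk1 flip: V.add.tA_ide)
qed simp

text \<open>The two distributors in the recursion of \<open>rwhisk\<close> cancel by naturality of
  \<open>dl\<close>.\<close>

lemma iT_rwhisk: "\<lbrakk>wf t; P \<in> Pol\<rbrakk> \<Longrightarrow> iT (rwhisk T G P t) = iT t \<boxtimes> \<iota> (iP P)"
proof (induct P)
  case (Cons U P)
  then have "(iT t \<boxtimes> \<iota> (iW U \<oplus> iP P)) \<bullet> dl R (iP (tc t)) (iW U) (iP P) = dl R (iP (td t)) (iW U)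
    (iP P) \<bullet> (iT t \<boxtimes> \<iota> (iW U) \<boxplus> iT t \<boxtimes> \<iota> (iP P))"
    using V.dl_natural [of "iT t" "\<iota> (iW U)" "\<iota> (iP P)"] by simp
  from this [THEN V.add.seq_eq, of "dli (iP (tc t)) (iW U) (iP P)"] Cons
  show ?case by (simp add: iT_rwhisk1)
qed simp

lemma iT_tten: "\<lbrakk>wf t; wf u\<rbrakk> \<Longrightarrow> iT (tten T G t u) = iT t \<boxtimes> iT u"
  by (simp add: tten_def iT_lwhisk iT_rwhisk)

lemma iT_csyms: "\<lbrakk>P \<in> Pol; V \<in> Wd\<rbrakk> \<Longrightarrow> iT (tsum (map (\<lambda>U. TCirc (csym U V)) P))
  = symm (mul R) (iP P) (iW V)"
proof (induct P)
  case (Cons U P)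
  then show ?case using V.lap2 [of "iW U" "iP P" "iW V"] by (simp add: iC_csym)
qed simp

lemma iT_tsymm: "\<lbrakk>P \<in> Pol; P' \<in> Pol\<rbrakk> \<Longrightarrow> iT (tsymm P P') = symm (mul R) (iP P) (iP P')"
proof (induct P')
  case Nil
  then show ?case by simp
next
  case (Cons V P')
  then show ?case by (simp add: iT_csyms V.sm_add)
qed

text \<open>The formula chosen for operations at words persists at polynomials. With it, the axiom
  \<open>op_nat\<close> becomes an instance of interchange in the target.\<close>

lemma iT_top_poly: "\<lbrakk>f \<in> ops T; P \<in> Pol\<rbrakk> \<Longrightarrow> iT (top_poly T f P) = onA (thy R) (law_gen T f) \<boxtimes> \<iota>
  (iP P)"
proof (induct P)
  case (Cons U P)
  let ?g = "onA (thy R) (law_gen T f)" and ?n = "V.add.pw \<one> (arity T f)"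
  have "(?g \<boxtimes> \<iota> (iW U \<oplus> iP P)) \<bullet> dl R ?n (iW U) (iP P) = ?g \<boxtimes> \<iota> (iW U) \<boxplus> ?g \<boxtimes> \<iota> (iP P)"
    using V.dl_natural [of ?g "\<iota> (iW U)" "\<iota> (iP P)"] Cons by simp
  from this [THEN V.add.seq_eq, of "dli ?n (iW U) (iP P)"] Cons
  show ?case by (simp add: iP_replicate)
qed simp

lemma iT_tsum_replicate: "wf t \<Longrightarrow> iT (tsum (replicate n t)) = \<iota> (V.add.pw \<one> n) \<boxtimes> iT t"
proof (induct n)
  case (Suc n)
  then show ?case by (simp flip: V.add.tA_ide)
qed simp

lemma iT_tcopy: "P \<in> Pol \<Longrightarrow> iT (tcopy P) = copy R (iP P)"
proof (induct P)
  case Nil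
  then show ?case using V.add.ext0 [of "copy R \<zero>" "\<iota> \<zero>"] by simp
next
  case (Cons U P)
  then show ?case by (simp add: iC_ccopy copy_plus Q.add.inv_arr_ide)
qed

lemma iT_tdisc: "P \<in> Pol \<Longrightarrow> iT (tdisc P) = disc R (iP P)"
proof (induct P)
  case Nil
  then show ?case using V.add.ext0 [of "disc R \<zero>" "bng R \<one>"] by simp
next
  case (Cons U P)
  then show ?case by (simp add: iC_cdisc Q.disc_add)
qed

lemma iT_tsum_tnabn: "\<lbrakk>P \<in> Pol; U \<in> Wd; \<forall>t \<in> set ts. wf t \<and> td t = [U] \<and> tc t = P\<rbrakk>
  \<Longrightarrow> iT (tsum ts) \<bullet> iT (tnabn (length ts) P) = V.add.cps (iP P) (map iT ts)"
proof (induct ts)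
  case (Cons t ts)
  then have [simp]: "wf t" "td t = [U]" "tc t = P" "P \<in> Pol" "wf (tsum ts)" "\<forall>t\<in>set ts. wf t"
    "U \<in> Wd" by auto
  have [simp]: "concat (map tc ts) = concat (replicate (length ts) P)" using Cons
    by (intro concat_replicate_cong) auto
  have IH: "iT (tsum ts) \<bullet> iT (tnabn (length ts) P) = V.add.cps (iP P) (map iT ts)" using Cons
    by auto
  show ?case by (simp add: V.add.cp_def flip: IH)
qed simp

text \<open>Right multiplication by the identity of U preserves injections and copairings strictly,
  so the recursion over terms can be carried out at the unit and multiplied by U afterwards.\<close>

lemma iT_ttrm: "\<lbrakk>wf_trm T n t; U \<in> Wd\<rbrakk> \<Longrightarrow> iT (ttrm n t U) = onA (thy R) (L.la n [t]) \<boxtimes> \<iota> (iW U)"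
proof (induct t rule: trm_induct)
  case (Var i)
  then show ?case using V.add.inj_sum [of "iW U" i n] by (simp add: ttrm.simps th_Var V.inj_mA
    iP_replicate)
next
  case (App f ts)
  then have w: "\<forall>t \<in> set ts. wf_trm T n t" and f: "f \<in> ops T" and l: "length ts = arity T f"
    by auto
  have c: "concat (map (\<lambda>t. tc (ttrm n t U)) ts) = concat (replicate (length ts) (replicate n U))"
    using App by (intro concat_replicate_cong) auto
  have e: "map (\<lambda>t. iT (ttrm n t U)) ts
    = map (\<lambda>f. f \<boxtimes> \<iota> (iW U)) (map (\<lambda>t. onA (thy R) (L.la n [t])) ts)"
    using App by auto
  note tl = V.add.cps_type [OF th_legs [OF w]]
  have "iT (ttrm n (App f ts) U) = iT (TOp f U) \<bullet> (iT (tsum (map (\<lambda>t. ttrm n t U) ts))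
    \<bullet> iT (tnabn (length ts) (replicate n U)))"
    using App w c V.pw_mA [of \<one> "iW U" "arity T f"] by (simp add: ttrm.simps iP_replicate o_def
      map_replicate_const)
  also have "iT (tsum (map (\<lambda>t. ttrm n t U) ts)) \<bullet> iT (tnabn (length ts) (replicate n U))
    = V.add.cps (iP (replicate n U)) (map (\<lambda>t. iT (ttrm n t U)) ts)"
    using iT_tsum_tnabn [of "replicate n U" U "map (\<lambda>t. ttrm n t U) ts"] App w
      by (simp add: o_def)
  also have "\<dots> = onA (thy R) (L.la n ts) \<boxtimes> \<iota> (iW U)"
    unfolding e th_cps [OF w] using V.cps_mA [OF th_legs [OF w], of "iW U"] \<open>U \<in> Wd\<close>
      by (simp add: iP_replicate V.pw_mA)
  also have "iT (TOp f U) \<bullet> \<dots> = (onA (thy R) (law_gen T f) \<bullet> onA (thy R) (L.la n ts)) \<boxtimes> \<iota> (iW U)"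
    using th_type [OF w] l f \<open>U \<in> Wd\<close> by simp
  also have "onA (thy R) (law_gen T f) \<bullet> onA (thy R) (L.la n ts)
    = onA (thy R) (L.la n [App f ts])"
    unfolding gen_la using th_seq [of "[App f (map Var [0..<arity T f])]" "arity T f" ts n] w f l
      map_nth [of ts] by (simp add: o_def)
  finally show ?case .
qed

end

section \<open>Freeness\<close>

context tapes
begin

text \<open>For uniqueness: a morphism is known to preserve the structure at the objects of the
  category, so the circuit generators have to be recognised as that structure at one-letter
  words.\<close>

lemma Ci_letters: assumes [simp]: "A \<in> sorts G" "A' \<in> sorts G"
  shows "Ci (CId A) = I [[A]]" "Ci (CSym A A') = M [[A]] [[A']]" "Ci (CCopy A) = C [[A]]"
    "Ci (CDisc A) = E [[A]]"
proof -
  interpret K: words_cd "sorts G" KAr ksrc ktgt "\<lambda>U. kc (cid U)" "(\<cdot>\<^sub>K)" "(\<oplus>\<^sub>K)"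
   "\<lambda>A B. kc (CSym A B)" "\<lambda>A V. kc (csym1 A V)" "\<lambda>U V. kc (csym U V)"
   "\<lambda>A. kc (CCopy A)" "\<lambda>A. kc (CDisc A)" "\<lambda>U. kc (ccopy U)" "\<lambda>U. kc (cdisc U)"
    by (rule KAr_cd)
  have c: "kc (CId A) = kc (cid [A])" using kc_CId [of A] by simp
  have s: "kc (CSym A A') = kc (csym [A] [A'])" using K.wsy_single [of A "[A']"] K.wsy1_single
    [of A A'] by simp
  have d: "kc (CDisc A) = kc (cdisc [A])" using circ_eq.ten_one [of G "CDisc A", THEN kc_eqI]
    by simp
  have "kc (ccopy [A]) = (kc (CCopy A) \<oplus>\<^sub>K kc (ccopy [])) \<cdot>\<^sub>K (kc (cid [A]) \<oplus>\<^sub>K kc (csym1 A [])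
    \<oplus>\<^sub>K kc (cid []))"
    by (rule K.wc_Cons) simp_all
  also have "\<dots> = kc (CCopy A) \<cdot>\<^sub>K kc (cid [A, A])"
    unfolding K.wc_Nil K.wsy1_Nil [OF assms(1)] by (simp del: cid.simps ccopy.simps csym1.simps
      kten_kc kseq_kc)
  also have "\<dots> = kc (CCopy A)" by (rule K.seq_ide) simp_all
  finally have p: "kc (CCopy A) = kc (ccopy [A])" by simp
  show "Ci (CId A) = I [[A]]" "Ci (CSym A A') = M [[A]] [[A']]" "Ci (CCopy A) = C [[A]]"
    "Ci (CDisc A) = E [[A]]"
    using Ci_eq [OF c] Ci_eq [OF s] Ci_eq [OF p] Ci_eq [OF d] Ci_cid [of "[A]"]
      M_single [of "[[A]]" "[A']"] Cs_single [of "[A]" "[A']"] C_single [of "[A]"] E_single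
        [of "[A]"]
    by (simp_all del: cid.simps csym.simps ccopy.simps cdisc.simps)
qed

end

context tape_model
begin

declare tid.simps [simp del] tsym1.simps [simp del] tsym.simps [simp del] tbng.simps [simp del]
  tnab.simps [simp del] tnabn.simps [simp del]
  tdl.simps [simp del] tdl_inv.simps [simp del] tsymm.simps [simp del] top_poly.simps [simp del]
    lwhisk.simps [simp del] rwhisk.simps [simp del]
  tcopy.simps [simp del] tdisc.simps [simp del]

interpretation L: lawvere_theory T
  by (rule lawvere_theory.intro) (rule T)

text \<open>The symmetries at both ends of the operation are identities, so naturality of the
  symmetry exchanges the factors.\<close>

lemma th_swap: "\<lbrakk>f \<in> ops T; U \<in> Wd\<rbrakk> \<Longrightarrow> onA (thy R) (law_gen T f) \<boxtimes> \<iota> (iW U)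
  = \<iota> (iW U) \<boxtimes> onA (thy R) (law_gen T f)"
  using V.mul.sy_nat [of "onA (thy R) (law_gen T f)" "\<iota> (iW U)"] V.pw_mA [of \<one> "iW U"] iW_pw
    by (simp add: sm_pw)

text \<open>Closure under the product is covered by \<open>iT_tten\<close>. The axiom
  \<open>thy_ax\<close> holds because the functor of the target is defined on classes of terms, so
  that provably equal terms have one image, transferred to U by \<open>iT_ttrm\<close>.\<close>

lemma iT_sound: "tape_eq T G t u \<Longrightarrow> iT t = iT u"
proof (induct rule: tape_eq.induct)
  case (cong_ten t t' u u')
  then show ?case using tape_eq_wf [of t t'] tape_eq_wf [of u u'] by (simp add: iT_tten)
next
  case (sym_nat t P)
  then show ?case using V.add.sy_nat' [of "iT t" "\<iota> (iP P)"] by simp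
next
  case (nab_circ c)
  then show ?case using V.add.nab_natural [of "iC c"] by simp
next
  case (nab_op f U)
  then show ?case using V.add.nab_natural [of "iT (TOp f U)"] V.pw_mA [of \<one> "iW U"]
    by (simp add: iP_replicate)
next
  case (bng_op f U)
  then show ?case using V.pw_mA [of \<one> "iW U"] by (simp add: iP_replicate)
next
  case (op_nat f t)
  then show ?case using V.mul.slide [of "onA (thy R) (law_gen T f)" "iT t" \<one> _ "iP (td t)"
    "iP (tc t)"] by (simp add: iT_top_poly iT_tsum_replicate)
next
  case (circ c d)
  then show ?case using iC_sound by simp
next
  case (thy_ax n t t' U)
  then have "trm_eq T n (subst Var t) (subst Var t')" by (intro trm_eq.ax) auto
  then have "L.la n [t] = L.la n [t']" using L.class_eqI by (simp add: L.la_def)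
  then show ?case using thy_ax L.eqs_wf [OF thy_ax(1)] by (simp add: iT_ttrm)
qed (auto simp: V.add.nab_assoc V.add.nab_lun V.add.nab_run V.add.nab_comm)

text \<open>Both maps are cut down to the carriers, as morphisms must be extensional. The choice of
  a representative is harmless by \<open>iT_sound\<close>.\<close>

definition iF :: "('s poly, ('s, 'g, 'f) tarr, 'o, 'a) func" where
  "iF = \<lparr>onO = restrict iP Pol, onA = restrict (\<lambda>f. iT (tape_rep f)) (arr TC)\<rparr>"

lemma iF_O [simp]: "P \<in> Pol \<Longrightarrow> onO iF P = iP P"
  by (simp add: iF_def)

lemma iF_cl [simp]: "wf t \<Longrightarrow> onA iF (cl t) = iT t"
  using iT_sound [OF tape_rep [of t]] by (simp add: iF_def)

lemma iF_arr: "f \<in> arr TC \<Longrightarrow> onA iF f \<in> arr R \<and> src R (onA iF f) = iP (src TC f) \<and> tgt R (onA iF f)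
  = iP (tgt TC f)"
  by (elim arrE) simp

lemma iF_seq: "\<lbrakk>f \<in> arr TC; g \<in> arr TC; tgt TC f = src TC g\<rbrakk> \<Longrightarrow> onA iF (f \<cdot> g) = onA iF f
  \<bullet> onA iF g"
  by (elim arrE) (simp flip: cl_seq)

lemma iF_add: "\<lbrakk>f \<in> arr TC; g \<in> arr TC\<rbrakk> \<Longrightarrow> onA iF (f \<^bold>\<oplus> g) = onA iF f \<boxplus> onA iF g"
  by (elim arrE) (simp flip: cl_sum)

lemma iF_mul: "\<lbrakk>f \<in> arr TC; g \<in> arr TC\<rbrakk> \<Longrightarrow> onA iF (f \<^bold>\<otimes> g) = onA iF f \<boxtimes> onA iF g"
  by (elim arrE) (simp add: iT_tten flip: cl_ten)

lemma iF_functor: "cat_functor TC R iF"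
proof -
  interpret C: category TC using category_iff_scat [of TC] TC_scat by simp
  show ?thesis
    by unfold_locales (auto simp: in_hom_iff iF_arr iF_seq)
qed

lemma iF_add_functor: "strict_sym_monoidal_functor TC (add TC) R (add R) iF"
proof -
  interpret C: strict_sym_monoidal_category TC "add TC" by (rule strict_add)
  interpret cat_functor TC R iF by (rule iF_functor)
  show ?thesis
    by unfold_locales (simp_all add: ssm_of_strict [OF strict_add] struct iF_add)
qed

lemma iF_mul_functor: "strict_sym_monoidal_functor TC (mul TC) R (mul R) iF"
proof -
  interpret C: strict_sym_monoidal_category TC "mul TC" by (rule strict_mul)
  interpret cat_functor TC R iF by (rule iF_functor)
  show ?thesis
    by unfold_locales (simp_all add: ssm_of_strict [OF strict_mul] struct iF_mul iT_tsymm)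
qed

text \<open>Both sides are copairings, and their components agree by \<open>iT_ttrm\<close> at the
  empty word; the representatives chosen in \<open>tape_thy\<close> lie in the same classes of
  terms.\<close>

lemma iF_thy: assumes "a \<in> arr (law_op T)" shows "onA iF (onA (thy TC) a) = onA (thy R) a"
proof -
  obtain n ts where a: "a = L.la n ts" and w: "\<forall>t \<in> set ts. wf_trm T n t" using assms
    by (rule L.LO_E)
  let ?r = "\<lambda>t. rep (trm_class T n t)"
  have w': "\<forall>t \<in> set ts. wf_trm T n (?r t)" using w L.class_rep L.trm_eq_wf by blast
  have "L.la n [?r t] = L.la n [t]" if "t \<in> set ts" for t
    using L.class_eqI [OF L.class_rep [of n t]] w that by (simp add: L.la_def)
  then have e: "map (\<lambda>t. iT (ttrm n (?r t) [])) ts = map (\<lambda>t. onA (thy R) (L.la n [t])) ts"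
    using w' th_type [of "[t]" n for t] w by (auto simp: iT_ttrm)
  have c: "concat (map (\<lambda>t. tc (ttrm n (?r t) [])) ts)
    = concat (replicate (length ts) (replicate n []))"
    using w' by (intro concat_replicate_cong) auto
  have "onA (thy TC) a = cl (TSeq (tsum (map (\<lambda>t. ttrm n (?r t) []) ts)) (tnabn (length ts)
    (replicate n [])))"
    by (simp add: thy_TC tape_thy_def L.la_def o_def a)
  then have "onA iF (onA (thy TC) a) = iT (tsum (map (\<lambda>t. ttrm n (?r t) []) ts))
    \<bullet> iT (tnabn (length ts) (replicate n []))"
    using w' c by (simp add: o_def del: tnabn.simps)
  also have "\<dots> = V.add.cps (V.add.pw \<one> n) (map (\<lambda>t. onA (thy R) (L.la n [t])) ts)"
    using iT_tsum_tnabn [of "replicate n []" "[]" "map (\<lambda>t. ttrm n (?r t) []) ts"] w'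
      by (simp add: o_def iP_replicate e)
  finally show ?thesis using th_cps [OF w] a by simp
qed

lemma iF_morphism: "sesquistrict_tcd_rig_morphism T (sorts G) tape_sort TC Mo Ho R (restrict aS
  (sorts G)) iF"
proof -
  interpret S: sesquistrict_tcd_rig_category T "sorts G" tape_sort TC
    by (rule sesquistrict_tcd_TC)
  interpret a: strict_sym_monoidal_functor TC "add TC" R "add R" iF by (rule iF_add_functor)
  interpret m: strict_sym_monoidal_functor TC "mul TC" R "mul R" iF by (rule iF_mul_functor)
  show ?thesis
  proof
    show "onO iF (onO (thy TC) n) = onO (thy R) n" for n
      by (simp add: thy_TC H_O iP_replicate Q.thy_onO F.nsum_pw)
    show "onA iF (onA (thy TC) a) = onA (thy R) a" if "a \<in> arr (law_op T)" for a
      using that by (rule iF_thy)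
    show "restrict aS (sorts G) A \<in> Mo" if "A \<in> sorts G" for A
      using that interp by (simp add: sig_interp_def)
    show "onO iF \<in> extensional (obj TC)" "onA iF \<in> extensional (arr TC)" by (simp_all add: iF_def)
  qed (simp_all add: tape_sort_def iT_tcopy iT_tdisc)
qed

lemmas cl_letters = TSym_S N_single [symmetric] B_single [symmetric]

lemma morphism_unique:
  assumes "sesquistrict_tcd_rig_morphism T (sorts G) tape_sort TC Mo Ho R \<alpha> \<beta>"
    and aS: "\<And>A. A \<in> sorts G \<Longrightarrow> \<alpha> A = aS A" and aG: "\<And>s. s \<in> gens G \<Longrightarrow> onA \<beta> (tape_gen T G s)
      = aG s"
  shows "\<alpha> = restrict aS (sorts G) \<and> \<beta> = iF"
proof -
  interpret J: sesquistrict_tcd_rig_morphism T "sorts G" tape_sort TC Mo Ho R \<alpha> \<beta> by fact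
  have sO: "onO \<beta> [[A]] = Ho (aS A)" if "A \<in> sorts G" for A
    using J.\<alpha>_H [of A] aS that by (simp add: tape_sort_def)
  have W: "onO \<beta> [U] = iW U" if "U \<in> Wd" for U
    using that
  proof (induct U)
    case Nil
    show ?case using J.mul.pres_un by simp
  next
    case (Cons A U)
    then show ?case using J.mul.pres_tenO [of "[[A]]" "[U]"] sO by simp
  qed
  have P: "onO \<beta> P = iP P" if "P \<in> Pol" for P
    using that
  proof (induct P)
    case Nil
    show ?case using J.add.pres_un by simp
  next
    case (Cons U P)
    then show ?case using J.add.pres_tenO [of "[U]" P] W by simp
  qed
  have ide: "onA \<beta> (I P) = \<iota> (iP P)" if "P \<in> Pol" for P
    using J.add.onA_ide [of P] that P by simp
  have seq: "onA \<beta> (cl t \<cdot> cl u) = onA \<beta> (cl t) \<bullet> onA \<beta> (cl u)" if "wf t" "wf u" "tc t = td u" for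
    t u
    using J.add.onA_seq [of "cl t" "td t" "tc t" "cl u" "tc u"] that by (simp add: in_hom_iff)
  have c: "onA \<beta> (Ci c) = iC c" if "wf_circ G c" for c
    using that
  proof (induct c)
    case (CId A)
    then show ?case using ide [of "[[A]]"] by (simp add: Ci_letters)
  next
    case CId1
    then show ?case using ide [of "[[]]"] Ci_cid [of "[]"] by simp
  next
    case (CGen s)
    then show ?case using aG by (simp add: tape_gen_def)
  next
    case (CSym A A')
    then show ?case using J.mul.pres_sym [of "[[A]]" "[[A']]"] by (simp add: Ci_letters P)
  next
    case (CSeq c d)
    then show ?case using seq [of "TCirc c" "TCirc d"] by (simp flip: Ci_seq)
  next
    case (CTen c d)
    then show ?case using J.mul.pres_tenA [of "Ci c" "Ci d"] by (simp add: Ci_ml)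
  next
    case (CCopy A)
    then show ?case using J.pres_copy [of "[[A]]"] by (simp add: Ci_letters P)
  next
    case (CDisc A)
    then show ?case using J.pres_disc [of "[[A]]"] by (simp add: Ci_letters P)
  qed
  have t: "onA \<beta> (cl t) = iT t" if "wf t" for t
    using that
  proof (induct t)
    case (TSym U V)
    then show ?case using J.add.pres_sym [of "[U]" "[V]"] by (simp add: cl_letters P)
  next
    case (TSeq t u)
    then show ?case using seq [of t u] by (simp add: cl_seq)
  next
    case (TSum t u)
    then show ?case using J.add.pres_tenA [of "cl t" "cl u"] by (simp add: cl_sum)
  next
    case (TBng U)
    then show ?case using J.pres_bng [of "[U]"] by (simp add: cl_letters P)
  next
    case (TNab U)
    then show ?case using J.pres_nab [of "[U]"] by (simp add: cl_letters P)
  next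
    case (TOp f U)
    \<comment> \<open>\<open>pres_thyA\<close> gives the value at the unit. Multiplying by the
      identity of U on the left reaches the operation at U, and \<open>th_swap\<close> brings the
      result into the form used in \<open>iT\<close>.\<close>
    have "law_gen T f \<in> arr L.LO" using TOp by (auto simp: gen_la intro!: L.LO_arr)
    then have "onA \<beta> (cl (TOp f [])) = onA (thy R) (law_gen T f)"
      using J.pres_thyA [of "law_gen T f"] H_gen [of f] TOp by (simp add: thy_TC)
    then have "onA \<beta> (I [U] \<^bold>\<otimes> cl (TOp f [])) = \<iota> (iW U) \<boxtimes> onA (thy R) (law_gen T f)"
      using J.mul.pres_tenA [of "I [U]" "cl (TOp f [])"] ide [of "[U]"] TOp by simp
    then show ?case using I1_ml_TOp [of f "[]" U] th_swap TOp by simp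
  next
    case (TId U)
    then show ?case using ide [of "[U]"] by (simp add: cl_TId)
  next
    case TId0
    show ?case using ide [of "[]"] by (simp add: cl_TId0)
  next
    case (TCirc d)
    then show ?case using c by simp
  qed
  have "\<alpha> = restrict aS (sorts G)"
    by (rule extensionalityI [OF J.ext_\<alpha>]) (simp_all add: aS)
  moreover have "onO \<beta> = onO iF"
    using J.ext_onO by (intro extensionalityI [of _ Pol]) (simp_all add: P iF_def)
  moreover have "onA \<beta> = onA iF"
  proof (rule extensionalityI [OF J.ext_onA])
    show "onA iF \<in> extensional (arr TC)" by (simp add: iF_def)
    show "onA \<beta> f = onA iF f" if "f \<in> arr TC" for f using that t by (elim arrE) simp
  qed
  ultimately show ?thesis by (auto intro: func.equality)
qed

end

theorem theorem29:
  fixes T :: "'f alg_theory" and G :: "('s, 'g) msig"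
  assumes "algebraic_theory T" and "monoidal_signature G"
  shows "sesquistrict_tcd_rig_category T (sorts G) tape_sort (tape_cat T G)
    \<and> (\<forall>f \<in> ops T. onA (thy (tape_cat T G)) (law_gen T f)
          = tape_class T G (TOp f [] :: ('s, 'g, 'f) tape))
    \<and> sig_interp G (sorts G) tape_sort (tape_cat T G) (\<lambda>A. A) (tape_gen T G)
    \<and> (\<forall>(M :: 'm set) (H :: 'm \<Rightarrow> 'o) (R :: ('f, 'o, 'a) tcd_rig) aS aG.
          sesquistrict_tcd_rig_category T M H R \<longrightarrow> sig_interp G M H R aS aG \<longrightarrow>
          (\<exists>!F. sesquistrict_tcd_rig_morphism T (sorts G) tape_sort (tape_cat T G) M H R
                  (fst F) (snd F)
              \<and> (\<forall>A \<in> sorts G. fst F A = aS A)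
              \<and> (\<forall>s \<in> gens G. onA (snd F) (tape_gen T G s) = aG s)))"
proof -
  interpret tapes G T
    using assms by (intro tapes.intro msignature.intro tapes_axioms.intro)
  show ?thesis
  proof (intro conjI allI impI ballI)
    fix M :: "'m set" and H :: "'m \<Rightarrow> 'o" and R :: "('f, 'o, 'a) tcd_rig" and aS aG
    assume "sesquistrict_tcd_rig_category T M H R" "sig_interp G M H R aS aG"
    then interpret tape_model G T M H R aS aG
      by (intro tape_model.intro tape_model_axioms.intro tapes_axioms)
    show "\<exists>!F. sesquistrict_tcd_rig_morphism T (sorts G) tape_sort (tape_cat T G) M H R
        (fst F) (snd F)
      \<and> (\<forall>A \<in> sorts G. fst F A = aS A)
      \<and> (\<forall>s \<in> gens G. onA (snd F) (tape_gen T G s) = aG s)" (is "\<exists>!F. ?morphism F")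
    \<comment> \<open>The interpretation of sorts is restricted to the sorts because morphisms are
      extensional.\<close>
    proof (rule ex1I [of _ "(restrict aS (sorts G), iF)"])
      show "F = (restrict aS (sorts G), iF)" if "?morphism F" for F
        using that morphism_unique [of "fst F" "snd F"] by (auto simp: prod_eq_iff)
    qed (use iF_morphism in \<open>simp add: tape_gen_def\<close>)
  qed (use sesquistrict_tcd_TC H_gen interp_TC in \<open>simp_all add: thy_TC\<close>)
qed

end
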